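(* Let $\mathcal{Z}$ be a $\Bbbk$-linear abelian category and $A$ a right coherent unital $\Bbbk$-algebra. The restriction to $A$, $T\mapsto T|_A$, and the functor $Z\mapsto(-)\otimes_AZ$ define quasi-inverse equivalences $$\operatorname{Rex}(\operatorname{mod-}A,\mathcal{Z})\ \xleftrightarrow{\ \simeq\ }\ \mathcal{Z}_A .$$ These restrict to equivalences between exact functors $\operatorname{mod-}A\to\mathcal{Z}$ and flat $A$-objects.
   Context: $\Bbbk$ is an algebraically closed field; functors between $\Bbbk$-linear categories are $\Bbbk$-linear. $A$ is right coherent if every finitely generated right ideal is finitely presented; then the category $\operatorname{mod-}A$ of finitely presented right $A$-modules is abelian. $\operatorname{Rex}(\mathcal{A},\mathcal{B})$ is the category of right exact functors $\mathcal{A}\to\mathcal{B}$ and natural transformations. An $A$-object in $\mathcal{Z}$ is a pair $(Z,\rho)$ with $Z\in\mathcal{Z}$ and $\rho\colon A\to\operatorname{End}_{\mathcal{Z}}(Z)$ a homomorphism of $\Bbbk$-algebras; $\mathcal{Z}_A$ is the category of $A$-objects, with morphisms the morphisms in $\mathcal{Z}$ commuting with the $A$-actions. The restriction $T|_A$ of $T\colon\operatorname{mod-}A\to\mathcal{Z}$ is the object $T(A)$ with action $A\simeq\operatorname{End}_A(A_A)\to\operatorname{End}_{\mathcal{Z}}(T(A))$. For $Z\in\mathcal{Z}_A$, $(-)\otimes_AZ\colon\operatorname{mod-}A\to\mathcal{Z}$ is the right exact functor, unique up to canonical isomorphism, whose restriction to $A$ is $(Z,\rho)$; equivalently, it is characterized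 by functorial isomorphisms $\operatorname{Hom}_{\mathcal{Z}}(M\otimes_AZ,Z')\simeq\operatorname{Hom}_A(M,\operatorname{Hom}_{\mathcal{Z}}(Z,Z'))$ for $M\in\operatorname{mod-}A$, $Z'\in\mathcal{Z}$. An $A$-object $Z$ is flat if the functor $(-)\otimes_AZ\colon\operatorname{mod-}A\to\mathcal{Z}$ is exact. *)

theory Defs
  imports "HOL-Algebra.Algebra"
begin

section \<open>Linear categories\<close>

text \<open>
  Every arrow determines its domain and codomain. \<open>Plus\<close>, \<open>Null\<close> and \<open>Scal\<close> are the vector space
  operations of the Hom-spaces; \<open>g \<cdot>\<^bsub>C\<^esub> f\<close> is the composite ``first f, then g''.
\<close>

record ('k, 'o, 'm) lincat =
  Obj :: "'o set"
  Arr :: "'m set"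
  Dom :: "'m \<Rightarrow> 'o"
  Cod :: "'m \<Rightarrow> 'o"
  Ide :: "'o \<Rightarrow> 'm"
  Comp :: "'m \<Rightarrow> 'm \<Rightarrow> 'm"  (infixl \<open>\<cdot>\<index>\<close> 70)
  Plus :: "'m \<Rightarrow> 'm \<Rightarrow> 'm"
  Null :: "'o \<Rightarrow> 'o \<Rightarrow> 'm"
  Scal :: "'k \<Rightarrow> 'm \<Rightarrow> 'm"

definition Hom :: "('k, 'o, 'm) lincat \<Rightarrow> 'o \<Rightarrow> 'o \<Rightarrow> 'm set" where
  "Hom C U Y = {f \<in> Arr C. Dom C f = U \<and> Cod C f = Y}"

text \<open>The ring multiplication and unit of a \<^type>\<open>module\<close> record play no role in a mere vector space.\<close>

definition hom_space :: "('k, 'o, 'm) lincat \<Rightarrow> 'o \<Rightarrow> 'o \<Rightarrow> ('k, 'm) module" where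
  "hom_space C U Y = \<lparr>carrier = Hom C U Y, monoid.mult = undefined, monoid.one = undefined,
     ring.zero = Null C U Y, ring.add = Plus C, smult = Scal C\<rparr>"

definition end_algebra :: "('k, 'o, 'm) lincat \<Rightarrow> 'o \<Rightarrow> ('k, 'm) module" where
  "end_algebra C U = (hom_space C U U)\<lparr>monoid.mult := Comp C, monoid.one := Ide C U\<rparr>"

locale linear_category = field K for K :: "'k ring" and C :: "('k, 'o, 'm) lincat" +
  assumes dom_in_Obj: "f \<in> Arr C \<Longrightarrow> Dom C f \<in> Obj C"
    and cod_in_Obj: "f \<in> Arr C \<Longrightarrow> Cod C f \<in> Obj C"
    and ide_in_Hom: "U \<in> Obj C \<Longrightarrow> Ide C U \<in> Hom C U U"
    and comp_in_Hom: "f \<in> Hom C U Y \<Longrightarrow> g \<in> Hom C Y Z \<Longrightarrow> g \<cdot>\<^bsub>C\<^esub> f \<in> Hom C U Z"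
    and comp_ide_right: "f \<in> Hom C U Y \<Longrightarrow> f \<cdot>\<^bsub>C\<^esub> Ide C U = f"
    and comp_ide_left: "f \<in> Hom C U Y \<Longrightarrow> Ide C Y \<cdot>\<^bsub>C\<^esub> f = f"
    and comp_assoc: "f \<in> Hom C W U \<Longrightarrow> g \<in> Hom C U Y \<Longrightarrow> h \<in> Hom C Y Z \<Longrightarrow>
          (h \<cdot>\<^bsub>C\<^esub> g) \<cdot>\<^bsub>C\<^esub> f = h \<cdot>\<^bsub>C\<^esub> (g \<cdot>\<^bsub>C\<^esub> f)"
    and hom_space_module: "U \<in> Obj C \<Longrightarrow> Y \<in> Obj C \<Longrightarrow> module K (hom_space C U Y)"
    and comp_plus_right: "f \<in> Hom C U Y \<Longrightarrow> f' \<in> Hom C U Y \<Longrightarrow> g \<in> Hom C Y Z \<Longrightarrow>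
          g \<cdot>\<^bsub>C\<^esub> Plus C f f' = Plus C (g \<cdot>\<^bsub>C\<^esub> f) (g \<cdot>\<^bsub>C\<^esub> f')"
    and comp_plus_left: "f \<in> Hom C U Y \<Longrightarrow> g \<in> Hom C Y Z \<Longrightarrow> g' \<in> Hom C Y Z \<Longrightarrow>
          Plus C g g' \<cdot>\<^bsub>C\<^esub> f = Plus C (g \<cdot>\<^bsub>C\<^esub> f) (g' \<cdot>\<^bsub>C\<^esub> f)"
    and comp_scal_right: "c \<in> carrier K \<Longrightarrow> f \<in> Hom C U Y \<Longrightarrow> g \<in> Hom C Y Z \<Longrightarrow>
          g \<cdot>\<^bsub>C\<^esub> Scal C c f = Scal C c (g \<cdot>\<^bsub>C\<^esub> f)"
    and comp_scal_left: "c \<in> carrier K \<Longrightarrow> f \<in> Hom C U Y \<Longrightarrow> g \<in> Hom C Y Z \<Longrightarrow>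
          Scal C c g \<cdot>\<^bsub>C\<^esub> f = Scal C c (g \<cdot>\<^bsub>C\<^esub> f)"

definition iso_arr :: "('k, 'o, 'm) lincat \<Rightarrow> 'm \<Rightarrow> bool" where
  "iso_arr C f \<longleftrightarrow> f \<in> Arr C \<and> (\<exists>g \<in> Hom C (Cod C f) (Dom C f).
     g \<cdot>\<^bsub>C\<^esub> f = Ide C (Dom C f) \<and> f \<cdot>\<^bsub>C\<^esub> g = Ide C (Cod C f))"

definition mono_arr :: "('k, 'o, 'm) lincat \<Rightarrow> 'm \<Rightarrow> bool" where
  "mono_arr C f \<longleftrightarrow> f \<in> Arr C \<and> (\<forall>W \<in> Obj C. \<forall>g \<in> Hom C W (Dom C f). \<forall>h \<in> Hom C W (Dom C f).
     f \<cdot>\<^bsub>C\<^esub> g = f \<cdot>\<^bsub>C\<^esub> h \<longrightarrow> g = h)"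

definition epi_arr :: "('k, 'o, 'm) lincat \<Rightarrow> 'm \<Rightarrow> bool" where
  "epi_arr C f \<longleftrightarrow> f \<in> Arr C \<and> (\<forall>W \<in> Obj C. \<forall>g \<in> Hom C (Cod C f) W. \<forall>h \<in> Hom C (Cod C f) W.
     g \<cdot>\<^bsub>C\<^esub> f = h \<cdot>\<^bsub>C\<^esub> f \<longrightarrow> g = h)"

definition is_zero_obj :: "('k, 'o, 'm) lincat \<Rightarrow> 'o \<Rightarrow> bool" where
  "is_zero_obj C N \<longleftrightarrow> N \<in> Obj C \<and>
     (\<forall>U \<in> Obj C. (\<exists>!f. f \<in> Hom C N U) \<and> (\<exists>!f. f \<in> Hom C U N))"

definition is_biproduct :: "('k, 'o, 'm) lincat \<Rightarrow> 'o \<Rightarrow> 'o \<Rightarrow> 'o \<Rightarrow> 'm \<Rightarrow> 'm \<Rightarrow> 'm \<Rightarrow> 'm \<Rightarrow> bool" where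
  "is_biproduct C U Y P i j p q \<longleftrightarrow> P \<in> Obj C \<and>
     i \<in> Hom C U P \<and> j \<in> Hom C Y P \<and> p \<in> Hom C P U \<and> q \<in> Hom C P Y \<and>
     p \<cdot>\<^bsub>C\<^esub> i = Ide C U \<and> q \<cdot>\<^bsub>C\<^esub> j = Ide C Y \<and>
     p \<cdot>\<^bsub>C\<^esub> j = Null C Y U \<and> q \<cdot>\<^bsub>C\<^esub> i = Null C U Y \<and>
     Plus C (i \<cdot>\<^bsub>C\<^esub> p) (j \<cdot>\<^bsub>C\<^esub> q) = Ide C P"

definition is_kernel :: "('k, 'o, 'm) lincat \<Rightarrow> 'm \<Rightarrow> 'm \<Rightarrow> bool" where
  "is_kernel C k f \<longleftrightarrow> f \<in> Arr C \<and> k \<in> Arr C \<and> Cod C k = Dom C f \<and>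
     f \<cdot>\<^bsub>C\<^esub> k = Null C (Dom C k) (Cod C f) \<and>
     (\<forall>W \<in> Obj C. \<forall>g \<in> Hom C W (Dom C f). f \<cdot>\<^bsub>C\<^esub> g = Null C W (Cod C f) \<longrightarrow>
        (\<exists>!h. h \<in> Hom C W (Dom C k) \<and> k \<cdot>\<^bsub>C\<^esub> h = g))"

definition is_cokernel :: "('k, 'o, 'm) lincat \<Rightarrow> 'm \<Rightarrow> 'm \<Rightarrow> bool" where
  "is_cokernel C c f \<longleftrightarrow> f \<in> Arr C \<and> c \<in> Arr C \<and> Dom C c = Cod C f \<and>
     c \<cdot>\<^bsub>C\<^esub> f = Null C (Dom C f) (Cod C c) \<and>
     (\<forall>W \<in> Obj C. \<forall>g \<in> Hom C (Cod C f) W. g \<cdot>\<^bsub>C\<^esub> f = Null C (Dom C f) W \<longrightarrow>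
        (\<exists>!h. h \<in> Hom C (Cod C c) W \<and> h \<cdot>\<^bsub>C\<^esub> c = g))"

locale abelian_category = linear_category K C for K :: "'k ring" and C :: "('k, 'o, 'm) lincat" +
  assumes zero_obj: "\<exists>N. is_zero_obj C N"
    and biproducts: "U \<in> Obj C \<Longrightarrow> Y \<in> Obj C \<Longrightarrow> \<exists>P i j p q. is_biproduct C U Y P i j p q"
    and kernels: "f \<in> Arr C \<Longrightarrow> \<exists>k. is_kernel C k f"
    and cokernels: "f \<in> Arr C \<Longrightarrow> \<exists>c. is_cokernel C c f"
    and mono_normal: "mono_arr C f \<Longrightarrow> \<exists>g. is_kernel C f g"
    and epi_conormal: "epi_arr C f \<Longrightarrow> \<exists>g. is_cokernel C f g"

text \<open>\<open>U \<rightarrow> V \<rightarrow> W\<close> is exact at \<open>V\<close> if the image of the first arrow is a kernel of the second one.\<close>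

definition is_image :: "('k, 'o, 'm) lincat \<Rightarrow> 'm \<Rightarrow> 'm \<Rightarrow> bool" where
  "is_image C i f \<longleftrightarrow> (\<exists>c. is_cokernel C c f \<and> is_kernel C i c)"

definition exact_at :: "('k, 'o, 'm) lincat \<Rightarrow> 'm \<Rightarrow> 'm \<Rightarrow> bool" where
  "exact_at C f g \<longleftrightarrow> (\<exists>i. is_image C i f \<and> is_kernel C i g)"

definition short_exact :: "('k, 'o, 'm) lincat \<Rightarrow> 'm \<Rightarrow> 'm \<Rightarrow> bool" where
  "short_exact C f g \<longleftrightarrow> mono_arr C f \<and> exact_at C f g \<and> epi_arr C g"

definition full_subcat :: "('k, 'o, 'm) lincat \<Rightarrow> ('o \<Rightarrow> bool) \<Rightarrow> ('k, 'o, 'm) lincat" where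
  "full_subcat C P = C\<lparr>Obj := {U \<in> Obj C. P U},
     Arr := {f \<in> Arr C. P (Dom C f) \<and> P (Cod C f)}\<rparr>"


section \<open>Functors and natural transformations\<close>

text \<open>
  Functors and families of arrows are extensional: they are \<open>undefined\<close> off their domain, so that
  equal functors and equal natural transformations are equal as HOL values.
\<close>

record ('o, 'm, 'p, 'n) func =
  fobj :: "'o \<Rightarrow> 'p"
  fmap :: "'m \<Rightarrow> 'n"

definition linear_functor ::
  "'k ring \<Rightarrow> ('k, 'o, 'm) lincat \<Rightarrow> ('k, 'p, 'n) lincat \<Rightarrow> ('o, 'm, 'p, 'n) func \<Rightarrow> bool" where
  "linear_functor K C D F \<longleftrightarrow>
     fobj F \<in> Obj C \<rightarrow>\<^sub>E Obj D \<and> fmap F \<in> Arr C \<rightarrow>\<^sub>E Arr D \<and>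
     (\<forall>f \<in> Arr C. Dom D (fmap F f) = fobj F (Dom C f) \<and> Cod D (fmap F f) = fobj F (Cod C f)) \<and>
     (\<forall>U \<in> Obj C. fmap F (Ide C U) = Ide D (fobj F U)) \<and>
     (\<forall>f \<in> Arr C. \<forall>g \<in> Arr C. Cod C f = Dom C g \<longrightarrow> fmap F (g \<cdot>\<^bsub>C\<^esub> f) = fmap F g \<cdot>\<^bsub>D\<^esub> fmap F f) \<and>
     (\<forall>f \<in> Arr C. \<forall>g \<in> Arr C. Dom C f = Dom C g \<longrightarrow> Cod C f = Cod C g \<longrightarrow>
        fmap F (Plus C f g) = Plus D (fmap F f) (fmap F g)) \<and>
     (\<forall>c \<in> carrier K. \<forall>f \<in> Arr C. fmap F (Scal C c f) = Scal D c (fmap F f))"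

definition right_exact ::
  "('k, 'o, 'm) lincat \<Rightarrow> ('k, 'p, 'n) lincat \<Rightarrow> ('o, 'm, 'p, 'n) func \<Rightarrow> bool" where
  "right_exact C D F \<longleftrightarrow>
     (\<forall>f g. short_exact C f g \<longrightarrow> exact_at D (fmap F f) (fmap F g) \<and> epi_arr D (fmap F g))"

definition exact ::
  "('k, 'o, 'm) lincat \<Rightarrow> ('k, 'p, 'n) lincat \<Rightarrow> ('o, 'm, 'p, 'n) func \<Rightarrow> bool" where
  "exact C D F \<longleftrightarrow> (\<forall>f g. short_exact C f g \<longrightarrow> short_exact D (fmap F f) (fmap F g))"

definition id_functor :: "('k, 'o, 'm) lincat \<Rightarrow> ('o, 'm, 'o, 'm) func" where
  "id_functor C = \<lparr>fobj = (\<lambda>U \<in> Obj C. U), fmap = (\<lambda>f \<in> Arr C. f)\<rparr>"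

definition comp_functor :: "('k, 'o, 'm) lincat \<Rightarrow> ('p, 'n, 'q, 'l) func \<Rightarrow> ('o, 'm, 'p, 'n) func \<Rightarrow>
    ('o, 'm, 'q, 'l) func" where
  "comp_functor C G F =
     \<lparr>fobj = (\<lambda>U \<in> Obj C. fobj G (fobj F U)), fmap = (\<lambda>f \<in> Arr C. fmap G (fmap F f))\<rparr>"

definition restrict_functor :: "('k, 'o, 'm) lincat \<Rightarrow> ('o, 'm, 'p, 'n) func \<Rightarrow>
    ('o, 'm, 'p, 'n) func" where
  "restrict_functor C F = \<lparr>fobj = restrict (fobj F) (Obj C), fmap = restrict (fmap F) (Arr C)\<rparr>"

definition nat_trans :: "('k, 'o, 'm) lincat \<Rightarrow> ('k, 'p, 'n) lincat \<Rightarrow>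
    ('o, 'm, 'p, 'n) func \<Rightarrow> ('o, 'm, 'p, 'n) func \<Rightarrow> ('o \<Rightarrow> 'n) \<Rightarrow> bool" where
  "nat_trans C D F G \<eta> \<longleftrightarrow> \<eta> \<in> extensional (Obj C) \<and>
     (\<forall>U \<in> Obj C. \<eta> U \<in> Hom D (fobj F U) (fobj G U)) \<and>
     (\<forall>f \<in> Arr C. \<eta> (Cod C f) \<cdot>\<^bsub>D\<^esub> fmap F f = fmap G f \<cdot>\<^bsub>D\<^esub> \<eta> (Dom C f))"

definition nat_isomorphic :: "('k, 'o, 'm) lincat \<Rightarrow> ('k, 'p, 'n) lincat \<Rightarrow>
    ('o, 'm, 'p, 'n) func \<Rightarrow> ('o, 'm, 'p, 'n) func \<Rightarrow> bool" where
  "nat_isomorphic C D F G \<longleftrightarrow> (\<exists>\<eta>. nat_trans C D F G \<eta> \<and> (\<forall>U \<in> Obj C. iso_arr D (\<eta> U)))"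

definition quasi_inverse_equivalences :: "'k ring \<Rightarrow> ('k, 'o, 'm) lincat \<Rightarrow> ('k, 'p, 'n) lincat \<Rightarrow>
    ('o, 'm, 'p, 'n) func \<Rightarrow> ('p, 'n, 'o, 'm) func \<Rightarrow> bool" where
  "quasi_inverse_equivalences K C D F G \<longleftrightarrow>
     linear_functor K C D F \<and> linear_functor K D C G \<and>
     nat_isomorphic C C (comp_functor C G F) (id_functor C) \<and>
     nat_isomorphic D D (comp_functor D F G) (id_functor D)"

type_synonym ('o, 'm, 'p, 'n) nattrans =
  "('o, 'm, 'p, 'n) func \<times> ('o \<Rightarrow> 'n) \<times> ('o, 'm, 'p, 'n) func"

definition functor_category :: "'k ring \<Rightarrow> ('k, 'o, 'm) lincat \<Rightarrow> ('k, 'p, 'n) lincat \<Rightarrow>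
    ('k, ('o, 'm, 'p, 'n) func, ('o, 'm, 'p, 'n) nattrans) lincat" where
  "functor_category K C D = \<lparr>
     Obj = {F. linear_functor K C D F},
     Arr = {(F, \<eta>, G). linear_functor K C D F \<and> linear_functor K C D G \<and> nat_trans C D F G \<eta>},
     Dom = (\<lambda>(F, \<eta>, G). F),
     Cod = (\<lambda>(F, \<eta>, G). G),
     Ide = (\<lambda>F. (F, \<lambda>U \<in> Obj C. Ide D (fobj F U), F)),
     Comp = (\<lambda>(G', \<theta>, H) (F, \<eta>, G). (F, \<lambda>U \<in> Obj C. \<theta> U \<cdot>\<^bsub>D\<^esub> \<eta> U, H)),
     Plus = (\<lambda>(F, \<eta>, G) (F', \<theta>, G'). (F, \<lambda>U \<in> Obj C. Plus D (\<eta> U) (\<theta> U), G)),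
     Null = (\<lambda>F G. (F, \<lambda>U \<in> Obj C. Null D (fobj F U) (fobj G U), G)),
     Scal = (\<lambda>c (F, \<eta>, G). (F, \<lambda>U \<in> Obj C. Scal D c (\<eta> U), G))\<rparr>"

definition Rex :: "'k ring \<Rightarrow> ('k, 'o, 'm) lincat \<Rightarrow> ('k, 'p, 'n) lincat \<Rightarrow>
    ('k, ('o, 'm, 'p, 'n) func, ('o, 'm, 'p, 'n) nattrans) lincat" where
  "Rex K C D = full_subcat (functor_category K C D) (right_exact C D)"

definition Exact :: "'k ring \<Rightarrow> ('k, 'o, 'm) lincat \<Rightarrow> ('k, 'p, 'n) lincat \<Rightarrow>
    ('k, ('o, 'm, 'p, 'n) func, ('o, 'm, 'p, 'n) nattrans) lincat" where
  "Exact K C D = full_subcat (functor_category K C D) (exact C D)"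


section \<open>Algebras and right modules\<close>

text \<open>
  A not necessarily commutative unital algebra; \<open>smult\<close> is the action of the scalars. (The
  library's locale \<^locale>\<open>algebra\<close> is about commutative algebras.) The zero algebra is allowed.
\<close>

locale unital_algebra = module K A + ring A for K :: "'k ring" and A :: "('k, 'a) module" +
  assumes smult_mult_left: "c \<in> carrier K \<Longrightarrow> x \<in> carrier A \<Longrightarrow> y \<in> carrier A \<Longrightarrow>
      (c \<odot>\<^bsub>A\<^esub> x) \<otimes>\<^bsub>A\<^esub> y = c \<odot>\<^bsub>A\<^esub> (x \<otimes>\<^bsub>A\<^esub> y)"
    and smult_mult_right: "c \<in> carrier K \<Longrightarrow> x \<in> carrier A \<Longrightarrow> y \<in> carrier A \<Longrightarrow>
      x \<otimes>\<^bsub>A\<^esub> (c \<odot>\<^bsub>A\<^esub> y) = c \<odot>\<^bsub>A\<^esub> (x \<otimes>\<^bsub>A\<^esub> y)"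

definition algebra_hom :: "'k ring \<Rightarrow> ('k, 'a) module \<Rightarrow> ('k, 'b) module \<Rightarrow> ('a \<Rightarrow> 'b) set" where
  "algebra_hom K A B = {h \<in> ring_hom A B. \<forall>c \<in> carrier K. \<forall>x \<in> carrier A.
     h (c \<odot>\<^bsub>A\<^esub> x) = c \<odot>\<^bsub>B\<^esub> h x}"

text \<open>
  As for \<^type>\<open>module\<close>, the record extends \<^type>\<open>ring\<close> only for the sake of the
  additive group; \<open>mult\<close> and \<open>one\<close> are irrelevant.
\<close>

record ('a, 'u) rmodule = "'u ring" +
  ract :: "'u \<Rightarrow> 'a \<Rightarrow> 'u"

locale right_module = A: ring A + M: abelian_group M
  for A :: "('k, 'a) module" and M :: "('a, 'u) rmodule" +
  assumes ract_closed: "x \<in> carrier M \<Longrightarrow> a \<in> carrier A \<Longrightarrow> ract M x a \<in> carrier M"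
    and ract_add_left: "x \<in> carrier M \<Longrightarrow> y \<in> carrier M \<Longrightarrow> a \<in> carrier A \<Longrightarrow>
      ract M (x \<oplus>\<^bsub>M\<^esub> y) a = ract M x a \<oplus>\<^bsub>M\<^esub> ract M y a"
    and ract_add_right: "x \<in> carrier M \<Longrightarrow> a \<in> carrier A \<Longrightarrow> b \<in> carrier A \<Longrightarrow>
      ract M x (a \<oplus>\<^bsub>A\<^esub> b) = ract M x a \<oplus>\<^bsub>M\<^esub> ract M x b"
    and ract_mult: "x \<in> carrier M \<Longrightarrow> a \<in> carrier A \<Longrightarrow> b \<in> carrier A \<Longrightarrow>
      ract M x (a \<otimes>\<^bsub>A\<^esub> b) = ract M (ract M x a) b"
    and ract_one: "x \<in> carrier M \<Longrightarrow> ract M x \<one>\<^bsub>A\<^esub> = x"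

definition rmod_hom ::
  "('k, 'a) module \<Rightarrow> ('a, 'u) rmodule \<Rightarrow> ('a, 'v) rmodule \<Rightarrow> ('u \<Rightarrow> 'v) set" where
  "rmod_hom A M N = {f \<in> carrier M \<rightarrow>\<^sub>E carrier N.
     (\<forall>x \<in> carrier M. \<forall>y \<in> carrier M. f (x \<oplus>\<^bsub>M\<^esub> y) = f x \<oplus>\<^bsub>N\<^esub> f y) \<and>
     (\<forall>x \<in> carrier M. \<forall>a \<in> carrier A. f (ract M x a) = ract N (f x) a)}"

definition self_rmod :: "('k, 'a) module \<Rightarrow> ('a, 'a) rmodule" where
  "self_rmod A = \<lparr>carrier = carrier A, monoid.mult = undefined, monoid.one = undefined,
     ring.zero = \<zero>\<^bsub>A\<^esub>, ring.add = (\<oplus>\<^bsub>A\<^esub>), ract = (\<otimes>\<^bsub>A\<^esub>)\<rparr>"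

definition free_rmod :: "('k, 'a) module \<Rightarrow> nat \<Rightarrow> ('a, nat \<Rightarrow> 'a) rmodule" where
  "free_rmod A n = \<lparr>carrier = {..<n} \<rightarrow>\<^sub>E carrier A, monoid.mult = undefined, monoid.one = undefined,
     ring.zero = (\<lambda>i \<in> {..<n}. \<zero>\<^bsub>A\<^esub>), ring.add = (\<lambda>x y. \<lambda>i \<in> {..<n}. x i \<oplus>\<^bsub>A\<^esub> y i),
     ract = (\<lambda>x a. \<lambda>i \<in> {..<n}. x i \<otimes>\<^bsub>A\<^esub> a)\<rparr>"

definition fin_generated :: "('k, 'a) module \<Rightarrow> ('a, 'u) rmodule \<Rightarrow> bool" where
  "fin_generated A M \<longleftrightarrow> (\<exists>n. \<exists>\<phi> \<in> rmod_hom A (free_rmod A n) M.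
     \<phi> ` carrier (free_rmod A n) = carrier M)"

definition fin_presented :: "('k, 'a) module \<Rightarrow> ('a, 'u) rmodule \<Rightarrow> bool" where
  "fin_presented A M \<longleftrightarrow> (\<exists>n. \<exists>\<phi> \<in> rmod_hom A (free_rmod A n) M.
     \<phi> ` carrier (free_rmod A n) = carrier M \<and>
     fin_generated A ((free_rmod A n)\<lparr>carrier := {x \<in> carrier (free_rmod A n). \<phi> x = \<zero>\<^bsub>M\<^esub>}\<rparr>))"

definition right_ideal :: "('k, 'a) module \<Rightarrow> 'a set \<Rightarrow> bool" where
  "right_ideal A I \<longleftrightarrow> additive_subgroup I A \<and> (\<forall>x \<in> I. \<forall>a \<in> carrier A. x \<otimes>\<^bsub>A\<^esub> a \<in> I)"

definition right_coherent :: "('k, 'a) module \<Rightarrow> bool" where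
  "right_coherent A \<longleftrightarrow> (\<forall>I. right_ideal A I \<longrightarrow>
     fin_generated A ((self_rmod A)\<lparr>carrier := I\<rparr>) \<longrightarrow>
     fin_presented A ((self_rmod A)\<lparr>carrier := I\<rparr>))"


section \<open>The category of finitely presented right modules\<close>

text \<open>
  The objects of \<open>mod-A\<close> are the finitely presented right \<open>A\<close>-modules carried by a set of elements
  of type \<^typ>\<open>(nat \<Rightarrow> 'a) set\<close>. This type contains the cosets of submodules of the free
  modules \<open>A\<^sup>n\<close>, so up to isomorphism no finitely presented module, of whatever carrier type, is
  missing: see \<open>fin_presented_isomorphic_to_object\<close> below. An arrow is a triple (source, map,
  target); scalars \<open>c\<close> act on a module through \<open>c \<odot> \<one>\<close>.
\<close>

type_synonym 'a umod = "('a, (nat \<Rightarrow> 'a) set) rmodule"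
type_synonym 'a uarr = "'a umod \<times> ((nat \<Rightarrow> 'a) set \<Rightarrow> (nat \<Rightarrow> 'a) set) \<times> 'a umod"

definition fpmod :: "('k, 'a) module \<Rightarrow> ('k, 'a umod, 'a uarr) lincat" where
  "fpmod A = \<lparr>
     Obj = {M. right_module A M \<and> fin_presented A M},
     Arr = {(M, f, N). right_module A M \<and> fin_presented A M \<and>
              right_module A N \<and> fin_presented A N \<and> f \<in> rmod_hom A M N},
     Dom = (\<lambda>(M, f, N). M),
     Cod = (\<lambda>(M, f, N). N),
     Ide = (\<lambda>M. (M, \<lambda>x \<in> carrier M. x, M)),
     Comp = (\<lambda>(N', g, P) (M, f, N). (M, \<lambda>x \<in> carrier M. g (f x), P)),
     Plus = (\<lambda>(M, f, N) (M', g, N'). (M, \<lambda>x \<in> carrier M. f x \<oplus>\<^bsub>N\<^esub> g x, N)),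
     Null = (\<lambda>M N. (M, \<lambda>x \<in> carrier M. \<zero>\<^bsub>N\<^esub>, N)),
     Scal = (\<lambda>c (M, f, N). (M, \<lambda>x \<in> carrier M. ract N (f x) (c \<odot>\<^bsub>A\<^esub> \<one>\<^bsub>A\<^esub>), N))\<rparr>"

definition transport_rmod :: "('u \<Rightarrow> 'v) \<Rightarrow> ('a, 'u) rmodule \<Rightarrow> ('a, 'v) rmodule" where
  "transport_rmod e M = (let d = inv_into (carrier M) e in
     \<lparr>carrier = e ` carrier M, monoid.mult = undefined, monoid.one = undefined, ring.zero = e \<zero>\<^bsub>M\<^esub>,
      ring.add = (\<lambda>x y. e (d x \<oplus>\<^bsub>M\<^esub> d y)), ract = (\<lambda>x a. e (ract M (d x) a))\<rparr>)"

text \<open>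
  The object \<open>A\<^sub>A\<close> of \<open>mod-A\<close>: the copy of \<open>A\<close> given by \<open>A\<^sup>1/0\<close>, and the isomorphism from \<open>A\<close> to
  \<open>End\<^sub>A(A\<^sub>A)\<close> which sends \<open>a\<close> to left multiplication by \<open>a\<close>.
\<close>

definition reg_elt :: "'a \<Rightarrow> (nat \<Rightarrow> 'a) set" where
  "reg_elt a = {\<lambda>i \<in> {..<1}. a}"

definition reg_rmod :: "('k, 'a) module \<Rightarrow> 'a umod" where
  "reg_rmod A = transport_rmod reg_elt (self_rmod A)"

definition left_mult :: "('k, 'a) module \<Rightarrow> 'a \<Rightarrow> 'a uarr" where
  "left_mult A a = (reg_rmod A,
     \<lambda>x \<in> carrier (reg_rmod A). reg_elt (a \<otimes>\<^bsub>A\<^esub> inv_into (carrier A) reg_elt x), reg_rmod A)"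


section \<open>Objects with an action of an algebra\<close>

type_synonym ('a, 'o, 'm) aobj = "'o \<times> ('a \<Rightarrow> 'm)"
type_synonym ('a, 'o, 'm) aarr = "('a, 'o, 'm) aobj \<times> 'm \<times> ('a, 'o, 'm) aobj"

definition is_aobj :: "'k ring \<Rightarrow> ('k, 'a) module \<Rightarrow> ('k, 'o, 'm) lincat \<Rightarrow>
    ('a, 'o, 'm) aobj \<Rightarrow> bool" where
  "is_aobj K A C = (\<lambda>(Z, \<rho>). Z \<in> Obj C \<and> \<rho> \<in> extensional (carrier A) \<and>
     \<rho> \<in> algebra_hom K A (end_algebra C Z))"

definition is_aarr :: "'k ring \<Rightarrow> ('k, 'a) module \<Rightarrow> ('k, 'o, 'm) lincat \<Rightarrow>
    ('a, 'o, 'm) aarr \<Rightarrow> bool" where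
  "is_aarr K A C = (\<lambda>((Z, \<rho>), h, (Z', \<rho>')). is_aobj K A C (Z, \<rho>) \<and> is_aobj K A C (Z', \<rho>') \<and>
     h \<in> Hom C Z Z' \<and> (\<forall>a \<in> carrier A. h \<cdot>\<^bsub>C\<^esub> \<rho> a = \<rho>' a \<cdot>\<^bsub>C\<^esub> h))"

definition aobj_category :: "'k ring \<Rightarrow> ('k, 'a) module \<Rightarrow> ('k, 'o, 'm) lincat \<Rightarrow>
    ('k, ('a, 'o, 'm) aobj, ('a, 'o, 'm) aarr) lincat" where
  "aobj_category K A C = \<lparr>
     Obj = {Z. is_aobj K A C Z},
     Arr = {h. is_aarr K A C h},
     Dom = (\<lambda>(Z, h, Z'). Z),
     Cod = (\<lambda>(Z, h, Z'). Z'),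
     Ide = (\<lambda>Z. (Z, Ide C (fst Z), Z)),
     Comp = (\<lambda>(Y, g, Z) (W, f, U). (W, g \<cdot>\<^bsub>C\<^esub> f, Z)),
     Plus = (\<lambda>(Y, g, Z) (Y', g', Z'). (Y, Plus C g g', Z)),
     Null = (\<lambda>Z Z'. (Z, Null C (fst Z) (fst Z'), Z')),
     Scal = (\<lambda>c (Z, h, Z'). (Z, Scal C c h, Z'))\<rparr>"

text \<open>The right \<open>A\<close>-module \<open>Hom(Z, Z')\<close>, for an \<open>A\<close>-object \<open>Z\<close> and an object \<open>Z'\<close>.\<close>

definition hom_rmod :: "('k, 'o, 'm) lincat \<Rightarrow> ('a, 'o, 'm) aobj \<Rightarrow> 'o \<Rightarrow> ('a, 'm) rmodule" where
  "hom_rmod C = (\<lambda>(Z, \<rho>) Z'. \<lparr>carrier = Hom C Z Z', monoid.mult = undefined, monoid.one = undefined,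
     ring.zero = Null C Z Z', ring.add = Plus C, ract = (\<lambda>f a. f \<cdot>\<^bsub>C\<^esub> \<rho> a)\<rparr>)"

definition restriction_obj :: "('k, 'a) module \<Rightarrow> ('a umod, 'a uarr, 'o, 'm) func \<Rightarrow>
    ('a, 'o, 'm) aobj" where
  "restriction_obj A T = (fobj T (reg_rmod A), \<lambda>a \<in> carrier A. fmap T (left_mult A a))"

definition restriction_functor :: "'k ring \<Rightarrow> ('k, 'a) module \<Rightarrow> ('k, 'o, 'm) lincat \<Rightarrow>
    (('a umod, 'a uarr, 'o, 'm) func, ('a umod, 'a uarr, 'o, 'm) nattrans,
     ('a, 'o, 'm) aobj, ('a, 'o, 'm) aarr) func" where
  "restriction_functor K A C = \<lparr>
     fobj = (\<lambda>T \<in> Obj (Rex K (fpmod A) C). restriction_obj A T),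
     fmap = (\<lambda>\<eta> \<in> Arr (Rex K (fpmod A) C). case \<eta> of (S, \<theta>, T) \<Rightarrow>
       (restriction_obj A S, \<theta> (reg_rmod A), restriction_obj A T))\<rparr>"

text \<open>
  A functor \<open>Ten\<close>, \<open>Z \<mapsto> (-) \<otimes>\<^sub>A Z\<close>, from \<open>A\<close>-objects to \<^bold>\<open>all\<close> linear functors on \<open>mod-A\<close>, together
  with isomorphisms \<open>\<Phi> Z M Z'\<close> from \<open>Hom(M \<otimes>\<^sub>A Z, Z')\<close> to \<open>Hom\<^sub>A(M, Hom(Z, Z'))\<close> which are functorial
  in \<open>Z'\<close>, \<open>M\<close> and \<open>Z\<close>. Functoriality in \<open>Z\<close> determines the action of \<open>Ten\<close> on morphisms of
  \<open>A\<close>-objects. Right exactness of \<open>(-) \<otimes>\<^sub>A Z\<close> and the fact that it restricts to \<open>Z\<close> are not assumed.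
\<close>

definition is_tensor :: "'k ring \<Rightarrow> ('k, 'a) module \<Rightarrow> ('k, 'o, 'm) lincat \<Rightarrow>
    (('a, 'o, 'm) aobj, ('a, 'o, 'm) aarr,
     ('a umod, 'a uarr, 'o, 'm) func, ('a umod, 'a uarr, 'o, 'm) nattrans) func \<Rightarrow>
    (('a, 'o, 'm) aobj \<Rightarrow> 'a umod \<Rightarrow> 'o \<Rightarrow> 'm \<Rightarrow> (nat \<Rightarrow> 'a) set \<Rightarrow> 'm) \<Rightarrow> bool" where
  "is_tensor K A C Ten \<Phi> \<longleftrightarrow>
     linear_functor K (aobj_category K A C) (functor_category K (fpmod A) C) Ten \<and>
     (\<forall>Z \<in> Obj (aobj_category K A C). \<forall>M \<in> Obj (fpmod A). \<forall>Z' \<in> Obj C.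
        bij_betw (\<Phi> Z M Z') (Hom C (fobj (fobj Ten Z) M) Z') (rmod_hom A M (hom_rmod C Z Z')) \<and>
        (\<forall>f \<in> Hom C (fobj (fobj Ten Z) M) Z'. \<forall>g \<in> Hom C (fobj (fobj Ten Z) M) Z'.
           \<forall>x \<in> carrier M. \<Phi> Z M Z' (Plus C f g) x = Plus C (\<Phi> Z M Z' f x) (\<Phi> Z M Z' g x)) \<and>
        (\<forall>c \<in> carrier K. \<forall>f \<in> Hom C (fobj (fobj Ten Z) M) Z'.
           \<forall>x \<in> carrier M. \<Phi> Z M Z' (Scal C c f) x = Scal C c (\<Phi> Z M Z' f x))) \<and>
     (\<forall>Z \<in> Obj (aobj_category K A C). \<forall>M \<in> Obj (fpmod A). \<forall>w \<in> Arr C.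
        \<forall>g \<in> Hom C (fobj (fobj Ten Z) M) (Dom C w). \<forall>x \<in> carrier M.
          \<Phi> Z M (Cod C w) (w \<cdot>\<^bsub>C\<^esub> g) x = w \<cdot>\<^bsub>C\<^esub> \<Phi> Z M (Dom C w) g x) \<and>
     (\<forall>Z \<in> Obj (aobj_category K A C). \<forall>(M, f, N) \<in> Arr (fpmod A). \<forall>Z' \<in> Obj C.
        \<forall>g \<in> Hom C (fobj (fobj Ten Z) N) Z'. \<forall>x \<in> carrier M.
          \<Phi> Z M Z' (g \<cdot>\<^bsub>C\<^esub> fmap (fobj Ten Z) (M, f, N)) x = \<Phi> Z N Z' g (f x)) \<and>
     (\<forall>(Y, h, Z) \<in> Arr (aobj_category K A C). \<forall>M \<in> Obj (fpmod A). \<forall>Z' \<in> Obj C.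
        \<forall>g \<in> Hom C (fobj (fobj Ten Z) M) Z'. \<forall>x \<in> carrier M.
          \<Phi> Y M Z' (g \<cdot>\<^bsub>C\<^esub> (case fmap Ten (Y, h, Z) of (_, \<tau>, _) \<Rightarrow> \<tau> M)) x =
            \<Phi> Z M Z' g x \<cdot>\<^bsub>C\<^esub> h)"

definition flat :: "('k, 'a) module \<Rightarrow> ('k, 'o, 'm) lincat \<Rightarrow>
    (('a, 'o, 'm) aobj, ('a, 'o, 'm) aarr,
     ('a umod, 'a uarr, 'o, 'm) func, ('a umod, 'a uarr, 'o, 'm) nattrans) func \<Rightarrow>
    ('a, 'o, 'm) aobj \<Rightarrow> bool" where
  "flat A C Ten Z \<longleftrightarrow> exact (fpmod A) C (fobj Ten Z)"

definition Flat :: "'k ring \<Rightarrow> ('k, 'a) module \<Rightarrow> ('k, 'o, 'm) lincat \<Rightarrow>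
    (('a, 'o, 'm) aobj, ('a, 'o, 'm) aarr,
     ('a umod, 'a uarr, 'o, 'm) func, ('a umod, 'a uarr, 'o, 'm) nattrans) func \<Rightarrow>
    ('k, ('a, 'o, 'm) aobj, ('a, 'o, 'm) aarr) lincat" where
  "Flat K A C Ten = full_subcat (aobj_category K A C) (flat A C Ten)"


section \<open>Every finitely presented module is isomorphic to an object of \<open>mod-A\<close>\<close>

lemma transport_rmod_iso:
  assumes M: "right_module A M" and e: "inj_on e (carrier M)"
  shows "right_module A (transport_rmod e M)"
    and "restrict e (carrier M) \<in> rmod_hom A M (transport_rmod e M)"
    and "bij_betw (restrict e (carrier M)) (carrier M) (carrier (transport_rmod e M))"
proof -
  interpret right_module A M by (rule M)
  let ?T = "transport_rmod e M"
  let ?d = "inv_into (carrier M) e"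
  have d: "?d (e x) = x" if "x \<in> carrier M" for x using e that by simp
  have T: "carrier ?T = e ` carrier M" "\<zero>\<^bsub>?T\<^esub> = e \<zero>\<^bsub>M\<^esub>"
    "x \<oplus>\<^bsub>?T\<^esub> y = e (?d x \<oplus>\<^bsub>M\<^esub> ?d y)" "ract ?T x a = e (ract M (?d x) a)" for x y a
    by (simp_all add: transport_rmod_def Let_def)
  have "abelian_group ?T"
  proof (rule abelian_groupI, goal_cases)
    case (6 x)
    then obtain x' where x': "x' \<in> carrier M" "x = e x'" by (auto simp: T)
    then have "e (\<ominus>\<^bsub>M\<^esub> x') \<in> carrier ?T" "e (\<ominus>\<^bsub>M\<^esub> x') \<oplus>\<^bsub>?T\<^esub> x = \<zero>\<^bsub>?T\<^esub>"
      by (auto simp: T d M.l_neg)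
    then show ?case by blast
  qed (auto simp: T d M.a_ac)
  then show "right_module A ?T"
    by (intro right_module.intro right_module_axioms.intro A.ring_axioms)
      (auto simp: T d ract_closed ract_add_left ract_add_right ract_mult ract_one)
  show "restrict e (carrier M) \<in> rmod_hom A M ?T"
    by (auto simp: rmod_hom_def T d ract_closed)
  show "bij_betw (restrict e (carrier M)) (carrier M) (carrier ?T)"
    using e by (simp add: T bij_betw_def inj_on_restrict_eq)
qed

lemma fin_presented_transfer:
  assumes "fin_presented A M" "right_module A M" "right_module A N"
    and f: "f \<in> rmod_hom A M N" "bij_betw f (carrier M) (carrier N)"
  shows "fin_presented A N"
proof -
  interpret M: right_module A M by fact
  interpret N: right_module A N by fact
  obtain n \<phi> where \<phi>: "\<phi> \<in> rmod_hom A (free_rmod A n) M"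
    "\<phi> ` carrier (free_rmod A n) = carrier M"
    "fin_generated A ((free_rmod A n)\<lparr>carrier := {x \<in> carrier (free_rmod A n). \<phi> x = \<zero>\<^bsub>M\<^esub>}\<rparr>)"
    using assms(1) by (auto simp: fin_presented_def)
  let ?F = "free_rmod A n"
  have cl: "x \<oplus>\<^bsub>?F\<^esub> y \<in> carrier ?F" "ract ?F x a \<in> carrier ?F"
    if "x \<in> carrier ?F" "y \<in> carrier ?F" "a \<in> carrier A" for x y a
    using that by (auto simp: free_rmod_def PiE_def Pi_def)
  have cl': "x \<oplus>\<^bsub>?F\<^esub> y \<in> carrier ?F" if "x \<in> carrier ?F" "y \<in> carrier ?F" for x y
    using that by (auto simp: free_rmod_def PiE_def Pi_def)
  have in_M: "\<phi> x \<in> carrier M" if "x \<in> carrier ?F" for x using \<phi>(2) that by blast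
  have "f \<zero>\<^bsub>M\<^esub> \<oplus>\<^bsub>N\<^esub> f \<zero>\<^bsub>M\<^esub> = f \<zero>\<^bsub>M\<^esub>"
    using f(1) by (auto simp: rmod_hom_def) (metis M.M.l_zero M.M.zero_closed)
  moreover have "f \<zero>\<^bsub>M\<^esub> \<in> carrier N" using f(1) by (auto simp: rmod_hom_def)
  ultimately have f0: "f \<zero>\<^bsub>M\<^esub> = \<zero>\<^bsub>N\<^esub>"
    by (metis N.M.add.l_cancel_one N.M.zero_closed)
  have ker: "(restrict (f \<circ> \<phi>) (carrier ?F) x = \<zero>\<^bsub>N\<^esub>) = (\<phi> x = \<zero>\<^bsub>M\<^esub>)" if "x \<in> carrier ?F" for x
    using that in_M[OF that] f(2) f0 by (auto simp: bij_betw_def) (metis M.M.zero_closed inj_onD)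
  have "restrict (f \<circ> \<phi>) (carrier ?F) \<in> rmod_hom A ?F N"
    using \<phi>(1) f(1) in_M by (auto simp: rmod_hom_def cl cl')
  moreover have "restrict (f \<circ> \<phi>) (carrier ?F) ` carrier ?F = carrier N"
  proof -
    have "restrict (f \<circ> \<phi>) (carrier ?F) ` carrier ?F = f ` (\<phi> ` carrier ?F)" by auto
    then show ?thesis using \<phi>(2) f(2) by (simp only: bij_betw_def)
  qed
  moreover have "{x \<in> carrier ?F. restrict (f \<circ> \<phi>) (carrier ?F) x = \<zero>\<^bsub>N\<^esub>} =
      {x \<in> carrier ?F. \<phi> x = \<zero>\<^bsub>M\<^esub>}"
    using ker by blast
  moreover have "fin_generated A ((free_rmod A n)\<lparr>carrier :=
      {x \<in> carrier ?F. restrict (f \<circ> \<phi>) (carrier ?F) x = \<zero>\<^bsub>N\<^esub>}\<rparr>)"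
    using \<phi>(3) calculation(3) by (simp only:)
  ultimately show ?thesis unfolding fin_presented_def by (intro exI bexI conjI)
qed

lemma fin_presented_isomorphic_to_object:
  fixes M :: "('a, 'u) rmodule"
  assumes M: "right_module A M" "fin_presented A M"
  shows "\<exists>N \<in> Obj (fpmod A). \<exists>f \<in> rmod_hom A M N. bij_betw f (carrier M) (carrier N)"
proof -
  obtain n \<phi> where \<phi>: "\<phi> ` carrier (free_rmod A n) = carrier M"
    using M(2) unfolding fin_presented_def by blast
  define e where "e m = {x \<in> carrier (free_rmod A n). \<phi> x = m}" for m
  have "inj_on e (carrier M)"
  proof (rule inj_onI)
    fix m m' assume m: "m \<in> carrier M" "m' \<in> carrier M" "e m = e m'"
    have "m \<in> \<phi> ` carrier (free_rmod A n)" unfolding \<phi> by (rule m(1))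
    then obtain x where "x \<in> carrier (free_rmod A n)" "\<phi> x = m" by blast
    then have "x \<in> e m'" using m(3) e_def by blast
    then show "m = m'" using \<open>\<phi> x = m\<close> by (simp add: e_def)
  qed
  note t = transport_rmod_iso[OF M(1) this]
  have "transport_rmod e M \<in> Obj (fpmod A)"
    using t(1) fin_presented_transfer[OF M(2) M(1) t] by (simp add: fpmod_def)
  then show ?thesis using t by blast
qed

end

theory Submission
  imports Defs
begin

text \<open>
  Both functors come from one universal property. For an \<open>A\<close>-object \<open>V\<close> and a finitely presented module
  \<open>M\<close>, the object \<open>M \<otimes> V\<close> represents the functor \<open>W \<mapsto> Hom\<^sub>A(M, Hom(V, W))\<close> (predicate \<open>represents\<close>), and
  an isomorphism of functors as in \<open>is_tensor\<close> amounts, by the Yoneda lemma, to universal \<open>A\<close>-linear maps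
  \<open>x \<mapsto> (z \<mapsto> x \<otimes> z)\<close> from \<open>M\<close> to \<open>Hom(V, M \<otimes> V)\<close>. Identities between arrows out of \<open>M \<otimes> V\<close> are therefore
  checked on elements \<open>x\<close> of \<open>M\<close>, and two representing objects are canonically isomorphic.

  Existence: \<open>A\<^sup>n \<otimes> V\<close> is the coproduct of \<open>n\<close> copies of \<open>V\<close>, and a presentation of \<open>M\<close> reduces \<open>M \<otimes> V\<close>
  to a cokernel (\<open>represents_quotient\<close>, \<open>represents_exists\<close>).

  Right exactness of \<open>(-) \<otimes> V\<close>: if \<open>L \<rightarrow> M \<rightarrow> N \<rightarrow> 0\<close> is exact on elements, then an \<open>A\<close>-linear map on \<open>N\<close> is
  an \<open>A\<close>-linear map on \<open>M\<close> which vanishes on the image of \<open>L\<close>, so \<open>N \<otimes> V\<close> is the cokernel of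
  \<open>L \<otimes> V \<rightarrow> M \<otimes> V\<close> (\<open>Ten_cokernel\<close>). That a short exact sequence of \<open>mod-A\<close> is exact on elements
  (\<open>fpmod_short_exactD\<close>) holds because quotients by finitely generated submodules are objects of
  \<open>mod-A\<close> and elements are arrows out of \<open>A\<close>.

  One composite is the identity since \<open>V\<close> itself represents \<open>Hom\<^sub>A(A, Hom(V, -))\<close> (\<open>regular_represents\<close>).
  For the other one, let \<open>T\<close> be right exact. It has to be shown that \<open>T(M)\<close>, with the map which sends
  \<open>x \<in> M\<close> to \<open>T\<close> of the arrow \<open>A \<rightarrow> M\<close>, \<open>1 \<mapsto> x\<close>, represents \<open>Hom\<^sub>A(M, Hom(T(A), -))\<close>
  (\<open>eval_represents\<close>). For \<open>M = A\<^sup>n\<close> this is additivity of \<open>T\<close>. In general \<open>M\<close> is the quotient of some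
  \<open>A\<^sup>n\<close> by a finitely generated submodule \<open>N\<close>. This is where coherence is needed: \<open>T\<close> is only known to
  respect short exact sequences of \<open>mod-A\<close>, and coherence makes \<open>N\<close> finitely presented
  (\<open>fpmod_presentation\<close>), because by induction on \<open>n\<close> the kernel of a homomorphism \<open>A\<^sup>m \<rightarrow> A\<^sup>n\<close> is
  finitely generated (\<open>fg_ker_free_hom\<close>).

  The second pair of equivalences is a restriction of the first one to full subcategories: by
  definition \<open>V\<close> is flat if \<open>(-) \<otimes> V\<close> is exact, and an exact functor \<open>T\<close> is isomorphic to
  \<open>(-) \<otimes> T(A)\<close>, which is then exact too.
\<close>

section \<open>Right modules and their homomorphisms\<close>

lemma rmod_homI:
  assumes "f \<in> extensional (carrier M)" "\<And>x. x \<in> carrier M \<Longrightarrow> f x \<in> carrier N"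
    "\<And>x y. x \<in> carrier M \<Longrightarrow> y \<in> carrier M \<Longrightarrow> f (x \<oplus>\<^bsub>M\<^esub> y) = f x \<oplus>\<^bsub>N\<^esub> f y"
    "\<And>x a. x \<in> carrier M \<Longrightarrow> a \<in> carrier A \<Longrightarrow> f (ract M x a) = ract N (f x) a"
  shows "f \<in> rmod_hom A M N"
  using assms by (auto simp: rmod_hom_def PiE_def)

lemma rmod_hom_closed: "f \<in> rmod_hom A M N \<Longrightarrow> x \<in> carrier M \<Longrightarrow> f x \<in> carrier N"
  by (auto simp: rmod_hom_def)

lemma rmod_hom_extensional: "f \<in> rmod_hom A M N \<Longrightarrow> f \<in> extensional (carrier M)"
  by (auto simp: rmod_hom_def PiE_def)

lemma rmod_hom_add: "f \<in> rmod_hom A M N \<Longrightarrow> x \<in> carrier M \<Longrightarrow> y \<in> carrier M \<Longrightarrow>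
    f (x \<oplus>\<^bsub>M\<^esub> y) = f x \<oplus>\<^bsub>N\<^esub> f y"
  by (auto simp: rmod_hom_def)

lemma rmod_hom_ract: "f \<in> rmod_hom A M N \<Longrightarrow> x \<in> carrier M \<Longrightarrow> a \<in> carrier A \<Longrightarrow>
    f (ract M x a) = ract N (f x) a"
  by (auto simp: rmod_hom_def)

lemma rmod_hom_eqI:
  assumes "f \<in> rmod_hom A M N" "g \<in> rmod_hom A M N'" "\<And>x. x \<in> carrier M \<Longrightarrow> f x = g x"
  shows "f = g"
  using assms by (auto intro!: extensionalityI dest!: rmod_hom_extensional)

context right_module
begin

lemma ract_zero_left: "a \<in> carrier A \<Longrightarrow> ract M \<zero>\<^bsub>M\<^esub> a = \<zero>\<^bsub>M\<^esub>"
  by (metis M.add.l_cancel_one M.l_zero M.zero_closed ract_add_left ract_closed)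

lemma ract_zero_right: "x \<in> carrier M \<Longrightarrow> ract M x \<zero>\<^bsub>A\<^esub> = \<zero>\<^bsub>M\<^esub>"
  by (metis A.l_zero A.zero_closed M.add.l_cancel_one ract_add_right ract_closed)

lemma ract_minus_one: "x \<in> carrier M \<Longrightarrow> ract M x (\<ominus>\<^bsub>A\<^esub> \<one>\<^bsub>A\<^esub>) = \<ominus>\<^bsub>M\<^esub> x"
  by (metis A.add.inv_closed A.l_neg A.one_closed M.minus_equality ract_add_right ract_closed
      ract_one ract_zero_right)

lemma ract_uminus: "x \<in> carrier M \<Longrightarrow> a \<in> carrier A \<Longrightarrow> ract M (\<ominus>\<^bsub>M\<^esub> x) a = \<ominus>\<^bsub>M\<^esub> ract M x a"
  by (metis M.add.inv_closed M.l_neg M.minus_equality ract_add_left ract_closed ract_zero_left)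

lemma minus_add_cancel: "x \<in> carrier M \<Longrightarrow> y \<in> carrier M \<Longrightarrow> (x \<ominus>\<^bsub>M\<^esub> y) \<oplus>\<^bsub>M\<^esub> y = x"
  by (simp add: a_minus_def M.a_assoc M.l_neg)

lemma eq_if_minus_zero:
  "x \<in> carrier M \<Longrightarrow> y \<in> carrier M \<Longrightarrow> x \<ominus>\<^bsub>M\<^esub> y = \<zero>\<^bsub>M\<^esub> \<Longrightarrow> x = y"
  using minus_add_cancel[of x y] by simp

lemma minus_self: "x \<in> carrier M \<Longrightarrow> x \<ominus>\<^bsub>M\<^esub> x = \<zero>\<^bsub>M\<^esub>"
  by (simp add: a_minus_def M.r_neg)

end

locale right_module_pair = M: right_module A M + N: right_module A N
  for A :: "('k, 'a) module" and M :: "('a, 'u) rmodule" and N :: "('a, 'v) rmodule"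
begin

lemma hom_zero: "f \<in> rmod_hom A M N \<Longrightarrow> f \<zero>\<^bsub>M\<^esub> = \<zero>\<^bsub>N\<^esub>"
  by (metis M.A.zero_closed M.M.zero_closed M.ract_zero_right N.ract_zero_right rmod_hom_closed
      rmod_hom_ract)

lemma hom_uminus: "f \<in> rmod_hom A M N \<Longrightarrow> x \<in> carrier M \<Longrightarrow> f (\<ominus>\<^bsub>M\<^esub> x) = \<ominus>\<^bsub>N\<^esub> f x"
  by (metis M.A.add.inv_closed M.A.one_closed M.ract_minus_one N.ract_minus_one rmod_hom_closed
      rmod_hom_ract)

lemma hom_minus: "f \<in> rmod_hom A M N \<Longrightarrow> x \<in> carrier M \<Longrightarrow> y \<in> carrier M \<Longrightarrow>
    f (x \<ominus>\<^bsub>M\<^esub> y) = f x \<ominus>\<^bsub>N\<^esub> f y"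
  by (simp add: a_minus_def hom_uminus rmod_hom_add)

lemma zero_hom: "(\<lambda>x \<in> carrier M. \<zero>\<^bsub>N\<^esub>) \<in> rmod_hom A M N"
  by (rule rmod_homI) (auto simp: M.ract_closed N.ract_zero_left)

end

lemmas rmod_hom_zero = right_module_pair.hom_zero[OF right_module_pair.intro]
lemmas rmod_hom_minus = right_module_pair.hom_minus[OF right_module_pair.intro]
lemmas rmod_hom_zero_map = right_module_pair.zero_hom[OF right_module_pair.intro]

lemma rmod_hom_comp:
  assumes "right_module A M" "f \<in> rmod_hom A M N" "g \<in> rmod_hom A N P"
  shows "(\<lambda>x \<in> carrier M. g (f x)) \<in> rmod_hom A M P"
proof -
  interpret right_module A M by fact
  show ?thesis using assms(2,3)
    by (intro rmod_homI) (auto simp: rmod_hom_closed rmod_hom_add rmod_hom_ract ract_closed)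
qed

lemma rmod_hom_id:
  assumes "right_module A M"
  shows "(\<lambda>x \<in> carrier M. x) \<in> rmod_hom A M M"
proof -
  interpret right_module A M by fact
  show ?thesis by (intro rmod_homI) (auto simp: ract_closed)
qed

lemma rmod_hom_plus:
  assumes "right_module A M" "right_module A N" "f \<in> rmod_hom A M N" "g \<in> rmod_hom A M N"
  shows "(\<lambda>x \<in> carrier M. f x \<oplus>\<^bsub>N\<^esub> g x) \<in> rmod_hom A M N"
proof -
  interpret M: right_module A M by fact
  interpret N: right_module A N by fact
  show ?thesis using assms(3,4)
    by (intro rmod_homI) (auto simp: rmod_hom_closed rmod_hom_add rmod_hom_ract M.ract_closed
        N.ract_add_left N.M.a_ac)
qed

lemma rmod_hom_diff:
  assumes "right_module A M" "right_module A N" "f \<in> rmod_hom A M N" "g \<in> rmod_hom A M N"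
  shows "(\<lambda>x \<in> carrier M. f x \<ominus>\<^bsub>N\<^esub> g x) \<in> rmod_hom A M N"
proof -
  interpret M: right_module A M by fact
  interpret N: right_module A N by fact
  show ?thesis using assms(3,4)
    by (intro rmod_homI) (auto simp: rmod_hom_closed rmod_hom_add rmod_hom_ract M.ract_closed
        N.ract_closed N.ract_add_left N.ract_uminus N.M.a_ac N.M.minus_add a_minus_def)
qed

definition submod :: "('k, 'a) module \<Rightarrow> ('a, 'u) rmodule \<Rightarrow> 'u set \<Rightarrow> bool" where
  "submod A M S \<longleftrightarrow> S \<subseteq> carrier M \<and> \<zero>\<^bsub>M\<^esub> \<in> S \<and> (\<forall>x \<in> S. \<forall>y \<in> S. x \<oplus>\<^bsub>M\<^esub> y \<in> S) \<and>
     (\<forall>x \<in> S. \<forall>a \<in> carrier A. ract M x a \<in> S)"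

lemma submod_right_module:
  assumes "right_module A M" "submod A M S"
  shows "right_module A (M\<lparr>carrier := S\<rparr>)"
proof -
  interpret right_module A M by fact
  have S: "x \<in> S \<Longrightarrow> x \<in> carrier M" for x using assms(2) by (auto simp: submod_def)
  have "abelian_group (M\<lparr>carrier := S\<rparr>)"
  proof (rule abelian_groupI, goal_cases)
    case (6 x)
    then have "ract M x (\<ominus>\<^bsub>A\<^esub> \<one>\<^bsub>A\<^esub>) \<in> S" using assms(2) by (auto simp: submod_def)
    then show ?case using 6 S by (auto simp: ract_minus_one M.l_neg intro!: bexI[of _ "\<ominus>\<^bsub>M\<^esub> x"])
  qed (use assms(2) S in \<open>auto simp: submod_def M.a_ac\<close>)
  then show ?thesis
    using assms(2) S
    by (intro right_module.intro right_module_axioms.intro A.ring_axioms)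
      (auto simp: submod_def ract_add_left ract_add_right ract_mult ract_one)
qed

lemma submod_minus:
  assumes "right_module A M" "submod A M S" "x \<in> S" "y \<in> S"
  shows "x \<ominus>\<^bsub>M\<^esub> y \<in> S"
proof -
  interpret right_module A M by fact
  have "\<ominus>\<^bsub>M\<^esub> y = ract M y (\<ominus>\<^bsub>A\<^esub> \<one>\<^bsub>A\<^esub>)" using assms by (auto simp: submod_def ract_minus_one)
  then show ?thesis using assms by (auto simp: submod_def a_minus_def)
qed

definition ker :: "('a, 'u) rmodule \<Rightarrow> ('a, 'v) rmodule \<Rightarrow> ('u \<Rightarrow> 'v) \<Rightarrow> 'u set" where
  "ker M N f = {x \<in> carrier M. f x = \<zero>\<^bsub>N\<^esub>}"

lemma submod_ker:
  assumes "right_module A M" "right_module A N" "f \<in> rmod_hom A M N"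
  shows "submod A M (ker M N f)"
proof -
  interpret M: right_module A M by fact
  interpret N: right_module A N by fact
  show ?thesis using assms rmod_hom_zero[OF assms]
    by (auto simp: submod_def ker_def rmod_hom_add rmod_hom_ract M.ract_closed N.ract_zero_left)
qed

lemma submod_image:
  assumes "right_module A M" "right_module A N" "f \<in> rmod_hom A M N"
  shows "submod A N (f ` carrier M)"
proof -
  interpret M: right_module A M by fact
  interpret N: right_module A N by fact
  have "f x \<oplus>\<^bsub>N\<^esub> f y \<in> f ` carrier M" if "x \<in> carrier M" "y \<in> carrier M" for x y
    using that assms(3) by (metis M.M.add.m_closed image_eqI rmod_hom_add)
  moreover have "ract N (f x) a \<in> f ` carrier M" if "x \<in> carrier M" "a \<in> carrier A" for x a
    using that assms(3) by (metis M.ract_closed image_eqI rmod_hom_ract)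
  moreover have "\<zero>\<^bsub>N\<^esub> \<in> f ` carrier M"
    using rmod_hom_zero[OF assms] M.M.zero_closed by (metis image_eqI)
  ultimately show ?thesis using assms(3) by (auto simp: submod_def rmod_hom_closed)
qed

lemma restrict_eqD: "restrict f S = restrict g S \<Longrightarrow> x \<in> S \<Longrightarrow> f x = g x"
  by (metis restrict_apply')

lemma rmod_factor_through_surj:
  assumes "right_module A M" "right_module A N" "right_module A W"
    and p: "p \<in> rmod_hom A M N" "p ` carrier M = carrier N"
    and g: "g \<in> rmod_hom A M W" "\<And>x. x \<in> ker M N p \<Longrightarrow> g x = \<zero>\<^bsub>W\<^esub>"
  shows "\<exists>h \<in> rmod_hom A N W. \<forall>x \<in> carrier M. h (p x) = g x"
proof -
  interpret M: right_module A M by fact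
  interpret N: right_module A N by fact
  interpret W: right_module A W by fact
  have eq: "g x = g y" if "x \<in> carrier M" "y \<in> carrier M" "p x = p y" for x y
  proof -
    have "x \<ominus>\<^bsub>M\<^esub> y \<in> ker M N p"
      using that by (simp add: ker_def rmod_hom_minus[OF assms(1,2) p(1)] N.minus_self rmod_hom_closed[OF p(1)])
    then have "g x \<ominus>\<^bsub>W\<^esub> g y = \<zero>\<^bsub>W\<^esub>"
      using g(2) that by (simp flip: rmod_hom_minus[OF assms(1,3) g(1)])
    then show ?thesis using that by (simp add: W.eq_if_minus_zero rmod_hom_closed[OF g(1)])
  qed
  define h where "h = (\<lambda>z \<in> carrier N. g (SOME x. x \<in> carrier M \<and> p x = z))"
  have h: "h (p x) = g x" if "x \<in> carrier M" for x
  proof -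
    obtain y where y: "(SOME y. y \<in> carrier M \<and> p y = p x) = y" by blast
    have "y \<in> carrier M \<and> p y = p x"
      unfolding y[symmetric] by (rule someI_ex) (use that in blast)
    then have "g y = g x" using eq[of y x] that by blast
    then show ?thesis using that p by (simp add: h_def rmod_hom_closed y)
  qed
  have "h \<in> rmod_hom A N W"
  proof (rule rmod_homI)
    show "h \<in> extensional (carrier N)" by (simp add: h_def)
    fix z assume "z \<in> carrier N"
    then obtain x where x: "x \<in> carrier M" "z = p x" using p(2) by blast
    then show "h z \<in> carrier W" by (simp add: h rmod_hom_closed[OF g(1)])
    show "h (ract N z a) = ract W (h z) a" if "a \<in> carrier A" for a
      using x that by (simp add: h M.ract_closed rmod_hom_ract[OF g(1)] flip: rmod_hom_ract[OF p(1)])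
    fix z' assume "z' \<in> carrier N"
    then obtain x' where x': "x' \<in> carrier M" "z' = p x'" using p(2) by blast
    then show "h (z \<oplus>\<^bsub>N\<^esub> z') = h z \<oplus>\<^bsub>W\<^esub> h z'"
      using x by (simp add: h rmod_hom_add[OF g(1)] flip: rmod_hom_add[OF p(1)])
  qed
  then show ?thesis using h by blast
qed


section \<open>Free modules\<close>

lemma free_rmod_simps:
  "carrier (free_rmod A n) = {..<n} \<rightarrow>\<^sub>E carrier A"
  "\<zero>\<^bsub>free_rmod A n\<^esub> = (\<lambda>i \<in> {..<n}. \<zero>\<^bsub>A\<^esub>)"
  "x \<oplus>\<^bsub>free_rmod A n\<^esub> y = (\<lambda>i \<in> {..<n}. x i \<oplus>\<^bsub>A\<^esub> y i)"
  "ract (free_rmod A n) x a = (\<lambda>i \<in> {..<n}. x i \<otimes>\<^bsub>A\<^esub> a)"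
  by (simp_all add: free_rmod_def)

lemma free_right_module: "ring A \<Longrightarrow> right_module A (free_rmod A n)"
proof -
  assume "ring A"
  then interpret ring A .
  have "abelian_group (free_rmod A n)"
  proof (rule abelian_groupI, goal_cases)
    case (6 x)
    then show ?case
      by (intro bexI[of _ "\<lambda>i \<in> {..<n}. \<ominus>\<^bsub>A\<^esub> x i"])
        (auto simp: free_rmod_simps PiE_iff l_neg intro!: restrict_ext)
  qed (auto simp: free_rmod_simps PiE_iff a_ac intro!: restrict_ext extensionalityI[of _ "{..<n}"])
  then show ?thesis
    by (intro right_module.intro right_module_axioms.intro \<open>ring A\<close>)
      (auto simp: free_rmod_simps PiE_iff l_distr r_distr m_assoc intro!: restrict_ext extensionalityI[of _ "{..<n}"])
qed

definition basis_vec :: "('k, 'a) module \<Rightarrow> nat \<Rightarrow> nat \<Rightarrow> nat \<Rightarrow> 'a" where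
  "basis_vec A n k = (\<lambda>i \<in> {..<n}. if i = k then \<one>\<^bsub>A\<^esub> else \<zero>\<^bsub>A\<^esub>)"

lemma basis_vec_in: "ring A \<Longrightarrow> basis_vec A n k \<in> carrier (free_rmod A n)"
  by (auto simp: basis_vec_def free_rmod_simps ring.ring_simprules)

text \<open>
  A linear combination is defined by recursion on the number of terms, so that additive maps are moved
  through it by a plain induction.
\<close>

primrec lin_comb :: "('a, 'u) rmodule \<Rightarrow> (nat \<Rightarrow> 'u) \<Rightarrow> nat \<Rightarrow> (nat \<Rightarrow> 'a) \<Rightarrow> 'u" where
  "lin_comb M x 0 a = \<zero>\<^bsub>M\<^esub>"
| "lin_comb M x (Suc n) a = lin_comb M x n a \<oplus>\<^bsub>M\<^esub> ract M (x n) (a n)"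

lemma lin_comb_cong: "(\<And>i. i < n \<Longrightarrow> a i = b i) \<Longrightarrow> lin_comb M x n a = lin_comb M x n b"
  by (induction n) auto

context right_module
begin

lemma lin_comb_closed:
  "(\<And>i. i < n \<Longrightarrow> x i \<in> carrier M) \<Longrightarrow> (\<And>i. i < n \<Longrightarrow> a i \<in> carrier A) \<Longrightarrow>
    lin_comb M x n a \<in> carrier M"
  by (induction n) (auto simp: ract_closed)

lemma lin_comb_add:
  "(\<And>i. i < n \<Longrightarrow> x i \<in> carrier M) \<Longrightarrow> (\<And>i. i < n \<Longrightarrow> a i \<in> carrier A) \<Longrightarrow>
    (\<And>i. i < n \<Longrightarrow> b i \<in> carrier A) \<Longrightarrow>
    lin_comb M x n (\<lambda>i. a i \<oplus>\<^bsub>A\<^esub> b i) = lin_comb M x n a \<oplus>\<^bsub>M\<^esub> lin_comb M x n b"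
proof (induction n)
  case (Suc n)
  then have "lin_comb M x n a \<in> carrier M" "lin_comb M x n b \<in> carrier M"
    by (auto intro!: lin_comb_closed)
  then show ?case using Suc by (simp add: ract_add_right M.a_ac ract_closed)
qed simp

lemma lin_comb_ract:
  "(\<And>i. i < n \<Longrightarrow> x i \<in> carrier M) \<Longrightarrow> (\<And>i. i < n \<Longrightarrow> a i \<in> carrier A) \<Longrightarrow> b \<in> carrier A \<Longrightarrow>
    lin_comb M x n (\<lambda>i. a i \<otimes>\<^bsub>A\<^esub> b) = ract M (lin_comb M x n a) b"
proof (induction n)
  case (Suc n)
  then have "lin_comb M x n a \<in> carrier M" by (auto intro!: lin_comb_closed)
  then show ?case using Suc by (simp add: ract_add_left ract_mult ract_closed)
qed (simp add: ract_zero_left)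

lemma lin_comb_hom:
  assumes "\<And>i. i < n \<Longrightarrow> x i \<in> carrier M"
  shows "(\<lambda>a \<in> carrier (free_rmod A n). lin_comb M x n a) \<in> rmod_hom A (free_rmod A n) M"
proof -
  interpret F: right_module A "free_rmod A n" by (rule free_right_module[OF A.ring_axioms])
  have "lin_comb M x n (\<lambda>i \<in> {..<n}. f i) = lin_comb M x n f" for f by (rule lin_comb_cong) simp
  then show ?thesis using assms
    by (intro rmod_homI)
      (auto simp: lin_comb_closed lin_comb_add lin_comb_ract F.ract_closed free_rmod_simps PiE_iff)
qed

lemma lin_comb_basis:
  assumes "\<And>i. i < n \<Longrightarrow> x i \<in> carrier M" "k < n"
  shows "lin_comb M x n (basis_vec A n k) = x k"
proof -
  have "lin_comb M x m (basis_vec A n k) = (if k < m then x k else \<zero>\<^bsub>M\<^esub>)" if "m \<le> n" for m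
    using that
  proof (induction m)
    case (Suc m)
    then show ?case using assms by (auto simp: basis_vec_def ract_one ract_zero_right less_Suc_eq)
  qed simp
  then show ?thesis using assms(2) by simp
qed

end

text \<open>
  Truncation to the first \<open>m\<close> coordinates runs from \<open>0\<close> to \<open>a\<close> as \<open>m\<close> grows, and each step adds one
  multiple of a basis vector. Inductions along it replace the decomposition of \<open>a\<close> as a finite sum.
\<close>

definition truncate :: "('k, 'a) module \<Rightarrow> nat \<Rightarrow> nat \<Rightarrow> (nat \<Rightarrow> 'a) \<Rightarrow> nat \<Rightarrow> 'a" where
  "truncate A n m a = (\<lambda>i \<in> {..<n}. if i < m then a i else \<zero>\<^bsub>A\<^esub>)"

lemma truncate_closed: "ring A \<Longrightarrow> a \<in> carrier (free_rmod A n) \<Longrightarrow>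
    truncate A n m a \<in> carrier (free_rmod A n)"
  by (auto simp: truncate_def free_rmod_simps PiE_iff ring.ring_simprules)

lemma truncate_Suc: 
  assumes "ring A" "a \<in> carrier (free_rmod A n)" "m < n"
  shows "truncate A n (Suc m) a =
    truncate A n m a \<oplus>\<^bsub>free_rmod A n\<^esub> ract (free_rmod A n) (basis_vec A n m) (a m)"
proof -
  interpret ring A by fact
  show ?thesis using assms(2,3)
    by (auto simp: truncate_def free_rmod_simps PiE_iff basis_vec_def fun_eq_iff less_Suc_eq)
qed

lemma truncate_full: "a \<in> carrier (free_rmod A n) \<Longrightarrow> truncate A n n a = a"
  by (auto simp: truncate_def free_rmod_simps fun_eq_iff PiE_iff extensional_def)

lemma truncate_0: "truncate A n 0 a = \<zero>\<^bsub>free_rmod A n\<^esub>"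
  by (auto simp: truncate_def free_rmod_simps fun_eq_iff)

lemma free_hom_lin_comb:
  assumes "right_module A M" "f \<in> rmod_hom A (free_rmod A n) M" "a \<in> carrier (free_rmod A n)"
  shows "f a = lin_comb M (\<lambda>i. f (basis_vec A n i)) n a"
proof -
  interpret M: right_module A M by fact
  note rA = M.A.ring_axioms
  note free = free_right_module[OF rA, of n]
  interpret F: right_module A "free_rmod A n" by (rule free)
  have "f (truncate A n m a) = lin_comb M (\<lambda>i. f (basis_vec A n i)) m a" if "m \<le> n" for m
    using that
  proof (induction m)
    case 0
    then show ?case by (simp add: truncate_0 rmod_hom_zero[OF free assms(1,2)])
  next
    case (Suc m)
    then have "a m \<in> carrier A" using assms(3) by (auto simp: free_rmod_simps PiE_iff)
    then show ?case
      using Suc assms by (simp add: truncate_Suc[OF rA] rmod_hom_add[OF assms(2)]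
          rmod_hom_ract[OF assms(2)] truncate_closed[OF rA] basis_vec_in[OF rA] F.ract_closed)
  qed
  from this[of n] show ?thesis by (simp add: truncate_full[OF assms(3)])
qed

lemma free_hom_eqI:
  assumes "right_module A M" "f \<in> rmod_hom A (free_rmod A n) M" "g \<in> rmod_hom A (free_rmod A n) M"
    "\<And>i. i < n \<Longrightarrow> f (basis_vec A n i) = g (basis_vec A n i)"
  shows "f = g"
proof (rule rmod_hom_eqI[OF assms(2,3)])
  fix a assume a: "a \<in> carrier (free_rmod A n)"
  have "lin_comb M (\<lambda>i. f (basis_vec A n i)) m a = lin_comb M (\<lambda>i. g (basis_vec A n i)) m a"
    if "m \<le> n" for m using that assms(4) by (induction m) auto
  then show "f a = g a"
    using free_hom_lin_comb[OF assms(1,2) a] free_hom_lin_comb[OF assms(1,3) a] by simp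
qed

lemma free_hom_exists:
  assumes "right_module A M" "\<And>i. i < n \<Longrightarrow> x i \<in> carrier M"
  shows "\<exists>f \<in> rmod_hom A (free_rmod A n) M. \<forall>i < n. f (basis_vec A n i) = x i"
proof -
  interpret M: right_module A M by fact
  show ?thesis
    using M.lin_comb_hom[of n x] M.lin_comb_basis[of n x] assms(2) basis_vec_in[OF M.A.ring_axioms]
    by (intro bexI[of _ "\<lambda>a \<in> carrier (free_rmod A n). lin_comb M x n a"]) auto
qed

text \<open>Free modules are projective: it is enough to lift the images of the basis vectors.\<close>

lemma free_hom_lift:
  assumes "right_module A M" "right_module A N" "g \<in> rmod_hom A M N"
    "f \<in> rmod_hom A (free_rmod A n) N" "f ` carrier (free_rmod A n) \<subseteq> g ` carrier M"
  shows "\<exists>h \<in> rmod_hom A (free_rmod A n) M. \<forall>a \<in> carrier (free_rmod A n). g (h a) = f a"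
proof -
  interpret M: right_module A M by fact
  note rA = M.A.ring_axioms
  have "\<forall>i. \<exists>x. x \<in> carrier M \<and> f (basis_vec A n i) = g x"
    using basis_vec_in[OF rA, of n] assms(5) by (auto simp: image_subset_iff)
  then obtain x where x: "\<And>i. x i \<in> carrier M" "\<And>i. f (basis_vec A n i) = g (x i)" by metis
  obtain h where h: "h \<in> rmod_hom A (free_rmod A n) M" "\<forall>i < n. h (basis_vec A n i) = x i"
    using free_hom_exists[OF assms(1), of n x] x by blast
  have "(\<lambda>a \<in> carrier (free_rmod A n). g (h a)) = f"
    using h x basis_vec_in[OF rA, of n]
    by (intro free_hom_eqI[OF assms(2) rmod_hom_comp[OF free_right_module[OF rA] h(1) assms(3)] assms(4)])
      auto
  then show ?thesis using h(1) by (metis restrict_apply')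
qed


section \<open>Finitely generated submodules\<close>

lemma fg_iff:
  assumes "S \<subseteq> carrier M"
  shows "fin_generated A (M\<lparr>carrier := S\<rparr>) \<longleftrightarrow>
    (\<exists>n. \<exists>\<phi> \<in> rmod_hom A (free_rmod A n) M. \<phi> ` carrier (free_rmod A n) = S)"
proof
  assume "fin_generated A (M\<lparr>carrier := S\<rparr>)"
  then obtain n \<phi> where "\<phi> \<in> rmod_hom A (free_rmod A n) (M\<lparr>carrier := S\<rparr>)"
    "\<phi> ` carrier (free_rmod A n) = S" by (auto simp: fin_generated_def)
  then show "\<exists>n. \<exists>\<phi> \<in> rmod_hom A (free_rmod A n) M. \<phi> ` carrier (free_rmod A n) = S"
    using assms by (intro exI[of _ n] bexI[of _ \<phi>]) (auto simp: rmod_hom_def PiE_iff)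
next
  assume "\<exists>n. \<exists>\<phi> \<in> rmod_hom A (free_rmod A n) M. \<phi> ` carrier (free_rmod A n) = S"
  then obtain n \<phi> where "\<phi> \<in> rmod_hom A (free_rmod A n) M" "\<phi> ` carrier (free_rmod A n) = S"
    by blast
  then show "fin_generated A (M\<lparr>carrier := S\<rparr>)"
    unfolding fin_generated_def
    by (intro exI[of _ n] bexI[of _ \<phi>]) (auto simp: rmod_hom_def PiE_iff)
qed

lemma fg_image:
  assumes "right_module A M" "f \<in> rmod_hom A M N" "S \<subseteq> carrier M"
    "fin_generated A (M\<lparr>carrier := S\<rparr>)"
  shows "fin_generated A (N\<lparr>carrier := f ` S\<rparr>)"
proof -
  interpret M: right_module A M by fact
  obtain n \<phi> where \<phi>: "\<phi> \<in> rmod_hom A (free_rmod A n) M" "\<phi> ` carrier (free_rmod A n) = S"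
    using assms(3,4) by (auto simp: fg_iff)
  have "(\<lambda>a \<in> carrier (free_rmod A n). f (\<phi> a)) ` carrier (free_rmod A n) = f ` S"
    using \<phi>(2) by auto
  moreover have "f ` S \<subseteq> carrier N" using assms(2,3) by (auto simp: rmod_hom_closed)
  ultimately show ?thesis
    using rmod_hom_comp[OF free_right_module[OF M.A.ring_axioms] \<phi>(1) assms(2)]
    by (simp only: fg_iff) blast
qed

lemma fg_sum:
  assumes "right_module A M" "S \<subseteq> carrier M" "T \<subseteq> carrier M"
    "fin_generated A (M\<lparr>carrier := S\<rparr>)" "fin_generated A (M\<lparr>carrier := T\<rparr>)"
  shows "fin_generated A (M\<lparr>carrier := {x \<oplus>\<^bsub>M\<^esub> y | x y. x \<in> S \<and> y \<in> T}\<rparr>)"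
proof -
  interpret M: right_module A M by fact
  obtain n \<phi> where \<phi>: "\<phi> \<in> rmod_hom A (free_rmod A n) M" "\<phi> ` carrier (free_rmod A n) = S"
    using assms(2,4) by (auto simp: fg_iff)
  obtain m \<psi> where \<psi>: "\<psi> \<in> rmod_hom A (free_rmod A m) M" "\<psi> ` carrier (free_rmod A m) = T"
    using assms(3,5) by (auto simp: fg_iff)
  let ?F = "free_rmod A (n + m)"
  define l where "l a = (\<lambda>i \<in> {..<n}. a i)" for a :: "nat \<Rightarrow> 'a"
  define r where "r a = (\<lambda>i \<in> {..<m}. a (n + i))" for a :: "nat \<Rightarrow> 'a"
  have lr: "l a \<in> carrier (free_rmod A n)" "r a \<in> carrier (free_rmod A m)" if "a \<in> carrier ?F" for a
    using that by (auto simp: l_def r_def free_rmod_simps PiE_iff)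
  have lr_add: "l (a \<oplus>\<^bsub>?F\<^esub> b) = l a \<oplus>\<^bsub>free_rmod A n\<^esub> l b"
    "r (a \<oplus>\<^bsub>?F\<^esub> b) = r a \<oplus>\<^bsub>free_rmod A m\<^esub> r b" for a b
    by (auto simp: l_def r_def free_rmod_simps fun_eq_iff)
  have lr_ract: "l (ract ?F a b) = ract (free_rmod A n) (l a) b"
    "r (ract ?F a b) = ract (free_rmod A m) (r a) b" for a b
    by (auto simp: l_def r_def free_rmod_simps fun_eq_iff)
  interpret F: right_module A ?F by (rule free_right_module[OF M.A.ring_axioms])
  let ?\<chi> = "\<lambda>a \<in> carrier ?F. \<phi> (l a) \<oplus>\<^bsub>M\<^esub> \<psi> (r a)"
  note cl = rmod_hom_closed[OF \<phi>(1)] rmod_hom_closed[OF \<psi>(1)]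
  have "?\<chi> \<in> rmod_hom A ?F M"
    using \<phi>(1) \<psi>(1)
    by (intro rmod_homI) (auto simp: lr lr_add lr_ract rmod_hom_add rmod_hom_ract cl M.ract_add_left
        F.ract_closed M.M.a_ac)
  moreover have "?\<chi> ` carrier ?F = {x \<oplus>\<^bsub>M\<^esub> y | x y. x \<in> S \<and> y \<in> T}"
  proof (intro equalityI subsetI)
    fix z assume "z \<in> ?\<chi> ` carrier ?F"
    then show "z \<in> {x \<oplus>\<^bsub>M\<^esub> y | x y. x \<in> S \<and> y \<in> T}" using lr \<phi>(2) \<psi>(2) by fastforce
  next
    fix z assume "z \<in> {x \<oplus>\<^bsub>M\<^esub> y | x y. x \<in> S \<and> y \<in> T}"
    then obtain a b where ab: "a \<in> carrier (free_rmod A n)" "b \<in> carrier (free_rmod A m)"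
      "z = \<phi> a \<oplus>\<^bsub>M\<^esub> \<psi> b" using \<phi>(2) \<psi>(2) by blast
    \<comment> \<open>The concatenation of the two coefficient vectors.\<close>
    define c where "c = (\<lambda>i \<in> {..<n + m}. if i < n then a i else b (i - n))"
    have "c \<in> carrier ?F" "l c = a" "r c = b"
      using ab by (auto simp: c_def l_def r_def free_rmod_simps PiE_iff extensional_def fun_eq_iff)
    then show "z \<in> ?\<chi> ` carrier ?F" using ab by (intro image_eqI[of _ _ c]) auto
  qed
  moreover have "{x \<oplus>\<^bsub>M\<^esub> y | x y. x \<in> S \<and> y \<in> T} \<subseteq> carrier M" using assms by blast
  ultimately show ?thesis by (simp only: fg_iff) blast
qed

lemma fin_presented_iff: "fin_presented A M \<longleftrightarrow> (\<exists>n. \<exists>\<phi> \<in> rmod_hom A (free_rmod A n) M.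
    \<phi> ` carrier (free_rmod A n) = carrier M \<and>
    fin_generated A ((free_rmod A n)\<lparr>carrier := ker (free_rmod A n) M \<phi>\<rparr>))"
  by (simp add: fin_presented_def ker_def)

lemma ker_subset: "ker M N f \<subseteq> carrier M"
  by (auto simp: ker_def)

lemma fg_carrier_free: 
  assumes "ring A"
  shows "fin_generated A ((free_rmod A n)\<lparr>carrier := carrier (free_rmod A n)\<rparr>)"
proof -
  have "(\<lambda>x \<in> carrier (free_rmod A n). x) ` carrier (free_rmod A n) = carrier (free_rmod A n)"
    by auto
  then show ?thesis
    using rmod_hom_id[OF free_right_module[OF assms, of n]] by (simp only: fg_iff subset_refl) blast
qed

text \<open>
  Schanuel's lemma: two surjections \<open>\<phi>\<close> and \<open>\<psi>\<close> from free modules onto the same module lift along each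
  other, \<open>\<psi> = \<phi> \<circ> \<beta>\<close> and \<open>\<phi> = \<psi> \<circ> \<gamma>\<close>, and \<open>x = (x - \<gamma> (\<beta> x)) + \<gamma> (\<beta> x)\<close> writes the kernel of \<open>\<psi>\<close>
  as the sum of two finitely generated submodules, the second one being the image under \<open>\<gamma>\<close> of the
  kernel of \<open>\<phi>\<close>.
\<close>

lemma fg_ker_if_fin_presented:
  assumes "right_module A M" "fin_presented A M" and \<psi>: "\<psi> \<in> rmod_hom A (free_rmod A m) M"
    "\<psi> ` carrier (free_rmod A m) = carrier M"
  shows "fin_generated A ((free_rmod A m)\<lparr>carrier := ker (free_rmod A m) M \<psi>\<rparr>)"
proof -
  interpret M: right_module A M by fact
  note rA = M.A.ring_axioms
  obtain n \<phi> where \<phi>: "\<phi> \<in> rmod_hom A (free_rmod A n) M" "\<phi> ` carrier (free_rmod A n) = carrier M"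
    "fin_generated A ((free_rmod A n)\<lparr>carrier := ker (free_rmod A n) M \<phi>\<rparr>)"
    using assms(2) by (auto simp: fin_presented_iff)
  let ?N = "free_rmod A n" and ?M = "free_rmod A m"
  note free = free_right_module[OF rA]
  obtain \<beta> where \<beta>: "\<beta> \<in> rmod_hom A ?M ?N" "\<forall>a \<in> carrier ?M. \<phi> (\<beta> a) = \<psi> a"
    using free_hom_lift[OF free assms(1) \<phi>(1) \<psi>(1)] \<phi>(2) \<psi>(2) by blast
  obtain \<gamma> where \<gamma>: "\<gamma> \<in> rmod_hom A ?N ?M" "\<forall>a \<in> carrier ?N. \<psi> (\<gamma> a) = \<phi> a"
    using free_hom_lift[OF free assms(1) \<psi>(1) \<phi>(1)] \<phi>(2) \<psi>(2) by blast
  interpret F: right_module A ?M by (rule free)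
  interpret G: right_module A ?N by (rule free)
  define \<delta> where "\<delta> = (\<lambda>x \<in> carrier ?M. x \<ominus>\<^bsub>?M\<^esub> \<gamma> (\<beta> x))"
  note cl = rmod_hom_closed[OF \<beta>(1)] rmod_hom_closed[OF \<gamma>(1)]
  have "\<delta> = (\<lambda>x \<in> carrier ?M. (\<lambda>x \<in> carrier ?M. x) x \<ominus>\<^bsub>?M\<^esub> (\<lambda>x \<in> carrier ?M. \<gamma> (\<beta> x)) x)"
    by (auto simp: \<delta>_def intro!: restrict_ext)
  then have \<delta>: "\<delta> \<in> rmod_hom A ?M ?M"
    using rmod_hom_diff[OF free free rmod_hom_id[OF free] rmod_hom_comp[OF free \<beta>(1) \<gamma>(1)]]
    by (simp only:)
  have "ker ?M M \<psi> = {x \<oplus>\<^bsub>?M\<^esub> y | x y. x \<in> \<delta> ` carrier ?M \<and> y \<in> \<gamma> ` ker ?N M \<phi>}"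
  proof (intro equalityI subsetI)
    fix x assume x: "x \<in> ker ?M M \<psi>"
    then have "\<beta> x \<in> ker ?N M \<phi>" using \<beta>(2) by (auto simp: ker_def cl)
    moreover have "x = \<delta> x \<oplus>\<^bsub>?M\<^esub> \<gamma> (\<beta> x)"
      using x by (auto simp: \<delta>_def ker_def cl F.minus_add_cancel)
    ultimately show "x \<in> {x \<oplus>\<^bsub>?M\<^esub> y | x y. x \<in> \<delta> ` carrier ?M \<and> y \<in> \<gamma> ` ker ?N M \<phi>}"
      using x by (auto simp: ker_def)
  next
    fix x assume "x \<in> {x \<oplus>\<^bsub>?M\<^esub> y | x y. x \<in> \<delta> ` carrier ?M \<and> y \<in> \<gamma> ` ker ?N M \<phi>}"
    then obtain y z where yz: "y \<in> carrier ?M" "z \<in> carrier ?N" "\<phi> z = \<zero>\<^bsub>M\<^esub>" "x = \<delta> y \<oplus>\<^bsub>?M\<^esub> \<gamma> z"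
      by (auto simp: ker_def)
    have "\<psi> (\<delta> y) = \<zero>\<^bsub>M\<^esub>"
      using yz \<beta>(2) \<gamma>(2)
      by (simp add: \<delta>_def rmod_hom_minus[OF free assms(1) \<psi>(1)] cl M.minus_self rmod_hom_closed[OF \<psi>(1)])
    then show "x \<in> ker ?M M \<psi>"
      using yz \<gamma>(2) rmod_hom_closed[OF \<delta>]
      by (auto simp: ker_def rmod_hom_add[OF \<psi>(1)] cl)
  qed
  moreover have "fin_generated A (?M\<lparr>carrier := {x \<oplus>\<^bsub>?M\<^esub> y | x y. x \<in> \<delta> ` carrier ?M \<and> y \<in> \<gamma> ` ker ?N M \<phi>}\<rparr>)"
    using rmod_hom_closed[OF \<delta>]
    by (intro fg_sum free fg_image[OF free \<delta> subset_refl fg_carrier_free[OF rA]]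
        fg_image[OF free \<gamma>(1) ker_subset \<phi>(3)]) (auto simp: ker_def cl)
  ultimately show ?thesis by (simp only:)
qed


section \<open>Consequences of coherence\<close>

lemma self_rmod_simps:
  "carrier (self_rmod A) = carrier A" "\<zero>\<^bsub>self_rmod A\<^esub> = \<zero>\<^bsub>A\<^esub>"
  "x \<oplus>\<^bsub>self_rmod A\<^esub> y = x \<oplus>\<^bsub>A\<^esub> y" "ract (self_rmod A) x y = x \<otimes>\<^bsub>A\<^esub> y"
  by (simp_all add: self_rmod_def)

lemma self_right_module: "ring A \<Longrightarrow> right_module A (self_rmod A)"
proof -
  assume "ring A"
  then interpret ring A .
  have "abelian_group (self_rmod A)"
    by (rule abelian_groupI) (auto simp: self_rmod_simps a_ac intro: l_neg)
  then show ?thesis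
    by (intro right_module.intro right_module_axioms.intro \<open>ring A\<close>)
      (auto simp: self_rmod_simps l_distr r_distr m_assoc)
qed

lemma submod_right_ideal:
  assumes "ring A" "submod A (self_rmod A) I"
  shows "right_ideal A I"
proof -
  interpret ring A by fact
  have "right_module A ((self_rmod A)\<lparr>carrier := I\<rparr>)"
    by (rule submod_right_module[OF self_right_module assms(2)]) fact
  then interpret I: right_module A "(self_rmod A)\<lparr>carrier := I\<rparr>" .
  have "additive_subgroup I A"
  proof (intro additive_subgroup.intro add.subgroupI)
    show "I \<subseteq> carrier A" "I \<noteq> {}" using assms(2) by (auto simp: submod_def self_rmod_simps)
    show "a \<oplus>\<^bsub>A\<^esub> b \<in> I" if "a \<in> I" "b \<in> I" for a b
      using that assms(2) by (auto simp: submod_def self_rmod_simps)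
    show "\<ominus>\<^bsub>A\<^esub> a \<in> I" if "a \<in> I" for a
    proof -
      have "a \<otimes>\<^bsub>A\<^esub> (\<ominus>\<^bsub>A\<^esub> \<one>\<^bsub>A\<^esub>) \<in> I" using that assms(2) by (auto simp: submod_def self_rmod_simps)
      moreover have "a \<in> carrier A" using that assms(2) by (auto simp: submod_def self_rmod_simps)
      ultimately show ?thesis by (simp add: r_minus)
    qed
  qed
  then show ?thesis using assms(2) by (auto simp: right_ideal_def submod_def self_rmod_simps)
qed

text \<open>
  By induction on the rank \<open>n\<close> of the target: the last coordinate of \<open>\<phi>\<close> has a finitely generated
  right ideal as its image, so coherence and Schanuel's lemma give a surjection \<open>\<chi>\<close> from a free
  module onto its kernel; the kernel of \<open>\<phi>\<close> is then the image under \<open>\<chi>\<close> of the kernel of the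
  remaining \<open>n - 1\<close> coordinates of \<open>\<phi> \<circ> \<chi>\<close>.
\<close>

lemma fg_ker_free_hom:
  assumes "ring A" "right_coherent A" "\<phi> \<in> rmod_hom A (free_rmod A m) (free_rmod A n)"
  shows "fin_generated A ((free_rmod A m)\<lparr>carrier := ker (free_rmod A m) (free_rmod A n) \<phi>\<rparr>)"
  using assms(3)
proof (induction n arbitrary: m \<phi>)
  case 0
  have "ker (free_rmod A m) (free_rmod A 0) \<phi> = carrier (free_rmod A m)"
    using rmod_hom_closed[OF 0] by (auto simp: ker_def free_rmod_simps)
  then show ?case using fg_carrier_free[OF assms(1)] by (simp only:)
next
  case (Suc n)
  interpret ring A by fact
  note free = free_right_module[OF assms(1)] and self = self_right_module[OF assms(1)]
  let ?M = "free_rmod A m"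
  interpret M: right_module A ?M by (rule free)
  have coord: "\<phi> a i \<in> carrier A" if "a \<in> carrier ?M" "i < Suc n" for a i
    using rmod_hom_closed[OF Suc.prems that(1)] that(2) by (auto simp: free_rmod_simps)
  define \<psi> where "\<psi> = (\<lambda>a \<in> carrier ?M. \<phi> a n)"
  have \<psi>: "\<psi> \<in> rmod_hom A ?M (self_rmod A)"
    by (rule rmod_homI) (auto simp: \<psi>_def self_rmod_simps coord M.ract_closed rmod_hom_add[OF Suc.prems]
        rmod_hom_ract[OF Suc.prems] free_rmod_simps(3,4)[of _ "Suc n"])
  let ?I = "\<psi> ` carrier ?M"
  have I: "submod A (self_rmod A) ?I" by (rule submod_image[OF free self \<psi>])
  then have I': "?I \<subseteq> carrier (self_rmod A)" by (auto simp: submod_def)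
  have "fin_generated A ((self_rmod A)\<lparr>carrier := ?I\<rparr>)"
    by (rule fg_image[OF free \<psi> subset_refl fg_carrier_free[OF assms(1)]])
  then have "fin_presented A ((self_rmod A)\<lparr>carrier := ?I\<rparr>)"
    using assms(2) submod_right_ideal[OF assms(1) I] by (auto simp: right_coherent_def)
  moreover have "\<psi> \<in> rmod_hom A ?M ((self_rmod A)\<lparr>carrier := ?I\<rparr>)"
    using \<psi> by (auto simp: rmod_hom_def PiE_iff)
  ultimately have "fin_generated A (?M\<lparr>carrier := ker ?M ((self_rmod A)\<lparr>carrier := ?I\<rparr>) \<psi>\<rparr>)"
    by (intro fg_ker_if_fin_presented submod_right_module[OF self I]) auto
  then have "fin_generated A (?M\<lparr>carrier := ker ?M (self_rmod A) \<psi>\<rparr>)"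
    by (simp add: ker_def)
  then obtain k \<chi> where \<chi>: "\<chi> \<in> rmod_hom A (free_rmod A k) ?M"
    "\<chi> ` carrier (free_rmod A k) = ker ?M (self_rmod A) \<psi>"
    by (auto simp: fg_iff[OF ker_subset])
  let ?K = "free_rmod A k"
  interpret K: right_module A ?K by (rule free)
  note \<chi>cl = rmod_hom_closed[OF \<chi>(1)]
  define \<phi>' where "\<phi>' = (\<lambda>a \<in> carrier ?K. \<lambda>i \<in> {..<n}. \<phi> (\<chi> a) i)"
  have "\<phi>' \<in> rmod_hom A ?K (free_rmod A n)"
    by (rule rmod_homI) (auto simp: \<phi>'_def \<chi>cl coord K.ract_closed rmod_hom_add[OF Suc.prems]
        rmod_hom_ract[OF Suc.prems] rmod_hom_add[OF \<chi>(1)] rmod_hom_ract[OF \<chi>(1)]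
        free_rmod_simps(1,3,4)[of _ n] free_rmod_simps(3,4)[of _ "Suc n"] intro!: restrict_ext)
  from Suc.IH[OF this]
  have "fin_generated A (?M\<lparr>carrier := \<chi> ` ker ?K (free_rmod A n) \<phi>'\<rparr>)"
    by (rule fg_image[OF free \<chi>(1) ker_subset])
  moreover have "\<chi> ` ker ?K (free_rmod A n) \<phi>' = ker ?M (free_rmod A (Suc n)) \<phi>"
  proof (intro equalityI subsetI)
    fix x assume "x \<in> \<chi> ` ker ?K (free_rmod A n) \<phi>'"
    then obtain a where a: "a \<in> carrier ?K" "\<phi>' a = \<zero>\<^bsub>free_rmod A n\<^esub>" "x = \<chi> a"
      by (auto simp: ker_def)
    have x: "x \<in> carrier ?M" "\<psi> x = \<zero>\<^bsub>A\<^esub>"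
      using a(1,3) \<chi>(2) by (auto simp: ker_def self_rmod_simps)
    have "\<phi> x i = \<zero>\<^bsub>A\<^esub>" if "i < Suc n" for i
    proof (cases "i = n")
      case True
      then show ?thesis using x by (simp add: \<psi>_def)
    next
      case False
      then have "\<phi>' a i = \<zero>\<^bsub>A\<^esub>" using a(2) that by (simp add: free_rmod_simps)
      then show ?thesis using False that a by (simp add: \<phi>'_def)
    qed
    then have "\<phi> x = \<zero>\<^bsub>free_rmod A (Suc n)\<^esub>"
      using rmod_hom_closed[OF Suc.prems x(1)]
      by (intro extensionalityI[of _ "{..<Suc n}"]) (auto simp: free_rmod_simps PiE_iff)
    then show "x \<in> ker ?M (free_rmod A (Suc n)) \<phi>" using x by (simp add: ker_def)
  next
    fix x assume x: "x \<in> ker ?M (free_rmod A (Suc n)) \<phi>"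
    then have "x \<in> ker ?M (self_rmod A) \<psi>"
      by (auto simp: ker_def \<psi>_def self_rmod_simps free_rmod_simps)
    then obtain a where a: "a \<in> carrier ?K" "x = \<chi> a" using \<chi>(2) by blast
    have "a \<in> ker ?K (free_rmod A n) \<phi>'"
      using x a by (auto simp: ker_def \<phi>'_def free_rmod_simps)
    then show "x \<in> \<chi> ` ker ?K (free_rmod A n) \<phi>'" using a by blast
  qed
  ultimately show ?case by (simp only:)
qed

lemma fin_presented_fg_submodule_of_free:
  assumes "ring A" "right_coherent A" "submod A (free_rmod A n) S"
    "fin_generated A ((free_rmod A n)\<lparr>carrier := S\<rparr>)"
  shows "fin_presented A ((free_rmod A n)\<lparr>carrier := S\<rparr>)"
proof -
  have S: "S \<subseteq> carrier (free_rmod A n)" using assms(3) by (auto simp: submod_def)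
  obtain m \<phi> where \<phi>: "\<phi> \<in> rmod_hom A (free_rmod A m) (free_rmod A n)"
    "\<phi> ` carrier (free_rmod A m) = S"
    using assms(4) by (auto simp: fg_iff[OF S])
  have "ker (free_rmod A m) ((free_rmod A n)\<lparr>carrier := S\<rparr>) \<phi> = ker (free_rmod A m) (free_rmod A n) \<phi>"
    by (simp add: ker_def)
  then show ?thesis
    using fg_ker_free_hom[OF assms(1,2) \<phi>(1)] \<phi>
    unfolding fin_presented_iff
    by (intro exI[of _ m] bexI[of _ \<phi>]) (auto simp: rmod_hom_def PiE_iff)
qed

section \<open>Quotient modules\<close>

lemma (in abelian_group) cancel_minus:
  assumes "x \<in> carrier G" "y \<in> carrier G" "z \<in> carrier G"
  shows "(z \<ominus> y) \<ominus> (z \<ominus> x) = x \<ominus> y" "(z \<ominus> x) \<oplus> (x \<ominus> y) = z \<ominus> y"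
    "(z \<ominus> y) \<ominus> (x \<ominus> y) = z \<ominus> x" "(z \<oplus> y) \<ominus> (x \<oplus> y) = z \<ominus> x"
proof -
  have c: "a \<oplus> (b \<oplus> \<ominus> a) = b" "a \<oplus> (b \<oplus> (\<ominus> a \<oplus> c)) = b \<oplus> c"
    "\<ominus> a \<oplus> (b \<oplus> a) = b" "\<ominus> a \<oplus> (b \<oplus> (a \<oplus> c)) = b \<oplus> c"
    if "a \<in> carrier G" "b \<in> carrier G" "c \<in> carrier G" for a b c
    using that by (simp_all add: a_lcomm[of a b] a_lcomm[of "\<ominus> a" b] r_neg l_neg r_neg1 r_neg2)
  show "(z \<ominus> y) \<ominus> (z \<ominus> x) = x \<ominus> y" "(z \<ominus> x) \<oplus> (x \<ominus> y) = z \<ominus> y"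
    "(z \<ominus> y) \<ominus> (x \<ominus> y) = z \<ominus> x" "(z \<oplus> y) \<ominus> (x \<oplus> y) = z \<ominus> x"
    using assms by (simp_all add: a_minus_def minus_add a_ac r_neg1 r_neg2 c)
qed

definition coset_rep :: "('a, 'u) rmodule \<Rightarrow> 'u set \<Rightarrow> 'u \<Rightarrow> 'u" where
  "coset_rep M S x = (SOME y. y \<in> carrier M \<and> y \<ominus>\<^bsub>M\<^esub> x \<in> S)"

text \<open>
  The quotient is carried by a set of coset representatives rather than by the set of cosets, so
  that a quotient of an object of \<open>mod-A\<close> has elements of the same type.
\<close>

definition quot_rmod :: "('a, 'u) rmodule \<Rightarrow> 'u set \<Rightarrow> ('a, 'u) rmodule" where
  "quot_rmod M S = \<lparr>carrier = coset_rep M S ` carrier M, monoid.mult = undefined,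
     monoid.one = undefined, ring.zero = coset_rep M S \<zero>\<^bsub>M\<^esub>,
     ring.add = (\<lambda>x y. coset_rep M S (x \<oplus>\<^bsub>M\<^esub> y)), ract = (\<lambda>x a. coset_rep M S (ract M x a))\<rparr>"

lemma quot_rmod_simps:
  "carrier (quot_rmod M S) = coset_rep M S ` carrier M"
  "\<zero>\<^bsub>quot_rmod M S\<^esub> = coset_rep M S \<zero>\<^bsub>M\<^esub>"
  "x \<oplus>\<^bsub>quot_rmod M S\<^esub> y = coset_rep M S (x \<oplus>\<^bsub>M\<^esub> y)"
  "ract (quot_rmod M S) x a = coset_rep M S (ract M x a)"
  by (simp_all add: quot_rmod_def)

locale submodule = right_module A M
  for A :: "('k, 'a) module" and M :: "('a, 'u) rmodule" +
  fixes S :: "'u set"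
  assumes submod: "submod A M S"
begin

lemma S_carrier: "x \<in> S \<Longrightarrow> x \<in> carrier M"
  using submod by (auto simp: submod_def)

lemma S_add: "x \<in> S \<Longrightarrow> y \<in> S \<Longrightarrow> x \<oplus>\<^bsub>M\<^esub> y \<in> S"
  using submod by (auto simp: submod_def)

lemma S_minus: "x \<in> S \<Longrightarrow> y \<in> S \<Longrightarrow> x \<ominus>\<^bsub>M\<^esub> y \<in> S"
  using submod_minus[OF right_module_axioms submod] .

lemma coset_rep: "x \<in> carrier M \<Longrightarrow> coset_rep M S x \<in> carrier M \<and> coset_rep M S x \<ominus>\<^bsub>M\<^esub> x \<in> S"
  unfolding coset_rep_def
  by (rule someI[of _ x]) (use submod in \<open>auto simp: submod_def minus_self\<close>)

lemma coset_rep_eq_iff: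
  assumes "x \<in> carrier M" "y \<in> carrier M"
  shows "coset_rep M S x = coset_rep M S y \<longleftrightarrow> x \<ominus>\<^bsub>M\<^esub> y \<in> S"
proof
  have *: "(z \<ominus>\<^bsub>M\<^esub> y) \<ominus>\<^bsub>M\<^esub> (z \<ominus>\<^bsub>M\<^esub> x) = x \<ominus>\<^bsub>M\<^esub> y" if "z \<in> carrier M" for z
    using that assms by (simp add: M.cancel_minus)
  assume "coset_rep M S x = coset_rep M S y"
  then show "x \<ominus>\<^bsub>M\<^esub> y \<in> S"
    using coset_rep[OF assms(1)] coset_rep[OF assms(2)] *[of "coset_rep M S x"]
      S_minus[of "coset_rep M S x \<ominus>\<^bsub>M\<^esub> y" "coset_rep M S x \<ominus>\<^bsub>M\<^esub> x"] by simp
next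
  assume S: "x \<ominus>\<^bsub>M\<^esub> y \<in> S"
  have "z \<ominus>\<^bsub>M\<^esub> y = (z \<ominus>\<^bsub>M\<^esub> x) \<oplus>\<^bsub>M\<^esub> (x \<ominus>\<^bsub>M\<^esub> y)"
    "z \<ominus>\<^bsub>M\<^esub> x = (z \<ominus>\<^bsub>M\<^esub> y) \<ominus>\<^bsub>M\<^esub> (x \<ominus>\<^bsub>M\<^esub> y)" if "z \<in> carrier M" for z
    using that assms by (simp_all add: M.cancel_minus)
  then have "z \<ominus>\<^bsub>M\<^esub> x \<in> S \<longleftrightarrow> z \<ominus>\<^bsub>M\<^esub> y \<in> S" if "z \<in> carrier M" for z
    using that S S_add[of "z \<ominus>\<^bsub>M\<^esub> x" "x \<ominus>\<^bsub>M\<^esub> y"] S_minus[of "z \<ominus>\<^bsub>M\<^esub> y" "x \<ominus>\<^bsub>M\<^esub> y"] by metis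
  then have "(\<lambda>z. z \<in> carrier M \<and> z \<ominus>\<^bsub>M\<^esub> x \<in> S) = (\<lambda>z. z \<in> carrier M \<and> z \<ominus>\<^bsub>M\<^esub> y \<in> S)"
    by blast
  then show "coset_rep M S x = coset_rep M S y" unfolding coset_rep_def by (rule arg_cong)
qed

lemma coset_rep_idem: "x \<in> carrier M \<Longrightarrow> coset_rep M S (coset_rep M S x) = coset_rep M S x"
  using coset_rep coset_rep_eq_iff by blast

lemma coset_rep_add:
  assumes "x \<in> carrier M" "y \<in> carrier M"
  shows "coset_rep M S (coset_rep M S x \<oplus>\<^bsub>M\<^esub> y) = coset_rep M S (x \<oplus>\<^bsub>M\<^esub> y)"
    and "coset_rep M S (x \<oplus>\<^bsub>M\<^esub> coset_rep M S y) = coset_rep M S (x \<oplus>\<^bsub>M\<^esub> y)"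
proof -
  have *: "coset_rep M S (coset_rep M S x \<oplus>\<^bsub>M\<^esub> y) = coset_rep M S (x \<oplus>\<^bsub>M\<^esub> y)"
    if "x \<in> carrier M" "y \<in> carrier M" for x y
  proof -
    have r: "coset_rep M S x \<in> carrier M" "coset_rep M S x \<ominus>\<^bsub>M\<^esub> x \<in> S" using coset_rep that by auto
    have "(coset_rep M S x \<oplus>\<^bsub>M\<^esub> y) \<ominus>\<^bsub>M\<^esub> (x \<oplus>\<^bsub>M\<^esub> y) = coset_rep M S x \<ominus>\<^bsub>M\<^esub> x"
      using r that by (simp add: M.cancel_minus)
    then show ?thesis using r that by (simp add: coset_rep_eq_iff)
  qed
  show "coset_rep M S (coset_rep M S x \<oplus>\<^bsub>M\<^esub> y) = coset_rep M S (x \<oplus>\<^bsub>M\<^esub> y)" using * assms .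
  show "coset_rep M S (x \<oplus>\<^bsub>M\<^esub> coset_rep M S y) = coset_rep M S (x \<oplus>\<^bsub>M\<^esub> y)"
    using *[OF assms(2,1)] assms coset_rep[OF assms(2)] by (simp add: M.a_comm)
qed

lemma coset_rep_ract:
  assumes "x \<in> carrier M" "a \<in> carrier A"
  shows "coset_rep M S (ract M (coset_rep M S x) a) = coset_rep M S (ract M x a)"
proof -
  have r: "coset_rep M S x \<in> carrier M" "coset_rep M S x \<ominus>\<^bsub>M\<^esub> x \<in> S" using coset_rep assms by auto
  have "ract M (coset_rep M S x) a \<ominus>\<^bsub>M\<^esub> ract M x a = ract M (coset_rep M S x \<ominus>\<^bsub>M\<^esub> x) a"
    using r assms by (simp add: a_minus_def ract_add_left ract_uminus)
  also have "\<dots> \<in> S" using r(2) assms submod by (auto simp: submod_def)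
  finally show ?thesis using r(1) assms by (simp add: coset_rep_eq_iff ract_closed)
qed

lemma quot_right_module: "right_module A (quot_rmod M S)"
proof -
  note c = coset_rep[THEN conjunct1]
  have "abelian_group (quot_rmod M S)"
  proof (rule abelian_groupI, goal_cases)
    case (4 x y)
    then show ?case by (auto simp: quot_rmod_simps coset_rep_add c M.a_comm)
  next
    case (6 x)
    then obtain x' where x': "x' \<in> carrier M" "x = coset_rep M S x'" by (auto simp: quot_rmod_simps)
    then have "coset_rep M S (\<ominus>\<^bsub>M\<^esub> x') \<oplus>\<^bsub>quot_rmod M S\<^esub> x = \<zero>\<^bsub>quot_rmod M S\<^esub>"
      by (simp add: quot_rmod_simps coset_rep_add c M.l_neg)
    then show ?case using x' by (auto simp: quot_rmod_simps)
  qed (auto simp: quot_rmod_simps coset_rep_add coset_rep_idem c M.a_assoc)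
  then show ?thesis
    by (intro right_module.intro right_module_axioms.intro A.ring_axioms)
      (auto simp: quot_rmod_simps coset_rep_add coset_rep_ract coset_rep_idem c ract_closed
        ract_add_left ract_one, simp_all add: ract_add_right ract_mult)
qed

lemma quot_proj: "restrict (coset_rep M S) (carrier M) \<in> rmod_hom A M (quot_rmod M S)"
  by (rule rmod_homI) (auto simp: quot_rmod_simps coset_rep_add coset_rep_ract ract_closed
      coset_rep[THEN conjunct1])

lemma quot_proj_eq_zero_iff: "x \<in> carrier M \<Longrightarrow> coset_rep M S x = \<zero>\<^bsub>quot_rmod M S\<^esub> \<longleftrightarrow> x \<in> S"
  using minus_add_cancel[of x "\<zero>\<^bsub>M\<^esub>"] by (simp add: quot_rmod_simps coset_rep_eq_iff)

text \<open>
  The relations of the quotient, among generators of \<open>M\<close>, are those of \<open>M\<close> together with lifts of the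
  generators of \<open>S\<close>.
\<close>

lemma quot_fin_presented:
  assumes "fin_presented A M" "fin_generated A (M\<lparr>carrier := S\<rparr>)"
  shows "fin_presented A (quot_rmod M S)"
proof -
  note free = free_right_module[OF A.ring_axioms]
  obtain n \<phi> where \<phi>: "\<phi> \<in> rmod_hom A (free_rmod A n) M" "\<phi> ` carrier (free_rmod A n) = carrier M"
    "fin_generated A ((free_rmod A n)\<lparr>carrier := ker (free_rmod A n) M \<phi>\<rparr>)"
    using assms(1) by (auto simp: fin_presented_iff)
  have "S \<subseteq> carrier M" using S_carrier by blast
  then obtain m \<sigma> where \<sigma>: "\<sigma> \<in> rmod_hom A (free_rmod A m) M" "\<sigma> ` carrier (free_rmod A m) = S"
    using assms(2) by (auto simp: fg_iff)
  let ?N = "free_rmod A n" and ?M = "free_rmod A m"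
  interpret N: right_module A ?N by (rule free)
  obtain \<tau> where \<tau>: "\<tau> \<in> rmod_hom A ?M ?N" "\<forall>a \<in> carrier ?M. \<phi> (\<tau> a) = \<sigma> a"
    using free_hom_lift[OF free right_module_axioms \<phi>(1) \<sigma>(1)] \<phi>(2) \<sigma>(2) \<open>S \<subseteq> carrier M\<close> by blast
  note cl = rmod_hom_closed[OF \<phi>(1)] rmod_hom_closed[OF \<tau>(1)] rmod_hom_closed[OF \<sigma>(1)]
  define \<pi> where "\<pi> = (\<lambda>a \<in> carrier ?N. restrict (coset_rep M S) (carrier M) (\<phi> a))"
  have \<pi>: "\<pi> \<in> rmod_hom A ?N (quot_rmod M S)"
    unfolding \<pi>_def by (rule rmod_hom_comp[OF free \<phi>(1) quot_proj])
  have "ker ?N (quot_rmod M S) \<pi> = {a \<in> carrier ?N. \<phi> a \<in> S}"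
    by (auto simp: ker_def \<pi>_def cl quot_proj_eq_zero_iff)
  also have "\<dots> = {x \<oplus>\<^bsub>?N\<^esub> y | x y. x \<in> ker ?N M \<phi> \<and> y \<in> \<tau> ` carrier ?M}"
  proof (intro equalityI subsetI)
    fix a assume a: "a \<in> {a \<in> carrier ?N. \<phi> a \<in> S}"
    then obtain b where b: "b \<in> carrier ?M" "\<phi> a = \<sigma> b" using \<sigma>(2) by blast
    then have "a \<ominus>\<^bsub>?N\<^esub> \<tau> b \<in> ker ?N M \<phi>"
      using a \<tau>(2) by (simp add: ker_def cl rmod_hom_minus[OF free right_module_axioms \<phi>(1)] minus_self)
    moreover have "a = (a \<ominus>\<^bsub>?N\<^esub> \<tau> b) \<oplus>\<^bsub>?N\<^esub> \<tau> b" using a b by (simp add: N.minus_add_cancel cl)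
    ultimately show "a \<in> {x \<oplus>\<^bsub>?N\<^esub> y | x y. x \<in> ker ?N M \<phi> \<and> y \<in> \<tau> ` carrier ?M}" using b by blast
  next
    fix a assume "a \<in> {x \<oplus>\<^bsub>?N\<^esub> y | x y. x \<in> ker ?N M \<phi> \<and> y \<in> \<tau> ` carrier ?M}"
    then obtain x b where "x \<in> carrier ?N" "\<phi> x = \<zero>\<^bsub>M\<^esub>" "b \<in> carrier ?M" "a = x \<oplus>\<^bsub>?N\<^esub> \<tau> b"
      by (auto simp: ker_def)
    then show "a \<in> {a \<in> carrier ?N. \<phi> a \<in> S}"
      using \<tau>(2) \<sigma>(2) by (auto simp: cl rmod_hom_add[OF \<phi>(1)])
  qed
  finally have k: "ker ?N (quot_rmod M S) \<pi> = {x \<oplus>\<^bsub>?N\<^esub> y | x y. x \<in> ker ?N M \<phi> \<and> y \<in> \<tau> ` carrier ?M}" .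
  have "fin_generated A (?N\<lparr>carrier := {x \<oplus>\<^bsub>?N\<^esub> y | x y. x \<in> ker ?N M \<phi> \<and> y \<in> \<tau> ` carrier ?M}\<rparr>)"
    by (rule fg_sum[OF free ker_subset _ \<phi>(3) fg_image[OF free \<tau>(1) subset_refl fg_carrier_free[OF A.ring_axioms]]])
      (auto simp: cl)
  then have "fin_generated A (?N\<lparr>carrier := ker ?N (quot_rmod M S) \<pi>\<rparr>)"
    by (simp only: k)
  moreover have "\<pi> ` carrier ?N = coset_rep M S ` (\<phi> ` carrier ?N)"
    by (auto simp: \<pi>_def cl)
  then have "\<pi> ` carrier ?N = carrier (quot_rmod M S)"
    by (simp only: \<phi>(2) quot_rmod_simps)
  ultimately show ?thesis using \<pi> unfolding fin_presented_iff by blast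
qed

end


section \<open>Kernels and cokernels\<close>

lemma mono_arrD:
  fixes C :: "('k, 'o, 'm) lincat"
  assumes "mono_arr C f" "W \<in> Obj C" "g \<in> Hom C W (Dom C f)" "h \<in> Hom C W (Dom C f)"
    "f \<cdot>\<^bsub>C\<^esub> g = f \<cdot>\<^bsub>C\<^esub> h"
  shows "g = h"
  using assms unfolding mono_arr_def by blast

lemma epi_arrD:
  fixes C :: "('k, 'o, 'm) lincat"
  assumes "epi_arr C f" "W \<in> Obj C" "g \<in> Hom C (Cod C f) W" "h \<in> Hom C (Cod C f) W"
    "g \<cdot>\<^bsub>C\<^esub> f = h \<cdot>\<^bsub>C\<^esub> f"
  shows "g = h"
  using assms unfolding epi_arr_def by blast

lemma is_cokernel_comp:
  fixes C :: "('k, 'o, 'm) lincat"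
  shows "is_cokernel C c f \<Longrightarrow> c \<cdot>\<^bsub>C\<^esub> f = Null C (Dom C f) (Cod C c)"
  by (simp add: is_cokernel_def)

lemma is_cokernel_factor:
  fixes C :: "('k, 'o, 'm) lincat"
  assumes "is_cokernel C c f" "W \<in> Obj C" "g \<in> Hom C (Cod C f) W" "g \<cdot>\<^bsub>C\<^esub> f = Null C (Dom C f) W"
  obtains h where "h \<in> Hom C (Cod C c) W" "h \<cdot>\<^bsub>C\<^esub> c = g"
  using assms unfolding is_cokernel_def by blast

lemma is_kernel_comp:
  fixes C :: "('k, 'o, 'm) lincat"
  shows "is_kernel C k f \<Longrightarrow> f \<cdot>\<^bsub>C\<^esub> k = Null C (Dom C k) (Cod C f)"
  by (simp add: is_kernel_def)

lemma is_kernel_factor: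
  fixes C :: "('k, 'o, 'm) lincat"
  assumes "is_kernel C k f" "W \<in> Obj C" "g \<in> Hom C W (Dom C f)" "f \<cdot>\<^bsub>C\<^esub> g = Null C W (Cod C f)"
  obtains h where "h \<in> Hom C W (Dom C k)" "k \<cdot>\<^bsub>C\<^esub> h = g"
  using assms unfolding is_kernel_def by blast


section \<open>The category of finitely presented modules\<close>

lemma fpmod_simps:
  "Dom (fpmod A) (M, f, N) = M" "Cod (fpmod A) (M, f, N) = N"
  "Ide (fpmod A) M = (M, \<lambda>x \<in> carrier M. x, M)"
  "(N', g, P) \<cdot>\<^bsub>fpmod A\<^esub> (M, f, N) = (M, \<lambda>x \<in> carrier M. g (f x), P)"
  "Plus (fpmod A) (M, f, N) (M', f', N'') = (M, \<lambda>x \<in> carrier M. f x \<oplus>\<^bsub>N\<^esub> f' x, N)"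
  "Null (fpmod A) M N = (M, \<lambda>x \<in> carrier M. \<zero>\<^bsub>N\<^esub>, N)"
  "Scal (fpmod A) c (M, f, N) = (M, \<lambda>x \<in> carrier M. ract N (f x) (c \<odot>\<^bsub>A\<^esub> \<one>\<^bsub>A\<^esub>), N)"
  by (simp_all add: fpmod_def)

lemma fpmod_Obj: "M \<in> Obj (fpmod A) \<longleftrightarrow> right_module A M \<and> fin_presented A M"
  by (simp add: fpmod_def)

lemma fpmod_Arr: "(M, f, N) \<in> Arr (fpmod A) \<longleftrightarrow>
    M \<in> Obj (fpmod A) \<and> N \<in> Obj (fpmod A) \<and> f \<in> rmod_hom A M N"
  by (auto simp: fpmod_def)

lemma fpmod_Hom: "h \<in> Hom (fpmod A) M N \<longleftrightarrow>
    (\<exists>f. h = (M, f, N) \<and> M \<in> Obj (fpmod A) \<and> N \<in> Obj (fpmod A) \<and> f \<in> rmod_hom A M N)"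
  by (cases h) (auto simp: Hom_def fpmod_Arr fpmod_simps)

lemma fin_generated_if_fin_presented:
  assumes "right_module A M" "fin_presented A M"
  shows "fin_generated A (M\<lparr>carrier := carrier M\<rparr>)"
  using assms(2) by (subst fg_iff) (auto simp: fin_presented_iff)

lemma fpmod_quot:
  assumes "M \<in> Obj (fpmod A)" "N \<in> Obj (fpmod A)" "f \<in> rmod_hom A M N"
  shows "quot_rmod N (f ` carrier M) \<in> Obj (fpmod A)" "submodule A N (f ` carrier M)"
proof -
  have M: "right_module A M" "fin_presented A M" and N: "right_module A N" "fin_presented A N"
    using assms by (auto simp: fpmod_Obj)
  show "submodule A N (f ` carrier M)"
    using N submod_image[OF M(1) N(1) assms(3)] by (simp add: submodule_def submodule_axioms_def)
  then interpret submodule A N "f ` carrier M" .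
  have "fin_generated A (N\<lparr>carrier := f ` carrier M\<rparr>)"
    by (rule fg_image[OF M(1) assms(3) subset_refl fin_generated_if_fin_presented[OF M]])
  then show "quot_rmod N (f ` carrier M) \<in> Obj (fpmod A)"
    using quot_right_module quot_fin_presented N by (simp add: fpmod_Obj)
qed

text \<open>
  The projection of \<open>N\<close> onto its quotient by the image of \<open>f\<close> and the zero map agree after composition
  with \<open>f\<close>, so they are equal.
\<close>

lemma fpmod_epi_surj:
  assumes "epi_arr (fpmod A) (M, f, N)"
  shows "f ` carrier M = carrier N"
proof -
  have MN: "M \<in> Obj (fpmod A)" "N \<in> Obj (fpmod A)" "f \<in> rmod_hom A M N"
    using assms by (auto simp: epi_arr_def fpmod_Arr)
  let ?Q = "quot_rmod N (f ` carrier M)"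
  have Q: "?Q \<in> Obj (fpmod A)" by (rule fpmod_quot[OF MN])
  interpret submodule A N "f ` carrier M" by (rule fpmod_quot[OF MN])
  let ?p = "restrict (coset_rep N (f ` carrier M)) (carrier N)"
  have z: "coset_rep N (f ` carrier M) (f x) = \<zero>\<^bsub>?Q\<^esub>" if "x \<in> carrier M" for x
    using that rmod_hom_closed[OF MN(3) that] by (simp add: quot_proj_eq_zero_iff)
  let ?z = "\<lambda>x \<in> carrier N. \<zero>\<^bsub>?Q\<^esub>"
  have "?z \<in> rmod_hom A N ?Q" by (rule rmod_hom_zero_map[OF right_module_axioms quot_right_module])
  then have "(N, ?p, ?Q) \<in> Hom (fpmod A) N ?Q" "(N, ?z, ?Q) \<in> Hom (fpmod A) N ?Q"
    using quot_proj MN Q by (simp_all add: fpmod_Hom)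
  moreover have "(N, ?p, ?Q) \<cdot>\<^bsub>fpmod A\<^esub> (M, f, N) = (N, ?z, ?Q) \<cdot>\<^bsub>fpmod A\<^esub> (M, f, N)"
    by (simp add: fpmod_simps rmod_hom_closed[OF MN(3)] z cong: restrict_cong)
  ultimately have "(N, ?p, ?Q) = (N, ?z, ?Q)"
    using epi_arrD[OF assms Q, unfolded fpmod_simps(2)] by blast
  then have "?p = ?z" by (elim Pair_inject)
  then have "x \<in> f ` carrier M" if "x \<in> carrier N" for x
    using restrict_eqD[of "coset_rep N (f ` carrier M)" "carrier N" "\<lambda>_. \<zero>\<^bsub>?Q\<^esub>" x] that
      quot_proj_eq_zero_iff[OF that] by simp
  then show ?thesis using S_carrier by (intro equalityI subsetI)
qed

text \<open>The projection of \<open>N\<close> onto its quotient by the image of \<open>f\<close> factors through every cokernel of \<open>f\<close>.\<close>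

lemma fpmod_cokernel_ker:
  assumes "is_cokernel (fpmod A) (N, c, Q) (M, f, N)"
  shows "ker N Q c = f ` carrier M"
proof -
  have MN: "M \<in> Obj (fpmod A)" "N \<in> Obj (fpmod A)" "f \<in> rmod_hom A M N"
    and c: "c \<in> rmod_hom A N Q" "Q \<in> Obj (fpmod A)"
    using assms by (auto simp: is_cokernel_def fpmod_Arr)
  let ?Q = "quot_rmod N (f ` carrier M)"
  have Q: "?Q \<in> Obj (fpmod A)" by (rule fpmod_quot[OF MN])
  interpret submodule A N "f ` carrier M" by (rule fpmod_quot[OF MN])
  have Qm: "right_module A Q" using c by (auto simp: fpmod_Obj)
  let ?p = "restrict (coset_rep N (f ` carrier M)) (carrier N)"
  have z: "coset_rep N (f ` carrier M) (f x) = \<zero>\<^bsub>?Q\<^esub>" if "x \<in> carrier M" for x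
    using that rmod_hom_closed[OF MN(3) that] by (simp add: quot_proj_eq_zero_iff)
  have cf: "c (f x) = \<zero>\<^bsub>Q\<^esub>" if "x \<in> carrier M" for x
  proof -
    have "(\<lambda>x \<in> carrier M. c (f x)) = (\<lambda>x \<in> carrier M. \<zero>\<^bsub>Q\<^esub>)"
      using is_cokernel_comp[OF assms] by (simp add: fpmod_simps)
    from restrict_eqD[OF this that] show ?thesis .
  qed
  have "(N, ?p, ?Q) \<in> Hom (fpmod A) N ?Q" using quot_proj MN Q by (simp add: fpmod_Hom)
  moreover have "(N, ?p, ?Q) \<cdot>\<^bsub>fpmod A\<^esub> (M, f, N) = Null (fpmod A) M ?Q"
    by (simp add: fpmod_simps rmod_hom_closed[OF MN(3)] z cong: restrict_cong)
  ultimately obtain h where "h \<in> Hom (fpmod A) Q ?Q" "h \<cdot>\<^bsub>fpmod A\<^esub> (N, c, Q) = (N, ?p, ?Q)"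
    using is_cokernel_factor[OF assms Q, of "(N, ?p, ?Q)"] unfolding fpmod_simps by blast
  then obtain g where g: "g \<in> rmod_hom A Q ?Q" "(\<lambda>x \<in> carrier N. g (c x)) = ?p"
    by (auto simp: fpmod_Hom fpmod_simps)
  have gc: "g (c x) = coset_rep N (f ` carrier M) x" if "x \<in> carrier N" for x
    using restrict_eqD[OF g(2) that] .
  show ?thesis
  proof (intro equalityI subsetI)
    fix x assume x: "x \<in> ker N Q c"
    then have "coset_rep N (f ` carrier M) x = \<zero>\<^bsub>?Q\<^esub>"
      using gc[of x] rmod_hom_zero[OF Qm quot_right_module g(1)] by (simp add: ker_def)
    then show "x \<in> f ` carrier M" using x by (simp add: ker_def quot_proj_eq_zero_iff)
  next
    fix x assume "x \<in> f ` carrier M"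
    then show "x \<in> ker N Q c" using cf S_carrier by (auto simp: ker_def)
  qed
qed

section \<open>Free modules and the regular module as objects\<close>

lemma transport_rmod_simps:
  assumes "inj_on e (carrier M)"
  shows "carrier (transport_rmod e M) = e ` carrier M" "\<zero>\<^bsub>transport_rmod e M\<^esub> = e \<zero>\<^bsub>M\<^esub>"
    and "x \<in> carrier M \<Longrightarrow> y \<in> carrier M \<Longrightarrow> e x \<oplus>\<^bsub>transport_rmod e M\<^esub> e y = e (x \<oplus>\<^bsub>M\<^esub> y)"
    and "x \<in> carrier M \<Longrightarrow> ract (transport_rmod e M) (e x) a = e (ract M x a)"
  using assms by (simp_all add: transport_rmod_def Let_def)

text \<open>
  The object \<open>A\<^sup>n\<close> of \<open>mod-A\<close>. Elements of objects are sets of vectors, so a vector \<open>x\<close> is represented by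
  \<open>{x}\<close>, its coset modulo the zero submodule.
\<close>

definition free_fp :: "('k, 'a) module \<Rightarrow> nat \<Rightarrow> 'a umod" where
  "free_fp A n = transport_rmod (\<lambda>x. {x}) (free_rmod A n)"

lemma free_fp_simps:
  "carrier (free_fp A n) = (\<lambda>x. {x}) ` carrier (free_rmod A n)"
  "\<zero>\<^bsub>free_fp A n\<^esub> = {\<zero>\<^bsub>free_rmod A n\<^esub>}"
  "x \<in> carrier (free_rmod A n) \<Longrightarrow> y \<in> carrier (free_rmod A n) \<Longrightarrow>
    {x} \<oplus>\<^bsub>free_fp A n\<^esub> {y} = {x \<oplus>\<^bsub>free_rmod A n\<^esub> y}"
  "x \<in> carrier (free_rmod A n) \<Longrightarrow> ract (free_fp A n) {x} a = {ract (free_rmod A n) x a}"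
proof -
  have e: "inj_on (\<lambda>x. {x}) (carrier (free_rmod A n))" by (simp add: inj_on_def)
  show "carrier (free_fp A n) = (\<lambda>x. {x}) ` carrier (free_rmod A n)"
    "\<zero>\<^bsub>free_fp A n\<^esub> = {\<zero>\<^bsub>free_rmod A n\<^esub>}"
    "x \<in> carrier (free_rmod A n) \<Longrightarrow> y \<in> carrier (free_rmod A n) \<Longrightarrow>
      {x} \<oplus>\<^bsub>free_fp A n\<^esub> {y} = {x \<oplus>\<^bsub>free_rmod A n\<^esub> y}"
    "x \<in> carrier (free_rmod A n) \<Longrightarrow> ract (free_fp A n) {x} a = {ract (free_rmod A n) x a}"
    using transport_rmod_simps[OF e] by (simp_all add: free_fp_def)
qed

lemma fg_zero_submodule:
  assumes "right_module A M"
  shows "fin_generated A (M\<lparr>carrier := {\<zero>\<^bsub>M\<^esub>}\<rparr>)"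
proof -
  interpret right_module A M by fact
  note free = free_right_module[OF A.ring_axioms, of 0]
  interpret F: right_module A "free_rmod A 0" by (rule free)
  have "(\<lambda>x \<in> carrier (free_rmod A 0). \<zero>\<^bsub>M\<^esub>) ` carrier (free_rmod A 0) = {\<zero>\<^bsub>M\<^esub>}"
    using F.M.zero_closed by auto
  moreover have "{\<zero>\<^bsub>M\<^esub>} \<subseteq> carrier M" by simp
  ultimately show ?thesis using rmod_hom_zero_map[OF free assms] by (simp only: fg_iff) blast
qed

lemma free_fin_presented:
  assumes "ring A"
  shows "fin_presented A (free_rmod A n)"
proof -
  note free = free_right_module[OF assms, of n]
  interpret F: right_module A "free_rmod A n" by (rule free)
  let ?i = "\<lambda>x \<in> carrier (free_rmod A n). x"
  have "ker (free_rmod A n) (free_rmod A n) ?i = {\<zero>\<^bsub>free_rmod A n\<^esub>}"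
    by (auto simp: ker_def)
  then have "fin_generated A ((free_rmod A n)\<lparr>carrier := ker (free_rmod A n) (free_rmod A n) ?i\<rparr>)"
    by (simp only: fg_zero_submodule[OF free])
  then show ?thesis
    unfolding fin_presented_iff using rmod_hom_id[OF free] by (intro exI[of _ n] bexI[of _ ?i]) auto
qed

lemma self_fin_presented:
  assumes "ring A"
  shows "fin_presented A (self_rmod A)"
proof -
  interpret ring A by fact
  note free = free_right_module[OF assms, of 1]
  interpret F: right_module A "free_rmod A 1" by (rule free)
  let ?i = "\<lambda>x \<in> carrier (free_rmod A 1). x 0"
  have *: "x = y" if "x \<in> carrier (free_rmod A 1)" "y \<in> carrier (free_rmod A 1)" "x 0 = y 0" for x y
    using that by (intro extensionalityI[of _ "{..<1}"]) (auto simp: free_rmod_simps PiE_iff)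
  have i: "?i \<in> rmod_hom A (free_rmod A 1) (self_rmod A)"
    by (rule rmod_homI) (auto simp: self_rmod_simps free_rmod_simps PiE_iff)
  have inj: "inj_on ?i (carrier (free_rmod A 1))" by (auto simp: inj_on_def intro: *)
  have "a \<in> ?i ` carrier (free_rmod A 1)" if "a \<in> carrier A" for a
    using that by (intro image_eqI[of _ _ "\<lambda>i \<in> {..<1}. a"]) (auto simp: free_rmod_simps)
  then have "bij_betw ?i (carrier (free_rmod A 1)) (carrier (self_rmod A))"
    using inj rmod_hom_closed[OF i] by (auto simp: bij_betw_def self_rmod_simps)
  then show ?thesis
    using fin_presented_transfer[OF free_fin_presented[OF assms] free self_right_module[OF assms] i] by blast
qed

lemma transport_fpmod:
  assumes "right_module A M" "fin_presented A M" "inj_on e (carrier M)"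
  shows "transport_rmod e M \<in> Obj (fpmod A)"
proof -
  note t = transport_rmod_iso[OF assms(1,3)]
  show ?thesis
    using t(1) fin_presented_transfer[OF assms(2,1) t] by (simp add: fpmod_Obj)
qed

lemma free_fp_fpmod: "ring A \<Longrightarrow> free_fp A n \<in> Obj (fpmod A)"
  unfolding free_fp_def
  by (intro transport_fpmod free_right_module free_fin_presented) (auto simp: inj_on_def)

lemma reg_elt_inj: "reg_elt a = reg_elt b \<longleftrightarrow> a = b"
proof
  assume "reg_elt a = reg_elt b"
  then have "(\<lambda>i \<in> {..<1::nat}. a) = (\<lambda>i \<in> {..<1}. b)" by (simp add: reg_elt_def)
  from restrict_eqD[OF this, of 0] show "a = b" by simp
qed simp

lemma reg_rmod_simps:
  "carrier (reg_rmod A) = reg_elt ` carrier A"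
  "\<zero>\<^bsub>reg_rmod A\<^esub> = reg_elt \<zero>\<^bsub>A\<^esub>"
  "a \<in> carrier A \<Longrightarrow> b \<in> carrier A \<Longrightarrow> reg_elt a \<oplus>\<^bsub>reg_rmod A\<^esub> reg_elt b = reg_elt (a \<oplus>\<^bsub>A\<^esub> b)"
  "a \<in> carrier A \<Longrightarrow> ract (reg_rmod A) (reg_elt a) b = reg_elt (a \<otimes>\<^bsub>A\<^esub> b)"
proof -
  have e: "inj_on reg_elt (carrier (self_rmod A))" by (simp add: inj_on_def reg_elt_inj)
  show "carrier (reg_rmod A) = reg_elt ` carrier A"
    "\<zero>\<^bsub>reg_rmod A\<^esub> = reg_elt \<zero>\<^bsub>A\<^esub>"
    "a \<in> carrier A \<Longrightarrow> b \<in> carrier A \<Longrightarrow> reg_elt a \<oplus>\<^bsub>reg_rmod A\<^esub> reg_elt b = reg_elt (a \<oplus>\<^bsub>A\<^esub> b)"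
    "a \<in> carrier A \<Longrightarrow> ract (reg_rmod A) (reg_elt a) b = reg_elt (a \<otimes>\<^bsub>A\<^esub> b)"
    using transport_rmod_simps[OF e] by (simp_all add: reg_rmod_def self_rmod_simps)
qed

lemma inv_reg_elt: "a \<in> carrier A \<Longrightarrow> inv_into (carrier A) reg_elt (reg_elt a) = a"
  by (rule inv_into_f_f) (auto simp: inj_on_def reg_elt_inj)

lemma reg_fpmod: "ring A \<Longrightarrow> reg_rmod A \<in> Obj (fpmod A)"
  unfolding reg_rmod_def
  by (intro transport_fpmod self_right_module self_fin_presented) (auto simp: inj_on_def reg_elt_inj)

text \<open>The homomorphism from \<open>A\<^sub>A\<close> to \<open>M\<close> which sends \<open>1\<close> to \<open>x\<close>.\<close>

definition elt_map :: "('k, 'a) module \<Rightarrow> ('a, 'u) rmodule \<Rightarrow> 'u \<Rightarrow> (nat \<Rightarrow> 'a) set \<Rightarrow> 'u" where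
  "elt_map A M x = (\<lambda>y \<in> carrier (reg_rmod A). ract M x (inv_into (carrier A) reg_elt y))"

definition elt_arr :: "('k, 'a) module \<Rightarrow> 'a umod \<Rightarrow> (nat \<Rightarrow> 'a) set \<Rightarrow> 'a uarr" where
  "elt_arr A M x = (reg_rmod A, elt_map A M x, M)"

lemma elt_map_apply: "a \<in> carrier A \<Longrightarrow> elt_map A M x (reg_elt a) = ract M x a"
  by (simp add: elt_map_def reg_rmod_simps inv_reg_elt)

lemma elt_map_hom:
  assumes "right_module A M" "x \<in> carrier M"
  shows "elt_map A M x \<in> rmod_hom A (reg_rmod A) M"
proof -
  interpret right_module A M by fact
  show ?thesis
    using assms(2) by (intro rmod_homI)
      (auto simp: reg_rmod_simps elt_map_apply ract_closed ract_add_right ract_mult,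
       auto simp: elt_map_def reg_rmod_simps)
qed

lemma elt_map_eqI:
  assumes "right_module A M" "x \<in> carrier M" "f \<in> rmod_hom A (reg_rmod A) M" "f (reg_elt \<one>\<^bsub>A\<^esub>) = x"
  shows "f = elt_map A M x"
proof -
  interpret right_module A M by fact
  show ?thesis
  proof (rule rmod_hom_eqI[OF assms(3) elt_map_hom[OF assms(1,2)]])
    fix y assume "y \<in> carrier (reg_rmod A)"
    then obtain a where a: "a \<in> carrier A" "y = reg_elt a" by (auto simp: reg_rmod_simps)
    then have "f y = f (ract (reg_rmod A) (reg_elt \<one>\<^bsub>A\<^esub>) a)" by (simp add: reg_rmod_simps)
    also have "\<dots> = ract M x a"
      using a assms(4) rmod_hom_ract[OF assms(3), of "reg_elt \<one>\<^bsub>A\<^esub>" a] by (simp add: reg_rmod_simps(1))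
    finally show "f y = elt_map A M x y" using a by (simp add: elt_map_apply)
  qed
qed

lemma elt_arr_Hom:
  assumes "M \<in> Obj (fpmod A)" "x \<in> carrier M"
  shows "elt_arr A M x \<in> Hom (fpmod A) (reg_rmod A) M"
proof -
  have M: "right_module A M" using assms by (simp add: fpmod_Obj)
  then interpret right_module A M .
  show ?thesis using assms elt_map_hom[OF M assms(2)] reg_fpmod[OF A.ring_axioms]
    by (simp add: fpmod_Hom elt_arr_def)
qed

lemma elt_arr_comp:
  assumes "M \<in> Obj (fpmod A)" "N \<in> Obj (fpmod A)" "f \<in> rmod_hom A M N" "x \<in> carrier M"
  shows "(M, f, N) \<cdot>\<^bsub>fpmod A\<^esub> elt_arr A M x = elt_arr A N (f x)"
proof -
  have M: "right_module A M" and N: "right_module A N" using assms by (auto simp: fpmod_Obj)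
  interpret right_module A M by (rule M)
  have reg: "right_module A (reg_rmod A)" using reg_fpmod[OF A.ring_axioms] by (simp add: fpmod_Obj)
  have "(\<lambda>y \<in> carrier (reg_rmod A). f (elt_map A M x y)) = elt_map A N (f x)"
    using assms(4)
    by (intro elt_map_eqI[OF N] rmod_hom_comp[OF reg elt_map_hom[OF M assms(4)] assms(3)])
      (auto simp: rmod_hom_closed[OF assms(3)] reg_rmod_simps(1) elt_map_apply ract_one)
  then show ?thesis by (simp add: elt_arr_def fpmod_simps)
qed

lemma left_mult_elt_arr: "left_mult A a = elt_arr A (reg_rmod A) (reg_elt a)" if "ring A" "a \<in> carrier A"
proof -
  interpret ring A by fact
  show ?thesis using that
    by (auto simp: left_mult_def elt_arr_def elt_map_def reg_rmod_simps inv_reg_elt intro!: restrict_ext)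
qed


section \<open>Short exact sequences of finitely presented modules\<close>

text \<open>
  If \<open>g x = 0\<close> then the arrow from \<open>A\<^sub>A\<close> which sends \<open>1\<close> to \<open>x\<close> is killed by \<open>g\<close>; it factors through the
  kernel, so \<open>x\<close> is in the image of \<open>k\<close>.
\<close>

lemma fpmod_kernel_image:
  assumes "is_kernel (fpmod A) (L, k, M) (M', g, N)"
  shows "k ` carrier L = ker M N g"
proof -
  have MN: "M' = M" "L \<in> Obj (fpmod A)" "M \<in> Obj (fpmod A)" "N \<in> Obj (fpmod A)"
    "k \<in> rmod_hom A L M" "g \<in> rmod_hom A M N"
    using assms by (auto simp: is_kernel_def fpmod_Arr fpmod_simps)
  then have mod: "right_module A L" "right_module A M" "right_module A N" by (auto simp: fpmod_Obj)
  interpret M: right_module A M by (rule mod)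
  interpret N: right_module A N by (rule mod)
  note rA = M.A.ring_axioms
  have gk: "(\<lambda>x \<in> carrier L. g (k x)) = (\<lambda>x \<in> carrier L. \<zero>\<^bsub>N\<^esub>)"
    using is_kernel_comp[OF assms] by (simp add: fpmod_simps MN(1))
  show ?thesis
  proof (intro equalityI subsetI)
    fix x assume "x \<in> k ` carrier L"
    then show "x \<in> ker M N g"
      using restrict_eqD[OF gk] by (auto simp: ker_def rmod_hom_closed[OF MN(5)])
  next
    fix x assume x: "x \<in> ker M N g"
    then have xM: "x \<in> carrier M" "g x = \<zero>\<^bsub>N\<^esub>" by (auto simp: ker_def)
    have "elt_map A N \<zero>\<^bsub>N\<^esub> = (\<lambda>y \<in> carrier (reg_rmod A). \<zero>\<^bsub>N\<^esub>)"
      by (intro extensionalityI[of _ "carrier (reg_rmod A)"])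
        (auto simp: reg_rmod_simps elt_map_apply N.ract_zero_left, simp add: elt_map_def reg_rmod_simps)
    then have "elt_arr A N \<zero>\<^bsub>N\<^esub> = Null (fpmod A) (reg_rmod A) N"
      by (simp add: elt_arr_def fpmod_simps)
    then have "(M, g, N) \<cdot>\<^bsub>fpmod A\<^esub> elt_arr A M x = Null (fpmod A) (reg_rmod A) N"
      by (simp only: elt_arr_comp[OF MN(3,4,6) xM(1)] xM(2))
    then obtain h where "h \<in> Hom (fpmod A) (reg_rmod A) L" "(L, k, M) \<cdot>\<^bsub>fpmod A\<^esub> h = elt_arr A M x"
      using is_kernel_factor[OF assms reg_fpmod[OF rA], of "elt_arr A M x"] elt_arr_Hom[OF MN(3) xM(1)]
      by (auto simp only: fpmod_simps MN(1))
    then obtain f where f: "f \<in> rmod_hom A (reg_rmod A) L"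
      "(\<lambda>y \<in> carrier (reg_rmod A). k (f y)) = elt_map A M x"
      by (auto simp: fpmod_Hom fpmod_simps elt_arr_def)
    have one: "reg_elt \<one>\<^bsub>A\<^esub> \<in> carrier (reg_rmod A)" by (simp add: reg_rmod_simps)
    have "k (f (reg_elt \<one>\<^bsub>A\<^esub>)) = x"
      using fun_cong[OF f(2), of "reg_elt \<one>\<^bsub>A\<^esub>"] one xM(1) by (simp add: elt_map_apply M.ract_one)
    then show "x \<in> k ` carrier L" using rmod_hom_closed[OF f(1) one] by blast
  qed
qed

lemma fpmod_short_exactD:
  assumes "short_exact (fpmod A) (L, f, M) (M', g, N)"
  shows "M' = M" "g ` carrier M = carrier N" "ker M N g = f ` carrier L"
    "L \<in> Obj (fpmod A)" "M \<in> Obj (fpmod A)" "N \<in> Obj (fpmod A)"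
    "f \<in> rmod_hom A L M" "g \<in> rmod_hom A M N"
proof -
  obtain i c where ic: "is_cokernel (fpmod A) c (L, f, M)" "is_kernel (fpmod A) i c"
    "is_kernel (fpmod A) i (M', g, N)"
    using assms by (auto simp: short_exact_def exact_at_def is_image_def)
  obtain I i' J where i: "i = (I, i', J)" by (cases i)
  obtain P c' Q where c: "c = (P, c', Q)" by (cases c)
  have eq: "P = M" "J = P" "J = M'" using ic by (auto simp: i c is_kernel_def is_cokernel_def fpmod_simps)
  show "M' = M" using eq by simp
  show "ker M N g = f ` carrier L"
    using fpmod_cokernel_ker[OF ic(1)[unfolded c eq]] fpmod_kernel_image[OF ic(2)[unfolded i c eq]]
      fpmod_kernel_image[OF ic(3)[unfolded i eq]] eq by simp
  show "g ` carrier M = carrier N"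
    using assms fpmod_epi_surj[of A M' g N] eq by (simp add: short_exact_def)
  show "L \<in> Obj (fpmod A)" "M \<in> Obj (fpmod A)" "N \<in> Obj (fpmod A)"
    "f \<in> rmod_hom A L M" "g \<in> rmod_hom A M N"
    using assms eq by (auto simp: short_exact_def mono_arr_def epi_arr_def fpmod_Arr)
qed

lemma fpmod_short_exactI:
  assumes obj: "L \<in> Obj (fpmod A)" "M \<in> Obj (fpmod A)" "N \<in> Obj (fpmod A)"
    and f: "f \<in> rmod_hom A L M" "inj_on f (carrier L)"
    and g: "g \<in> rmod_hom A M N" "g ` carrier M = carrier N"
    and ker: "ker M N g = f ` carrier L"
  shows "short_exact (fpmod A) (L, f, M) (M, g, N)"
proof -
  have mod: "right_module A L" "right_module A M" "right_module A N"
    using obj by (auto simp: fpmod_Obj)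
  interpret L: right_module A L by (rule mod)
  have gf: "(M, g, N) \<cdot>\<^bsub>fpmod A\<^esub> (L, f, M) = Null (fpmod A) L N"
    using ker by (auto simp: fpmod_simps ker_def intro!: restrict_ext)
  have arr: "(L, f, M) \<in> Arr (fpmod A)" "(M, g, N) \<in> Arr (fpmod A)" using assms by (auto simp: fpmod_Arr)
  have mono: "u = v" if uv: "u \<in> Hom (fpmod A) W L" "v \<in> Hom (fpmod A) W L"
    "(L, f, M) \<cdot>\<^bsub>fpmod A\<^esub> u = (L, f, M) \<cdot>\<^bsub>fpmod A\<^esub> v" for W u v
  proof -
    obtain u' v' where u': "u = (W, u', L)" "v = (W, v', L)" "u' \<in> rmod_hom A W L" "v' \<in> rmod_hom A W L"
      using uv by (auto simp: fpmod_Hom)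
    then have e: "(\<lambda>x \<in> carrier W. f (u' x)) = (\<lambda>x \<in> carrier W. f (v' x))"
      using uv(3) by (simp add: fpmod_simps)
    have "u' = v'"
      using inj_onD[OF f(2) restrict_eqD[OF e]] rmod_hom_closed[OF u'(3)] rmod_hom_closed[OF u'(4)]
      by (intro rmod_hom_eqI[OF u'(3,4)]) blast
    then show ?thesis by (simp add: u')
  qed
  have epi: "u = v" if uv: "u \<in> Hom (fpmod A) N W" "v \<in> Hom (fpmod A) N W"
    "u \<cdot>\<^bsub>fpmod A\<^esub> (M, g, N) = v \<cdot>\<^bsub>fpmod A\<^esub> (M, g, N)" for W u v
  proof -
    obtain u' v' where u': "u = (N, u', W)" "v = (N, v', W)" "u' \<in> rmod_hom A N W" "v' \<in> rmod_hom A N W"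
      using uv by (auto simp: fpmod_Hom)
    then have e: "(\<lambda>x \<in> carrier M. u' (g x)) = (\<lambda>x \<in> carrier M. v' (g x))"
      using uv(3) by (simp add: fpmod_simps)
    have "u' z = v' z" if "z \<in> carrier N" for z
      using that restrict_eqD[OF e] by (auto simp flip: g(2))
    then have "u' = v'" by (rule rmod_hom_eqI[OF u'(3,4)])
    then show ?thesis by (simp add: u')
  qed
  have "is_cokernel (fpmod A) (M, g, N) (L, f, M)"
    unfolding is_cokernel_def fpmod_simps(1,2)
  proof (intro conjI ballI impI arr refl gf)
    fix W h assume W: "W \<in> Obj (fpmod A)" and h: "h \<in> Hom (fpmod A) M W"
      "h \<cdot>\<^bsub>fpmod A\<^esub> (L, f, M) = Null (fpmod A) L W"
    then obtain h' where h': "h = (M, h', W)" "h' \<in> rmod_hom A M W" by (auto simp: fpmod_Hom)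
    have e: "(\<lambda>x \<in> carrier L. h' (f x)) = (\<lambda>x \<in> carrier L. \<zero>\<^bsub>W\<^esub>)"
      using h(2) by (simp add: h' fpmod_simps)
    have "\<exists>k \<in> rmod_hom A N W. \<forall>x \<in> carrier M. k (g x) = h' x"
      using W restrict_eqD[OF e] ker
      by (intro rmod_factor_through_surj[OF mod(2,3) _ g h'(2)]) (auto simp: fpmod_Obj)
    then obtain k where k: "k \<in> rmod_hom A N W" "\<And>x. x \<in> carrier M \<Longrightarrow> k (g x) = h' x" by blast
    have "(\<lambda>x \<in> carrier M. k (g x)) = h'"
      using k(2) rmod_hom_extensional[OF h'(2)] by (intro extensionalityI[of _ "carrier M"]) auto
    then have "(N, k, W) \<in> Hom (fpmod A) N W \<and> (N, k, W) \<cdot>\<^bsub>fpmod A\<^esub> (M, g, N) = h"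
      using k W obj by (simp add: fpmod_Hom h' fpmod_simps)
    then show "\<exists>!k. k \<in> Hom (fpmod A) N W \<and> k \<cdot>\<^bsub>fpmod A\<^esub> (M, g, N) = h"
      using epi by blast
  qed
  moreover have "is_kernel (fpmod A) (L, f, M) (M, g, N)"
    unfolding is_kernel_def fpmod_simps(1,2)
  proof (intro conjI ballI impI arr refl gf)
    fix W h assume W: "W \<in> Obj (fpmod A)" and h: "h \<in> Hom (fpmod A) W M"
      "(M, g, N) \<cdot>\<^bsub>fpmod A\<^esub> h = Null (fpmod A) W N"
    then obtain h' where h': "h = (W, h', M)" "h' \<in> rmod_hom A W M" by (auto simp: fpmod_Hom)
    interpret W: right_module A W using W by (simp add: fpmod_Obj)
    have e: "(\<lambda>x \<in> carrier W. g (h' x)) = (\<lambda>x \<in> carrier W. \<zero>\<^bsub>N\<^esub>)"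
      using h(2) by (simp add: h' fpmod_simps)
    have im: "h' x \<in> f ` carrier L" if "x \<in> carrier W" for x
      using restrict_eqD[OF e that] rmod_hom_closed[OF h'(2) that]
      unfolding ker[symmetric] by (simp add: ker_def)
    define k where "k = (\<lambda>x \<in> carrier W. inv_into (carrier L) f (h' x))"
    have k: "k x \<in> carrier L" "f (k x) = h' x" if "x \<in> carrier W" for x
      using that inv_into_into[OF im[OF that]] f_inv_into_f[OF im[OF that]] by (simp_all add: k_def)
    have "k \<in> rmod_hom A W L"
    proof (rule rmod_homI)
      show "k x \<in> carrier L" if "x \<in> carrier W" for x using that by (rule k)
      show "k (x \<oplus>\<^bsub>W\<^esub> y) = k x \<oplus>\<^bsub>L\<^esub> k y" if xy: "x \<in> carrier W" "y \<in> carrier W" for x y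
      proof (rule inj_onD[OF f(2)])
        show "f (k (x \<oplus>\<^bsub>W\<^esub> y)) = f (k x \<oplus>\<^bsub>L\<^esub> k y)"
          using xy by (simp add: rmod_hom_add[OF f(1)] rmod_hom_add[OF h'(2)] k)
      qed (use xy in \<open>simp_all add: k\<close>)
      show "k (ract W x a) = ract L (k x) a" if xa: "x \<in> carrier W" "a \<in> carrier A" for x a
      proof (rule inj_onD[OF f(2)])
        show "f (k (ract W x a)) = f (ract L (k x) a)"
          using xa by (simp add: rmod_hom_ract[OF f(1)] rmod_hom_ract[OF h'(2)] k W.ract_closed)
      qed (use xa in \<open>simp_all add: k W.ract_closed L.ract_closed\<close>)
    qed (simp add: k_def)
    moreover have "(\<lambda>x \<in> carrier W. f (k x)) = h'"
      using k(2) rmod_hom_extensional[OF h'(2)] by (intro extensionalityI[of _ "carrier W"]) auto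
    ultimately have "(W, k, L) \<in> Hom (fpmod A) W L \<and> (L, f, M) \<cdot>\<^bsub>fpmod A\<^esub> (W, k, L) = h"
      using W obj by (simp add: fpmod_Hom h' fpmod_simps)
    then show "\<exists>!k. k \<in> Hom (fpmod A) W L \<and> (L, f, M) \<cdot>\<^bsub>fpmod A\<^esub> k = h"
      using mono by blast
  qed
  moreover have "mono_arr (fpmod A) (L, f, M)"
    unfolding mono_arr_def fpmod_simps using arr mono by blast
  moreover have "epi_arr (fpmod A) (M, g, N)"
    unfolding epi_arr_def fpmod_simps using arr epi by blast
  ultimately show ?thesis unfolding short_exact_def exact_at_def is_image_def by blast
qed

text \<open>
  Here coherence enters: the kernel of a presentation of \<open>M\<close> is again an object of \<open>mod-A\<close>, so that
  \<open>M\<close> is the cokernel of a monomorphism of \<open>mod-A\<close>.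
\<close>

lemma fpmod_presentation:
  assumes rA: "ring A" and coh: "right_coherent A" and M: "M \<in> Obj (fpmod A)"
  shows "\<exists>n p N. p \<in> rmod_hom A (free_fp A n) M \<and> p ` carrier (free_fp A n) = carrier M \<and>
    N \<in> Obj (fpmod A) \<and> carrier N = ker (free_fp A n) M p \<and> (\<lambda>x \<in> carrier N. x) \<in> rmod_hom A N (free_fp A n) \<and>
    short_exact (fpmod A) (N, \<lambda>x \<in> carrier N. x, free_fp A n) (free_fp A n, p, M)"
proof -
  have Mm: "right_module A M" using M by (simp add: fpmod_Obj)
  obtain n \<phi> where \<phi>: "\<phi> \<in> rmod_hom A (free_rmod A n) M" "\<phi> ` carrier (free_rmod A n) = carrier M"
    "fin_generated A ((free_rmod A n)\<lparr>carrier := ker (free_rmod A n) M \<phi>\<rparr>)"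
    using M by (auto simp: fin_presented_iff fpmod_Obj)
  let ?F = "free_rmod A n" and ?G = "free_fp A n"
  note free = free_right_module[OF rA, of n]
  interpret F: right_module A ?F by (rule free)
  have G: "?G \<in> Obj (fpmod A)" by (rule free_fp_fpmod[OF rA])
  then have Gm: "right_module A ?G" by (simp add: fpmod_Obj)
  define p where "p = (\<lambda>x \<in> carrier ?G. \<phi> (the_elem x))"
  have p_apply: "p {x} = \<phi> x" if "x \<in> carrier ?F" for x using that by (simp add: p_def free_fp_simps)
  have p: "p \<in> rmod_hom A ?G M"
    by (rule rmod_homI) (auto simp: free_fp_simps p_apply rmod_hom_closed[OF \<phi>(1)] rmod_hom_add[OF \<phi>(1)]
        rmod_hom_ract[OF \<phi>(1)] F.ract_closed, simp add: p_def free_fp_simps)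
  have p_surj: "p ` carrier ?G = carrier M"
    by (simp add: free_fp_simps image_image p_apply flip: \<phi>(2))
  let ?K = "?F\<lparr>carrier := ker ?F M \<phi>\<rparr>" and ?N = "?G\<lparr>carrier := ker ?G M p\<rparr>"
  have Ksub: "submod A ?F (ker ?F M \<phi>)" by (rule submod_ker[OF free Mm \<phi>(1)])
  have Nm: "right_module A ?N" by (rule submod_right_module[OF Gm submod_ker[OF Gm Mm p]])
  have Kcl: "x \<oplus>\<^bsub>?F\<^esub> y \<in> ker ?F M \<phi>" "ract ?F x a \<in> ker ?F M \<phi>"
    if "x \<in> ker ?F M \<phi>" "y \<in> ker ?F M \<phi>" "a \<in> carrier A" for x y a
    using that Ksub by (auto simp: submod_def)
  have K_in: "x \<in> ker ?F M \<phi> \<Longrightarrow> x \<in> carrier ?F" for x by (simp add: ker_def)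
  have ker_eq: "ker ?G M p = (\<lambda>x. {x}) ` ker ?F M \<phi>"
  proof (intro equalityI subsetI)
    fix z assume "z \<in> ker ?G M p"
    then obtain x where "x \<in> carrier ?F" "z = {x}" "p z = \<zero>\<^bsub>M\<^esub>"
      unfolding ker_def free_fp_simps(1) by blast
    then show "z \<in> (\<lambda>x. {x}) ` ker ?F M \<phi>" using p_apply[of x] by (simp add: ker_def)
  next
    fix z assume "z \<in> (\<lambda>x. {x}) ` ker ?F M \<phi>"
    then obtain x where "x \<in> carrier ?F" "z = {x}" "\<phi> x = \<zero>\<^bsub>M\<^esub>"
      unfolding ker_def by blast
    then show "z \<in> ker ?G M p" using p_apply[of x] by (simp add: ker_def free_fp_simps(1))
  qed
  have "(\<lambda>x \<in> ker ?F M \<phi>. {x}) \<in> rmod_hom A ?K ?N"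
    using Ksub by (intro rmod_homI) (auto simp: ker_eq submod_def free_fp_simps K_in)
  moreover have "bij_betw (\<lambda>x \<in> ker ?F M \<phi>. {x}) (carrier ?K) (carrier ?N)"
    by (auto simp: bij_betw_def inj_on_def ker_eq)
  ultimately have "fin_presented A ?N"
    by (rule fin_presented_transfer[OF fin_presented_fg_submodule_of_free[OF rA coh Ksub \<phi>(3)]
          submod_right_module[OF free Ksub] Nm])
  then have N: "?N \<in> Obj (fpmod A)" using Nm by (simp add: fpmod_Obj)
  have j: "(\<lambda>x \<in> carrier ?N. x) \<in> rmod_hom A ?N ?G"
    using submod_ker[OF Gm Mm p] by (intro rmod_homI) (auto simp: submod_def)
  have "short_exact (fpmod A) (?N, \<lambda>x \<in> carrier ?N. x, ?G) (?G, p, M)"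
    by (rule fpmod_short_exactI[OF N G M j _ p p_surj]) (auto simp: inj_on_def)
  moreover have "carrier ?N = ker ?G M p" by simp
  ultimately show ?thesis using p p_surj N j by (intro exI conjI)
qed

section \<open>Linear and abelian categories\<close>

lemma HomD: "f \<in> Hom C U Y \<Longrightarrow> f \<in> Arr C" "f \<in> Hom C U Y \<Longrightarrow> Dom C f = U"
  "f \<in> Hom C U Y \<Longrightarrow> Cod C f = Y"
  by (auto simp: Hom_def)

lemma arr_in_Hom: "f \<in> Arr C \<Longrightarrow> f \<in> Hom C (Dom C f) (Cod C f)"
  by (simp add: Hom_def)

lemma (in abelian_group) idem_zero: "x \<in> carrier G \<Longrightarrow> x \<oplus> x = x \<Longrightarrow> x = \<zero>"
  using add.l_cancel_one[of x x] by simp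

context linear_category
begin

abbreviation comp_arrows :: "'m \<Rightarrow> 'm \<Rightarrow> 'm"  (infixl \<open>\<bullet>\<close> 70) where
  "g \<bullet> f \<equiv> g \<cdot>\<^bsub>C\<^esub> f"

lemma Hom_Obj: "f \<in> Hom C U Y \<Longrightarrow> U \<in> Obj C" "f \<in> Hom C U Y \<Longrightarrow> Y \<in> Obj C"
  by (auto simp: Hom_def dom_in_Obj cod_in_Obj)

lemma hom_space_simps:
  "carrier (hom_space C U Y) = Hom C U Y" "\<zero>\<^bsub>hom_space C U Y\<^esub> = Null C U Y"
  "f \<oplus>\<^bsub>hom_space C U Y\<^esub> g = Plus C f g" "c \<odot>\<^bsub>hom_space C U Y\<^esub> f = Scal C c f"
  by (simp_all add: hom_space_def)

lemma hom_group: "U \<in> Obj C \<Longrightarrow> Y \<in> Obj C \<Longrightarrow> abelian_group (hom_space C U Y)"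
  using hom_space_module by (simp add: module_def)

lemma null_in_Hom: "U \<in> Obj C \<Longrightarrow> Y \<in> Obj C \<Longrightarrow> Null C U Y \<in> Hom C U Y"
  using abelian_monoid.zero_closed[OF abelian_group.axioms(1)[OF hom_group]]
  by (simp add: hom_space_simps)

lemma plus_in_Hom:
  assumes "f \<in> Hom C U Y" "g \<in> Hom C U Y"
  shows "Plus C f g \<in> Hom C U Y"
  using abelian_monoid.a_closed[OF abelian_group.axioms(1)[OF hom_group], of U Y f g] assms
  by (simp add: hom_space_simps Hom_Obj[OF assms(1)])

lemma scal_in_Hom:
  assumes "f \<in> Hom C U Y" "c \<in> carrier K"
  shows "Scal C c f \<in> Hom C U Y"
  using module.smult_closed[OF hom_space_module, of U Y c f] assms
  by (simp add: hom_space_simps Hom_Obj[OF assms(1)])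

lemma plus_null:
  assumes "f \<in> Hom C U Y"
  shows "Plus C f (Null C U Y) = f" "Plus C (Null C U Y) f = f"
  using abelian_monoid.r_zero[OF abelian_group.axioms(1)[OF hom_group], of U Y f]
    abelian_monoid.l_zero[OF abelian_group.axioms(1)[OF hom_group], of U Y f] assms
  by (simp_all add: hom_space_simps Hom_Obj[OF assms(1)])

lemma plus_self_null:
  assumes "f \<in> Hom C U Y" "Plus C f f = f"
  shows "f = Null C U Y"
proof -
  have "abelian_group (hom_space C U Y)" using Hom_Obj assms(1) by (blast intro: hom_group)
  from abelian_group.idem_zero[OF this, of f] show ?thesis using assms by (simp add: hom_space_simps)
qed

lemma comp_null_right:
  assumes "g \<in> Hom C Y Z" "U \<in> Obj C"
  shows "g \<bullet> Null C U Y = Null C U Z"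
proof (rule plus_self_null)
  have n: "Null C U Y \<in> Hom C U Y" using assms by (auto intro: null_in_Hom Hom_Obj)
  then show "g \<bullet> Null C U Y \<in> Hom C U Z" using assms(1) by (rule comp_in_Hom)
  show "Plus C (g \<bullet> Null C U Y) (g \<bullet> Null C U Y) = g \<bullet> Null C U Y"
    using comp_plus_right[OF n n assms(1)] plus_null[OF n] by simp
qed

lemma comp_null_left:
  assumes "f \<in> Hom C U Y" "Z \<in> Obj C"
  shows "Null C Y Z \<bullet> f = Null C U Z"
proof (rule plus_self_null)
  have n: "Null C Y Z \<in> Hom C Y Z" using assms by (auto intro: null_in_Hom Hom_Obj)
  show "Null C Y Z \<bullet> f \<in> Hom C U Z" using assms(1) n by (rule comp_in_Hom)
  show "Plus C (Null C Y Z \<bullet> f) (Null C Y Z \<bullet> f) = Null C Y Z \<bullet> f"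
    using comp_plus_left[OF assms(1) n n] plus_null[OF n] by simp
qed

lemma biproduct_coproduct:
  assumes "is_biproduct C U Y P i j p q" "g \<in> Hom C U W" "g' \<in> Hom C Y W"
  shows "\<exists>!h. h \<in> Hom C P W \<and> h \<bullet> i = g \<and> h \<bullet> j = g'"
proof -
  have b: "P \<in> Obj C" "i \<in> Hom C U P" "j \<in> Hom C Y P" "p \<in> Hom C P U" "q \<in> Hom C P Y"
    "p \<bullet> i = Ide C U" "q \<bullet> j = Ide C Y"
    "p \<bullet> j = Null C Y U" "q \<bullet> i = Null C U Y"
    "Plus C (i \<bullet> p) (j \<bullet> q) = Ide C P"
    using assms(1) by (auto simp: is_biproduct_def)
  let ?h = "Plus C (g \<bullet> p) (g' \<bullet> q)"
  have gp: "g \<bullet> p \<in> Hom C P W" "g' \<bullet> q \<in> Hom C P W"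
    using comp_in_Hom[OF b(4) assms(2)] comp_in_Hom[OF b(5) assms(3)] .
  note UY = Hom_Obj[OF assms(2)] Hom_Obj[OF assms(3)]
  show ?thesis
  proof (rule ex1I[of _ ?h], intro conjI)
    show "?h \<in> Hom C P W" using gp by (rule plus_in_Hom)
    show "?h \<bullet> i = g"
      using comp_plus_left[OF b(2) gp] comp_assoc[OF b(2,4) assms(2)] comp_assoc[OF b(2,5) assms(3)]
        comp_null_right[OF assms(3) UY(1)] comp_ide_right[OF assms(2)] plus_null[OF assms(2)]
      by (simp add: b)
    show "?h \<bullet> j = g'"
      using comp_plus_left[OF b(3) gp] comp_assoc[OF b(3,4) assms(2)] comp_assoc[OF b(3,5) assms(3)]
        comp_null_right[OF assms(2) UY(3)] comp_ide_right[OF assms(3)] plus_null[OF assms(3)]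
      by (simp add: b)
  next
    fix h assume h: "h \<in> Hom C P W \<and> h \<bullet> i = g \<and> h \<bullet> j = g'"
    then have hP: "h \<in> Hom C P W" by blast
    have "h = h \<bullet> Plus C (i \<bullet> p) (j \<bullet> q)" using b(10) comp_ide_right[OF hP] by simp
    also have "\<dots> = ?h"
      using comp_plus_right[OF comp_in_Hom[OF b(4,2)] comp_in_Hom[OF b(5,3)] hP]
        comp_assoc[OF b(4,2) hP] comp_assoc[OF b(5,3) hP] h by simp
    finally show "h = ?h" .
  qed
qed

lemma iso_arrE:
  assumes "iso_arr C \<alpha>" "\<alpha> \<in> Hom C U Y"
  obtains \<beta> where "\<beta> \<in> Hom C Y U" "\<beta> \<bullet> \<alpha> = Ide C U" "\<alpha> \<bullet> \<beta> = Ide C Y"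
  using assms unfolding iso_arr_def HomD[OF assms(2)] by blast

lemma iso_arrI:
  assumes "\<alpha> \<in> Hom C U Y" "\<beta> \<in> Hom C Y U" "\<beta> \<bullet> \<alpha> = Ide C U" "\<alpha> \<bullet> \<beta> = Ide C Y"
  shows "iso_arr C \<alpha>"
  using assms unfolding iso_arr_def HomD(2,3)[OF assms(1)] by (blast dest: HomD)

lemma iso_cancel_left:
  assumes "iso_arr C \<alpha>" "\<alpha> \<in> Hom C U Y" "f \<in> Hom C W U" "g \<in> Hom C W U" "\<alpha> \<bullet> f = \<alpha> \<bullet> g"
  shows "f = g"
proof -
  obtain \<beta> where \<beta>: "\<beta> \<in> Hom C Y U" "\<beta> \<bullet> \<alpha> = Ide C U" using iso_arrE[OF assms(1,2)] by blast
  have "(\<beta> \<bullet> \<alpha>) \<bullet> f = (\<beta> \<bullet> \<alpha>) \<bullet> g"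
    using assms(5) comp_assoc[OF assms(3,2) \<beta>(1)] comp_assoc[OF assms(4,2) \<beta>(1)] by simp
  then show ?thesis using \<beta>(2) comp_ide_left[OF assms(3)] comp_ide_left[OF assms(4)] by simp
qed

lemma iso_cancel_right:
  assumes "iso_arr C \<alpha>" "\<alpha> \<in> Hom C U Y" "f \<in> Hom C Y W" "g \<in> Hom C Y W" "f \<bullet> \<alpha> = g \<bullet> \<alpha>"
  shows "f = g"
proof -
  obtain \<beta> where \<beta>: "\<beta> \<in> Hom C Y U" "\<alpha> \<bullet> \<beta> = Ide C Y" using iso_arrE[OF assms(1,2)] by blast
  have "f \<bullet> (\<alpha> \<bullet> \<beta>) = g \<bullet> (\<alpha> \<bullet> \<beta>)"
    using assms(5) comp_assoc[OF \<beta>(1) assms(2,3)] comp_assoc[OF \<beta>(1) assms(2,4)] by simp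
  then show ?thesis using \<beta>(2) comp_ide_right[OF assms(3)] comp_ide_right[OF assms(4)] by simp
qed

lemma iso_square_inverse:
  assumes "\<alpha> \<in> Hom C U U'" "\<alpha>' \<in> Hom C U' U" "\<alpha> \<bullet> \<alpha>' = Ide C U'"
    and "\<beta> \<in> Hom C Y Y'" "\<beta>' \<in> Hom C Y' Y" "\<beta>' \<bullet> \<beta> = Ide C Y"
    and "f \<in> Hom C U Y" "f' \<in> Hom C U' Y'" "f' \<bullet> \<alpha> = \<beta> \<bullet> f"
  shows "f \<bullet> \<alpha>' = \<beta>' \<bullet> f'"
proof -
  have "\<beta>' \<bullet> f' = \<beta>' \<bullet> (f' \<bullet> (\<alpha> \<bullet> \<alpha>'))" using assms(3) comp_ide_right[OF assms(8)] by simp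
  also have "\<dots> = \<beta>' \<bullet> ((\<beta> \<bullet> f) \<bullet> \<alpha>')"
    using comp_assoc[OF assms(2,1,8)] assms(9) by simp
  also have "\<dots> = ((\<beta>' \<bullet> \<beta>) \<bullet> f) \<bullet> \<alpha>'"
    using comp_assoc[OF assms(2) comp_in_Hom[OF assms(7,4)] assms(5)] comp_assoc[OF assms(7,4,5)] by simp
  also have "\<dots> = f \<bullet> \<alpha>'" using assms(6) comp_ide_left[OF assms(7)] by simp
  finally show ?thesis by simp
qed

lemma is_kernelI:
  assumes "f \<in> Hom C U Y" "k \<in> Hom C V U" "f \<bullet> k = Null C V Y"
    "\<And>W g. g \<in> Hom C W U \<Longrightarrow> f \<bullet> g = Null C W Y \<Longrightarrow> \<exists>!h. h \<in> Hom C W V \<and> k \<bullet> h = g"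
  shows "is_kernel C k f"
  using assms HomD(2,3)[OF assms(1)] HomD(2,3)[OF assms(2)] unfolding is_kernel_def by (auto dest: HomD(1))

lemma is_cokernelI:
  assumes "f \<in> Hom C U Y" "c \<in> Hom C Y V" "c \<bullet> f = Null C U V"
    "\<And>W g. g \<in> Hom C Y W \<Longrightarrow> g \<bullet> f = Null C U W \<Longrightarrow> \<exists>!h. h \<in> Hom C V W \<and> h \<bullet> c = g"
  shows "is_cokernel C c f"
  using assms HomD(2,3)[OF assms(1)] HomD(2,3)[OF assms(2)] unfolding is_cokernel_def by (auto dest: HomD(1))

lemma is_kernelD:
  assumes "is_kernel C k f" "f \<in> Hom C U Y"
  shows "k \<in> Hom C (Dom C k) U" "f \<bullet> k = Null C (Dom C k) Y"
    "g \<in> Hom C W U \<Longrightarrow> f \<bullet> g = Null C W Y \<Longrightarrow> \<exists>!h. h \<in> Hom C W (Dom C k) \<and> k \<bullet> h = g"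
proof -
  show "k \<in> Hom C (Dom C k) U" "f \<bullet> k = Null C (Dom C k) Y"
    using assms HomD[OF assms(2)] unfolding is_kernel_def Hom_def by auto
  show "g \<in> Hom C W U \<Longrightarrow> f \<bullet> g = Null C W Y \<Longrightarrow> \<exists>!h. h \<in> Hom C W (Dom C k) \<and> k \<bullet> h = g"
    using assms(1) Hom_Obj[of g W U] unfolding is_kernel_def HomD(2,3)[OF assms(2)] by blast
qed

lemma is_cokernelD:
  assumes "is_cokernel C c f" "f \<in> Hom C U Y"
  shows "c \<in> Hom C Y (Cod C c)" "c \<bullet> f = Null C U (Cod C c)"
    "g \<in> Hom C Y W \<Longrightarrow> g \<bullet> f = Null C U W \<Longrightarrow> \<exists>!h. h \<in> Hom C (Cod C c) W \<and> h \<bullet> c = g"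
proof -
  show "c \<in> Hom C Y (Cod C c)" "c \<bullet> f = Null C U (Cod C c)"
    using assms HomD[OF assms(2)] unfolding is_cokernel_def Hom_def by auto
  show "g \<in> Hom C Y W \<Longrightarrow> g \<bullet> f = Null C U W \<Longrightarrow> \<exists>!h. h \<in> Hom C (Cod C c) W \<and> h \<bullet> c = g"
    using assms(1) Hom_Obj[of g Y W] unfolding is_cokernel_def HomD(2,3)[OF assms(2)] by blast
qed

lemma is_cokernel_epi:
  assumes "is_cokernel C c f"
  shows "epi_arr C c"
proof -
  have f: "f \<in> Hom C (Dom C f) (Cod C f)" using assms by (auto simp: is_cokernel_def Hom_def)
  note c = is_cokernelD[OF assms f]
  show ?thesis
    unfolding epi_arr_def
  proof (intro conjI ballI impI)
    show "c \<in> Arr C" using c(1) by (rule HomD)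
    fix W g h assume gh: "W \<in> Obj C" "g \<in> Hom C (Cod C c) W" "h \<in> Hom C (Cod C c) W" "g \<bullet> c = h \<bullet> c"
    have "(g \<bullet> c) \<bullet> f = Null C (Dom C f) W"
      using comp_assoc[OF f c(1) gh(2)] c(2) comp_null_right[OF gh(2)] Hom_Obj[OF f] by simp
    from c(3)[OF comp_in_Hom[OF c(1) gh(2)] this] show "g = h" using gh by metis
  qed
qed

text \<open>Kernels, cokernels, monomorphisms and epimorphisms are moved along isomorphisms of arrows.\<close>

context
  fixes U Y U' Y' f f' \<alpha> \<beta>
  assumes f: "f \<in> Hom C U Y" and f': "f' \<in> Hom C U' Y'"
    and \<alpha>: "iso_arr C \<alpha>" "\<alpha> \<in> Hom C U U'" and \<beta>: "iso_arr C \<beta>" "\<beta> \<in> Hom C Y Y'"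
    and square: "f' \<bullet> \<alpha> = \<beta> \<bullet> f"
begin

lemma kernel_iso:
  assumes k: "is_kernel C k f"
  shows "is_kernel C (\<alpha> \<bullet> k) f'"
proof -
  obtain \<alpha>' where \<alpha>': "\<alpha>' \<in> Hom C U' U" "\<alpha>' \<bullet> \<alpha> = Ide C U" "\<alpha> \<bullet> \<alpha>' = Ide C U'"
    using iso_arrE[OF \<alpha>] by blast
  obtain \<beta>' where \<beta>': "\<beta>' \<in> Hom C Y' Y" "\<beta>' \<bullet> \<beta> = Ide C Y" using iso_arrE[OF \<beta>] by blast
  have inv: "f \<bullet> \<alpha>' = \<beta>' \<bullet> f'"
    by (rule iso_square_inverse[OF \<alpha>(2) \<alpha>'(1,3) \<beta>(2) \<beta>' f f' square])
  note kD = is_kernelD[OF k f]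
  show ?thesis
  proof (rule is_kernelI[OF f' comp_in_Hom[OF kD(1) \<alpha>(2)]])
    show "f' \<bullet> (\<alpha> \<bullet> k) = Null C (Dom C k) Y'"
      using comp_assoc[OF kD(1) \<alpha>(2) f'] comp_assoc[OF kD(1) f \<beta>(2)] square kD(2)
        comp_null_right[OF \<beta>(2)] Hom_Obj[OF kD(1)] by simp
    fix W g assume g: "g \<in> Hom C W U'" "f' \<bullet> g = Null C W Y'"
    have g': "\<alpha>' \<bullet> g \<in> Hom C W U" using comp_in_Hom[OF g(1) \<alpha>'(1)] .
    have "f \<bullet> (\<alpha>' \<bullet> g) = Null C W Y"
      using comp_assoc[OF g(1) \<alpha>'(1) f] comp_assoc[OF g(1) f' \<beta>'(1)] inv g(2)
        comp_null_right[OF \<beta>'(1)] Hom_Obj[OF g(1)] by simp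
    from kD(3)[OF g' this] have ex: "\<exists>!h. h \<in> Hom C W (Dom C k) \<and> k \<bullet> h = \<alpha>' \<bullet> g" .
    have eq: "(\<alpha> \<bullet> k) \<bullet> h = g \<longleftrightarrow> k \<bullet> h = \<alpha>' \<bullet> g" if h: "h \<in> Hom C W (Dom C k)" for h
    proof
      assume "(\<alpha> \<bullet> k) \<bullet> h = g"
      then have "\<alpha>' \<bullet> g = (\<alpha>' \<bullet> \<alpha>) \<bullet> (k \<bullet> h)"
        using comp_assoc[OF h kD(1) \<alpha>(2)] comp_assoc[OF comp_in_Hom[OF h kD(1)] \<alpha>(2) \<alpha>'(1)] by simp
      then show "k \<bullet> h = \<alpha>' \<bullet> g" using \<alpha>'(2) comp_ide_left[OF comp_in_Hom[OF h kD(1)]] by simp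
    next
      assume "k \<bullet> h = \<alpha>' \<bullet> g"
      then have "(\<alpha> \<bullet> k) \<bullet> h = (\<alpha> \<bullet> \<alpha>') \<bullet> g"
        using comp_assoc[OF h kD(1) \<alpha>(2)] comp_assoc[OF g(1) \<alpha>'(1) \<alpha>(2)] by simp
      then show "(\<alpha> \<bullet> k) \<bullet> h = g" using \<alpha>'(3) comp_ide_left[OF g(1)] by simp
    qed
    show "\<exists>!h. h \<in> Hom C W (Dom C k) \<and> (\<alpha> \<bullet> k) \<bullet> h = g"
      using ex eq by metis
  qed
qed

lemma cokernel_iso:
  assumes c: "is_cokernel C c f" and \<beta>': "\<beta>' \<in> Hom C Y' Y" "\<beta>' \<bullet> \<beta> = Ide C Y" "\<beta> \<bullet> \<beta>' = Ide C Y'"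
  shows "is_cokernel C (c \<bullet> \<beta>') f'"
proof -
  obtain \<alpha>' where \<alpha>': "\<alpha>' \<in> Hom C U' U" "\<alpha> \<bullet> \<alpha>' = Ide C U'"
    using iso_arrE[OF \<alpha>] by blast
  have inv: "f \<bullet> \<alpha>' = \<beta>' \<bullet> f'"
    by (rule iso_square_inverse[OF \<alpha>(2) \<alpha>' \<beta>(2) \<beta>'(1,2) f f' square])
  note cD = is_cokernelD[OF c f]
  show ?thesis
  proof (rule is_cokernelI[OF f' comp_in_Hom[OF \<beta>'(1) cD(1)]])
    show "(c \<bullet> \<beta>') \<bullet> f' = Null C U' (Cod C c)"
      using comp_assoc[OF f' \<beta>'(1) cD(1)] comp_assoc[OF \<alpha>'(1) f cD(1)] inv cD(2)
        comp_null_left[OF \<alpha>'(1)] Hom_Obj[OF cD(1)] by simp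
    fix W g assume g: "g \<in> Hom C Y' W" "g \<bullet> f' = Null C U' W"
    have g': "g \<bullet> \<beta> \<in> Hom C Y W" using comp_in_Hom[OF \<beta>(2) g(1)] .
    have "(g \<bullet> \<beta>) \<bullet> f = Null C U W"
      using comp_assoc[OF f \<beta>(2) g(1)] comp_assoc[OF \<alpha>(2) f' g(1)] square g(2)
        comp_null_left[OF \<alpha>(2)] Hom_Obj[OF g(1)] by simp
    from cD(3)[OF g' this] have ex: "\<exists>!h. h \<in> Hom C (Cod C c) W \<and> h \<bullet> c = g \<bullet> \<beta>" .
    have eq: "h \<bullet> (c \<bullet> \<beta>') = g \<longleftrightarrow> h \<bullet> c = g \<bullet> \<beta>" if h: "h \<in> Hom C (Cod C c) W" for h
    proof
      assume "h \<bullet> (c \<bullet> \<beta>') = g"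
      then have "g \<bullet> \<beta> = (h \<bullet> c) \<bullet> (\<beta>' \<bullet> \<beta>)"
        using comp_assoc[OF \<beta>'(1) cD(1) h] comp_assoc[OF \<beta>(2) \<beta>'(1) comp_in_Hom[OF cD(1) h]] by simp
      then show "h \<bullet> c = g \<bullet> \<beta>" using \<beta>'(2) comp_ide_right[OF comp_in_Hom[OF cD(1) h]] by simp
    next
      assume "h \<bullet> c = g \<bullet> \<beta>"
      then have "h \<bullet> (c \<bullet> \<beta>') = g \<bullet> (\<beta> \<bullet> \<beta>')"
        using comp_assoc[OF \<beta>'(1) cD(1) h] comp_assoc[OF \<beta>'(1) \<beta>(2) g(1)] by simp
      then show "h \<bullet> (c \<bullet> \<beta>') = g" using \<beta>'(3) comp_ide_right[OF g(1)] by simp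
    qed
    show "\<exists>!h. h \<in> Hom C (Cod C c) W \<and> h \<bullet> (c \<bullet> \<beta>') = g"
      using ex eq by metis
  qed
qed

lemma mono_iso:
  assumes "mono_arr C f"
  shows "mono_arr C f'"
  unfolding mono_arr_def HomD(2)[OF f']
proof (intro conjI ballI impI HomD(1)[OF f'])
  obtain \<alpha>' where \<alpha>': "\<alpha>' \<in> Hom C U' U" "\<alpha> \<bullet> \<alpha>' = Ide C U'" "\<alpha>' \<bullet> \<alpha> = Ide C U"
    using iso_arrE[OF \<alpha>] by blast
  obtain \<beta>' where \<beta>': "\<beta>' \<in> Hom C Y' Y" "\<beta>' \<bullet> \<beta> = Ide C Y" using iso_arrE[OF \<beta>] by blast
  have inv: "f \<bullet> \<alpha>' = \<beta>' \<bullet> f'"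
    by (rule iso_square_inverse[OF \<alpha>(2) \<alpha>'(1,2) \<beta>(2) \<beta>' f f' square])
  fix W g h assume gh: "W \<in> Obj C" "g \<in> Hom C W U'" "h \<in> Hom C W U'" "f' \<bullet> g = f' \<bullet> h"
  have gh': "\<alpha>' \<bullet> g \<in> Hom C W U" "\<alpha>' \<bullet> h \<in> Hom C W U"
    using comp_in_Hom[OF gh(2) \<alpha>'(1)] comp_in_Hom[OF gh(3) \<alpha>'(1)] .
  have "f \<bullet> (\<alpha>' \<bullet> g) = f \<bullet> (\<alpha>' \<bullet> h)"
    using comp_assoc[OF gh(2) \<alpha>'(1) f] comp_assoc[OF gh(2) f' \<beta>'(1)]
      comp_assoc[OF gh(3) \<alpha>'(1) f] comp_assoc[OF gh(3) f' \<beta>'(1)] inv gh(4) by simp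
  from mono_arrD[OF assms gh(1) _ _ this] have "\<alpha>' \<bullet> g = \<alpha>' \<bullet> h"
    using gh' by (simp add: HomD(2)[OF f])
  then show "g = h"
    by (rule iso_cancel_left[OF iso_arrI[OF \<alpha>'(1) \<alpha>(2) \<alpha>'(2,3)] \<alpha>'(1) gh(2,3)])
qed

lemma epi_iso:
  assumes "epi_arr C f"
  shows "epi_arr C f'"
  unfolding epi_arr_def HomD(3)[OF f']
proof (intro conjI ballI impI HomD(1)[OF f'])
  fix W g h assume gh: "W \<in> Obj C" "g \<in> Hom C Y' W" "h \<in> Hom C Y' W" "g \<bullet> f' = h \<bullet> f'"
  have "(g \<bullet> \<beta>) \<bullet> f = (h \<bullet> \<beta>) \<bullet> f"
    using comp_assoc[OF f \<beta>(2) gh(2)] comp_assoc[OF \<alpha>(2) f' gh(2)]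
      comp_assoc[OF f \<beta>(2) gh(3)] comp_assoc[OF \<alpha>(2) f' gh(3)] square gh(4) by simp
  from epi_arrD[OF assms gh(1) _ _ this] have "g \<bullet> \<beta> = h \<bullet> \<beta>"
    using comp_in_Hom[OF \<beta>(2) gh(2)] comp_in_Hom[OF \<beta>(2) gh(3)] by (simp add: HomD(3)[OF f])
  then show "g = h" by (rule iso_cancel_right[OF \<beta> gh(2,3)])
qed

end

lemma short_exact_iso:
  assumes "short_exact C f g"
    and f: "f \<in> Hom C L M" "f' \<in> Hom C L' M'" and g: "g \<in> Hom C M N" "g' \<in> Hom C M' N'"
    and \<alpha>: "iso_arr C \<alpha>" "\<alpha> \<in> Hom C L L'" and \<beta>: "iso_arr C \<beta>" "\<beta> \<in> Hom C M M'"
    and \<gamma>: "iso_arr C \<gamma>" "\<gamma> \<in> Hom C N N'"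
    and sf: "f' \<bullet> \<alpha> = \<beta> \<bullet> f" and sg: "g' \<bullet> \<beta> = \<gamma> \<bullet> g"
  shows "short_exact C f' g'"
proof -
  obtain i c where ic: "is_cokernel C c f" "is_kernel C i c" "is_kernel C i g"
    using assms(1) by (auto simp: short_exact_def exact_at_def is_image_def)
  obtain \<beta>' where \<beta>': "\<beta>' \<in> Hom C M' M" "\<beta>' \<bullet> \<beta> = Ide C M" "\<beta> \<bullet> \<beta>' = Ide C M'"
    using iso_arrE[OF \<beta>] by blast
  have c: "c \<in> Hom C M (Cod C c)" by (rule is_cokernelD[OF ic(1) f(1)])
  let ?Q = "Cod C c"
  have Q: "?Q \<in> Obj C" using Hom_Obj[OF c] by blast
  have "iso_arr C (Ide C ?Q)" by (rule iso_arrI[OF ide_in_Hom ide_in_Hom]) (simp_all add: Q comp_ide_left[OF ide_in_Hom])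
  moreover have "(c \<bullet> \<beta>') \<bullet> \<beta> = Ide C ?Q \<bullet> c"
    using comp_assoc[OF \<beta>(2) \<beta>'(1) c] \<beta>'(2) comp_ide_left[OF c] comp_ide_right[OF c] by simp
  ultimately have "is_kernel C (\<beta> \<bullet> i) (c \<bullet> \<beta>')"
    using kernel_iso[OF c comp_in_Hom[OF \<beta>'(1) c] \<beta> _ ide_in_Hom[OF Q] _ ic(2)] by blast
  moreover have "is_cokernel C (c \<bullet> \<beta>') f'" by (rule cokernel_iso[OF f \<alpha> \<beta> sf ic(1) \<beta>'])
  moreover have "is_kernel C (\<beta> \<bullet> i) g'" by (rule kernel_iso[OF g \<beta> \<gamma> sg ic(3)])
  moreover have "mono_arr C f'" using mono_iso[OF f \<alpha> \<beta> sf] assms(1) by (simp add: short_exact_def)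
  moreover have "epi_arr C g'" using epi_iso[OF g \<beta> \<gamma> sg] assms(1) by (simp add: short_exact_def)
  ultimately show ?thesis unfolding short_exact_def exact_at_def is_image_def by blast
qed

text \<open>The universal property of the coproduct of \<open>n\<close> copies of \<open>Z\<close>.\<close>

definition is_copower :: "'o \<Rightarrow> nat \<Rightarrow> 'o \<Rightarrow> (nat \<Rightarrow> 'm) \<Rightarrow> bool" where
  "is_copower Z n P i \<longleftrightarrow> P \<in> Obj C \<and> (\<forall>k < n. i k \<in> Hom C Z P) \<and>
     (\<forall>W \<in> Obj C. \<forall>g. (\<forall>k < n. g k \<in> Hom C Z W) \<longrightarrow>
        (\<exists>!h. h \<in> Hom C P W \<and> (\<forall>k < n. h \<bullet> i k = g k)))"

lemma copowerD:
  assumes "is_copower Z n P i" "W \<in> Obj C" "\<And>k. k < n \<Longrightarrow> g k \<in> Hom C Z W"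
  shows "\<exists>!h. h \<in> Hom C P W \<and> (\<forall>k < n. h \<bullet> i k = g k)"
  using assms by (simp add: is_copower_def)

end

context abelian_category
begin

lemma copower_exists:
  assumes "Z \<in> Obj C"
  shows "\<exists>P i. is_copower Z n P i"
proof (induction n)
  case 0
  obtain N where "is_zero_obj C N" using zero_obj by blast
  then show ?case by (intro exI[of _ N]) (simp add: is_copower_def is_zero_obj_def)
next
  case (Suc n)
  then obtain P i where P: "is_copower Z n P i" by blast
  then have PO: "P \<in> Obj C" by (simp add: is_copower_def)
  obtain Q a b p q where Q: "is_biproduct C P Z Q a b p q" using biproducts[OF PO assms] by blast
  have ab: "a \<in> Hom C P Q" "b \<in> Hom C Z Q" "Q \<in> Obj C" using Q by (auto simp: is_biproduct_def)
  define i' where "i' k = (if k < n then a \<bullet> i k else b)" for k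
  have i: "i k \<in> Hom C Z P" if "k < n" for k using P that by (simp add: is_copower_def)
  have "is_copower Z (Suc n) Q i'"
    unfolding is_copower_def
  proof (intro conjI allI impI ballI)
    show "Q \<in> Obj C" by (rule ab)
    show "i' k \<in> Hom C Z Q" for k using i ab(2) comp_in_Hom[OF _ ab(1)] by (auto simp: i'_def)
    fix W g assume W: "W \<in> Obj C" and g: "\<forall>k < Suc n. g k \<in> Hom C Z W"
    then have "\<exists>!h. h \<in> Hom C P W \<and> (\<forall>k < n. h \<bullet> i k = g k)"
      using P unfolding is_copower_def by simp
    then obtain h where h: "h \<in> Hom C P W" "\<And>k. k < n \<Longrightarrow> h \<bullet> i k = g k"
      and h_unique: "\<And>h'. h' \<in> Hom C P W \<Longrightarrow> (\<forall>k < n. h' \<bullet> i k = g k) \<Longrightarrow> h' = h" by blast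
    have eq: "(\<forall>k < Suc n. h' \<bullet> i' k = g k) \<longleftrightarrow> h' \<bullet> a = h \<and> h' \<bullet> b = g n"
      if h': "h' \<in> Hom C Q W" for h'
    proof -
      have *: "h' \<bullet> i' k = (h' \<bullet> a) \<bullet> i k" if "k < n" for k
        using that comp_assoc[OF i[OF that] ab(1) h'] by (simp add: i'_def)
      have "h' \<bullet> i' n = h' \<bullet> b" by (simp add: i'_def)
      then have "(\<forall>k < Suc n. h' \<bullet> i' k = g k) \<longleftrightarrow>
          (\<forall>k < n. (h' \<bullet> a) \<bullet> i k = g k) \<and> h' \<bullet> b = g n"
        using * by (auto simp: less_Suc_eq)
      also have "(\<forall>k < n. (h' \<bullet> a) \<bullet> i k = g k) \<longleftrightarrow> h' \<bullet> a = h"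
        using h h_unique[OF comp_in_Hom[OF ab(1) h']] by blast
      finally show ?thesis .
    qed
    have "\<exists>!h'. h' \<in> Hom C Q W \<and> h' \<bullet> a = h \<and> h' \<bullet> b = g n"
      using biproduct_coproduct[OF Q h(1)] g by simp
    then show "\<exists>!h'. h' \<in> Hom C Q W \<and> (\<forall>k < Suc n. h' \<bullet> i' k = g k)"
      using eq by metis
  qed
  then show ?case by blast
qed

text \<open>
  The arrows are killed one after the other, each by the cokernel of its composite with the quotient
  reached so far.
\<close>

lemma joint_cokernel_exists:
  fixes n :: nat
  assumes "P \<in> Obj C" "\<And>k. k < n \<Longrightarrow> g k \<in> Hom C Z P"
  shows "\<exists>T c. c \<in> Hom C P T \<and> (\<forall>k < n. c \<bullet> g k = Null C Z T) \<and>
    (\<forall>W w. w \<in> Hom C P W \<longrightarrow> (\<forall>k < n. w \<bullet> g k = Null C Z W) \<longrightarrow>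
       (\<exists>!h. h \<in> Hom C T W \<and> h \<bullet> c = w))"
  using assms(2)
proof (induction n)
  case 0
  then show ?case
    using assms(1) ide_in_Hom comp_ide_right by (intro exI[of _ P] exI[of _ "Ide C P"]) auto
next
  case (Suc n)
  have "g k \<in> Hom C Z P" if "k < n" for k using Suc.prems that by simp
  from Suc.IH[OF this] obtain T c where c: "c \<in> Hom C P T" "\<And>k. k < n \<Longrightarrow> c \<bullet> g k = Null C Z T"
    and c_univ: "\<And>W w. w \<in> Hom C P W \<Longrightarrow> (\<forall>k < n. w \<bullet> g k = Null C Z W) \<Longrightarrow>
       (\<exists>!h. h \<in> Hom C T W \<and> h \<bullet> c = w)" by blast
  have gn: "g n \<in> Hom C Z P" using Suc.prems by simp
  note cg = comp_in_Hom[OF gn c(1)]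
  obtain d where d: "is_cokernel C d (c \<bullet> g n)" using cokernels[OF HomD(1)[OF cg]] by blast
  note dD = is_cokernelD[OF d cg]
  note dc = comp_in_Hom[OF c(1) dD(1)]
  show ?case
  proof (intro exI[of _ "Cod C d"] exI[of _ "d \<bullet> c"] conjI allI impI)
    show "d \<bullet> c \<in> Hom C P (Cod C d)" by (rule dc)
    show "(d \<bullet> c) \<bullet> g k = Null C Z (Cod C d)" if "k < Suc n" for k
    proof (cases "k = n")
      case True
      then show ?thesis using comp_assoc[OF gn c(1) dD(1)] dD(2) by simp
    next
      case False
      then have "k < n" using that by simp
      then show ?thesis
        using comp_assoc[OF Suc.prems[OF that] c(1) dD(1)] c(2) comp_null_right[OF dD(1)] Hom_Obj[OF gn] by simp
    qed
    fix W w assume w: "w \<in> Hom C P W" "\<forall>k < Suc n. w \<bullet> g k = Null C Z W"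
    obtain h where h: "h \<in> Hom C T W" "h \<bullet> c = w" "\<And>h'. h' \<in> Hom C T W \<Longrightarrow> h' \<bullet> c = w \<Longrightarrow> h' = h"
    proof -
      have "\<forall>k < n. w \<bullet> g k = Null C Z W" using w(2) by simp
      from c_univ[OF w(1) this] show ?thesis using that by (elim ex1E) blast
    qed
    have "h \<bullet> (c \<bullet> g n) = Null C Z W" using comp_assoc[OF gn c(1) h(1)] h(2) w(2) by simp
    from dD(3)[OF h(1) this] have ex: "\<exists>!h'. h' \<in> Hom C (Cod C d) W \<and> h' \<bullet> d = h" .
    have "h' \<bullet> (d \<bullet> c) = w \<longleftrightarrow> h' \<bullet> d = h" if h': "h' \<in> Hom C (Cod C d) W" for h'
    proof
      assume "h' \<bullet> (d \<bullet> c) = w"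
      then have "(h' \<bullet> d) \<bullet> c = w" by (simp only: comp_assoc[OF c(1) dD(1) h'])
      then show "h' \<bullet> d = h" by (rule h(3)[OF comp_in_Hom[OF dD(1) h']])
    next
      assume "h' \<bullet> d = h"
      then show "h' \<bullet> (d \<bullet> c) = w"
        by (simp only: comp_assoc[OF c(1) dD(1) h', symmetric] h(2))
    qed
    then show "\<exists>!h'. h' \<in> Hom C (Cod C d) W \<and> h' \<bullet> (d \<bullet> c) = w" using ex by metis
  qed
qed

text \<open>
  An epimorphism \<open>g\<close> is a cokernel of some \<open>r\<close>, and \<open>r\<close> factors through the common kernel of \<open>g\<close>
  and of the cokernel of \<open>f\<close>; so the cokernel of \<open>f\<close> kills \<open>r\<close> and factors through \<open>g\<close>, and with it
  every \<open>w\<close> which kills \<open>f\<close>.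
\<close>

lemma exact_epi_factor:
  assumes "exact_at C f g" "epi_arr C g" and f: "f \<in> Hom C L M" and g: "g \<in> Hom C M N"
    and w: "w \<in> Hom C M W" "w \<bullet> f = Null C L W"
  shows "\<exists>h. h \<in> Hom C N W \<and> h \<bullet> g = w"
proof -
  obtain i c where ic: "is_cokernel C c f" "is_kernel C i c" "is_kernel C i g"
    using assms(1) by (auto simp: exact_at_def is_image_def)
  obtain r where r: "is_cokernel C g r" using epi_conormal[OF assms(2)] by blast
  then have rH: "r \<in> Hom C (Dom C r) M"
    using HomD(2)[OF g] by (auto simp: is_cokernel_def Hom_def)
  note gD = is_cokernelD[OF r rH, unfolded HomD(3)[OF g]] and cD = is_cokernelD[OF ic(1) f]
  note iD = is_kernelD[OF ic(3) g] and iD' = is_kernelD[OF ic(2) cD(1)]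
  obtain s where s: "s \<in> Hom C (Dom C r) (Dom C i)" "i \<bullet> s = r"
    using iD(3)[OF rH gD(2)] by blast
  have "c \<bullet> r = Null C (Dom C r) (Cod C c)"
    using comp_assoc[OF s(1) iD(1) cD(1)] iD'(2) s(2) comp_null_left[OF s(1)] Hom_Obj[OF cD(1)] by simp
  then obtain t where t: "t \<in> Hom C N (Cod C c)" "t \<bullet> g = c" using gD(3)[OF cD(1)] by blast
  obtain h where h: "h \<in> Hom C (Cod C c) W" "h \<bullet> c = w" using cD(3)[OF w] by blast
  show ?thesis using comp_in_Hom[OF t(1) h(1)] comp_assoc[OF g t(1) h(1)] t(2) h(2) by auto
qed

lemma cokernel_exact:
  assumes "is_cokernel C c f"
  shows "exact_at C f c \<and> epi_arr C c"
proof -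
  have "c \<in> Arr C" using assms by (simp add: is_cokernel_def)
  then obtain k where "is_kernel C k c" using kernels by blast
  then show ?thesis using assms is_cokernel_epi by (auto simp: exact_at_def is_image_def)
qed

end

section \<open>Linear functors\<close>

lemma linear_functorI:
  fixes C :: "('k, 'o, 'm) lincat" and D :: "('k, 'p, 'n) lincat"
  assumes "fobj F \<in> extensional (Obj C)" "fmap F \<in> extensional (Arr C)"
    "\<And>U. U \<in> Obj C \<Longrightarrow> fobj F U \<in> Obj D"
    "\<And>f. f \<in> Arr C \<Longrightarrow> fmap F f \<in> Hom D (fobj F (Dom C f)) (fobj F (Cod C f))"
    "\<And>U. U \<in> Obj C \<Longrightarrow> fmap F (Ide C U) = Ide D (fobj F U)"
    "\<And>f g. f \<in> Arr C \<Longrightarrow> g \<in> Arr C \<Longrightarrow> Cod C f = Dom C g \<Longrightarrow>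
       fmap F (g \<cdot>\<^bsub>C\<^esub> f) = fmap F g \<cdot>\<^bsub>D\<^esub> fmap F f"
    "\<And>f g. f \<in> Arr C \<Longrightarrow> g \<in> Arr C \<Longrightarrow> Dom C f = Dom C g \<Longrightarrow> Cod C f = Cod C g \<Longrightarrow>
       fmap F (Plus C f g) = Plus D (fmap F f) (fmap F g)"
    "\<And>c f. c \<in> carrier K \<Longrightarrow> f \<in> Arr C \<Longrightarrow> fmap F (Scal C c f) = Scal D c (fmap F f)"
  shows "linear_functor K C D F"
  unfolding linear_functor_def
  using assms by (simp add: Hom_def PiE_def Pi_iff)

lemma linear_functorD:
  fixes C :: "('k, 'o, 'm) lincat" and D :: "('k, 'p, 'n) lincat"
  assumes "linear_functor K C D F"
  shows "fobj F \<in> extensional (Obj C)" "fmap F \<in> extensional (Arr C)"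
    and functor_obj: "U \<in> Obj C \<Longrightarrow> fobj F U \<in> Obj D"
    and functor_hom: "f \<in> Hom C U Y \<Longrightarrow> fmap F f \<in> Hom D (fobj F U) (fobj F Y)"
    and functor_ide: "U \<in> Obj C \<Longrightarrow> fmap F (Ide C U) = Ide D (fobj F U)"
    and functor_comp: "f \<in> Hom C U Y \<Longrightarrow> g \<in> Hom C Y Z \<Longrightarrow>
      fmap F (g \<cdot>\<^bsub>C\<^esub> f) = fmap F g \<cdot>\<^bsub>D\<^esub> fmap F f"
    and functor_plus: "f \<in> Hom C U Y \<Longrightarrow> f' \<in> Hom C U Y \<Longrightarrow>
      fmap F (Plus C f f') = Plus D (fmap F f) (fmap F f')"
    and functor_scal: "c \<in> carrier K \<Longrightarrow> f \<in> Hom C U Y \<Longrightarrow>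
      fmap F (Scal C c f) = Scal D c (fmap F f)"
  using assms unfolding linear_functor_def Hom_def PiE_def by auto

lemma functor_category_simps:
  fixes C :: "('k, 'o, 'm) lincat" and D :: "('k, 'p, 'n) lincat"
  shows
  "F \<in> Obj (functor_category K C D) \<longleftrightarrow> linear_functor K C D F"
  "(F, \<eta>, G) \<in> Arr (functor_category K C D) \<longleftrightarrow>
     linear_functor K C D F \<and> linear_functor K C D G \<and> nat_trans C D F G \<eta>"
  "Dom (functor_category K C D) (F, \<eta>, G) = F" "Cod (functor_category K C D) (F, \<eta>, G) = G"
  "Ide (functor_category K C D) F = (F, \<lambda>U \<in> Obj C. Ide D (fobj F U), F)"
  "(G', \<theta>, H) \<cdot>\<^bsub>functor_category K C D\<^esub> (F, \<eta>, G) = (F, \<lambda>U \<in> Obj C. \<theta> U \<cdot>\<^bsub>D\<^esub> \<eta> U, H)"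
  "Plus (functor_category K C D) (F, \<eta>, G) (F', \<theta>, G') = (F, \<lambda>U \<in> Obj C. Plus D (\<eta> U) (\<theta> U), G)"
  "Scal (functor_category K C D) c (F, \<eta>, G) = (F, \<lambda>U \<in> Obj C. Scal D c (\<eta> U), G)"
  by (simp_all add: functor_category_def)

lemma nat_transD:
  fixes C :: "('k, 'o, 'm) lincat" and D :: "('k, 'p, 'n) lincat"
  assumes "nat_trans C D F G \<eta>"
  shows "\<eta> \<in> extensional (Obj C)" "U \<in> Obj C \<Longrightarrow> \<eta> U \<in> Hom D (fobj F U) (fobj G U)"
    "f \<in> Hom C U Y \<Longrightarrow> \<eta> Y \<cdot>\<^bsub>D\<^esub> fmap F f = fmap G f \<cdot>\<^bsub>D\<^esub> \<eta> U"
  using assms by (auto simp: nat_trans_def Hom_def)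

lemma aobj_category_simps:
  fixes C :: "('k, 'o, 'm) lincat"
  shows
  "Z \<in> Obj (aobj_category K A C) \<longleftrightarrow> is_aobj K A C Z"
  "q \<in> Arr (aobj_category K A C) \<longleftrightarrow> is_aarr K A C q"
  "Dom (aobj_category K A C) (V, h, Y) = V" "Cod (aobj_category K A C) (V, h, Y) = Y"
  "Ide (aobj_category K A C) V = (V, Ide C (fst V), V)"
  "(Y', g, Z) \<cdot>\<^bsub>aobj_category K A C\<^esub> (V, f, Y) = (V, g \<cdot>\<^bsub>C\<^esub> f, Z)"
  "Plus (aobj_category K A C) (V, f, Y) (V', f', Y') = (V, Plus C f f', Y)"
  "Scal (aobj_category K A C) c (V, f, Y) = (V, Scal C c f, Y)"
  by (simp_all add: aobj_category_def)


section \<open>Objects with an action of an algebra\<close>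

lemma ex1_eq: "\<exists>!x. P x \<Longrightarrow> P a \<Longrightarrow> P b \<Longrightarrow> a = b"
  by blast

lemma abelian_group_cong:
  assumes "abelian_group G" "carrier H = carrier G" "\<zero>\<^bsub>H\<^esub> = \<zero>\<^bsub>G\<^esub>" "\<And>x y. x \<oplus>\<^bsub>H\<^esub> y = x \<oplus>\<^bsub>G\<^esub> y"
  shows "abelian_group H"
proof -
  interpret G: abelian_group G by fact
  show ?thesis
    by (rule abelian_groupI) (auto simp: assms(2-) G.a_ac intro: G.l_neg)
qed

locale abelian_category_with_algebra = abelian_category K C
  for K :: "'k ring" and C :: "('k, 'o, 'm) lincat" +
  fixes A :: "('k, 'a) module"
  assumes algebra: "unital_algebra K A"
begin

lemma ring_A: "ring A"
  using algebra by (simp add: unital_algebra_def)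

sublocale A: ring A by (rule ring_A)

lemma smult_A_closed: "c \<in> carrier K \<Longrightarrow> a \<in> carrier A \<Longrightarrow> c \<odot>\<^bsub>A\<^esub> a \<in> carrier A"
  using algebra module.smult_closed unfolding unital_algebra_def by metis

lemma smult_one_central:
  assumes "c \<in> carrier K" "a \<in> carrier A"
  shows "(c \<odot>\<^bsub>A\<^esub> \<one>\<^bsub>A\<^esub>) \<otimes>\<^bsub>A\<^esub> a = c \<odot>\<^bsub>A\<^esub> a" "a \<otimes>\<^bsub>A\<^esub> (c \<odot>\<^bsub>A\<^esub> \<one>\<^bsub>A\<^esub>) = c \<odot>\<^bsub>A\<^esub> a"
  using unital_algebra.smult_mult_left[OF algebra assms(1) A.one_closed assms(2)]
    unital_algebra.smult_mult_right[OF algebra assms(1) assms(2) A.one_closed] assms(2) by simp_all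

lemma fpmod_ide: "M \<in> Obj (fpmod A) \<Longrightarrow> Ide (fpmod A) M \<in> Hom (fpmod A) M M"
  using rmod_hom_id[of A M] by (simp add: fpmod_Hom fpmod_simps fpmod_Obj)

lemma fpmod_comp:
  assumes "f \<in> Hom (fpmod A) L M" "g \<in> Hom (fpmod A) M N"
  shows "g \<cdot>\<^bsub>fpmod A\<^esub> f \<in> Hom (fpmod A) L N"
  using assms rmod_hom_comp[of A L _ M _ N] by (auto simp: fpmod_Hom fpmod_simps fpmod_Obj)

lemma fpmod_plus:
  assumes "f \<in> Hom (fpmod A) M N" "g \<in> Hom (fpmod A) M N"
  shows "Plus (fpmod A) f g \<in> Hom (fpmod A) M N"
  using assms rmod_hom_plus[of A M N] by (auto simp: fpmod_Hom fpmod_simps fpmod_Obj)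

lemma fpmod_scal:
  assumes "f \<in> Hom (fpmod A) M N" "c \<in> carrier K"
  shows "Scal (fpmod A) c f \<in> Hom (fpmod A) M N"
proof -
  obtain f' where f: "f = (M, f', N)" "M \<in> Obj (fpmod A)" "N \<in> Obj (fpmod A)" "f' \<in> rmod_hom A M N"
    using assms(1) by (auto simp: fpmod_Hom)
  interpret M: right_module A M using f by (simp add: fpmod_Obj)
  interpret N: right_module A N using f by (simp add: fpmod_Obj)
  have c: "c \<odot>\<^bsub>A\<^esub> \<one>\<^bsub>A\<^esub> \<in> carrier A" using smult_A_closed assms(2) by simp
  have "ract N (ract N x a) (c \<odot>\<^bsub>A\<^esub> \<one>\<^bsub>A\<^esub>) = ract N (ract N x (c \<odot>\<^bsub>A\<^esub> \<one>\<^bsub>A\<^esub>)) a"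
    if "x \<in> carrier N" "a \<in> carrier A" for x a
    using that c assms(2) by (simp flip: N.ract_mult add: smult_one_central)
  then have "(\<lambda>x \<in> carrier M. ract N (f' x) (c \<odot>\<^bsub>A\<^esub> \<one>\<^bsub>A\<^esub>)) \<in> rmod_hom A M N"
    using c by (intro rmod_homI) (auto simp: rmod_hom_closed[OF f(4)] rmod_hom_add[OF f(4)]
        rmod_hom_ract[OF f(4)] N.ract_closed N.ract_add_left M.ract_closed)
  then show ?thesis using f by (simp add: fpmod_Hom fpmod_simps)
qed

lemma aobjD:
  assumes "is_aobj K A C V"
  shows aobj_obj: "fst V \<in> Obj C"
    and aobj_hom: "a \<in> carrier A \<Longrightarrow> snd V a \<in> Hom C (fst V) (fst V)"
    and aobj_mult: "a \<in> carrier A \<Longrightarrow> b \<in> carrier A \<Longrightarrow> snd V (a \<otimes>\<^bsub>A\<^esub> b) = snd V a \<bullet> snd V b"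
    and aobj_add: "a \<in> carrier A \<Longrightarrow> b \<in> carrier A \<Longrightarrow> snd V (a \<oplus>\<^bsub>A\<^esub> b) = Plus C (snd V a) (snd V b)"
    and aobj_one: "snd V \<one>\<^bsub>A\<^esub> = Ide C (fst V)"
    and aobj_smult: "c \<in> carrier K \<Longrightarrow> a \<in> carrier A \<Longrightarrow> snd V (c \<odot>\<^bsub>A\<^esub> a) = Scal C c (snd V a)"
  using assms by (auto simp: is_aobj_def algebra_hom_def ring_hom_def end_algebra_def hom_space_def)

lemma is_aarr_iff: "is_aarr K A C (V, h, Y) \<longleftrightarrow> is_aobj K A C V \<and> is_aobj K A C Y \<and>
    h \<in> Hom C (fst V) (fst Y) \<and> (\<forall>a \<in> carrier A. h \<bullet> snd V a = snd Y a \<bullet> h)"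
  by (cases V; cases Y) (auto simp: is_aarr_def)

lemma hom_rmod_simps:
  "carrier (hom_rmod C V W) = Hom C (fst V) W"
  "\<zero>\<^bsub>hom_rmod C V W\<^esub> = Null C (fst V) W"
  "f \<oplus>\<^bsub>hom_rmod C V W\<^esub> g = Plus C f g"
  "ract (hom_rmod C V W) f a = f \<bullet> snd V a"
  by (simp_all add: hom_rmod_def split: prod.split)

lemma hom_rmod_right_module:
  assumes V: "is_aobj K A C V" and W: "W \<in> Obj C"
  shows "right_module A (hom_rmod C V W)"
proof -
  have "abelian_group (hom_space C (fst V) W)" using aobj_obj[OF V] W by (rule hom_group)
  then have ab: "abelian_group (hom_rmod C V W)"
    by (rule abelian_group_cong) (simp_all add: hom_rmod_simps hom_space_simps)
  show ?thesis
  proof (intro right_module.intro right_module_axioms.intro ring_A ab; unfold hom_rmod_simps)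
    fix f assume f: "f \<in> Hom C (fst V) W"
    show "f \<bullet> snd V \<one>\<^bsub>A\<^esub> = f" using comp_ide_right[OF f] by (simp add: aobj_one[OF V])
    fix a assume a: "a \<in> carrier A"
    show "f \<bullet> snd V a \<in> Hom C (fst V) W" by (rule comp_in_Hom[OF aobj_hom[OF V a] f])
    show "Plus C f g \<bullet> snd V a = Plus C (f \<bullet> snd V a) (g \<bullet> snd V a)"
      if "g \<in> Hom C (fst V) W" for g
      by (rule comp_plus_left[OF aobj_hom[OF V a] f that])
    fix b assume b: "b \<in> carrier A"
    show "f \<bullet> snd V (a \<oplus>\<^bsub>A\<^esub> b) = Plus C (f \<bullet> snd V a) (f \<bullet> snd V b)"
      using comp_plus_right[OF aobj_hom[OF V a] aobj_hom[OF V b] f] a b by (simp add: aobj_add[OF V])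
    show "f \<bullet> snd V (a \<otimes>\<^bsub>A\<^esub> b) = (f \<bullet> snd V a) \<bullet> snd V b"
      using comp_assoc[OF aobj_hom[OF V b] aobj_hom[OF V a] f] a b by (simp add: aobj_mult[OF V])
  qed
qed

lemma hom_rmod_postcomp:
  assumes V: "is_aobj K A C V" and M: "right_module A M"
    and u: "u \<in> rmod_hom A M (hom_rmod C V P)" and c: "c \<in> Hom C P T"
  shows "(\<lambda>x \<in> carrier M. c \<bullet> u x) \<in> rmod_hom A M (hom_rmod C V T)"
proof -
  interpret M: right_module A M by (rule M)
  have ux: "u x \<in> Hom C (fst V) P" if "x \<in> carrier M" for x
    using rmod_hom_closed[OF u that] by (simp add: hom_rmod_simps)
  show ?thesis
  proof (rule rmod_homI; (simp only: hom_rmod_simps)?)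
    fix x assume x: "x \<in> carrier M"
    show "(\<lambda>x \<in> carrier M. c \<bullet> u x) x \<in> Hom C (fst V) T"
      using x comp_in_Hom[OF ux[OF x] c] by simp
    show "(\<lambda>x \<in> carrier M. c \<bullet> u x) (x \<oplus>\<^bsub>M\<^esub> y) =
        Plus C ((\<lambda>x \<in> carrier M. c \<bullet> u x) x) ((\<lambda>x \<in> carrier M. c \<bullet> u x) y)"
      if "y \<in> carrier M" for y
      using x that comp_plus_right[OF ux[OF x] ux[OF that] c]
      by (simp add: rmod_hom_add[OF u] hom_rmod_simps)
    show "(\<lambda>x \<in> carrier M. c \<bullet> u x) (ract M x a) = (\<lambda>x \<in> carrier M. c \<bullet> u x) x \<bullet> snd V a"
      if "a \<in> carrier A" for a
      using x that comp_assoc[OF aobj_hom[OF V that] ux[OF x] c]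
      by (simp add: rmod_hom_ract[OF u] hom_rmod_simps M.ract_closed)
  qed simp
qed


section \<open>Objects representing A-linear maps into Hom-modules\<close>

text \<open>
  \<open>T\<close> is a tensor product of \<open>M\<close> and \<open>V\<close>, and \<open>u\<close> is the universal map \<open>x \<mapsto> (z \<mapsto> x \<otimes> z)\<close>: composition
  with \<open>u\<close> is the isomorphism of \<open>Hom(T, W)\<close> with \<open>Hom\<^sub>A(M, Hom(V, W))\<close>.
\<close>

definition represents :: "('a, 'o, 'm) aobj \<Rightarrow> ('a, 'u) rmodule \<Rightarrow> 'o \<Rightarrow> ('u \<Rightarrow> 'm) \<Rightarrow> bool" where
  "represents V M T u \<longleftrightarrow> T \<in> Obj C \<and> u \<in> rmod_hom A M (hom_rmod C V T) \<and>
     (\<forall>W \<in> Obj C. \<forall>v \<in> rmod_hom A M (hom_rmod C V W).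
        \<exists>!h. h \<in> Hom C T W \<and> (\<forall>x \<in> carrier M. h \<bullet> u x = v x))"

lemma representsD:
  assumes "represents V M T u"
  shows "T \<in> Obj C" "u \<in> rmod_hom A M (hom_rmod C V T)"
    "x \<in> carrier M \<Longrightarrow> u x \<in> Hom C (fst V) T"
    "W \<in> Obj C \<Longrightarrow> v \<in> rmod_hom A M (hom_rmod C V W) \<Longrightarrow>
      \<exists>!h. h \<in> Hom C T W \<and> (\<forall>x \<in> carrier M. h \<bullet> u x = v x)"
proof -
  show "T \<in> Obj C" and u: "u \<in> rmod_hom A M (hom_rmod C V T)"
    using assms by (auto simp: represents_def)
  show "u x \<in> Hom C (fst V) T" if "x \<in> carrier M"
    using rmod_hom_closed[OF u that] by (simp add: hom_rmod_simps)
  show "W \<in> Obj C \<Longrightarrow> v \<in> rmod_hom A M (hom_rmod C V W) \<Longrightarrow>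
      \<exists>!h. h \<in> Hom C T W \<and> (\<forall>x \<in> carrier M. h \<bullet> u x = v x)"
    using assms unfolding represents_def by blast
qed

lemma represents_eqI:
  assumes r: "represents V M T u" and V: "is_aobj K A C V" and M: "right_module A M"
    and h: "h \<in> Hom C T W" "h' \<in> Hom C T W" and eq: "\<And>x. x \<in> carrier M \<Longrightarrow> h \<bullet> u x = h' \<bullet> u x"
  shows "h = h'"
proof -
  have "W \<in> Obj C" using Hom_Obj[OF h(1)] by blast
  from representsD(4)[OF r this hom_rmod_postcomp[OF V M representsD(2)[OF r] h(2)]]
  show ?thesis by (rule ex1_eq) (simp_all add: h eq)
qed

text \<open>
  Hence a presentation \<open>F \<rightarrow> M\<close> reduces the tensor product with \<open>M\<close> to that with \<open>F\<close>: it is the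
  universal quotient of \<open>F \<otimes> V\<close> which kills \<open>r \<otimes> V\<close> for all \<open>r\<close> in the kernel.
\<close>

lemma represents_quotient:
  assumes V: "is_aobj K A C V" and F: "right_module A F" and M: "right_module A M"
    and p: "p \<in> rmod_hom A F M" "p ` carrier F = carrier M"
    and r: "represents V F P u"
    and c: "c \<in> Hom C P T" "\<And>y. y \<in> ker F M p \<Longrightarrow> c \<bullet> u y = Null C (fst V) T"
    and univ: "\<And>W w. w \<in> Hom C P W \<Longrightarrow> (\<And>y. y \<in> ker F M p \<Longrightarrow> w \<bullet> u y = Null C (fst V) W) \<Longrightarrow>
      \<exists>!h. h \<in> Hom C T W \<and> h \<bullet> c = w"
  shows "\<exists>u'. represents V M T u' \<and> (\<forall>y \<in> carrier F. u' (p y) = c \<bullet> u y)"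
proof -
  interpret F: right_module A F by (rule F)
  note u = representsD(2)[OF r] and ux = representsD(3)[OF r]
  have T: "T \<in> Obj C" using Hom_Obj[OF c(1)] by blast
  obtain u' where u': "u' \<in> rmod_hom A M (hom_rmod C V T)" "\<And>y. y \<in> carrier F \<Longrightarrow> u' (p y) = c \<bullet> u y"
  proof -
    have "(\<lambda>y \<in> carrier F. c \<bullet> u y) y = \<zero>\<^bsub>hom_rmod C V T\<^esub>" if "y \<in> ker F M p" for y
      using c(2)[OF that] that ker_subset[of F M p] by (auto simp: hom_rmod_simps)
    from rmod_factor_through_surj[OF F M hom_rmod_right_module[OF V T] p hom_rmod_postcomp[OF V F u c(1)] this]
    obtain u' where u': "u' \<in> rmod_hom A M (hom_rmod C V T)"
      "\<forall>y \<in> carrier F. u' (p y) = (\<lambda>y \<in> carrier F. c \<bullet> u y) y" by blast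
    show thesis by (rule that[OF u'(1)]) (use u'(2) in simp)
  qed
  have "represents V M T u'"
    unfolding represents_def
  proof (intro conjI ballI T u'(1))
    fix W v assume W: "W \<in> Obj C" and v: "v \<in> rmod_hom A M (hom_rmod C V W)"
    note hW = hom_rmod_right_module[OF V W]
    have vp: "(\<lambda>y \<in> carrier F. v (p y)) \<in> rmod_hom A F (hom_rmod C V W)"
      by (rule rmod_hom_comp[OF F p(1) v])
    obtain w where w: "w \<in> Hom C P W" "\<And>y. y \<in> carrier F \<Longrightarrow> w \<bullet> u y = v (p y)"
    proof -
      obtain w where w: "w \<in> Hom C P W" "\<forall>y \<in> carrier F. w \<bullet> u y = (\<lambda>y \<in> carrier F. v (p y)) y"
        using representsD(4)[OF r W vp] by (elim ex1E) blast
      show thesis by (rule that[OF w(1)]) (use w(2) in simp)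
    qed
    have "w \<bullet> u y = Null C (fst V) W" if "y \<in> ker F M p" for y
      using that w(2)[of y] rmod_hom_zero[OF M hW v] by (simp add: ker_def hom_rmod_simps)
    from univ[OF w(1) this] have ex: "\<exists>!h. h \<in> Hom C T W \<and> h \<bullet> c = w" .
    have eq: "(\<forall>x \<in> carrier M. h \<bullet> u' x = v x) \<longleftrightarrow> h \<bullet> c = w" if h: "h \<in> Hom C T W" for h
    proof -
      have *: "h \<bullet> u' (p y) = (h \<bullet> c) \<bullet> u y" if "y \<in> carrier F" for y
        using u'(2)[OF that] comp_assoc[OF ux[OF that] c(1) h] by simp
      have "(\<forall>x \<in> carrier M. h \<bullet> u' x = v x) \<longleftrightarrow> (\<forall>y \<in> carrier F. h \<bullet> u' (p y) = v (p y))"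
        unfolding p(2)[symmetric] by blast
      also have "\<dots> \<longleftrightarrow> (\<forall>y \<in> carrier F. (h \<bullet> c) \<bullet> u y = w \<bullet> u y)"
        using * w(2) by simp
      also have "\<dots> \<longleftrightarrow> h \<bullet> c = w"
        using represents_eqI[OF r V F comp_in_Hom[OF c(1) h] w(1)] by blast
      finally show ?thesis .
    qed
    show "\<exists>!h. h \<in> Hom C T W \<and> (\<forall>x \<in> carrier M. h \<bullet> u' x = v x)"
      using ex eq by metis
  qed
  then show ?thesis using u'(2) by blast
qed

text \<open>
  An \<open>A\<close>-linear map on \<open>A\<^sup>n\<close> with values in \<open>Hom(V, W)\<close> is a family of \<open>n\<close> arrows from \<open>V\<close> to \<open>W\<close>, so
  the coproduct of \<open>n\<close> copies of \<open>V\<close> represents these maps.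
\<close>

lemma represents_free:
  assumes V: "is_aobj K A C V"
  shows "\<exists>P u. represents V (free_rmod A n) P u"
proof -
  obtain P i where P: "is_copower (fst V) n P i" using copower_exists[OF aobj_obj[OF V]] by blast
  then have PO: "P \<in> Obj C" and i: "\<And>k. k < n \<Longrightarrow> i k \<in> Hom C (fst V) P"
    by (auto simp: is_copower_def)
  note free = free_right_module[OF ring_A, of n]
  have "\<exists>u \<in> rmod_hom A (free_rmod A n) (hom_rmod C V P). \<forall>k < n. u (basis_vec A n k) = i k"
    by (rule free_hom_exists[OF hom_rmod_right_module[OF V PO]]) (simp add: hom_rmod_simps i)
  then obtain u where u: "u \<in> rmod_hom A (free_rmod A n) (hom_rmod C V P)"
    "\<And>k. k < n \<Longrightarrow> u (basis_vec A n k) = i k" by blast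
  have "represents V (free_rmod A n) P u"
    unfolding represents_def
  proof (intro conjI ballI PO u(1))
    fix W v assume W: "W \<in> Obj C" and v: "v \<in> rmod_hom A (free_rmod A n) (hom_rmod C V W)"
    have e: "basis_vec A n k \<in> carrier (free_rmod A n)" for k by (rule basis_vec_in[OF ring_A])
    have "v (basis_vec A n k) \<in> Hom C (fst V) W" for k
      using rmod_hom_closed[OF v e] by (simp add: hom_rmod_simps)
    then have ex: "\<exists>!h. h \<in> Hom C P W \<and> (\<forall>k < n. h \<bullet> i k = v (basis_vec A n k))"
      by (rule copowerD[OF P W])
    have eq: "(\<forall>x \<in> carrier (free_rmod A n). h \<bullet> u x = v x) \<longleftrightarrow> (\<forall>k < n. h \<bullet> i k = v (basis_vec A n k))"
      if h: "h \<in> Hom C P W" for h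
    proof
      assume "\<forall>x \<in> carrier (free_rmod A n). h \<bullet> u x = v x"
      then show "\<forall>k < n. h \<bullet> i k = v (basis_vec A n k)" using e u(2) by metis
    next
      assume a: "\<forall>k < n. h \<bullet> i k = v (basis_vec A n k)"
      have "(\<lambda>x \<in> carrier (free_rmod A n). h \<bullet> u x) = v"
        by (rule free_hom_eqI[OF hom_rmod_right_module[OF V W] hom_rmod_postcomp[OF V free u(1) h] v])
          (simp add: e u(2) a)
      then show "\<forall>x \<in> carrier (free_rmod A n). h \<bullet> u x = v x"
        using fun_cong by fastforce
    qed
    show "\<exists>!h. h \<in> Hom C P W \<and> (\<forall>x \<in> carrier (free_rmod A n). h \<bullet> u x = v x)"
      using ex eq by metis
  qed
  then show ?thesis by blast
qed

text \<open>It is enough to kill \<open>r \<otimes> V\<close> for the finitely many generators \<open>r\<close> of the kernel.\<close>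

lemma represents_exists:
  assumes V: "is_aobj K A C V" and M: "M \<in> Obj (fpmod A)"
  shows "\<exists>T u. represents V M T u"
proof -
  have Mm: "right_module A M" using M by (simp add: fpmod_Obj)
  obtain n \<phi> where \<phi>: "\<phi> \<in> rmod_hom A (free_rmod A n) M" "\<phi> ` carrier (free_rmod A n) = carrier M"
    "fin_generated A ((free_rmod A n)\<lparr>carrier := ker (free_rmod A n) M \<phi>\<rparr>)"
    using M by (auto simp: fin_presented_iff fpmod_Obj)
  let ?F = "free_rmod A n"
  note free = free_right_module[OF ring_A]
  obtain m \<sigma> where \<sigma>: "\<sigma> \<in> rmod_hom A (free_rmod A m) ?F" "\<sigma> ` carrier (free_rmod A m) = ker ?F M \<phi>"
    using \<phi>(3) by (auto simp: fg_iff[OF ker_subset])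
  obtain P u where r: "represents V ?F P u" using represents_free[OF V] by blast
  note u = representsD(2)[OF r]
  let ?g = "\<lambda>k. u (\<sigma> (basis_vec A m k))"
  have e: "basis_vec A m k \<in> carrier (free_rmod A m)" for k by (rule basis_vec_in[OF ring_A])
  have g: "?g k \<in> Hom C (fst V) P" for k
    using representsD(3)[OF r rmod_hom_closed[OF \<sigma>(1) e]] .
  have kill: "(\<forall>k < m. w \<bullet> ?g k = Null C (fst V) W) \<longleftrightarrow>
      (\<forall>y \<in> ker ?F M \<phi>. w \<bullet> u y = Null C (fst V) W)" if w: "w \<in> Hom C P W" for w W
  proof
    assume a: "\<forall>k < m. w \<bullet> ?g k = Null C (fst V) W"
    have W: "W \<in> Obj C" using Hom_Obj[OF w] by blast
    note hW = hom_rmod_right_module[OF V W]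
    have z: "(\<lambda>b \<in> carrier (free_rmod A m). (\<lambda>x \<in> carrier ?F. w \<bullet> u x) (\<sigma> b)) =
        (\<lambda>b \<in> carrier (free_rmod A m). \<zero>\<^bsub>hom_rmod C V W\<^esub>)"
      by (rule free_hom_eqI[OF hW rmod_hom_comp[OF free \<sigma>(1) hom_rmod_postcomp[OF V free u w]]
            rmod_hom_zero_map[OF free hW]]) (simp add: e rmod_hom_closed[OF \<sigma>(1)] a hom_rmod_simps)
    show "\<forall>y \<in> ker ?F M \<phi>. w \<bullet> u y = Null C (fst V) W"
    proof
      fix y assume "y \<in> ker ?F M \<phi>"
      then obtain b where b: "b \<in> carrier (free_rmod A m)" "y = \<sigma> b" using \<sigma>(2) by blast
      then show "w \<bullet> u y = Null C (fst V) W"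
        using restrict_eqD[OF z b(1)] rmod_hom_closed[OF \<sigma>(1) b(1)] by (simp add: hom_rmod_simps)
    qed
  next
    assume "\<forall>y \<in> ker ?F M \<phi>. w \<bullet> u y = Null C (fst V) W"
    then show "\<forall>k < m. w \<bullet> ?g k = Null C (fst V) W" using \<sigma>(2) e by blast
  qed
  obtain T c where c: "c \<in> Hom C P T" "\<forall>k < m. c \<bullet> ?g k = Null C (fst V) T"
    and univ: "\<And>W w. w \<in> Hom C P W \<Longrightarrow> (\<forall>k < m. w \<bullet> ?g k = Null C (fst V) W) \<Longrightarrow>
       (\<exists>!h. h \<in> Hom C T W \<and> h \<bullet> c = w)"
    using joint_cokernel_exists[OF representsD(1)[OF r], of m ?g "fst V", OF g] by blast
  have "\<exists>u'. represents V M T u' \<and> (\<forall>y \<in> carrier ?F. u' (\<phi> y) = c \<bullet> u y)"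
  proof (rule represents_quotient[OF V free Mm \<phi>(1,2) r c(1)])
    show "c \<bullet> u y = Null C (fst V) T" if "y \<in> ker ?F M \<phi>" for y
      using kill[OF c(1)] c(2) that by blast
    show "\<exists>!h. h \<in> Hom C T W \<and> h \<bullet> c = w"
      if "w \<in> Hom C P W" "\<And>y. y \<in> ker ?F M \<phi> \<Longrightarrow> w \<bullet> u y = Null C (fst V) W" for W w
      using univ[OF that(1)] kill[OF that(1)] that(2) by blast
  qed
  then show ?thesis by blast
qed

end

section \<open>Existence of tensor products\<close>

context abelian_category_with_algebra
begin

lemma hom_rmod_precomp:
  assumes h: "is_aarr K A C (V, h, V')" and M: "right_module A M"
    and u: "u \<in> rmod_hom A M (hom_rmod C V' P)"
  shows "(\<lambda>x \<in> carrier M. u x \<bullet> h) \<in> rmod_hom A M (hom_rmod C V P)"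
proof -
  interpret M: right_module A M by (rule M)
  have V: "is_aobj K A C V" "is_aobj K A C V'" "h \<in> Hom C (fst V) (fst V')"
    and equiv: "\<And>a. a \<in> carrier A \<Longrightarrow> h \<bullet> snd V a = snd V' a \<bullet> h"
    using h by (auto simp: is_aarr_iff)
  have ux: "u x \<in> Hom C (fst V') P" if "x \<in> carrier M" for x
    using rmod_hom_closed[OF u that] by (simp add: hom_rmod_simps)
  show ?thesis
  proof (rule rmod_homI; (simp only: hom_rmod_simps)?)
    fix x assume x: "x \<in> carrier M"
    show "(\<lambda>x \<in> carrier M. u x \<bullet> h) x \<in> Hom C (fst V) P"
      using x comp_in_Hom[OF V(3) ux[OF x]] by simp
    show "(\<lambda>x \<in> carrier M. u x \<bullet> h) (x \<oplus>\<^bsub>M\<^esub> y) =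
        Plus C ((\<lambda>x \<in> carrier M. u x \<bullet> h) x) ((\<lambda>x \<in> carrier M. u x \<bullet> h) y)"
      if "y \<in> carrier M" for y
      using x that comp_plus_left[OF V(3) ux[OF x] ux[OF that]]
      by (simp add: rmod_hom_add[OF u] hom_rmod_simps)
    show "(\<lambda>x \<in> carrier M. u x \<bullet> h) (ract M x a) = (\<lambda>x \<in> carrier M. u x \<bullet> h) x \<bullet> snd V a"
      if "a \<in> carrier A" for a
      using x that comp_assoc[OF aobj_hom[OF V(1) that] V(3) ux[OF x]]
        comp_assoc[OF V(3) aobj_hom[OF V(2) that] ux[OF x]] equiv[OF that]
      by (simp add: rmod_hom_ract[OF u] hom_rmod_simps M.ract_closed)
  qed simp
qed

definition tens_pair :: "('a, 'o, 'm) aobj \<Rightarrow> 'a umod \<Rightarrow> 'o \<times> ((nat \<Rightarrow> 'a) set \<Rightarrow> 'm)" where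
  "tens_pair V M = (SOME p. represents V M (fst p) (snd p))"

abbreviation tens_obj :: "('a, 'o, 'm) aobj \<Rightarrow> 'a umod \<Rightarrow> 'o" where
  "tens_obj V M \<equiv> fst (tens_pair V M)"

abbreviation tens_map :: "('a, 'o, 'm) aobj \<Rightarrow> 'a umod \<Rightarrow> (nat \<Rightarrow> 'a) set \<Rightarrow> 'm" where
  "tens_map V M \<equiv> snd (tens_pair V M)"

definition factor :: "('a, 'o, 'm) aobj \<Rightarrow> 'a umod \<Rightarrow> 'o \<Rightarrow> ((nat \<Rightarrow> 'a) set \<Rightarrow> 'm) \<Rightarrow> 'm" where
  "factor V M W v = (THE h. h \<in> Hom C (tens_obj V M) W \<and>
     (\<forall>x \<in> carrier M. h \<bullet> tens_map V M x = v x))"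

definition tens_functor :: "('a, 'o, 'm) aobj \<Rightarrow> ('a umod, 'a uarr, 'o, 'm) func" where
  "tens_functor V = \<lparr>fobj = (\<lambda>M \<in> Obj (fpmod A). tens_obj V M),
     fmap = (\<lambda>f \<in> Arr (fpmod A). case f of (M, f', N) \<Rightarrow>
       factor V M (tens_obj V N) (\<lambda>x \<in> carrier M. tens_map V N (f' x)))\<rparr>"

definition tens_trans :: "('a, 'o, 'm) aobj \<Rightarrow> 'm \<Rightarrow> ('a, 'o, 'm) aobj \<Rightarrow> 'a umod \<Rightarrow> 'm" where
  "tens_trans V h V' = (\<lambda>M \<in> Obj (fpmod A).
     factor V M (tens_obj V' M) (\<lambda>x \<in> carrier M. tens_map V' M x \<bullet> h))"

definition tensor :: "(('a, 'o, 'm) aobj, ('a, 'o, 'm) aarr,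
    ('a umod, 'a uarr, 'o, 'm) func, ('a umod, 'a uarr, 'o, 'm) nattrans) func" where
  "tensor = \<lparr>fobj = (\<lambda>V \<in> Obj (aobj_category K A C). tens_functor V),
     fmap = (\<lambda>q \<in> Arr (aobj_category K A C). case q of (V, h, V') \<Rightarrow>
       (tens_functor V, tens_trans V h V', tens_functor V'))\<rparr>"

lemma tens_represents:
  assumes "is_aobj K A C V" "M \<in> Obj (fpmod A)"
  shows "represents V M (tens_obj V M) (tens_map V M)"
proof -
  have "\<exists>p. represents V M (fst p) (snd p)" using represents_exists[OF assms] by auto
  then show ?thesis unfolding tens_pair_def by (rule someI_ex)
qed

lemma factor:
  assumes V: "is_aobj K A C V" and M: "M \<in> Obj (fpmod A)" and W: "W \<in> Obj C"
    and v: "v \<in> rmod_hom A M (hom_rmod C V W)"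
  shows "factor V M W v \<in> Hom C (tens_obj V M) W"
    and "x \<in> carrier M \<Longrightarrow> factor V M W v \<bullet> tens_map V M x = v x"
proof -
  have "factor V M W v \<in> Hom C (tens_obj V M) W \<and>
     (\<forall>x \<in> carrier M. factor V M W v \<bullet> tens_map V M x = v x)"
    unfolding factor_def by (rule theI'[OF representsD(4)[OF tens_represents[OF V M] W v]])
  then show "factor V M W v \<in> Hom C (tens_obj V M) W"
    "x \<in> carrier M \<Longrightarrow> factor V M W v \<bullet> tens_map V M x = v x" by blast+
qed

lemma tens_eqI:
  assumes V: "is_aobj K A C V" and M: "M \<in> Obj (fpmod A)"
    and "h \<in> Hom C (tens_obj V M) W" "h' \<in> Hom C (tens_obj V M) W"
    "\<And>x. x \<in> carrier M \<Longrightarrow> h \<bullet> tens_map V M x = h' \<bullet> tens_map V M x"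
  shows "h = h'"
  using represents_eqI[OF tens_represents[OF V M] V _ assms(3-5)] M by (simp add: fpmod_Obj)

lemma tens_map_in_Hom:
  assumes "is_aobj K A C V" "M \<in> Obj (fpmod A)" "x \<in> carrier M"
  shows "tens_map V M x \<in> Hom C (fst V) (tens_obj V M)"
  by (rule representsD(3)[OF tens_represents[OF assms(1,2)] assms(3)])

lemma tens_map_add:
  assumes "is_aobj K A C V" "M \<in> Obj (fpmod A)" "x \<in> carrier M" "y \<in> carrier M"
  shows "tens_map V M (x \<oplus>\<^bsub>M\<^esub> y) = Plus C (tens_map V M x) (tens_map V M y)"
  using rmod_hom_add[OF representsD(2)[OF tens_represents[OF assms(1,2)]] assms(3,4)]
  by (simp add: hom_rmod_simps)

lemma tens_map_scal:
  assumes V: "is_aobj K A C V" and M: "M \<in> Obj (fpmod A)" and x: "x \<in> carrier M" and c: "c \<in> carrier K"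
  shows "tens_map V M (ract M x (c \<odot>\<^bsub>A\<^esub> \<one>\<^bsub>A\<^esub>)) = Scal C c (tens_map V M x)"
proof -
  note ux = tens_map_in_Hom[OF V M x]
  have "tens_map V M (ract M x (c \<odot>\<^bsub>A\<^esub> \<one>\<^bsub>A\<^esub>)) = tens_map V M x \<bullet> Scal C c (Ide C (fst V))"
    using rmod_hom_ract[OF representsD(2)[OF tens_represents[OF V M]] x] smult_A_closed[OF c]
    by (simp add: hom_rmod_simps aobj_smult[OF V c] aobj_one[OF V])
  also have "\<dots> = Scal C c (tens_map V M x)"
    using comp_scal_right[OF c ide_in_Hom[OF aobj_obj[OF V]] ux] comp_ide_right[OF ux] by simp
  finally show ?thesis .
qed

lemma tens_functor_map:
  assumes V: "is_aobj K A C V" and f: "(M, f, N) \<in> Arr (fpmod A)"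
  shows "fmap (tens_functor V) (M, f, N) \<in> Hom C (tens_obj V M) (tens_obj V N)"
    and "x \<in> carrier M \<Longrightarrow> fmap (tens_functor V) (M, f, N) \<bullet> tens_map V M x = tens_map V N (f x)"
proof -
  have MN: "M \<in> Obj (fpmod A)" "N \<in> Obj (fpmod A)" "f \<in> rmod_hom A M N" "right_module A M"
    using f by (auto simp: fpmod_Arr fpmod_Obj)
  have "(\<lambda>x \<in> carrier M. tens_map V N (f x)) \<in> rmod_hom A M (hom_rmod C V (tens_obj V N))"
    by (rule rmod_hom_comp[OF MN(4,3) representsD(2)[OF tens_represents[OF V MN(2)]]])
  note fac = factor[OF V MN(1) representsD(1)[OF tens_represents[OF V MN(2)]] this]
  have eq: "fmap (tens_functor V) (M, f, N) = factor V M (tens_obj V N) (\<lambda>x \<in> carrier M. tens_map V N (f x))"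
    using f by (simp add: tens_functor_def)
  show "fmap (tens_functor V) (M, f, N) \<in> Hom C (tens_obj V M) (tens_obj V N)"
    unfolding eq by (rule fac)
  show "fmap (tens_functor V) (M, f, N) \<bullet> tens_map V M x = tens_map V N (f x)" if "x \<in> carrier M"
    using fac(2)[OF that] that unfolding eq by simp
qed

lemma tens_trans:
  assumes h: "is_aarr K A C (V, h, V')" and M: "M \<in> Obj (fpmod A)"
  shows "tens_trans V h V' M \<in> Hom C (tens_obj V M) (tens_obj V' M)"
    and "x \<in> carrier M \<Longrightarrow> tens_trans V h V' M \<bullet> tens_map V M x = tens_map V' M x \<bullet> h"
proof -
  have V: "is_aobj K A C V" "is_aobj K A C V'" using h by (auto simp: is_aarr_iff)
  have Mm: "right_module A M" using M by (simp add: fpmod_Obj)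
  note r = tens_represents[OF V(2) M]
  note fac = factor[OF V(1) M representsD(1)[OF r] hom_rmod_precomp[OF h Mm representsD(2)[OF r]]]
  show "tens_trans V h V' M \<in> Hom C (tens_obj V M) (tens_obj V' M)"
    using fac(1) M by (simp add: tens_trans_def)
  show "tens_trans V h V' M \<bullet> tens_map V M x = tens_map V' M x \<bullet> h" if "x \<in> carrier M"
    using fac(2)[OF that] that M by (simp add: tens_trans_def)
qed

lemma tens_functor_obj: "M \<in> Obj (fpmod A) \<Longrightarrow> fobj (tens_functor V) M = tens_obj V M"
  by (simp add: tens_functor_def)

lemma tens_functor_linear:
  assumes V: "is_aobj K A C V"
  shows "linear_functor K (fpmod A) C (tens_functor V)"
proof (rule linear_functorI)
  let ?F = "tens_functor V"
  note map = tens_functor_map[OF V] and obj = tens_functor_obj and uH = tens_map_in_Hom[OF V]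
  show "fobj ?F \<in> extensional (Obj (fpmod A))" "fmap ?F \<in> extensional (Arr (fpmod A))"
    by (simp_all add: tens_functor_def)
  show "fobj ?F M \<in> Obj C" if "M \<in> Obj (fpmod A)" for M
    using representsD(1)[OF tens_represents[OF V that]] that by (simp add: obj)
  show "fmap ?F f \<in> Hom C (fobj ?F (Dom (fpmod A) f)) (fobj ?F (Cod (fpmod A) f))"
    if f: "f \<in> Arr (fpmod A)" for f
  proof -
    obtain M f' N where "f = (M, f', N)" by (cases f)
    then show ?thesis using map(1)[of M f' N] f by (auto simp: fpmod_simps obj fpmod_Arr)
  qed
  show "fmap ?F (Ide (fpmod A) M) = Ide C (fobj ?F M)" if M: "M \<in> Obj (fpmod A)" for M
  proof -
    have i: "(M, \<lambda>x \<in> carrier M. x, M) \<in> Arr (fpmod A)"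
      using HomD(1)[OF fpmod_ide[OF M]] by (simp add: fpmod_simps)
    have T: "tens_obj V M \<in> Obj C" by (rule representsD(1)[OF tens_represents[OF V M]])
    show ?thesis
      unfolding fpmod_simps obj[OF M]
      by (rule tens_eqI[OF V M map(1)[OF i] ide_in_Hom[OF T]])
        (simp add: map(2)[OF i] comp_ide_left[OF uH[OF M]])
  qed
  show "fmap ?F (g \<cdot>\<^bsub>fpmod A\<^esub> f) = fmap ?F g \<bullet> fmap ?F f"
    if fg: "f \<in> Arr (fpmod A)" "g \<in> Arr (fpmod A)" "Cod (fpmod A) f = Dom (fpmod A) g" for f g
  proof -
    obtain L f' M g' N where e: "f = (L, f', M)" "g = (M, g', N)"
      using fg(3) by (cases f; cases g) (simp add: fpmod_simps)
    have MN: "L \<in> Obj (fpmod A)" "M \<in> Obj (fpmod A)" "f' \<in> rmod_hom A L M"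
      using fg e by (auto simp: fpmod_Arr)
    have gf: "(L, \<lambda>x \<in> carrier L. g' (f' x), N) \<in> Arr (fpmod A)"
      using HomD(1)[OF fpmod_comp[OF arr_in_Hom[OF fg(1)] arr_in_Hom[OF fg(2), folded fg(3)]]]
      by (simp add: e fpmod_simps)
    note f = map[OF fg(1)[unfolded e]] and g = map[OF fg(2)[unfolded e]]
    show ?thesis
      unfolding e fpmod_simps
    proof (rule tens_eqI[OF V MN(1) map(1)[OF gf] comp_in_Hom[OF f(1) g(1)]])
      fix x assume x: "x \<in> carrier L"
      show "fmap ?F (L, \<lambda>x \<in> carrier L. g' (f' x), N) \<bullet> tens_map V L x =
          (fmap ?F (M, g', N) \<bullet> fmap ?F (L, f', M)) \<bullet> tens_map V L x"
        using x by (simp add: map(2)[OF gf] comp_assoc[OF uH[OF MN(1) x] f(1) g(1)] f(2) g(2)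
            rmod_hom_closed[OF MN(3)])
    qed
  qed
  show "fmap ?F (Plus (fpmod A) f g) = Plus C (fmap ?F f) (fmap ?F g)"
    if fg: "f \<in> Arr (fpmod A)" "g \<in> Arr (fpmod A)" "Dom (fpmod A) f = Dom (fpmod A) g"
      "Cod (fpmod A) f = Cod (fpmod A) g" for f g
  proof -
    obtain M f' N g' where e: "f = (M, f', N)" "g = (M, g', N)"
      using fg(3,4) by (cases f; cases g) (simp add: fpmod_simps)
    have MN: "M \<in> Obj (fpmod A)" "N \<in> Obj (fpmod A)" "f' \<in> rmod_hom A M N" "g' \<in> rmod_hom A M N"
      using fg e by (auto simp: fpmod_Arr)
    have p: "(M, \<lambda>x \<in> carrier M. f' x \<oplus>\<^bsub>N\<^esub> g' x, N) \<in> Arr (fpmod A)"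
      using HomD(1)[OF fpmod_plus[of f M N g]] fg(1,2) by (simp add: e fpmod_simps fpmod_Hom fpmod_Arr)
    note f = map[OF fg(1)[unfolded e]] and g = map[OF fg(2)[unfolded e]]
    show ?thesis
      unfolding e fpmod_simps
    proof (rule tens_eqI[OF V MN(1) map(1)[OF p] plus_in_Hom[OF f(1) g(1)]])
      fix x assume x: "x \<in> carrier M"
      show "fmap ?F (M, \<lambda>x \<in> carrier M. f' x \<oplus>\<^bsub>N\<^esub> g' x, N) \<bullet> tens_map V M x =
          Plus C (fmap ?F (M, f', N)) (fmap ?F (M, g', N)) \<bullet> tens_map V M x"
        using x by (simp add: map(2)[OF p] comp_plus_left[OF uH[OF MN(1) x] f(1) g(1)] f(2) g(2)
            tens_map_add[OF V MN(2)] rmod_hom_closed[OF MN(3)] rmod_hom_closed[OF MN(4)])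
    qed
  qed
  show "fmap ?F (Scal (fpmod A) c f) = Scal C c (fmap ?F f)"
    if c: "c \<in> carrier K" and f: "f \<in> Arr (fpmod A)" for c f
  proof -
    obtain M f' N where e: "f = (M, f', N)" by (cases f)
    have MN: "M \<in> Obj (fpmod A)" "N \<in> Obj (fpmod A)" "f' \<in> rmod_hom A M N"
      using f e by (auto simp: fpmod_Arr)
    have p: "(M, \<lambda>x \<in> carrier M. ract N (f' x) (c \<odot>\<^bsub>A\<^esub> \<one>\<^bsub>A\<^esub>), N) \<in> Arr (fpmod A)"
      using HomD(1)[OF fpmod_scal[OF arr_in_Hom[OF f] c]] by (simp add: e fpmod_simps)
    note f = map[OF f[unfolded e]]
    show ?thesis
      unfolding e fpmod_simps
    proof (rule tens_eqI[OF V MN(1) map(1)[OF p] scal_in_Hom[OF f(1) c]])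
      fix x assume x: "x \<in> carrier M"
      show "fmap ?F (M, \<lambda>x \<in> carrier M. ract N (f' x) (c \<odot>\<^bsub>A\<^esub> \<one>\<^bsub>A\<^esub>), N) \<bullet> tens_map V M x =
          Scal C c (fmap ?F (M, f', N)) \<bullet> tens_map V M x"
        using x by (simp add: map(2)[OF p] comp_scal_left[OF c uH[OF MN(1) x] f(1)] f(2)
            tens_map_scal[OF V MN(2) _ c] rmod_hom_closed[OF MN(3)])
    qed
  qed
qed

lemma aarr_ide: "is_aobj K A C V \<Longrightarrow> is_aarr K A C (V, Ide C (fst V), V)"
  using comp_ide_left[OF aobj_hom[of V]] comp_ide_right[OF aobj_hom[of V]]
  by (simp add: is_aarr_iff ide_in_Hom aobj_obj)

lemma aarr_comp:
  assumes "is_aarr K A C (U, h, V)" "is_aarr K A C (V, g, W)"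
  shows "is_aarr K A C (U, g \<bullet> h, W)"
proof -
  have h: "is_aobj K A C U" "h \<in> Hom C (fst U) (fst V)"
    "\<And>a. a \<in> carrier A \<Longrightarrow> h \<bullet> snd U a = snd V a \<bullet> h"
    and g: "is_aobj K A C V" "is_aobj K A C W" "g \<in> Hom C (fst V) (fst W)"
    "\<And>a. a \<in> carrier A \<Longrightarrow> g \<bullet> snd V a = snd W a \<bullet> g"
    using assms by (auto simp: is_aarr_iff)
  have "(g \<bullet> h) \<bullet> snd U a = snd W a \<bullet> (g \<bullet> h)" if a: "a \<in> carrier A" for a
    using comp_assoc[OF aobj_hom[OF h(1) a] h(2) g(3)] comp_assoc[OF h(2) aobj_hom[OF g(1) a] g(3)]
      comp_assoc[OF h(2) g(3) aobj_hom[OF g(2) a]] h(3)[OF a] g(4)[OF a] by simp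
  then show ?thesis using h g comp_in_Hom[OF h(2) g(3)] by (simp add: is_aarr_iff)
qed

lemma aarr_plus:
  assumes "is_aarr K A C (V, h, W)" "is_aarr K A C (V, g, W)"
  shows "is_aarr K A C (V, Plus C h g, W)"
proof -
  have h: "is_aobj K A C V" "is_aobj K A C W" "h \<in> Hom C (fst V) (fst W)" "g \<in> Hom C (fst V) (fst W)"
    "\<And>a. a \<in> carrier A \<Longrightarrow> h \<bullet> snd V a = snd W a \<bullet> h"
    "\<And>a. a \<in> carrier A \<Longrightarrow> g \<bullet> snd V a = snd W a \<bullet> g"
    using assms by (auto simp: is_aarr_iff)
  have "Plus C h g \<bullet> snd V a = snd W a \<bullet> Plus C h g" if a: "a \<in> carrier A" for a
    using comp_plus_left[OF aobj_hom[OF h(1) a] h(3,4)] comp_plus_right[OF h(3,4) aobj_hom[OF h(2) a]]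
      h(5,6)[OF a] by simp
  then show ?thesis using h plus_in_Hom[OF h(3,4)] by (simp add: is_aarr_iff)
qed

lemma aarr_scal:
  assumes "is_aarr K A C (V, h, W)" "c \<in> carrier K"
  shows "is_aarr K A C (V, Scal C c h, W)"
proof -
  have h: "is_aobj K A C V" "is_aobj K A C W" "h \<in> Hom C (fst V) (fst W)"
    "\<And>a. a \<in> carrier A \<Longrightarrow> h \<bullet> snd V a = snd W a \<bullet> h"
    using assms by (auto simp: is_aarr_iff)
  have "Scal C c h \<bullet> snd V a = snd W a \<bullet> Scal C c h" if a: "a \<in> carrier A" for a
    using comp_scal_left[OF assms(2) aobj_hom[OF h(1) a] h(3)]
      comp_scal_right[OF assms(2) h(3) aobj_hom[OF h(2) a]] h(4)[OF a] by simp
  then show ?thesis using h scal_in_Hom[OF h(3) assms(2)] by (simp add: is_aarr_iff)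
qed

lemma tens_trans_nat:
  assumes h: "is_aarr K A C (V, h, W)"
  shows "nat_trans (fpmod A) C (tens_functor V) (tens_functor W) (tens_trans V h W)"
  unfolding nat_trans_def
proof (intro conjI ballI)
  have V: "is_aobj K A C V" "is_aobj K A C W" "h \<in> Hom C (fst V) (fst W)"
    using h by (auto simp: is_aarr_iff)
  show "tens_trans V h W \<in> extensional (Obj (fpmod A))" by (simp add: tens_trans_def)
  show "tens_trans V h W M \<in> Hom C (fobj (tens_functor V) M) (fobj (tens_functor W) M)"
    if "M \<in> Obj (fpmod A)" for M
    using tens_trans(1)[OF h that] by (simp add: tens_functor_obj that)
  fix f assume f: "f \<in> Arr (fpmod A)"
  obtain M f' N where e: "f = (M, f', N)" by (cases f)
  then have MN: "M \<in> Obj (fpmod A)" "N \<in> Obj (fpmod A)" "f' \<in> rmod_hom A M N"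
    using f by (auto simp: fpmod_Arr)
  note fV = tens_functor_map[OF V(1) f[unfolded e]] and fW = tens_functor_map[OF V(2) f[unfolded e]]
  note tM = tens_trans[OF h MN(1)] and tN = tens_trans[OF h MN(2)]
  show "tens_trans V h W (Cod (fpmod A) f) \<bullet> fmap (tens_functor V) f =
      fmap (tens_functor W) f \<bullet> tens_trans V h W (Dom (fpmod A) f)"
    unfolding e fpmod_simps
  proof (rule tens_eqI[OF V(1) MN(1) comp_in_Hom[OF fV(1) tN(1)] comp_in_Hom[OF tM(1) fW(1)]])
    fix x assume x: "x \<in> carrier M"
    note fx = rmod_hom_closed[OF MN(3) x]
    have "(tens_trans V h W N \<bullet> fmap (tens_functor V) (M, f', N)) \<bullet> tens_map V M x =
        tens_map W N (f' x) \<bullet> h"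
      using comp_assoc[OF tens_map_in_Hom[OF V(1) MN(1) x] fV(1) tN(1)] fV(2)[OF x] tN(2)[OF fx] by simp
    also have "\<dots> = (fmap (tens_functor W) (M, f', N) \<bullet> tens_trans V h W M) \<bullet> tens_map V M x"
      using comp_assoc[OF tens_map_in_Hom[OF V(1) MN(1) x] tM(1) fW(1)] tM(2)[OF x]
        comp_assoc[OF V(3) tens_map_in_Hom[OF V(2) MN(1) x] fW(1)] fW(2)[OF x] by simp
    finally show "(tens_trans V h W N \<bullet> fmap (tens_functor V) (M, f', N)) \<bullet> tens_map V M x =
        (fmap (tens_functor W) (M, f', N) \<bullet> tens_trans V h W M) \<bullet> tens_map V M x" .
  qed
qed

text \<open>
  Arrows out of \<open>M \<otimes> V\<close> are determined by their composites with the universal map, so functoriality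
  in \<open>V\<close> reduces to identities between arrows out of \<open>V\<close>.
\<close>

lemma tens_trans_eqI:
  assumes h: "is_aarr K A C (V, h, W)" and \<eta>: "\<eta> \<in> extensional (Obj (fpmod A))"
    and "\<And>M. M \<in> Obj (fpmod A) \<Longrightarrow> \<eta> M \<in> Hom C (tens_obj V M) (tens_obj W M)"
    and "\<And>M x. M \<in> Obj (fpmod A) \<Longrightarrow> x \<in> carrier M \<Longrightarrow>
      \<eta> M \<bullet> tens_map V M x = tens_map W M x \<bullet> h"
  shows "tens_trans V h W = \<eta>"
proof (rule extensionalityI[OF _ \<eta>])
  show "tens_trans V h W \<in> extensional (Obj (fpmod A))" by (simp add: tens_trans_def)
  have V: "is_aobj K A C V" using h by (auto simp: is_aarr_iff)
  fix M assume M: "M \<in> Obj (fpmod A)"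
  show "tens_trans V h W M = \<eta> M"
    by (rule tens_eqI[OF V M tens_trans(1)[OF h M] assms(3)[OF M]]) (simp add: tens_trans(2)[OF h M] assms(4)[OF M])
qed

lemma tensor_map: "is_aarr K A C (V, h, W) \<Longrightarrow>
    fmap tensor (V, h, W) = (tens_functor V, tens_trans V h W, tens_functor W)"
  by (simp add: tensor_def aobj_category_simps)

lemma tensor_obj: "is_aobj K A C V \<Longrightarrow> fobj tensor V = tens_functor V"
  by (simp add: tensor_def aobj_category_simps)

lemma tensor_linear: "linear_functor K (aobj_category K A C) (functor_category K (fpmod A) C) tensor"
proof (rule linear_functorI)
  let ?Z = "aobj_category K A C" and ?F = "functor_category K (fpmod A) C"
  show "fobj tensor \<in> extensional (Obj ?Z)" "fmap tensor \<in> extensional (Arr ?Z)"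
    by (simp_all add: tensor_def)
  show "fobj tensor V \<in> Obj ?F" if "V \<in> Obj ?Z" for V
    using that tens_functor_linear by (simp add: aobj_category_simps tensor_obj functor_category_simps)
  show "fmap tensor q \<in> Hom ?F (fobj tensor (Dom ?Z q)) (fobj tensor (Cod ?Z q))" if q: "q \<in> Arr ?Z" for q
  proof -
    obtain V h W where e: "q = (V, h, W)" by (cases q)
    then have h: "is_aarr K A C (V, h, W)" using q by (simp add: aobj_category_simps)
    then have V: "is_aobj K A C V" "is_aobj K A C W" by (auto simp: is_aarr_iff)
    show ?thesis
      unfolding e aobj_category_simps
      using h V tens_trans_nat[OF h] tens_functor_linear
      by (simp add: tensor_map tensor_obj Hom_def functor_category_simps)
  qed
  show "fmap tensor (Ide ?Z V) = Ide ?F (fobj tensor V)" if "V \<in> Obj ?Z" for V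
  proof -
    have V: "is_aobj K A C V" using that by (simp add: aobj_category_simps)
    have "tens_trans V (Ide C (fst V)) V = (\<lambda>M \<in> Obj (fpmod A). Ide C (fobj (tens_functor V) M))"
    proof (rule tens_trans_eqI[OF aarr_ide[OF V]])
      fix M assume M: "M \<in> Obj (fpmod A)"
      show "(\<lambda>M \<in> Obj (fpmod A). Ide C (fobj (tens_functor V) M)) M \<in> Hom C (tens_obj V M) (tens_obj V M)"
        using M representsD(1)[OF tens_represents[OF V M]] by (simp add: tens_functor_obj ide_in_Hom)
      fix x assume x: "x \<in> carrier M"
      note ux = tens_map_in_Hom[OF V M x]
      show "(\<lambda>M \<in> Obj (fpmod A). Ide C (fobj (tens_functor V) M)) M \<bullet> tens_map V M x =
          tens_map V M x \<bullet> Ide C (fst V)"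
        using M by (simp add: tens_functor_obj comp_ide_left[OF ux] comp_ide_right[OF ux])
    qed simp
    then show ?thesis
      by (simp add: aobj_category_simps tensor_map[OF aarr_ide[OF V]] tensor_obj[OF V] functor_category_simps)
  qed
  show "fmap tensor (r \<cdot>\<^bsub>?Z\<^esub> q) = fmap tensor r \<cdot>\<^bsub>?F\<^esub> fmap tensor q"
    if q: "q \<in> Arr ?Z" "r \<in> Arr ?Z" "Cod ?Z q = Dom ?Z r" for q r
  proof -
    obtain U h V g W where e: "q = (U, h, V)" "r = (V, g, W)"
      using q(3) by (cases q; cases r) (simp add: aobj_category_simps)
    have h: "is_aarr K A C (U, h, V)" and g: "is_aarr K A C (V, g, W)"
      using q by (simp_all add: e aobj_category_simps)
    have V: "is_aobj K A C U" "is_aobj K A C V" "is_aobj K A C W" "h \<in> Hom C (fst U) (fst V)"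
      "g \<in> Hom C (fst V) (fst W)"
      using h g by (auto simp: is_aarr_iff)
    have "tens_trans U (g \<bullet> h) W = (\<lambda>M \<in> Obj (fpmod A). tens_trans V g W M \<bullet> tens_trans U h V M)"
    proof (rule tens_trans_eqI[OF aarr_comp[OF h g]])
      fix M assume M: "M \<in> Obj (fpmod A)"
      note th = tens_trans[OF h M] and tg = tens_trans[OF g M]
      show "(\<lambda>M \<in> Obj (fpmod A). tens_trans V g W M \<bullet> tens_trans U h V M) M \<in>
          Hom C (tens_obj U M) (tens_obj W M)"
        using M comp_in_Hom[OF th(1) tg(1)] by simp
      fix x assume x: "x \<in> carrier M"
      show "(\<lambda>M \<in> Obj (fpmod A). tens_trans V g W M \<bullet> tens_trans U h V M) M \<bullet> tens_map U M x =
          tens_map W M x \<bullet> (g \<bullet> h)"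
        using M comp_assoc[OF tens_map_in_Hom[OF V(1) M x] th(1) tg(1)] th(2)[OF x] tg(2)[OF x]
          comp_assoc[OF V(4) tens_map_in_Hom[OF V(2) M x] tg(1)]
          comp_assoc[OF V(4,5) tens_map_in_Hom[OF V(3) M x]] by simp
    qed simp
    then show ?thesis
      by (simp add: e aobj_category_simps tensor_map[OF aarr_comp[OF h g]] tensor_map[OF h]
          tensor_map[OF g] functor_category_simps)
  qed
  show "fmap tensor (Plus ?Z q r) = Plus ?F (fmap tensor q) (fmap tensor r)"
    if q: "q \<in> Arr ?Z" "r \<in> Arr ?Z" "Dom ?Z q = Dom ?Z r" "Cod ?Z q = Cod ?Z r" for q r
  proof -
    obtain V h W g where e: "q = (V, h, W)" "r = (V, g, W)"
      using q(3,4) by (cases q; cases r) (simp add: aobj_category_simps)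
    have h: "is_aarr K A C (V, h, W)" and g: "is_aarr K A C (V, g, W)"
      using q by (simp_all add: e aobj_category_simps)
    have V: "is_aobj K A C V" "is_aobj K A C W" "h \<in> Hom C (fst V) (fst W)" "g \<in> Hom C (fst V) (fst W)"
      using h g by (auto simp: is_aarr_iff)
    have "tens_trans V (Plus C h g) W = (\<lambda>M \<in> Obj (fpmod A). Plus C (tens_trans V h W M) (tens_trans V g W M))"
    proof (rule tens_trans_eqI[OF aarr_plus[OF h g]])
      fix M assume M: "M \<in> Obj (fpmod A)"
      note th = tens_trans[OF h M] and tg = tens_trans[OF g M]
      show "(\<lambda>M \<in> Obj (fpmod A). Plus C (tens_trans V h W M) (tens_trans V g W M)) M \<in>
          Hom C (tens_obj V M) (tens_obj W M)"
        using M plus_in_Hom[OF th(1) tg(1)] by simp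
      fix x assume x: "x \<in> carrier M"
      show "(\<lambda>M \<in> Obj (fpmod A). Plus C (tens_trans V h W M) (tens_trans V g W M)) M \<bullet> tens_map V M x =
          tens_map W M x \<bullet> Plus C h g"
        using M comp_plus_left[OF tens_map_in_Hom[OF V(1) M x] th(1) tg(1)] th(2)[OF x] tg(2)[OF x]
          comp_plus_right[OF V(3,4) tens_map_in_Hom[OF V(2) M x]] by simp
    qed simp
    then show ?thesis
      by (simp add: e aobj_category_simps tensor_map[OF aarr_plus[OF h g]] tensor_map[OF h]
          tensor_map[OF g] functor_category_simps)
  qed
  show "fmap tensor (Scal ?Z c q) = Scal ?F c (fmap tensor q)" if c: "c \<in> carrier K" and q: "q \<in> Arr ?Z" for c q
  proof -
    obtain V h W where e: "q = (V, h, W)" by (cases q)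
    then have h: "is_aarr K A C (V, h, W)" using q by (simp add: aobj_category_simps)
    then have V: "is_aobj K A C V" "is_aobj K A C W" "h \<in> Hom C (fst V) (fst W)" by (auto simp: is_aarr_iff)
    have "tens_trans V (Scal C c h) W = (\<lambda>M \<in> Obj (fpmod A). Scal C c (tens_trans V h W M))"
    proof (rule tens_trans_eqI[OF aarr_scal[OF h c]])
      fix M assume M: "M \<in> Obj (fpmod A)"
      note th = tens_trans[OF h M]
      show "(\<lambda>M \<in> Obj (fpmod A). Scal C c (tens_trans V h W M)) M \<in> Hom C (tens_obj V M) (tens_obj W M)"
        using M scal_in_Hom[OF th(1) c] by simp
      fix x assume x: "x \<in> carrier M"
      show "(\<lambda>M \<in> Obj (fpmod A). Scal C c (tens_trans V h W M)) M \<bullet> tens_map V M x =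
          tens_map W M x \<bullet> Scal C c h"
        using M comp_scal_left[OF c tens_map_in_Hom[OF V(1) M x] th(1)] th(2)[OF x]
          comp_scal_right[OF c V(3) tens_map_in_Hom[OF V(2) M x]] by simp
    qed simp
    then show ?thesis
      by (simp add: e aobj_category_simps tensor_map[OF aarr_scal[OF h c]] tensor_map[OF h]
          functor_category_simps)
  qed
qed

definition tens_adj :: "('a, 'o, 'm) aobj \<Rightarrow> 'a umod \<Rightarrow> 'o \<Rightarrow> 'm \<Rightarrow> (nat \<Rightarrow> 'a) set \<Rightarrow> 'm" where
  "tens_adj V M W f = (\<lambda>x \<in> carrier M. f \<bullet> tens_map V M x)"

lemma tens_adj_bij:
  assumes V: "is_aobj K A C V" and M: "M \<in> Obj (fpmod A)" and W: "W \<in> Obj C"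
  shows "bij_betw (tens_adj V M W) (Hom C (tens_obj V M) W) (rmod_hom A M (hom_rmod C V W))"
proof -
  have Mm: "right_module A M" using M by (simp add: fpmod_Obj)
  note r = tens_represents[OF V M]
  show ?thesis
  proof (intro bij_betwI' iffI)
    fix f g assume f: "f \<in> Hom C (tens_obj V M) W" and g: "g \<in> Hom C (tens_obj V M) W"
    assume eq: "tens_adj V M W f = tens_adj V M W g"
    show "f = g"
      by (rule tens_eqI[OF V M f g]) (rule restrict_eqD[OF eq[unfolded tens_adj_def]])
  next
    fix f assume f: "f \<in> Hom C (tens_obj V M) W"
    show "tens_adj V M W f \<in> rmod_hom A M (hom_rmod C V W)"
      unfolding tens_adj_def by (rule hom_rmod_postcomp[OF V Mm representsD(2)[OF r] f])
  next
    fix v assume v: "v \<in> rmod_hom A M (hom_rmod C V W)"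
    note fac = factor[OF V M W v]
    have "v = tens_adj V M W (factor V M W v)"
      using rmod_hom_extensional[OF v] fac(2)
      by (intro extensionalityI[of v "carrier M"]) (simp_all add: tens_adj_def)
    then show "\<exists>f \<in> Hom C (tens_obj V M) W. v = tens_adj V M W f" using fac(1) by blast
  qed simp
qed

lemma tensor_is_tensor: "is_tensor K A C tensor tens_adj"
  unfolding is_tensor_def
proof (intro conjI ballI tensor_linear)
  let ?Z = "aobj_category K A C"
  fix V M W assume "V \<in> Obj ?Z" and M: "M \<in> Obj (fpmod A)" and W: "W \<in> Obj C"
  then have V: "is_aobj K A C V" by (simp add: aobj_category_simps)
  have T: "fobj (fobj tensor V) M = tens_obj V M" by (simp add: tensor_obj[OF V] tens_functor_obj[OF M])
  note uH = tens_map_in_Hom[OF V M]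
  show "bij_betw (tens_adj V M W) (Hom C (fobj (fobj tensor V) M) W) (rmod_hom A M (hom_rmod C V W))"
    unfolding T by (rule tens_adj_bij[OF V M W])
  fix f x assume f: "f \<in> Hom C (fobj (fobj tensor V) M) W" and x: "x \<in> carrier M"
  show "tens_adj V M W (Plus C f g) x = Plus C (tens_adj V M W f x) (tens_adj V M W g x)"
    if "g \<in> Hom C (fobj (fobj tensor V) M) W" for g
    using comp_plus_left[OF uH[OF x], of f W g] f that x by (simp add: T tens_adj_def)
  show "tens_adj V M W (Scal C c f) x = Scal C c (tens_adj V M W f x)" if "c \<in> carrier K" for c
    using comp_scal_left[OF that uH[OF x], of f W] f x by (simp add: T tens_adj_def)
next
  let ?Z = "aobj_category K A C"
  fix V M w g x assume "V \<in> Obj ?Z" and M: "M \<in> Obj (fpmod A)" and w: "w \<in> Arr C"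
    and g: "g \<in> Hom C (fobj (fobj tensor V) M) (Dom C w)" and x: "x \<in> carrier M"
  then have V: "is_aobj K A C V" by (simp add: aobj_category_simps)
  have T: "fobj (fobj tensor V) M = tens_obj V M" by (simp add: tensor_obj[OF V] tens_functor_obj[OF M])
  show "tens_adj V M (Cod C w) (w \<bullet> g) x = w \<bullet> tens_adj V M (Dom C w) g x"
    using comp_assoc[OF tens_map_in_Hom[OF V M x] g[unfolded T] arr_in_Hom[OF w]] x by (simp add: tens_adj_def)
next
  let ?Z = "aobj_category K A C"
  fix V f assume "V \<in> Obj ?Z" and f: "f \<in> Arr (fpmod A)"
  then have V: "is_aobj K A C V" by (simp add: aobj_category_simps)
  obtain M f' N where e: "f = (M, f', N)" by (cases f)
  then have MN: "M \<in> Obj (fpmod A)" "N \<in> Obj (fpmod A)" "f' \<in> rmod_hom A M N"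
    using f by (auto simp: fpmod_Arr)
  note map = tens_functor_map[OF V f[unfolded e]]
  have "tens_adj V M W (g \<bullet> fmap (fobj tensor V) (M, f', N)) x = tens_adj V N W g (f' x)"
    if g: "g \<in> Hom C (fobj (fobj tensor V) N) W" and x: "x \<in> carrier M" for W g x
    using comp_assoc[OF tens_map_in_Hom[OF V MN(1) x] map(1), of g W] g x rmod_hom_closed[OF MN(3) x] map(2)[OF x]
    by (simp add: tens_adj_def tensor_obj[OF V] tens_functor_obj[OF MN(2)])
  then show "case f of (M, f, N) \<Rightarrow> \<forall>W \<in> Obj C. \<forall>g \<in> Hom C (fobj (fobj tensor V) N) W. \<forall>x \<in> carrier M.
      tens_adj V M W (g \<bullet> fmap (fobj tensor V) (M, f, N)) x = tens_adj V N W g (f x)"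
    by (simp add: e)
next
  fix q assume q: "q \<in> Arr (aobj_category K A C)"
  obtain V h W where e: "q = (V, h, W)" by (cases q)
  then have h: "is_aarr K A C (V, h, W)" using q by (simp add: aobj_category_simps)
  then have V: "is_aobj K A C V" "is_aobj K A C W" "h \<in> Hom C (fst V) (fst W)" by (auto simp: is_aarr_iff)
  have "tens_adj V M T (g \<bullet> tens_trans V h W M) x = tens_adj W M T g x \<bullet> h"
    if M: "M \<in> Obj (fpmod A)" and g: "g \<in> Hom C (fobj (fobj tensor W) M) T" and x: "x \<in> carrier M" for M T g x
  proof -
    have g': "g \<in> Hom C (tens_obj W M) T" using g by (simp add: tensor_obj[OF V(2)] tens_functor_obj[OF M])
    note t = tens_trans[OF h M]
    show ?thesis
      using comp_assoc[OF tens_map_in_Hom[OF V(1) M x] t(1) g'] t(2)[OF x] x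
        comp_assoc[OF V(3) tens_map_in_Hom[OF V(2) M x] g'] by (simp add: tens_adj_def)
  qed
  then show "case q of (V, h, W) \<Rightarrow> \<forall>M \<in> Obj (fpmod A). \<forall>T \<in> Obj C.
      \<forall>g \<in> Hom C (fobj (fobj tensor W) M) T. \<forall>x \<in> carrier M.
        tens_adj V M T (g \<bullet> (case fmap tensor (V, h, W) of (_, \<tau>, _) \<Rightarrow> \<tau> M)) x =
          tens_adj W M T g x \<bullet> h"
    by (simp add: e tensor_map[OF h])
qed

end

section \<open>Full subcategories\<close>

text \<open>
  The typing rules of a linear category. A functor restricted to a full subcategory is \<open>undefined\<close>
  elsewhere, so it preserves composites, sums and multiples only if these stay in the subcategory.
\<close>

definition arrows_closed :: "'k ring \<Rightarrow> ('k, 'o, 'm) lincat \<Rightarrow> bool" where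
  "arrows_closed K C \<longleftrightarrow> (\<forall>f \<in> Arr C. Dom C f \<in> Obj C \<and> Cod C f \<in> Obj C) \<and>
     (\<forall>U \<in> Obj C. Ide C U \<in> Hom C U U) \<and>
     (\<forall>U Y Z. \<forall>f \<in> Hom C U Y. \<forall>g \<in> Hom C Y Z. g \<cdot>\<^bsub>C\<^esub> f \<in> Hom C U Z) \<and>
     (\<forall>U Y. \<forall>f \<in> Hom C U Y. \<forall>g \<in> Hom C U Y. Plus C f g \<in> Hom C U Y) \<and>
     (\<forall>U Y. \<forall>f \<in> Hom C U Y. \<forall>c \<in> carrier K. Scal C c f \<in> Hom C U Y)"

lemma full_subcat_simps:
  fixes C :: "('k, 'o, 'm) lincat"
  shows
  "Obj (full_subcat C P) = {U \<in> Obj C. P U}"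
  "Arr (full_subcat C P) = {f \<in> Arr C. P (Dom C f) \<and> P (Cod C f)}"
  "Dom (full_subcat C P) = Dom C" "Cod (full_subcat C P) = Cod C" "Ide (full_subcat C P) = Ide C"
  "g \<cdot>\<^bsub>full_subcat C P\<^esub> f = g \<cdot>\<^bsub>C\<^esub> f" "Plus (full_subcat C P) = Plus C" "Scal (full_subcat C P) = Scal C"
  by (simp_all add: full_subcat_def)

lemma full_subcat_Hom:
  fixes C :: "('k, 'o, 'm) lincat"
  shows "f \<in> Hom (full_subcat C P) U Y \<longleftrightarrow> f \<in> Hom C U Y \<and> P U \<and> P Y"
  by (auto simp: Hom_def full_subcat_simps)

lemma arrows_closed_full_subcat:
  fixes C :: "('k, 'o, 'm) lincat"
  assumes "arrows_closed K C"
  shows "arrows_closed K (full_subcat C P)"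
proof -
  have "g \<cdot>\<^bsub>C\<^esub> f \<in> Hom C U Z" if "f \<in> Hom C U Y" "g \<in> Hom C Y Z" for f g U Y Z
    using assms that unfolding arrows_closed_def by blast
  then show ?thesis
    using assms unfolding arrows_closed_def
    by (intro conjI ballI allI) (auto simp: full_subcat_Hom full_subcat_simps)
qed

lemma linear_functor_into_full_subcat:
  fixes C :: "('k, 'o, 'm) lincat" and D :: "('k, 'p, 'n) lincat"
  assumes F: "linear_functor K C D F" and C: "arrows_closed K C"
    and Q: "\<And>U. U \<in> Obj C \<Longrightarrow> Q (fobj F U)"
  shows "linear_functor K C (full_subcat D Q) F"
proof (rule linear_functorI)
  note F' = linear_functorD[OF F]
  show "fobj F \<in> extensional (Obj C)" "fmap F \<in> extensional (Arr C)" by (fact F'(1,2))+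
  show "fobj F U \<in> Obj (full_subcat D Q)" if "U \<in> Obj C" for U
    using F'(3)[OF that] Q[OF that] by (simp add: full_subcat_simps)
  show "fmap F f \<in> Hom (full_subcat D Q) (fobj F (Dom C f)) (fobj F (Cod C f))" if "f \<in> Arr C" for f
    using F'(4)[OF arr_in_Hom[OF that]] Q C that by (simp add: full_subcat_Hom arrows_closed_def)
  show "fmap F (Ide C U) = Ide (full_subcat D Q) (fobj F U)" if "U \<in> Obj C" for U
    using F'(5)[OF that] by (simp add: full_subcat_simps)
  show "fmap F (g \<cdot>\<^bsub>C\<^esub> f) = fmap F g \<cdot>\<^bsub>full_subcat D Q\<^esub> fmap F f"
    if "f \<in> Arr C" "g \<in> Arr C" "Cod C f = Dom C g" for f g
    using F'(6)[OF arr_in_Hom[OF that(1)] arr_in_Hom[OF that(2), folded that(3)]] by (simp add: full_subcat_simps)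
  show "fmap F (Plus C f g) = Plus (full_subcat D Q) (fmap F f) (fmap F g)"
    if "f \<in> Arr C" "g \<in> Arr C" "Dom C f = Dom C g" "Cod C f = Cod C g" for f g
    using F'(7)[OF arr_in_Hom[OF that(1)] arr_in_Hom[OF that(2), folded that(3,4)]] by (simp add: full_subcat_simps)
  show "fmap F (Scal C c f) = Scal (full_subcat D Q) c (fmap F f)"
    if "c \<in> carrier K" "f \<in> Arr C" for c f
    using F'(8)[OF that(1) arr_in_Hom[OF that(2)]] by (simp add: full_subcat_simps)
qed

lemma linear_functor_restrict:
  fixes C :: "('k, 'o, 'm) lincat" and D :: "('k, 'p, 'n) lincat"
  assumes F: "linear_functor K C D F" and C: "arrows_closed K C"
  shows "linear_functor K (full_subcat C P) D (restrict_functor (full_subcat C P) F)"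
proof (rule linear_functorI)
  let ?C = "full_subcat C P"
  let ?F = "restrict_functor ?C F"
  note F' = linear_functorD[OF F]
  have C': "arrows_closed K ?C" by (rule arrows_closed_full_subcat[OF C])
  have sub: "f \<in> Hom ?C U Y \<Longrightarrow> f \<in> Hom C U Y" for f U Y by (simp add: full_subcat_Hom)
  have o: "U \<in> Obj ?C \<Longrightarrow> U \<in> Obj C" for U by (simp add: full_subcat_simps)
  have ob: "U \<in> Obj ?C \<Longrightarrow> fobj ?F U = fobj F U" and ma: "f \<in> Arr ?C \<Longrightarrow> fmap ?F f = fmap F f" for U f
    by (simp_all add: restrict_functor_def)
  have obj: "Dom C f \<in> Obj ?C" "Cod C f \<in> Obj ?C" if "f \<in> Arr ?C" for f
    using C' that by (auto simp: arrows_closed_def full_subcat_simps)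
  show "fobj ?F \<in> extensional (Obj ?C)" "fmap ?F \<in> extensional (Arr ?C)"
    by (simp_all add: restrict_functor_def)
  show "fobj ?F U \<in> Obj D" if "U \<in> Obj ?C" for U
    using F'(3)[OF o[OF that]] ob[OF that] by simp
  show "fmap ?F f \<in> Hom D (fobj ?F (Dom ?C f)) (fobj ?F (Cod ?C f))" if "f \<in> Arr ?C" for f
    using F'(4)[OF sub[OF arr_in_Hom[OF that]]] obj[OF that] ob ma[OF that] by (simp add: full_subcat_simps(3,4))
  show "fmap ?F (Ide ?C U) = Ide D (fobj ?F U)" if "U \<in> Obj ?C" for U
  proof -
    have "Ide ?C U \<in> Arr ?C" using C' that unfolding arrows_closed_def by (blast dest: HomD)
    then show ?thesis using F'(5)[OF o[OF that]] ob[OF that] ma by (simp add: full_subcat_simps(5))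
  qed
  show "fmap ?F (g \<cdot>\<^bsub>?C\<^esub> f) = fmap ?F g \<cdot>\<^bsub>D\<^esub> fmap ?F f"
    if fg: "f \<in> Arr ?C" "g \<in> Arr ?C" "Cod ?C f = Dom ?C g" for f g
  proof -
    note fH = arr_in_Hom[OF fg(1)] and gH = arr_in_Hom[OF fg(2), folded fg(3)]
    have "g \<cdot>\<^bsub>?C\<^esub> f \<in> Arr ?C" using C' fH gH unfolding arrows_closed_def by (blast dest: HomD)
    then show ?thesis using F'(6)[OF sub[OF fH] sub[OF gH]] ma fg(1,2) by (simp add: full_subcat_simps(6))
  qed
  show "fmap ?F (Plus ?C f g) = Plus D (fmap ?F f) (fmap ?F g)"
    if fg: "f \<in> Arr ?C" "g \<in> Arr ?C" "Dom ?C f = Dom ?C g" "Cod ?C f = Cod ?C g" for f g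
  proof -
    note fH = arr_in_Hom[OF fg(1)] and gH = arr_in_Hom[OF fg(2), folded fg(3,4)]
    have "Plus ?C f g \<in> Arr ?C" using C' fH gH unfolding arrows_closed_def by (blast dest: HomD)
    then show ?thesis using F'(7)[OF sub[OF fH] sub[OF gH]] ma fg(1,2) by (simp add: full_subcat_simps(7))
  qed
  show "fmap ?F (Scal ?C c f) = Scal D c (fmap ?F f)" if c: "c \<in> carrier K" and f: "f \<in> Arr ?C" for c f
  proof -
    note fH = arr_in_Hom[OF f]
    have "Scal ?C c f \<in> Arr ?C" using C' fH c unfolding arrows_closed_def by (blast dest: HomD)
    then show ?thesis using F'(8)[OF c sub[OF fH]] ma f by (simp add: full_subcat_simps(8))
  qed
qed

lemma nat_isomorphic_restrict:
  fixes C :: "('k, 'o, 'm) lincat" and D :: "('k, 'p, 'n) lincat"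
  assumes iso: "nat_isomorphic C C (comp_functor C G F) (id_functor C)"
    and F: "linear_functor K C D F" and C: "arrows_closed K C"
    and PQ: "\<And>U. U \<in> Obj C \<Longrightarrow> P U \<Longrightarrow> Q (fobj F U)"
    and QP: "\<And>Y. Y \<in> Obj D \<Longrightarrow> Q Y \<Longrightarrow> P (fobj G Y)"
  shows "nat_isomorphic (full_subcat C P) (full_subcat C P)
    (comp_functor (full_subcat C P) (restrict_functor (full_subcat D Q) G)
       (restrict_functor (full_subcat C P) F)) (id_functor (full_subcat C P))"
proof -
  let ?C = "full_subcat C P" and ?D = "full_subcat D Q"
  let ?GF = "comp_functor ?C (restrict_functor ?D G) (restrict_functor ?C F)"
  note F' = linear_functorD[OF F]
  obtain \<eta> where \<eta>: "nat_trans C C (comp_functor C G F) (id_functor C) \<eta>"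
    "\<And>U. U \<in> Obj C \<Longrightarrow> iso_arr C (\<eta> U)"
    using iso by (auto simp: nat_isomorphic_def)
  have domcod: "Dom C f \<in> Obj C" "Cod C f \<in> Obj C" if "f \<in> Arr C" for f
    using C that by (auto simp: arrows_closed_def)
  have P_obj: "P (fobj G (fobj F U))" if "U \<in> Obj C" "P U" for U
    using PQ[OF that] QP F'(3)[OF that(1)] by blast
  have ob: "fobj ?GF U = fobj G (fobj F U)" if "U \<in> Obj C" "P U" for U
    using that PQ F'(3) by (simp add: comp_functor_def restrict_functor_def full_subcat_simps)
  have ma: "fmap ?GF f = fmap G (fmap F f)" if f: "f \<in> Arr ?C" for f
  proof -
    have f': "f \<in> Arr C" "P (Dom C f)" "P (Cod C f)" using f by (auto simp: full_subcat_simps)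
    have "fmap F f \<in> Hom ?D (fobj F (Dom C f)) (fobj F (Cod C f))"
      using F'(4)[OF arr_in_Hom[OF f'(1)]] PQ domcod[OF f'(1)] f' by (simp add: full_subcat_Hom)
    then have "fmap F f \<in> Arr ?D" by (rule HomD)
    then show ?thesis using f by (simp add: comp_functor_def restrict_functor_def)
  qed
  have \<eta>H: "\<eta> U \<in> Hom C (fobj G (fobj F U)) U" if "U \<in> Obj C" for U
    using nat_transD(2)[OF \<eta>(1) that] that by (simp add: comp_functor_def id_functor_def)
  have \<eta>H': "\<eta> U \<in> Hom ?C (fobj G (fobj F U)) U" if "U \<in> Obj C" "P U" for U
    using \<eta>H[OF that(1)] P_obj[OF that] that by (simp add: full_subcat_Hom)
  let ?\<eta> = "\<lambda>U \<in> Obj ?C. \<eta> U"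
  have "nat_trans ?C ?C ?GF (id_functor ?C) ?\<eta>"
    unfolding nat_trans_def
  proof (intro conjI ballI)
    show "?\<eta> U \<in> Hom ?C (fobj ?GF U) (fobj (id_functor ?C) U)" if "U \<in> Obj ?C" for U
      using that \<eta>H' by (simp add: ob id_functor_def full_subcat_simps)
    fix f assume f: "f \<in> Arr ?C"
    then have f': "f \<in> Arr C" "P (Dom C f)" "P (Cod C f)" by (auto simp: full_subcat_simps)
    show "?\<eta> (Cod ?C f) \<cdot>\<^bsub>?C\<^esub> fmap ?GF f = fmap (id_functor ?C) f \<cdot>\<^bsub>?C\<^esub> ?\<eta> (Dom ?C f)"
      using nat_transD(3)[OF \<eta>(1) arr_in_Hom[OF f'(1)]] domcod[OF f'(1)] f' f
      by (simp add: ma[OF f]) (simp add: id_functor_def comp_functor_def full_subcat_simps)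
  qed simp
  moreover have "iso_arr ?C (?\<eta> U)" if U: "U \<in> Obj ?C" for U
  proof -
    have U': "U \<in> Obj C" "P U" using U by (auto simp: full_subcat_simps)
    note H = HomD[OF \<eta>H[OF U'(1)]] and H' = HomD[OF \<eta>H'[OF U']]
    obtain g where g: "g \<in> Hom C U (fobj G (fobj F U))" "g \<cdot>\<^bsub>C\<^esub> \<eta> U = Ide C (fobj G (fobj F U))"
      "\<eta> U \<cdot>\<^bsub>C\<^esub> g = Ide C U"
      using \<eta>(2)[OF U'(1)] unfolding iso_arr_def H by blast
    have "g \<in> Hom ?C U (fobj G (fobj F U))" using g(1) P_obj[OF U'] U' by (simp add: full_subcat_Hom)
    then have "iso_arr ?C (\<eta> U)"
      using g(2,3) H'(1) unfolding iso_arr_def H' full_subcat_simps(5,6) by blast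
    then show ?thesis using U by simp
  qed
  ultimately show ?thesis unfolding nat_isomorphic_def by blast
qed

lemma quasi_inverse_equivalences_restrict:
  fixes C :: "('k, 'o, 'm) lincat" and D :: "('k, 'p, 'n) lincat"
  assumes q: "quasi_inverse_equivalences K C D F G"
    and C: "arrows_closed K C" and D: "arrows_closed K D"
    and PQ: "\<And>U. U \<in> Obj C \<Longrightarrow> P U \<Longrightarrow> Q (fobj F U)"
    and QP: "\<And>Y. Y \<in> Obj D \<Longrightarrow> Q Y \<Longrightarrow> P (fobj G Y)"
  shows "quasi_inverse_equivalences K (full_subcat C P) (full_subcat D Q)
    (restrict_functor (full_subcat C P) F) (restrict_functor (full_subcat D Q) G)"
proof -
  have F: "linear_functor K C D F" and G: "linear_functor K D C G"
    and iso: "nat_isomorphic C C (comp_functor C G F) (id_functor C)"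
      "nat_isomorphic D D (comp_functor D F G) (id_functor D)"
    using q by (auto simp: quasi_inverse_equivalences_def)
  have "linear_functor K (full_subcat C P) (full_subcat D Q) (restrict_functor (full_subcat C P) F)"
    by (rule linear_functor_into_full_subcat[OF linear_functor_restrict[OF F C] arrows_closed_full_subcat[OF C]])
      (simp add: restrict_functor_def full_subcat_simps PQ)
  moreover have "linear_functor K (full_subcat D Q) (full_subcat C P) (restrict_functor (full_subcat D Q) G)"
    by (rule linear_functor_into_full_subcat[OF linear_functor_restrict[OF G D] arrows_closed_full_subcat[OF D]])
      (simp add: restrict_functor_def full_subcat_simps QP)
  ultimately show ?thesis
    unfolding quasi_inverse_equivalences_def
    using nat_isomorphic_restrict[OF iso(1) F C, of P Q, OF PQ QP]
      nat_isomorphic_restrict[OF iso(2) G D, of Q P, OF QP PQ] by blast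
qed


section \<open>Natural transformations of linear functors\<close>

context linear_category
begin

lemma functor_category_closed:
  fixes B :: "('k, 'p, 'n) lincat"
  assumes B: "\<And>f. f \<in> Arr B \<Longrightarrow> Dom B f \<in> Obj B \<and> Cod B f \<in> Obj B"
  shows "arrows_closed K (functor_category K B C)"
proof -
  let ?F = "functor_category K B C"
  have Hom_iff: "q \<in> Hom ?F F G \<longleftrightarrow> (\<exists>\<eta>. q = (F, \<eta>, G) \<and> linear_functor K B C F \<and>
      linear_functor K B C G \<and> nat_trans B C F G \<eta>)" for q F G
    by (cases q) (auto simp: Hom_def functor_category_simps)
  show ?thesis
    unfolding arrows_closed_def
  proof (intro conjI ballI allI)
    fix q assume "q \<in> Arr ?F"
    then show "Dom ?F q \<in> Obj ?F" "Cod ?F q \<in> Obj ?F"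
      by (cases q; simp add: functor_category_simps)+
  next
    fix F assume "F \<in> Obj ?F"
    then have F: "linear_functor K B C F" by (simp add: functor_category_simps)
    note F' = linear_functorD[OF F]
    have "nat_trans B C F F (\<lambda>U \<in> Obj B. Ide C (fobj F U))"
      unfolding nat_trans_def
    proof (intro conjI ballI)
      fix f assume f: "f \<in> Arr B"
      show "(\<lambda>U \<in> Obj B. Ide C (fobj F U)) (Cod B f) \<bullet> fmap F f =
          fmap F f \<bullet> (\<lambda>U \<in> Obj B. Ide C (fobj F U)) (Dom B f)"
        using B[OF f] comp_ide_left[OF F'(4)[OF arr_in_Hom[OF f]]] comp_ide_right[OF F'(4)[OF arr_in_Hom[OF f]]]
        by simp
    qed (simp_all add: F'(3) ide_in_Hom)
    then show "Ide ?F F \<in> Hom ?F F F" using F by (simp add: Hom_iff functor_category_simps)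
  next
    fix F G H q r assume q: "q \<in> Hom ?F F G" and r: "r \<in> Hom ?F G H"
    then obtain \<eta> \<theta> where e: "q = (F, \<eta>, G)" "r = (G, \<theta>, H)" and FG: "linear_functor K B C F"
      "linear_functor K B C G" "linear_functor K B C H" and \<eta>: "nat_trans B C F G \<eta>" and \<theta>: "nat_trans B C G H \<theta>"
      by (auto simp: Hom_iff)
    have "nat_trans B C F H (\<lambda>U \<in> Obj B. \<theta> U \<bullet> \<eta> U)"
      unfolding nat_trans_def
    proof (intro conjI ballI)
      show "(\<lambda>U \<in> Obj B. \<theta> U \<bullet> \<eta> U) U \<in> Hom C (fobj F U) (fobj H U)" if "U \<in> Obj B" for U
        using that comp_in_Hom[OF nat_transD(2)[OF \<eta> that] nat_transD(2)[OF \<theta> that]] by simp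
      fix f assume f: "f \<in> Arr B"
      have DC: "Dom B f \<in> Obj B" "Cod B f \<in> Obj B" using B[OF f] by auto
      note fH = arr_in_Hom[OF f]
      show "(\<lambda>U \<in> Obj B. \<theta> U \<bullet> \<eta> U) (Cod B f) \<bullet> fmap F f =
          fmap H f \<bullet> (\<lambda>U \<in> Obj B. \<theta> U \<bullet> \<eta> U) (Dom B f)"
        using DC comp_assoc[OF functor_hom[OF FG(1) fH] nat_transD(2)[OF \<eta> DC(2)] nat_transD(2)[OF \<theta> DC(2)]]
          comp_assoc[OF nat_transD(2)[OF \<eta> DC(1)] functor_hom[OF FG(2) fH] nat_transD(2)[OF \<theta> DC(2)]]
          comp_assoc[OF nat_transD(2)[OF \<eta> DC(1)] nat_transD(2)[OF \<theta> DC(1)] functor_hom[OF FG(3) fH]]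
          nat_transD(3)[OF \<eta> fH] nat_transD(3)[OF \<theta> fH] by simp
    qed simp
    then show "r \<cdot>\<^bsub>?F\<^esub> q \<in> Hom ?F F H" using FG by (simp add: Hom_iff functor_category_simps e)
  next
    fix F G q r assume q: "q \<in> Hom ?F F G" and r: "r \<in> Hom ?F F G"
    then obtain \<eta> \<theta> where e: "q = (F, \<eta>, G)" "r = (F, \<theta>, G)" and FG: "linear_functor K B C F"
      "linear_functor K B C G" and \<eta>: "nat_trans B C F G \<eta>" and \<theta>: "nat_trans B C F G \<theta>"
      by (auto simp: Hom_iff)
    have "nat_trans B C F G (\<lambda>U \<in> Obj B. Plus C (\<eta> U) (\<theta> U))"
      unfolding nat_trans_def
    proof (intro conjI ballI)
      show "(\<lambda>U \<in> Obj B. Plus C (\<eta> U) (\<theta> U)) U \<in> Hom C (fobj F U) (fobj G U)" if "U \<in> Obj B" for U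
        using that plus_in_Hom[OF nat_transD(2)[OF \<eta> that] nat_transD(2)[OF \<theta> that]] by simp
      fix f assume f: "f \<in> Arr B"
      have DC: "Dom B f \<in> Obj B" "Cod B f \<in> Obj B" using B[OF f] by auto
      note fH = arr_in_Hom[OF f]
      show "(\<lambda>U \<in> Obj B. Plus C (\<eta> U) (\<theta> U)) (Cod B f) \<bullet> fmap F f =
          fmap G f \<bullet> (\<lambda>U \<in> Obj B. Plus C (\<eta> U) (\<theta> U)) (Dom B f)"
        using DC comp_plus_left[OF functor_hom[OF FG(1) fH] nat_transD(2)[OF \<eta> DC(2)] nat_transD(2)[OF \<theta> DC(2)]]
          comp_plus_right[OF nat_transD(2)[OF \<eta> DC(1)] nat_transD(2)[OF \<theta> DC(1)] functor_hom[OF FG(2) fH]]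
          nat_transD(3)[OF \<eta> fH] nat_transD(3)[OF \<theta> fH] by simp
    qed simp
    then show "Plus ?F q r \<in> Hom ?F F G" using FG by (simp add: Hom_iff functor_category_simps e)
  next
    fix F G q c assume q: "q \<in> Hom ?F F G" and c: "c \<in> carrier K"
    then obtain \<eta> where e: "q = (F, \<eta>, G)" and FG: "linear_functor K B C F"
      "linear_functor K B C G" and \<eta>: "nat_trans B C F G \<eta>"
      by (auto simp: Hom_iff)
    have "nat_trans B C F G (\<lambda>U \<in> Obj B. Scal C c (\<eta> U))"
      unfolding nat_trans_def
    proof (intro conjI ballI)
      show "(\<lambda>U \<in> Obj B. Scal C c (\<eta> U)) U \<in> Hom C (fobj F U) (fobj G U)" if "U \<in> Obj B" for U
        using that scal_in_Hom[OF nat_transD(2)[OF \<eta> that] c] by simp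
      fix f assume f: "f \<in> Arr B"
      have DC: "Dom B f \<in> Obj B" "Cod B f \<in> Obj B" using B[OF f] by auto
      note fH = arr_in_Hom[OF f]
      show "(\<lambda>U \<in> Obj B. Scal C c (\<eta> U)) (Cod B f) \<bullet> fmap F f =
          fmap G f \<bullet> (\<lambda>U \<in> Obj B. Scal C c (\<eta> U)) (Dom B f)"
        using DC comp_scal_left[OF c functor_hom[OF FG(1) fH] nat_transD(2)[OF \<eta> DC(2)]]
          comp_scal_right[OF c nat_transD(2)[OF \<eta> DC(1)] functor_hom[OF FG(2) fH]]
          nat_transD(3)[OF \<eta> fH] by simp
    qed simp
    then show "Scal ?F c q \<in> Hom ?F F G" using FG by (simp add: Hom_iff functor_category_simps e)
  qed
qed

lemma nat_trans_inverse:
  fixes B :: "('k, 'p, 'n) lincat"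
  assumes B: "\<And>f. f \<in> Arr B \<Longrightarrow> Dom B f \<in> Obj B \<and> Cod B f \<in> Obj B"
    and F: "linear_functor K B C F" and G: "linear_functor K B C G"
    and \<eta>: "nat_trans B C F G \<eta>" and iso: "\<And>U. U \<in> Obj B \<Longrightarrow> iso_arr C (\<eta> U)"
  shows "\<exists>\<theta>. nat_trans B C G F \<theta> \<and>
    (\<forall>U \<in> Obj B. \<theta> U \<bullet> \<eta> U = Ide C (fobj F U) \<and> \<eta> U \<bullet> \<theta> U = Ide C (fobj G U))"
proof -
  have "\<exists>g. g \<in> Hom C (fobj G U) (fobj F U) \<and> g \<bullet> \<eta> U = Ide C (fobj F U) \<and> \<eta> U \<bullet> g = Ide C (fobj G U)"
    if "U \<in> Obj B" for U
    using iso_arrE[OF iso[OF that] nat_transD(2)[OF \<eta> that]] by metis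
  then obtain \<theta> where \<theta>: "\<And>U. U \<in> Obj B \<Longrightarrow> \<theta> U \<in> Hom C (fobj G U) (fobj F U) \<and>
      \<theta> U \<bullet> \<eta> U = Ide C (fobj F U) \<and> \<eta> U \<bullet> \<theta> U = Ide C (fobj G U)" by metis
  have "nat_trans B C G F (restrict \<theta> (Obj B))"
    unfolding nat_trans_def
  proof (intro conjI ballI)
    fix f assume f: "f \<in> Arr B"
    have DC: "Dom B f \<in> Obj B" "Cod B f \<in> Obj B" using B[OF f] by auto
    note fH = arr_in_Hom[OF f]
    have "fmap F f \<bullet> \<theta> (Dom B f) = \<theta> (Cod B f) \<bullet> fmap G f"
      by (rule iso_square_inverse[OF nat_transD(2)[OF \<eta> DC(1)] _ _ nat_transD(2)[OF \<eta> DC(2)] _ _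
            functor_hom[OF F fH] functor_hom[OF G fH]])
        (simp_all add: \<theta> DC nat_transD(3)[OF \<eta> fH])
    then show "restrict \<theta> (Obj B) (Cod B f) \<bullet> fmap G f = fmap F f \<bullet> restrict \<theta> (Obj B) (Dom B f)"
      using DC by simp
  qed (simp_all add: \<theta>)
  then show ?thesis using \<theta> by (intro exI[of _ "restrict \<theta> (Obj B)"]) simp
qed

lemma exact_nat_iso:
  fixes B :: "('k, 'p, 'n) lincat"
  assumes B: "\<And>f. f \<in> Arr B \<Longrightarrow> Dom B f \<in> Obj B \<and> Cod B f \<in> Obj B"
    and F: "linear_functor K B C F" and G: "linear_functor K B C G"
    and \<eta>: "nat_trans B C F G \<eta>" and iso: "\<And>U. U \<in> Obj B \<Longrightarrow> iso_arr C (\<eta> U)"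
    and ex: "exact B C F"
  shows "exact B C G"
  unfolding exact_def
proof (intro allI impI)
  fix f g assume fg: "short_exact B f g"
  then have f: "f \<in> Arr B" and g: "g \<in> Arr B" and mid: "Cod B f = Dom B g"
    by (auto simp: short_exact_def mono_arr_def epi_arr_def exact_at_def is_image_def is_kernel_def is_cokernel_def)
  have DC: "Dom B f \<in> Obj B" "Dom B g \<in> Obj B" "Cod B g \<in> Obj B" using B[OF f] B[OF g] by auto
  note fH = arr_in_Hom[OF f, unfolded mid] and gH = arr_in_Hom[OF g]
  have "short_exact C (fmap F f) (fmap F g)" using ex fg by (simp add: exact_def)
  from short_exact_iso[OF this functor_hom[OF F fH] functor_hom[OF G fH] functor_hom[OF F gH] functor_hom[OF G gH]
      iso[OF DC(1)] nat_transD(2)[OF \<eta> DC(1)] iso[OF DC(2)] nat_transD(2)[OF \<eta> DC(2)]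
      iso[OF DC(3)] nat_transD(2)[OF \<eta> DC(3)]
      nat_transD(3)[OF \<eta> fH, symmetric] nat_transD(3)[OF \<eta> gH, symmetric]]
  show "short_exact C (fmap G f) (fmap G g)" .
qed

end

section \<open>Tensor products are right exact\<close>

locale tensor_product = abelian_category_with_algebra K C A
  for K :: "'k ring" and C :: "('k, 'o, 'm) lincat" and A :: "('k, 'a) module" +
  fixes Ten :: "(('a, 'o, 'm) aobj, ('a, 'o, 'm) aarr,
      ('a umod, 'a uarr, 'o, 'm) func, ('a umod, 'a uarr, 'o, 'm) nattrans) func"
    and \<Phi> :: "('a, 'o, 'm) aobj \<Rightarrow> 'a umod \<Rightarrow> 'o \<Rightarrow> 'm \<Rightarrow> (nat \<Rightarrow> 'a) set \<Rightarrow> 'm"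
  assumes is_tensor: "is_tensor K A C Ten \<Phi>"
begin

abbreviation tobj :: "('a, 'o, 'm) aobj \<Rightarrow> 'a umod \<Rightarrow> 'o" where
  "tobj V M \<equiv> fobj (fobj Ten V) M"

definition univ_map :: "('a, 'o, 'm) aobj \<Rightarrow> 'a umod \<Rightarrow> (nat \<Rightarrow> 'a) set \<Rightarrow> 'm" where
  "univ_map V M = \<Phi> V M (tobj V M) (Ide C (tobj V M))"

lemma Ten_linear: "linear_functor K (aobj_category K A C) (functor_category K (fpmod A) C) Ten"
  using is_tensor by (simp add: is_tensor_def)

lemma Ten_obj_linear: "is_aobj K A C V \<Longrightarrow> linear_functor K (fpmod A) C (fobj Ten V)"
  using functor_obj[OF Ten_linear, of V] by (simp add: aobj_category_simps functor_category_simps)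

lemma tobj_Obj: "is_aobj K A C V \<Longrightarrow> M \<in> Obj (fpmod A) \<Longrightarrow> tobj V M \<in> Obj C"
  using functor_obj[OF Ten_obj_linear] by blast

text \<open>The Yoneda lemma: \<open>\<Phi>\<close> is natural in \<open>W\<close>, so it is determined by its value at the identity.\<close>

lemma adj_eq:
  assumes V: "is_aobj K A C V" and M: "M \<in> Obj (fpmod A)" and g: "g \<in> Hom C (tobj V M) W"
    and x: "x \<in> carrier M"
  shows "\<Phi> V M W g x = g \<bullet> univ_map V M x"
proof -
  have "\<forall>V \<in> Obj (aobj_category K A C). \<forall>M \<in> Obj (fpmod A). \<forall>w \<in> Arr C.
        \<forall>g \<in> Hom C (tobj V M) (Dom C w). \<forall>x \<in> carrier M.
          \<Phi> V M (Cod C w) (w \<bullet> g) x = w \<bullet> \<Phi> V M (Dom C w) g x"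
    using is_tensor by (simp add: is_tensor_def)
  from this[rule_format, of V M g "Ide C (tobj V M)" x]
  show ?thesis
    using V M x HomD[OF g] ide_in_Hom[OF tobj_Obj[OF V M]] comp_ide_right[OF g]
    by (simp add: univ_map_def aobj_category_simps)
qed

lemma univ_map_represents:
  assumes V: "is_aobj K A C V" and M: "M \<in> Obj (fpmod A)"
  shows "represents V M (tobj V M) (univ_map V M)"
proof -
  have bij: "bij_betw (\<Phi> V M W) (Hom C (tobj V M) W) (rmod_hom A M (hom_rmod C V W))"
    if "W \<in> Obj C" for W
    using is_tensor V M that by (simp add: is_tensor_def aobj_category_simps)
  note T = tobj_Obj[OF V M]
  show ?thesis
    unfolding represents_def
  proof (intro conjI ballI T)
    show "univ_map V M \<in> rmod_hom A M (hom_rmod C V (tobj V M))"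
      using bij_betwE[OF bij[OF T]] ide_in_Hom[OF T] by (simp add: univ_map_def)
    fix W v assume W: "W \<in> Obj C" and v: "v \<in> rmod_hom A M (hom_rmod C V W)"
    have iff: "(\<forall>x \<in> carrier M. h \<bullet> univ_map V M x = v x) \<longleftrightarrow> \<Phi> V M W h = v"
      if h: "h \<in> Hom C (tobj V M) W" for h
    proof
      have \<Phi>h: "\<Phi> V M W h \<in> rmod_hom A M (hom_rmod C V W)" using bij_betwE[OF bij[OF W]] h by blast
      assume "\<forall>x \<in> carrier M. h \<bullet> univ_map V M x = v x"
      then show "\<Phi> V M W h = v" by (intro rmod_hom_eqI[OF \<Phi>h v]) (simp add: adj_eq[OF V M h])
    next
      assume e: "\<Phi> V M W h = v"
      show "\<forall>x \<in> carrier M. h \<bullet> univ_map V M x = v x"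
        by (simp add: adj_eq[OF V M h, symmetric] e)
    qed
    have "v \<in> \<Phi> V M W ` Hom C (tobj V M) W"
      unfolding bij_betw_imp_surj_on[OF bij[OF W]] by (rule v)
    then obtain h where h: "h \<in> Hom C (tobj V M) W" "\<Phi> V M W h = v" by (elim imageE) simp
    show "\<exists>!h. h \<in> Hom C (tobj V M) W \<and> (\<forall>x \<in> carrier M. h \<bullet> univ_map V M x = v x)"
    proof (rule ex1I[of _ h])
      show "h \<in> Hom C (tobj V M) W \<and> (\<forall>x \<in> carrier M. h \<bullet> univ_map V M x = v x)"
        using h iff by blast
      fix h' assume h': "h' \<in> Hom C (tobj V M) W \<and> (\<forall>x \<in> carrier M. h' \<bullet> univ_map V M x = v x)"
      then have "\<Phi> V M W h' = \<Phi> V M W h" using iff[of h'] h(2) by simp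
      then show "h' = h" using inj_onD[OF bij_betw_imp_inj_on[OF bij[OF W]], of h' h] h' h(1) by simp
    qed
  qed
qed

lemma univ_map_in_Hom:
  "is_aobj K A C V \<Longrightarrow> M \<in> Obj (fpmod A) \<Longrightarrow> x \<in> carrier M \<Longrightarrow> univ_map V M x \<in> Hom C (fst V) (tobj V M)"
  by (rule representsD(3)[OF univ_map_represents])

lemma tobj_eqI:
  assumes "is_aobj K A C V" "M \<in> Obj (fpmod A)"
    and "h \<in> Hom C (tobj V M) W" "h' \<in> Hom C (tobj V M) W"
    "\<And>x. x \<in> carrier M \<Longrightarrow> h \<bullet> univ_map V M x = h' \<bullet> univ_map V M x"
  shows "h = h'"
  using represents_eqI[OF univ_map_represents[OF assms(1,2)] assms(1) _ assms(3-5)] assms(2)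
  by (simp add: fpmod_Obj)

lemma Ten_map_Hom:
  assumes "is_aobj K A C V" "(M, f, N) \<in> Arr (fpmod A)"
  shows "fmap (fobj Ten V) (M, f, N) \<in> Hom C (tobj V M) (tobj V N)"
  using functor_hom[OF Ten_obj_linear[OF assms(1)] arr_in_Hom[OF assms(2)]] by (simp add: fpmod_simps)

lemma Ten_map_univ:
  assumes V: "is_aobj K A C V" and f: "(M, f, N) \<in> Arr (fpmod A)" and x: "x \<in> carrier M"
  shows "fmap (fobj Ten V) (M, f, N) \<bullet> univ_map V M x = univ_map V N (f x)"
proof -
  have MN: "M \<in> Obj (fpmod A)" "N \<in> Obj (fpmod A)" "f \<in> rmod_hom A M N" using f by (auto simp: fpmod_Arr)
  note map = Ten_map_Hom[OF V f] and T = tobj_Obj[OF V MN(2)]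
  have "\<forall>Z \<in> Obj (aobj_category K A C). \<forall>(M, f, N) \<in> Arr (fpmod A). \<forall>Z' \<in> Obj C.
        \<forall>g \<in> Hom C (tobj Z N) Z'. \<forall>x \<in> carrier M.
          \<Phi> Z M Z' (g \<bullet> fmap (fobj Ten Z) (M, f, N)) x = \<Phi> Z N Z' g (f x)"
    using is_tensor by (simp add: is_tensor_def)
  then have "\<Phi> V M (tobj V N) (Ide C (tobj V N) \<bullet> fmap (fobj Ten V) (M, f, N)) x =
      \<Phi> V N (tobj V N) (Ide C (tobj V N)) (f x)"
    using V f x T ide_in_Hom[OF T] by (force simp: aobj_category_simps)
  then show ?thesis
    using comp_ide_left[OF map] adj_eq[OF V MN(1) map x] by (simp add: univ_map_def)
qed

definition tens_arr :: "('a, 'o, 'm) aobj \<Rightarrow> 'm \<Rightarrow> ('a, 'o, 'm) aobj \<Rightarrow> 'a umod \<Rightarrow> 'm" where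
  "tens_arr V h W = fst (snd (fmap Ten (V, h, W)))"

lemma Ten_arr:
  assumes h: "is_aarr K A C (V, h, W)"
  shows "fmap Ten (V, h, W) = (fobj Ten V, tens_arr V h W, fobj Ten W)"
    and "nat_trans (fpmod A) C (fobj Ten V) (fobj Ten W) (tens_arr V h W)"
proof -
  have "(V, h, W) \<in> Hom (aobj_category K A C) V W"
    using h by (simp add: Hom_def aobj_category_simps)
  from functor_hom[OF Ten_linear this]
  have "fmap Ten (V, h, W) \<in> Hom (functor_category K (fpmod A) C) (fobj Ten V) (fobj Ten W)" .
  then show "fmap Ten (V, h, W) = (fobj Ten V, tens_arr V h W, fobj Ten W)"
    "nat_trans (fpmod A) C (fobj Ten V) (fobj Ten W) (tens_arr V h W)"
    unfolding tens_arr_def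
    by (cases "fmap Ten (V, h, W)"; simp add: Hom_def functor_category_simps)+
qed

lemma tens_arr_univ:
  assumes h: "is_aarr K A C (V, h, W)" and M: "M \<in> Obj (fpmod A)" and x: "x \<in> carrier M"
  shows "tens_arr V h W M \<bullet> univ_map V M x = univ_map W M x \<bullet> h"
proof -
  have V: "is_aobj K A C V" "is_aobj K A C W" using h by (auto simp: is_aarr_iff)
  have t: "tens_arr V h W M \<in> Hom C (tobj V M) (tobj W M)"
    using nat_transD(2)[OF Ten_arr(2)[OF h] M] .
  note T = tobj_Obj[OF V(2) M]
  have "\<forall>(Y, h, Z) \<in> Arr (aobj_category K A C). \<forall>M \<in> Obj (fpmod A). \<forall>Z' \<in> Obj C.
        \<forall>g \<in> Hom C (tobj Z M) Z'. \<forall>x \<in> carrier M.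
          \<Phi> Y M Z' (g \<bullet> (case fmap Ten (Y, h, Z) of (_, \<tau>, _) \<Rightarrow> \<tau> M)) x =
            \<Phi> Z M Z' g x \<bullet> h"
    using is_tensor by (simp add: is_tensor_def)
  moreover have "(V, h, W) \<in> Arr (aobj_category K A C)" using h by (simp add: aobj_category_simps)
  ultimately have "\<forall>M \<in> Obj (fpmod A). \<forall>Z' \<in> Obj C. \<forall>g \<in> Hom C (tobj W M) Z'. \<forall>x \<in> carrier M.
          \<Phi> V M Z' (g \<bullet> (case fmap Ten (V, h, W) of (_, \<tau>, _) \<Rightarrow> \<tau> M)) x = \<Phi> W M Z' g x \<bullet> h"
    by blast
  from this[rule_format, OF M T ide_in_Hom[OF T] x]
  show ?thesis
    using comp_ide_left[OF t] adj_eq[OF V(1) M t x] by (simp add: univ_map_def Ten_arr(1)[OF h])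
qed

text \<open>
  A map out of \<open>M \<otimes> V\<close> which vanishes on the image of \<open>L \<otimes> V\<close> is an \<open>A\<close>-linear map on \<open>M\<close> which
  vanishes on the image of \<open>L\<close>, so it is an \<open>A\<close>-linear map on \<open>N\<close>.
\<close>

lemma Ten_cokernel:
  assumes V: "is_aobj K A C V" and e: "short_exact (fpmod A) (L, f, M) (M', g, N)"
  shows "is_cokernel C (fmap (fobj Ten V) (M', g, N)) (fmap (fobj Ten V) (L, f, M))"
proof -
  note D = fpmod_short_exactD[OF e]
  have f: "(L, f, M) \<in> Arr (fpmod A)" and g: "(M, g, N) \<in> Arr (fpmod A)" using D by (auto simp: fpmod_Arr)
  have mod: "right_module A L" "right_module A M" "right_module A N" using D by (auto simp: fpmod_Obj)
  let ?T = "fobj Ten V"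
  note Tf = Ten_map_Hom[OF V f] and Tg = Ten_map_Hom[OF V g]
  note uf = Ten_map_univ[OF V f] and ug = Ten_map_univ[OF V g]
  note uL = univ_map_in_Hom[OF V D(4)] and uM = univ_map_in_Hom[OF V D(5)] and uN = univ_map_in_Hom[OF V D(6)]
  note fcl = rmod_hom_closed[OF D(7)] and gcl = rmod_hom_closed[OF D(8)]
  have TN: "tobj V N \<in> Obj C" by (rule tobj_Obj[OF V D(6)])
  have "is_cokernel C (fmap ?T (M, g, N)) (fmap ?T (L, f, M))"
  proof (rule is_cokernelI[OF Tf Tg])
    have "fmap ?T (M, g, N) \<bullet> fmap ?T (L, f, M) \<bullet> univ_map V L x = Null C (tobj V L) (tobj V N) \<bullet> univ_map V L x"
      if x: "x \<in> carrier L" for x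
    proof -
      have "f x \<in> ker M N g" unfolding D(3) using x by (rule imageI)
      then have "univ_map V N (g (f x)) = Null C (fst V) (tobj V N)"
        using rmod_hom_zero[OF mod(3) hom_rmod_right_module[OF V TN] representsD(2)[OF univ_map_represents[OF V D(6)]]]
        by (simp add: ker_def hom_rmod_simps)
      then show ?thesis
        using comp_assoc[OF uL[OF x] Tf Tg] uf[OF x] ug[OF fcl[OF x]] comp_null_left[OF uL[OF x] TN] by simp
    qed
    then show "fmap ?T (M, g, N) \<bullet> fmap ?T (L, f, M) = Null C (tobj V L) (tobj V N)"
      by (rule tobj_eqI[OF V D(4) comp_in_Hom[OF Tf Tg] null_in_Hom[OF tobj_Obj[OF V D(4)] TN]])
    fix W w assume w: "w \<in> Hom C (tobj V M) W" "w \<bullet> fmap ?T (L, f, M) = Null C (tobj V L) W"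
    have W: "W \<in> Obj C" using Hom_Obj[OF w(1)] by blast
    have "(\<lambda>y \<in> carrier M. w \<bullet> univ_map V M y) y = \<zero>\<^bsub>hom_rmod C V W\<^esub>" if y: "y \<in> ker M N g" for y
    proof -
      obtain x where x: "x \<in> carrier L" "y = f x" using y unfolding D(3) by (elim imageE)
      have "w \<bullet> univ_map V M (f x) = Null C (fst V) W"
        using comp_assoc[OF uL[OF x(1)] Tf w(1)] uf[OF x(1)] w(2) comp_null_left[OF uL[OF x(1)] W] by simp
      then show ?thesis using x fcl[OF x(1)] by (simp add: hom_rmod_simps)
    qed
    from rmod_factor_through_surj[OF mod(2,3) hom_rmod_right_module[OF V W] D(8,2)
        hom_rmod_postcomp[OF V mod(2) representsD(2)[OF univ_map_represents[OF V D(5)]] w(1)] this]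
    obtain v where v: "v \<in> rmod_hom A N (hom_rmod C V W)"
      "\<forall>y \<in> carrier M. v (g y) = (\<lambda>y \<in> carrier M. w \<bullet> univ_map V M y) y" by blast
    have ex: "\<exists>!h. h \<in> Hom C (tobj V N) W \<and> (\<forall>x \<in> carrier N. h \<bullet> univ_map V N x = v x)"
      by (rule representsD(4)[OF univ_map_represents[OF V D(6)] W v(1)])
    have iff: "(\<forall>x \<in> carrier N. h \<bullet> univ_map V N x = v x) \<longleftrightarrow> h \<bullet> fmap ?T (M, g, N) = w"
      if h: "h \<in> Hom C (tobj V N) W" for h
    proof -
      have *: "(h \<bullet> fmap ?T (M, g, N)) \<bullet> univ_map V M y = h \<bullet> univ_map V N (g y)"
        if "y \<in> carrier M" for y
        using comp_assoc[OF uM[OF that] Tg h] ug[OF that] by simp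
      have "(\<forall>x \<in> carrier N. h \<bullet> univ_map V N x = v x) \<longleftrightarrow>
          (\<forall>y \<in> carrier M. h \<bullet> univ_map V N (g y) = v (g y))"
        unfolding D(2)[symmetric] by blast
      also have "\<dots> \<longleftrightarrow> (\<forall>y \<in> carrier M. (h \<bullet> fmap ?T (M, g, N)) \<bullet> univ_map V M y = w \<bullet> univ_map V M y)"
        using * v(2) by simp
      also have "\<dots> \<longleftrightarrow> h \<bullet> fmap ?T (M, g, N) = w"
        using tobj_eqI[OF V D(5) comp_in_Hom[OF Tg h] w(1)] by blast
      finally show ?thesis .
    qed
    show "\<exists>!h. h \<in> Hom C (tobj V N) W \<and> h \<bullet> fmap ?T (M, g, N) = w"
      using ex iff by metis
  qed
  then show ?thesis using D(1) by simp
qed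

lemma Ten_right_exact:
  assumes V: "is_aobj K A C V"
  shows "right_exact (fpmod A) C (fobj Ten V)"
  unfolding right_exact_def
proof (intro allI impI)
  fix f g assume fg: "short_exact (fpmod A) f g"
  obtain L f' M M' g' N where "f = (L, f', M)" "g = (M', g', N)" by (cases f; cases g)
  then show "exact_at C (fmap (fobj Ten V) f) (fmap (fobj Ten V) g) \<and> epi_arr C (fmap (fobj Ten V) g)"
    using cokernel_exact[OF Ten_cokernel[OF V]] fg by blast
qed

end

section \<open>Restriction to the algebra\<close>

context abelian_category_with_algebra
begin

lemma elt_arr_plus:
  assumes M: "M \<in> Obj (fpmod A)" and x: "x \<in> carrier M" "y \<in> carrier M"
  shows "Plus (fpmod A) (elt_arr A M x) (elt_arr A M y) = elt_arr A M (x \<oplus>\<^bsub>M\<^esub> y)"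
proof -
  interpret M: right_module A M using M by (simp add: fpmod_Obj)
  show ?thesis
    unfolding elt_arr_def fpmod_simps using x
    by (auto simp: elt_map_def reg_rmod_simps inv_reg_elt M.ract_add_left intro!: restrict_ext)
qed

lemma elt_arr_scal:
  assumes M: "M \<in> Obj (fpmod A)" and x: "x \<in> carrier M" and c: "c \<in> carrier K"
  shows "Scal (fpmod A) c (elt_arr A M x) = elt_arr A M (ract M x (c \<odot>\<^bsub>A\<^esub> \<one>\<^bsub>A\<^esub>))"
proof -
  interpret M: right_module A M using M by (simp add: fpmod_Obj)
  have c1: "c \<odot>\<^bsub>A\<^esub> \<one>\<^bsub>A\<^esub> \<in> carrier A" using smult_A_closed c by simp
  have *: "ract M (ract M x a) (c \<odot>\<^bsub>A\<^esub> \<one>\<^bsub>A\<^esub>) = ract M (ract M x (c \<odot>\<^bsub>A\<^esub> \<one>\<^bsub>A\<^esub>)) a" if "a \<in> carrier A" for a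
    using that x c c1 by (simp flip: M.ract_mult add: smult_one_central)
  show ?thesis
    unfolding elt_arr_def fpmod_simps
    by (auto simp: elt_map_def reg_rmod_simps inv_reg_elt * intro!: restrict_ext)
qed

lemma reg_Obj: "reg_rmod A \<in> Obj (fpmod A)"
  by (rule reg_fpmod[OF ring_A])

lemma reg_elt_in: "a \<in> carrier A \<Longrightarrow> reg_elt a \<in> carrier (reg_rmod A)"
  by (simp add: reg_rmod_simps)

lemma left_mult_eq: "a \<in> carrier A \<Longrightarrow> left_mult A a = elt_arr A (reg_rmod A) (reg_elt a)"
  by (rule left_mult_elt_arr[OF ring_A])

lemma left_mult_Hom: "a \<in> carrier A \<Longrightarrow> left_mult A a \<in> Hom (fpmod A) (reg_rmod A) (reg_rmod A)"
  by (simp add: left_mult_eq elt_arr_Hom reg_Obj reg_elt_in)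

lemma elt_arr_left_mult:
  assumes M: "M \<in> Obj (fpmod A)" and x: "x \<in> carrier M" and a: "a \<in> carrier A"
  shows "elt_arr A M x \<cdot>\<^bsub>fpmod A\<^esub> left_mult A a = elt_arr A M (ract M x a)"
proof -
  have "right_module A M" using M by (simp add: fpmod_Obj)
  from elt_arr_comp[OF reg_Obj M elt_map_hom[OF this x] reg_elt_in[OF a]]
  show ?thesis by (simp add: left_mult_eq[OF a] elt_arr_def[of A M x] elt_map_apply[OF a])
qed

lemma elt_arr_one: "Ide (fpmod A) (reg_rmod A) = elt_arr A (reg_rmod A) (reg_elt \<one>\<^bsub>A\<^esub>)"
  unfolding elt_arr_def fpmod_simps
  by (auto simp: elt_map_def reg_rmod_simps inv_reg_elt intro!: restrict_ext)

lemma restriction_obj_simps: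
  "fst (restriction_obj A T) = fobj T (reg_rmod A)"
  "a \<in> carrier A \<Longrightarrow> snd (restriction_obj A T) a = fmap T (left_mult A a)"
  by (simp_all add: restriction_obj_def)

lemma restriction_is_aobj:
  assumes T: "linear_functor K (fpmod A) C T"
  shows "is_aobj K A C (restriction_obj A T)"
proof -
  let ?R = "reg_rmod A"
  note T' = linear_functorD[OF T] and lm = left_mult_Hom
  have "fmap T (left_mult A (a \<otimes>\<^bsub>A\<^esub> b)) = fmap T (left_mult A a) \<bullet> fmap T (left_mult A b)"
    if "a \<in> carrier A" "b \<in> carrier A" for a b
    using T'(6)[OF lm[OF that(2)] lm[OF that(1)]] elt_arr_left_mult[OF reg_Obj reg_elt_in[OF that(1)] that(2)]
      that by (simp add: left_mult_eq reg_rmod_simps)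
  moreover have "fmap T (left_mult A (a \<oplus>\<^bsub>A\<^esub> b)) = Plus C (fmap T (left_mult A a)) (fmap T (left_mult A b))"
    if "a \<in> carrier A" "b \<in> carrier A" for a b
    using T'(7)[OF lm[OF that(1)] lm[OF that(2)]] elt_arr_plus[OF reg_Obj reg_elt_in[OF that(1)] reg_elt_in[OF that(2)]]
      that by (simp add: left_mult_eq reg_rmod_simps)
  moreover have "fmap T (left_mult A \<one>\<^bsub>A\<^esub>) = Ide C (fobj T ?R)"
    using T'(5)[OF reg_Obj] by (simp add: left_mult_eq elt_arr_one)
  moreover have "fmap T (left_mult A (c \<odot>\<^bsub>A\<^esub> a)) = Scal C c (fmap T (left_mult A a))"
    if "c \<in> carrier K" "a \<in> carrier A" for a c
    using T'(8)[OF that(1) lm[OF that(2)]] elt_arr_scal[OF reg_Obj reg_elt_in[OF that(2)] that(1)]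
      that smult_A_closed[OF that] smult_A_closed[OF that(1) A.one_closed]
    by (simp add: left_mult_eq reg_rmod_simps smult_one_central)
  moreover have "fmap T (left_mult A a) \<in> Hom C (fobj T ?R) (fobj T ?R)" if "a \<in> carrier A" for a
    using T'(4)[OF lm[OF that]] .
  ultimately show ?thesis
    using T'(3)[OF reg_Obj] smult_A_closed
    by (auto simp: is_aobj_def restriction_obj_def algebra_hom_def ring_hom_def end_algebra_def hom_space_def)
qed

text \<open>
  An element \<open>x\<close> of \<open>M\<close> is an arrow from \<open>A\<^sub>A\<close> to \<open>M\<close>, and \<open>T\<close> takes it to an arrow from \<open>T(A)\<close> to \<open>T(M)\<close>.
  For right exact \<open>T\<close> this turns out to be a universal map, so that \<open>T(M)\<close> is a tensor product of \<open>M\<close>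
  and \<open>T(A)\<close>.
\<close>

definition eval_map :: "('a umod, 'a uarr, 'o, 'm) func \<Rightarrow> 'a umod \<Rightarrow> (nat \<Rightarrow> 'a) set \<Rightarrow> 'm" where
  "eval_map T M = (\<lambda>x \<in> carrier M. fmap T (elt_arr A M x))"

context
  fixes T :: "('a umod, 'a uarr, 'o, 'm) func"
  assumes T: "linear_functor K (fpmod A) C T"
begin

lemma eval_map_in_Hom:
  "M \<in> Obj (fpmod A) \<Longrightarrow> x \<in> carrier M \<Longrightarrow> eval_map T M x \<in> Hom C (fobj T (reg_rmod A)) (fobj T M)"
  using functor_hom[OF T elt_arr_Hom] by (simp add: eval_map_def)

lemma eval_map_hom:
  assumes M: "M \<in> Obj (fpmod A)"
  shows "eval_map T M \<in> rmod_hom A M (hom_rmod C (restriction_obj A T) (fobj T M))"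
proof -
  interpret M: right_module A M using M by (simp add: fpmod_Obj)
  show ?thesis
  proof (rule rmod_homI; (simp only: hom_rmod_simps)?)
    show "eval_map T M \<in> extensional (carrier M)" by (simp add: eval_map_def)
    fix x assume x: "x \<in> carrier M"
    show "eval_map T M x \<in> Hom C (fst (restriction_obj A T)) (fobj T M)"
      using eval_map_in_Hom[OF M x] by (simp add: restriction_obj_simps)
    show "eval_map T M (x \<oplus>\<^bsub>M\<^esub> y) = Plus C (eval_map T M x) (eval_map T M y)" if y: "y \<in> carrier M" for y
      using functor_plus[OF T elt_arr_Hom[OF M x] elt_arr_Hom[OF M y]] elt_arr_plus[OF M x y] x y
      by (simp add: eval_map_def)
    show "eval_map T M (ract M x a) = eval_map T M x \<bullet> snd (restriction_obj A T) a" if a: "a \<in> carrier A" for a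
      using functor_comp[OF T left_mult_Hom[OF a] elt_arr_Hom[OF M x]] elt_arr_left_mult[OF M x a] x a
      by (simp add: eval_map_def restriction_obj_simps M.ract_closed)
  qed
qed

lemma eval_map_natural:
  assumes f: "(M, f, N) \<in> Arr (fpmod A)" and x: "x \<in> carrier M"
  shows "fmap T (M, f, N) \<bullet> eval_map T M x = eval_map T N (f x)"
proof -
  have MN: "M \<in> Obj (fpmod A)" "N \<in> Obj (fpmod A)" "f \<in> rmod_hom A M N" using f by (auto simp: fpmod_Arr)
  have "(M, f, N) \<in> Hom (fpmod A) M N" using MN by (simp add: fpmod_Hom)
  from functor_comp[OF T elt_arr_Hom[OF MN(1) x] this]
  show ?thesis using x by (simp add: eval_map_def elt_arr_comp[OF MN x] rmod_hom_closed[OF MN(3)])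
qed

lemma functor_null:
  assumes "M \<in> Obj (fpmod A)" "N \<in> Obj (fpmod A)"
  shows "fmap T (Null (fpmod A) M N) = Null C (fobj T M) (fobj T N)"
proof -
  have mod: "right_module A M" "right_module A N" using assms by (auto simp: fpmod_Obj)
  interpret N: right_module A N by (rule mod)
  have z: "Null (fpmod A) M N \<in> Hom (fpmod A) M N"
    using rmod_hom_zero_map[OF mod] assms by (simp add: fpmod_Hom fpmod_simps)
  have "Plus (fpmod A) (Null (fpmod A) M N) (Null (fpmod A) M N) = Null (fpmod A) M N"
    by (simp add: fpmod_simps cong: restrict_cong)
  then show ?thesis using plus_self_null[OF functor_hom[OF T z]] functor_plus[OF T z z] by simp
qed

text \<open>
  On the free module \<open>A\<^sup>n\<close> the truncations to the first \<open>m\<close> coordinates are built up from the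
  coordinate maps; so the identity of \<open>T(A\<^sup>n)\<close> is a sum of composites through \<open>T(A)\<close>.
\<close>

definition coord_arr :: "nat \<Rightarrow> nat \<Rightarrow> 'a uarr" where
  "coord_arr n m = (free_fp A n, \<lambda>z \<in> carrier (free_fp A n). reg_elt (the_elem z m), reg_rmod A)"

definition trunc_arr :: "nat \<Rightarrow> nat \<Rightarrow> 'a uarr" where
  "trunc_arr n m = (free_fp A n, \<lambda>z \<in> carrier (free_fp A n). {truncate A n m (the_elem z)}, free_fp A n)"

lemma free_Obj: "free_fp A n \<in> Obj (fpmod A)"
  by (rule free_fp_fpmod[OF ring_A])

lemma free_in: "y \<in> carrier (free_rmod A n) \<Longrightarrow> {y} \<in> carrier (free_fp A n)"
  by (simp add: free_fp_simps)

lemma coord_closed: "y \<in> carrier (free_rmod A n) \<Longrightarrow> m < n \<Longrightarrow> y m \<in> carrier A"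
  by (auto simp: free_rmod_simps)

lemma coord_hom:
  assumes "m < n"
  shows "(\<lambda>z \<in> carrier (free_fp A n). reg_elt (the_elem z m)) \<in> rmod_hom A (free_fp A n) (reg_rmod A)"
proof -
  interpret F: right_module A "free_rmod A n" by (rule free_right_module[OF ring_A])
  interpret G: right_module A "free_fp A n" using free_Obj by (simp add: fpmod_Obj)
  show ?thesis
  proof (rule rmod_homI)
    fix z assume "z \<in> carrier (free_fp A n)"
    then obtain y where y: "y \<in> carrier (free_rmod A n)" "z = {y}" by (auto simp: free_fp_simps)
    note ym = coord_closed[OF y(1) assms]
    show "(\<lambda>z \<in> carrier (free_fp A n). reg_elt (the_elem z m)) z \<in> carrier (reg_rmod A)"
      using ym by (simp add: y free_in reg_elt_in)
    show "(\<lambda>z \<in> carrier (free_fp A n). reg_elt (the_elem z m)) (ract (free_fp A n) z a) =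
        ract (reg_rmod A) ((\<lambda>z \<in> carrier (free_fp A n). reg_elt (the_elem z m)) z) a" if "a \<in> carrier A" for a
    proof -
      have "ract (free_fp A n) z a = {ract (free_rmod A n) y a}" using y by (simp add: free_fp_simps)
      moreover have "ract (free_rmod A n) y a m = y m \<otimes>\<^bsub>A\<^esub> a" using assms by (simp add: free_rmod_simps)
      ultimately show ?thesis using y ym that
        by (simp add: free_in F.ract_closed reg_rmod_simps)
    qed
    fix z' assume "z' \<in> carrier (free_fp A n)"
    then obtain y' where y': "y' \<in> carrier (free_rmod A n)" "z' = {y'}" by (auto simp: free_fp_simps)
    note ym' = coord_closed[OF y'(1) assms]
    show "(\<lambda>z \<in> carrier (free_fp A n). reg_elt (the_elem z m)) (z \<oplus>\<^bsub>free_fp A n\<^esub> z') =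
        (\<lambda>z \<in> carrier (free_fp A n). reg_elt (the_elem z m)) z \<oplus>\<^bsub>reg_rmod A\<^esub>
        (\<lambda>z \<in> carrier (free_fp A n). reg_elt (the_elem z m)) z'"
    proof -
      have "z \<oplus>\<^bsub>free_fp A n\<^esub> z' = {y \<oplus>\<^bsub>free_rmod A n\<^esub> y'}" using y y' by (simp add: free_fp_simps)
      moreover have "(y \<oplus>\<^bsub>free_rmod A n\<^esub> y') m = y m \<oplus>\<^bsub>A\<^esub> y' m" using assms by (simp add: free_rmod_simps)
      ultimately show ?thesis using y y' ym ym' by (simp add: free_in reg_rmod_simps)
    qed
  qed simp
qed

lemma coord_arr_Hom: "m < n \<Longrightarrow> coord_arr n m \<in> Hom (fpmod A) (free_fp A n) (reg_rmod A)"
  using coord_hom by (simp add: coord_arr_def fpmod_Hom free_Obj reg_Obj)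

lemma coord_arr_elt:
  assumes "m < n" "y \<in> carrier (free_rmod A n)"
  shows "coord_arr n m \<cdot>\<^bsub>fpmod A\<^esub> elt_arr A (free_fp A n) {y} = left_mult A (y m)"
  using elt_arr_comp[OF free_Obj reg_Obj coord_hom[OF assms(1)] free_in[OF assms(2)]]
  by (simp add: coord_arr_def left_mult_eq[OF coord_closed[OF assms(2,1)]] free_in[OF assms(2)])

lemma trunc_arr_0: "trunc_arr n 0 = Null (fpmod A) (free_fp A n) (free_fp A n)"
  by (simp add: trunc_arr_def fpmod_simps truncate_0 free_fp_simps)

lemma trunc_arr_full: "trunc_arr n n = Ide (fpmod A) (free_fp A n)"
  by (auto simp: trunc_arr_def fpmod_simps free_fp_simps truncate_full intro!: restrict_ext)

lemma trunc_arr_Suc: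
  assumes "m < n"
  shows "trunc_arr n (Suc m) = Plus (fpmod A) (trunc_arr n m)
    (elt_arr A (free_fp A n) {basis_vec A n m} \<cdot>\<^bsub>fpmod A\<^esub> coord_arr n m)"
proof -
  have e: "basis_vec A n m \<in> carrier (free_rmod A n)" by (rule basis_vec_in[OF ring_A])
  interpret F: right_module A "free_rmod A n" by (rule free_right_module[OF ring_A])
  have "{truncate A n (Suc m) (the_elem z)} = {truncate A n m (the_elem z)} \<oplus>\<^bsub>free_fp A n\<^esub>
      elt_map A (free_fp A n) {basis_vec A n m} (reg_elt (the_elem z m))"
    if "z \<in> carrier (free_fp A n)" for z
  proof -
    obtain y where y: "y \<in> carrier (free_rmod A n)" "z = {y}" using \<open>z \<in> _\<close> by (auto simp: free_fp_simps)
    show ?thesis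
      using truncate_Suc[OF ring_A y(1) assms] y(2) e truncate_closed[OF ring_A y(1)] coord_closed[OF y(1) assms]
      by (simp add: elt_map_apply free_fp_simps F.ract_closed)
  qed
  then show ?thesis
    by (simp add: trunc_arr_def coord_arr_def elt_arr_def fpmod_simps cong: restrict_cong)
qed

lemma trunc_arr_Hom: "m \<le> n \<Longrightarrow> trunc_arr n m \<in> Hom (fpmod A) (free_fp A n) (free_fp A n)"
proof (induction m)
  case 0
  have "right_module A (free_fp A n)" using free_Obj by (simp add: fpmod_Obj)
  from rmod_hom_zero_map[OF this this] show ?case
    by (simp add: trunc_arr_0 fpmod_Hom fpmod_simps free_Obj)
next
  case (Suc m)
  then have "m < n" by simp
  show ?case
    unfolding trunc_arr_Suc[OF \<open>m < n\<close>]
    using Suc fpmod_comp[OF coord_arr_Hom[OF \<open>m < n\<close>] elt_arr_Hom[OF free_Obj free_in[OF basis_vec_in[OF ring_A]]]]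
    by (intro fpmod_plus) simp_all
qed

text \<open>
  The identity of \<open>T(A\<^sup>n)\<close> is the sum of the composites of \<open>T(\<pi>\<^sub>m)\<close> and \<open>T(e\<^sub>m)\<close>, where \<open>\<pi>\<^sub>m\<close> is a
  coordinate map; so an arrow out of \<open>T(A\<^sup>n)\<close> is determined by its composites with the \<open>T(e\<^sub>m)\<close>.
\<close>

lemma free_eval_unique:
  assumes w: "w \<in> Hom C (fobj T (free_fp A n)) W" "w' \<in> Hom C (fobj T (free_fp A n)) W"
    and eq: "\<And>z. z \<in> carrier (free_fp A n) \<Longrightarrow> w \<bullet> eval_map T (free_fp A n) z = w' \<bullet> eval_map T (free_fp A n) z"
  shows "w = w'"
proof -
  let ?F = "free_fp A n"
  have "w \<bullet> fmap T (trunc_arr n m) = w' \<bullet> fmap T (trunc_arr n m)" if "m \<le> n" for m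
    using that
  proof (induction m)
    case 0
    then show ?case
      using functor_null[OF free_Obj free_Obj] comp_null_right[OF w(1)] comp_null_right[OF w(2)] functor_obj[OF T free_Obj]
      by (simp add: trunc_arr_0)
  next
    case (Suc m)
    then have m: "m < n" by simp
    have e: "{basis_vec A n m} \<in> carrier ?F" by (rule free_in[OF basis_vec_in[OF ring_A]])
    note eH = elt_arr_Hom[OF free_Obj e] and cH = coord_arr_Hom[OF m]
    note TeH = functor_hom[OF T eH] and TcH = functor_hom[OF T cH]
    have tH: "trunc_arr n m \<in> Hom (fpmod A) ?F ?F" using m by (intro trunc_arr_Hom) simp
    have TS: "fmap T (trunc_arr n (Suc m)) =
        Plus C (fmap T (trunc_arr n m)) (fmap T (elt_arr A ?F {basis_vec A n m}) \<bullet> fmap T (coord_arr n m))"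
      using functor_plus[OF T tH fpmod_comp[OF cH eH]] functor_comp[OF T cH eH] by (simp add: trunc_arr_Suc[OF m])
    have we: "w \<bullet> fmap T (elt_arr A ?F {basis_vec A n m}) = w' \<bullet> fmap T (elt_arr A ?F {basis_vec A n m})"
      using eq[OF e] e by (simp add: eval_map_def)
    show ?case
      unfolding TS
      using comp_plus_right[OF functor_hom[OF T tH] comp_in_Hom[OF TcH TeH] w(1)]
        comp_plus_right[OF functor_hom[OF T tH] comp_in_Hom[OF TcH TeH] w(2)]
        comp_assoc[OF TcH TeH w(1)] comp_assoc[OF TcH TeH w(2)] we Suc by simp
  qed
  from this[of n] show ?thesis
    using functor_ide[OF T free_Obj] comp_ide_right[OF w(1)] comp_ide_right[OF w(2)] by (simp add: trunc_arr_full)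
qed

text \<open>The arrow is the sum of the composites of \<open>T(\<pi>\<^sub>m)\<close> and \<open>v(e\<^sub>m)\<close>.\<close>

lemma free_eval_exists:
  assumes W: "W \<in> Obj C" and v: "v \<in> rmod_hom A (free_fp A n) (hom_rmod C (restriction_obj A T) W)"
  shows "\<exists>h. h \<in> Hom C (fobj T (free_fp A n)) W \<and>
    (\<forall>z \<in> carrier (free_fp A n). h \<bullet> eval_map T (free_fp A n) z = v z)"
proof -
  let ?F = "free_fp A n" and ?R = "restriction_obj A T"
  have R: "is_aobj K A C ?R" by (rule restriction_is_aobj[OF T])
  note free = free_right_module[OF ring_A, of n]
  interpret F: right_module A "free_rmod A n" by (rule free)
  define v' where "v' = (\<lambda>y \<in> carrier (free_rmod A n). v {y})"
  have v': "v' \<in> rmod_hom A (free_rmod A n) (hom_rmod C ?R W)"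
  proof (rule rmod_homI)
    fix x assume x: "x \<in> carrier (free_rmod A n)"
    show "v' x \<in> carrier (hom_rmod C ?R W)" using x rmod_hom_closed[OF v free_in[OF x]] by (simp add: v'_def)
    show "v' (x \<oplus>\<^bsub>free_rmod A n\<^esub> y) = v' x \<oplus>\<^bsub>hom_rmod C ?R W\<^esub> v' y" if y: "y \<in> carrier (free_rmod A n)" for y
      using x y rmod_hom_add[OF v free_in[OF x] free_in[OF y]] by (simp add: v'_def free_fp_simps)
    show "v' (ract (free_rmod A n) x a) = ract (hom_rmod C ?R W) (v' x) a" if a: "a \<in> carrier A" for a
      using x a rmod_hom_ract[OF v free_in[OF x] a] by (simp add: v'_def free_fp_simps F.ract_closed)
  qed (simp add: v'_def)
  have e: "basis_vec A n k \<in> carrier (free_rmod A n)" for k by (rule basis_vec_in[OF ring_A])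
  have ve: "v' (basis_vec A n k) \<in> Hom C (fobj T (reg_rmod A)) W" for k
    using rmod_hom_closed[OF v' e] by (simp add: hom_rmod_simps restriction_obj_simps)
  have "\<exists>h. h \<in> Hom C (fobj T ?F) W \<and> (\<forall>y \<in> carrier (free_rmod A n).
      h \<bullet> eval_map T ?F {y} = lin_comb (hom_rmod C ?R W) (\<lambda>k. v' (basis_vec A n k)) m y)" if "m \<le> n" for m
    using that
  proof (induction m)
    case 0
    show ?case
      using null_in_Hom[OF functor_obj[OF T free_Obj] W] comp_null_left[OF eval_map_in_Hom[OF free_Obj free_in] W]
      by (intro exI[of _ "Null C (fobj T ?F) W"]) (simp add: hom_rmod_simps restriction_obj_simps)
  next
    case (Suc m)
    then have m: "m < n" by simp
    obtain h where h: "h \<in> Hom C (fobj T ?F) W" "\<And>y. y \<in> carrier (free_rmod A n) \<Longrightarrow>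
      h \<bullet> eval_map T ?F {y} = lin_comb (hom_rmod C ?R W) (\<lambda>k. v' (basis_vec A n k)) m y"
      using Suc by auto
    let ?g = "v' (basis_vec A n m)"
    note cH = coord_arr_Hom[OF m]
    note TcH = functor_hom[OF T cH]
    have gH: "?g \<bullet> fmap T (coord_arr n m) \<in> Hom C (fobj T ?F) W" by (rule comp_in_Hom[OF TcH ve])
    have "Plus C h (?g \<bullet> fmap T (coord_arr n m)) \<bullet> eval_map T ?F {y} =
        lin_comb (hom_rmod C ?R W) (\<lambda>k. v' (basis_vec A n k)) (Suc m) y" if y: "y \<in> carrier (free_rmod A n)" for y
    proof -
      note eH = eval_map_in_Hom[OF free_Obj free_in[OF y]]
      have "fmap T (coord_arr n m) \<bullet> eval_map T ?F {y} = fmap T (left_mult A (y m))"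
        using functor_comp[OF T elt_arr_Hom[OF free_Obj free_in[OF y]] cH] coord_arr_elt[OF m y] free_in[OF y]
        by (simp add: eval_map_def)
      then show ?thesis
        using comp_plus_left[OF eH h(1) gH] comp_assoc[OF eH TcH ve] h(2)[OF y] coord_closed[OF y m]
        by (simp add: hom_rmod_simps restriction_obj_simps)
    qed
    then show ?case using plus_in_Hom[OF h(1) gH] by blast
  qed
  from this[of n] obtain h where h: "h \<in> Hom C (fobj T ?F) W" "\<And>y. y \<in> carrier (free_rmod A n) \<Longrightarrow>
      h \<bullet> eval_map T ?F {y} = lin_comb (hom_rmod C ?R W) (\<lambda>k. v' (basis_vec A n k)) n y" by auto
  have "h \<bullet> eval_map T ?F z = v z" if z: "z \<in> carrier ?F" for z
  proof -
    obtain y where y: "y \<in> carrier (free_rmod A n)" "z = {y}" using z by (auto simp: free_fp_simps)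
    then show ?thesis
      using h(2)[OF y(1)] free_hom_lin_comb[OF hom_rmod_right_module[OF R W] v' y(1)] by (simp add: v'_def)
  qed
  then show ?thesis using h(1) by blast
qed

lemma free_eval_represents:
  "represents (restriction_obj A T) (free_fp A n) (fobj T (free_fp A n)) (eval_map T (free_fp A n))"
  unfolding represents_def
proof (intro conjI ballI functor_obj[OF T free_Obj] eval_map_hom[OF free_Obj])
  fix W v assume W: "W \<in> Obj C" and v: "v \<in> rmod_hom A (free_fp A n) (hom_rmod C (restriction_obj A T) W)"
  obtain h where h: "h \<in> Hom C (fobj T (free_fp A n)) W"
    "\<forall>z \<in> carrier (free_fp A n). h \<bullet> eval_map T (free_fp A n) z = v z"
    using free_eval_exists[OF W v] by blast
  show "\<exists>!h. h \<in> Hom C (fobj T (free_fp A n)) W \<and>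
      (\<forall>z \<in> carrier (free_fp A n). h \<bullet> eval_map T (free_fp A n) z = v z)"
  proof (rule ex1I[of _ h])
    fix h' assume h': "h' \<in> Hom C (fobj T (free_fp A n)) W \<and>
      (\<forall>z \<in> carrier (free_fp A n). h' \<bullet> eval_map T (free_fp A n) z = v z)"
    show "h' = h" by (rule free_eval_unique[OF conjunct1[OF h'] h(1)]) (simp add: h(2) conjunct2[OF h'])
  qed (use h in simp)
qed

text \<open>
  A presentation of \<open>M\<close> with kernel \<open>N\<close> is a short exact sequence of \<open>mod-A\<close> by coherence, so right
  exactness makes \<open>T(M)\<close> the universal quotient of \<open>T(A\<^sup>n)\<close> which kills \<open>T(N)\<close>. Since \<open>N\<close> has such a
  presentation too, killing \<open>T(N)\<close> is the same as killing \<open>T(y)\<close> for all elements \<open>y\<close> of \<open>N\<close>, and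
  this is the quotient that represents the \<open>A\<close>-linear maps on \<open>M\<close>.
\<close>

lemma eval_represents:
  assumes rex: "right_exact (fpmod A) C T" and coh: "right_coherent A" and M: "M \<in> Obj (fpmod A)"
  shows "represents (restriction_obj A T) M (fobj T M) (eval_map T M)"
proof -
  let ?R = "restriction_obj A T"
  have R: "is_aobj K A C ?R" by (rule restriction_is_aobj[OF T])
  have mod: "right_module A N" if "N \<in> Obj (fpmod A)" for N using that by (simp add: fpmod_Obj)
  obtain n p N where p: "p \<in> rmod_hom A (free_fp A n) M" "p ` carrier (free_fp A n) = carrier M"
    and N: "N \<in> Obj (fpmod A)" "carrier N = ker (free_fp A n) M p"
    and j: "(\<lambda>x \<in> carrier N. x) \<in> rmod_hom A N (free_fp A n)"
    and ex: "short_exact (fpmod A) (N, \<lambda>x \<in> carrier N. x, free_fp A n) (free_fp A n, p, M)"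
    using fpmod_presentation[OF ring_A coh M] by blast
  let ?F = "free_fp A n"
  define j' where "j' = (N, \<lambda>x \<in> carrier N. x, ?F)"
  define p' where "p' = (?F, p, M)"
  have pA: "(?F, p, M) \<in> Arr (fpmod A)" using p M by (simp add: fpmod_Arr free_Obj)
  have jA: "(N, \<lambda>x \<in> carrier N. x, ?F) \<in> Arr (fpmod A)" using j N by (simp add: fpmod_Arr free_Obj)
  have pH: "fmap T p' \<in> Hom C (fobj T ?F) (fobj T M)"
    using functor_hom[OF T arr_in_Hom[OF pA]] by (simp add: fpmod_simps p'_def)
  have jH: "fmap T j' \<in> Hom C (fobj T N) (fobj T ?F)"
    using functor_hom[OF T arr_in_Hom[OF jA]] by (simp add: fpmod_simps j'_def)
  have Tex: "exact_at C (fmap T j') (fmap T p')" and Tepi: "epi_arr C (fmap T p')"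
    using rex ex by (auto simp: right_exact_def j'_def p'_def)
  \<comment> \<open>\<open>T(N)\<close> is a quotient of some \<open>T(A\<^sup>m)\<close>, so arrows out of it are tested on the elements of \<open>N\<close>.\<close>
  have zero: "w \<bullet> fmap T j' = Null C (fobj T N) W"
    if w: "w \<in> Hom C (fobj T ?F) W" and kill: "\<And>y. y \<in> ker ?F M p \<Longrightarrow> w \<bullet> eval_map T ?F y = Null C (fobj T (reg_rmod A)) W"
    for w W
  proof -
    have W: "W \<in> Obj C" using Hom_Obj[OF w] by blast
    obtain m q N' where q: "q \<in> rmod_hom A (free_fp A m) N"
      and qex: "short_exact (fpmod A) (N', \<lambda>x \<in> carrier N'. x, free_fp A m) (free_fp A m, q, N)"
      using fpmod_presentation[OF ring_A coh N(1)] by blast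
    let ?q = "(free_fp A m, q, N)"
    have qA: "?q \<in> Arr (fpmod A)" using q N by (simp add: fpmod_Arr free_Obj)
    have qH: "fmap T ?q \<in> Hom C (fobj T (free_fp A m)) (fobj T N)"
      using functor_hom[OF T arr_in_Hom[OF qA]] by (simp add: fpmod_simps)
    have qepi: "epi_arr C (fmap T ?q)" using rex qex by (auto simp: right_exact_def)
    note wj = comp_in_Hom[OF jH w]
    have n: "Null C (fobj T N) W \<in> Hom C (fobj T N) W" using Hom_Obj[OF jH] W by (blast intro: null_in_Hom)
    have "(w \<bullet> fmap T j') \<bullet> fmap T ?q = Null C (fobj T N) W \<bullet> fmap T ?q"
    proof (rule free_eval_unique[OF comp_in_Hom[OF qH wj] comp_in_Hom[OF qH n]])
      fix z assume z: "z \<in> carrier (free_fp A m)"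
      note ez = eval_map_in_Hom[OF free_Obj z]
      have qz: "q z \<in> carrier N" by (rule rmod_hom_closed[OF q z])
      note eq = eval_map_in_Hom[OF N(1) qz]
      have "((w \<bullet> fmap T j') \<bullet> fmap T ?q) \<bullet> eval_map T (free_fp A m) z =
          w \<bullet> (fmap T j' \<bullet> eval_map T N (q z))"
        using comp_assoc[OF ez qH wj] eval_map_natural[OF qA z] comp_assoc[OF eq jH w] by simp
      also have "\<dots> = w \<bullet> eval_map T ?F (q z)"
        using eval_map_natural[OF jA qz] qz by (simp add: j'_def)
      also have "\<dots> = Null C (fobj T (reg_rmod A)) W" by (rule kill) (use qz N(2) in simp)
      also have "\<dots> = (Null C (fobj T N) W \<bullet> fmap T ?q) \<bullet> eval_map T (free_fp A m) z"
        using comp_null_left[OF qH W] comp_null_left[OF ez W] by simp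
      finally show "((w \<bullet> fmap T j') \<bullet> fmap T ?q) \<bullet> eval_map T (free_fp A m) z =
          (Null C (fobj T N) W \<bullet> fmap T ?q) \<bullet> eval_map T (free_fp A m) z" .
    qed
    from epi_arrD[OF qepi W _ _ this] wj n show ?thesis by (simp add: HomD(3)[OF qH])
  qed
  have "\<exists>u'. represents ?R M (fobj T M) u' \<and> (\<forall>y \<in> carrier ?F. u' (p y) = fmap T p' \<bullet> eval_map T ?F y)"
  proof (rule represents_quotient[OF R mod[OF free_Obj] mod[OF M] p free_eval_represents pH])
    show "fmap T p' \<bullet> eval_map T ?F y = Null C (fst ?R) (fobj T M)" if "y \<in> ker ?F M p" for y
    proof -
      have y: "y \<in> carrier ?F" "p y = \<zero>\<^bsub>M\<^esub>" using that by (auto simp: ker_def)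
      have "eval_map T M \<zero>\<^bsub>M\<^esub> = Null C (fst ?R) (fobj T M)"
        using rmod_hom_zero[OF mod[OF M] hom_rmod_right_module[OF R functor_obj[OF T M]] eval_map_hom[OF M]]
        by (simp add: hom_rmod_simps)
      then show ?thesis using eval_map_natural[OF pA y(1)] y(2) by (simp add: p'_def)
    qed
    fix W w assume w: "w \<in> Hom C (fobj T ?F) W"
      and kill: "\<And>y. y \<in> ker ?F M p \<Longrightarrow> w \<bullet> eval_map T ?F y = Null C (fst ?R) W"
    have W: "W \<in> Obj C" using Hom_Obj[OF w] by blast
    have "w \<bullet> fmap T j' = Null C (fobj T N) W"
      by (rule zero[OF w]) (use kill in \<open>simp add: restriction_obj_simps\<close>)
    from exact_epi_factor[OF Tex Tepi jH pH w this]
    obtain h where h: "h \<in> Hom C (fobj T M) W" "h \<bullet> fmap T p' = w" by blast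
    show "\<exists>!h. h \<in> Hom C (fobj T M) W \<and> h \<bullet> fmap T p' = w"
    proof (rule ex1I[of _ h])
      fix h' assume h': "h' \<in> Hom C (fobj T M) W \<and> h' \<bullet> fmap T p' = w"
      show "h' = h" by (rule epi_arrD[OF Tepi W]) (use h h' in \<open>simp_all add: HomD(3)[OF pH]\<close>)
    qed (use h in simp)
  qed
  then obtain u' where u': "represents ?R M (fobj T M) u'"
    "\<forall>y \<in> carrier ?F. u' (p y) = fmap T p' \<bullet> eval_map T ?F y" by blast
  have "u' = eval_map T M"
  proof (rule rmod_hom_eqI[OF representsD(2)[OF u'(1)] eval_map_hom[OF M]])
    fix x assume "x \<in> carrier M"
    then have "x \<in> p ` carrier ?F" by (simp only: p(2))
    then obtain y where y: "y \<in> carrier ?F" "x = p y" by (elim imageE) simp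
    then show "u' x = eval_map T M x" using u'(2) eval_map_natural[OF pA y(1)] by (simp add: p'_def)
  qed
  then show ?thesis using u'(1) by simp
qed

end

lemma represents_iso:
  assumes V: "is_aobj K A C V" and M: "right_module A M"
    and r: "represents V M P u" and r': "represents V M P' u'"
  shows "\<exists>h. h \<in> Hom C P P' \<and> iso_arr C h \<and> (\<forall>x \<in> carrier M. h \<bullet> u x = u' x)"
proof -
  obtain h where h: "h \<in> Hom C P P'" "\<forall>x \<in> carrier M. h \<bullet> u x = u' x"
    using representsD(4)[OF r representsD(1,2)[OF r']] by (elim ex1E) blast
  obtain g where g: "g \<in> Hom C P' P" "\<forall>x \<in> carrier M. g \<bullet> u' x = u x"
    using representsD(4)[OF r' representsD(1,2)[OF r]] by (elim ex1E) blast
  have "g \<bullet> h = Ide C P"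
  proof (rule represents_eqI[OF r V M comp_in_Hom[OF h(1) g(1)] ide_in_Hom[OF representsD(1)[OF r]]])
    fix x assume x: "x \<in> carrier M"
    note ux = representsD(3)[OF r x]
    show "(g \<bullet> h) \<bullet> u x = Ide C P \<bullet> u x"
      using comp_assoc[OF ux h(1) g(1)] h(2) g(2) x comp_ide_left[OF ux] by simp
  qed
  moreover have "h \<bullet> g = Ide C P'"
  proof (rule represents_eqI[OF r' V M comp_in_Hom[OF g(1) h(1)] ide_in_Hom[OF representsD(1)[OF r']]])
    fix x assume x: "x \<in> carrier M"
    note ux = representsD(3)[OF r' x]
    show "(h \<bullet> g) \<bullet> u' x = Ide C P' \<bullet> u' x"
      using comp_assoc[OF ux g(1) h(1)] h(2) g(2) x comp_ide_left[OF ux] by simp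
  qed
  ultimately show ?thesis using iso_arrI[OF h(1) g(1)] h by blast
qed

text \<open>
  An \<open>A\<close>-linear map on \<open>A\<close> is determined by its value at \<open>1\<close>, which is arbitrary; so \<open>V\<close> itself is a
  tensor product of \<open>A\<close> and \<open>V\<close>.
\<close>

lemma regular_represents:
  assumes V: "is_aobj K A C V"
  shows "represents V (reg_rmod A) (fst V)
    (\<lambda>y \<in> carrier (reg_rmod A). snd V (inv_into (carrier A) reg_elt y))" (is "represents V ?R _ ?u")
proof -
  have u: "?u (reg_elt a) = snd V a" if "a \<in> carrier A" for a
    using that by (simp add: reg_elt_in inv_reg_elt)
  have one: "reg_elt \<one>\<^bsub>A\<^esub> \<in> carrier ?R" by (simp add: reg_elt_in)
  have Rm: "right_module A ?R" using reg_Obj by (simp add: fpmod_Obj)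
  have uhom: "?u \<in> rmod_hom A ?R (hom_rmod C V (fst V))"
    by (rule rmod_homI)
      (auto simp: reg_rmod_simps inv_reg_elt hom_rmod_simps aobj_hom[OF V] aobj_add[OF V] aobj_mult[OF V])
  show ?thesis
    unfolding represents_def
  proof (intro conjI ballI aobj_obj[OF V] uhom)
    fix W v assume W: "W \<in> Obj C" and v: "v \<in> rmod_hom A ?R (hom_rmod C V W)"
    let ?h = "v (reg_elt \<one>\<^bsub>A\<^esub>)"
    have h: "?h \<in> Hom C (fst V) W" using rmod_hom_closed[OF v one] by (simp add: hom_rmod_simps)
    show "\<exists>!h. h \<in> Hom C (fst V) W \<and> (\<forall>x \<in> carrier ?R. h \<bullet> ?u x = v x)"
    proof (rule ex1I[of _ ?h], intro conjI ballI h)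
      fix x assume "x \<in> carrier ?R"
      then obtain a where a: "a \<in> carrier A" "x = reg_elt a" by (auto simp: reg_rmod_simps)
      have "v x = v (ract ?R (reg_elt \<one>\<^bsub>A\<^esub>) a)" using a by (simp add: reg_rmod_simps)
      also have "\<dots> = ?h \<bullet> snd V a" using rmod_hom_ract[OF v one a(1)] by (simp add: hom_rmod_simps)
      finally show "?h \<bullet> ?u x = v x" using u[OF a(1)] a(2) by simp
    next
      fix h' assume h': "h' \<in> Hom C (fst V) W \<and> (\<forall>x \<in> carrier ?R. h' \<bullet> ?u x = v x)"
      then have "h' \<bullet> ?u (reg_elt \<one>\<^bsub>A\<^esub>) = ?h" using one by blast
      then show "h' = ?h" using u[OF A.one_closed] h' comp_ide_right[of h' "fst V" W] by (simp add: aobj_one[OF V])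
    qed
  qed
qed

end

section \<open>The equivalences\<close>

context tensor_product
begin

lemma exact_imp_right_exact: "exact (fpmod A) C T \<Longrightarrow> right_exact (fpmod A) C T"
  unfolding exact_def right_exact_def short_exact_def by blast

lemma fpmod_dom_cod: "f \<in> Arr (fpmod A) \<Longrightarrow> Dom (fpmod A) f \<in> Obj (fpmod A) \<and> Cod (fpmod A) f \<in> Obj (fpmod A)"
  by (cases f) (auto simp: fpmod_Arr fpmod_simps)

lemma Rex_simps:
  "T \<in> Obj (Rex K (fpmod A) C) \<longleftrightarrow> linear_functor K (fpmod A) C T \<and> right_exact (fpmod A) C T"
  "(S, \<theta>, T) \<in> Arr (Rex K (fpmod A) C) \<longleftrightarrow> linear_functor K (fpmod A) C S \<and> right_exact (fpmod A) C S \<and>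
     linear_functor K (fpmod A) C T \<and> right_exact (fpmod A) C T \<and> nat_trans (fpmod A) C S T \<theta>"
  "Dom (Rex K (fpmod A) C) (S, \<theta>, T) = S" "Cod (Rex K (fpmod A) C) (S, \<theta>, T) = T"
  "Ide (Rex K (fpmod A) C) T = (T, \<lambda>U \<in> Obj (fpmod A). Ide C (fobj T U), T)"
  "(S', \<theta>', T') \<cdot>\<^bsub>Rex K (fpmod A) C\<^esub> (S, \<theta>, T) = (S, \<lambda>U \<in> Obj (fpmod A). \<theta>' U \<bullet> \<theta> U, T')"
  "Plus (Rex K (fpmod A) C) (S, \<theta>, T) (S', \<theta>', T') = (S, \<lambda>U \<in> Obj (fpmod A). Plus C (\<theta> U) (\<theta>' U), T)"
  "Scal (Rex K (fpmod A) C) c (S, \<theta>, T) = (S, \<lambda>U \<in> Obj (fpmod A). Scal C c (\<theta> U), T)"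
  by (auto simp: Rex_def full_subcat_simps functor_category_simps)

lemma Rex_Hom: "q \<in> Hom (Rex K (fpmod A) C) S T \<longleftrightarrow>
    (\<exists>\<theta>. q = (S, \<theta>, T) \<and> (S, \<theta>, T) \<in> Arr (Rex K (fpmod A) C))"
  by (cases q) (auto simp: Hom_def Rex_simps)

lemma Rex_closed: "arrows_closed K (Rex K (fpmod A) C)"
  unfolding Rex_def by (rule arrows_closed_full_subcat[OF functor_category_closed[OF fpmod_dom_cod]])

lemma aobj_Hom: "q \<in> Hom (aobj_category K A C) V W \<longleftrightarrow> (\<exists>h. q = (V, h, W) \<and> is_aarr K A C (V, h, W))"
  by (cases q) (auto simp: Hom_def aobj_category_simps)

lemma aobj_closed: "arrows_closed K (aobj_category K A C)"
  unfolding arrows_closed_def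
proof (intro conjI ballI allI)
  fix q assume "q \<in> Arr (aobj_category K A C)"
  then show "Dom (aobj_category K A C) q \<in> Obj (aobj_category K A C)"
    "Cod (aobj_category K A C) q \<in> Obj (aobj_category K A C)"
    by (cases q; simp add: aobj_category_simps is_aarr_iff del: split_paired_All)+
qed (auto simp: aobj_Hom aobj_category_simps aarr_ide aarr_comp aarr_plus aarr_scal)

lemma Ten_linear_Rex: "linear_functor K (aobj_category K A C) (Rex K (fpmod A) C) Ten"
  unfolding Rex_def
  by (rule linear_functor_into_full_subcat[OF Ten_linear aobj_closed])
    (simp add: aobj_category_simps Ten_right_exact)

abbreviation Res :: "(('a umod, 'a uarr, 'o, 'm) func, ('a umod, 'a uarr, 'o, 'm) nattrans,
    ('a, 'o, 'm) aobj, ('a, 'o, 'm) aarr) func" where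
  "Res \<equiv> restriction_functor K A C"

lemma Res_obj: "T \<in> Obj (Rex K (fpmod A) C) \<Longrightarrow> fobj Res T = restriction_obj A T"
  by (simp add: restriction_functor_def)

lemma Res_map: "(S, \<theta>, T) \<in> Arr (Rex K (fpmod A) C) \<Longrightarrow>
    fmap Res (S, \<theta>, T) = (restriction_obj A S, \<theta> (reg_rmod A), restriction_obj A T)"
  by (simp add: restriction_functor_def)

lemma Res_arr:
  assumes "(S, \<theta>, T) \<in> Arr (Rex K (fpmod A) C)"
  shows "is_aarr K A C (restriction_obj A S, \<theta> (reg_rmod A), restriction_obj A T)"
proof -
  have "linear_functor K (fpmod A) C S" "linear_functor K (fpmod A) C T" and \<theta>: "nat_trans (fpmod A) C S T \<theta>"
    using assms by (auto simp: Rex_simps)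
  then show ?thesis
    using nat_transD(2)[OF \<theta> reg_Obj] nat_transD(3)[OF \<theta> left_mult_Hom]
    by (simp add: is_aarr_iff restriction_is_aobj restriction_obj_simps)
qed

lemma Res_linear: "linear_functor K (Rex K (fpmod A) C) (aobj_category K A C) Res"
proof (rule linear_functorI)
  let ?R = "Rex K (fpmod A) C" and ?Z = "aobj_category K A C"
  have closed: "Ide ?R T \<in> Arr ?R" if "T \<in> Obj ?R" for T
    using Rex_closed that unfolding arrows_closed_def by (blast dest: HomD)
  show "fobj Res \<in> extensional (Obj ?R)" "fmap Res \<in> extensional (Arr ?R)"
    by (simp_all add: restriction_functor_def)
  show "fobj Res T \<in> Obj ?Z" if "T \<in> Obj ?R" for T
    using that by (simp add: Res_obj aobj_category_simps) (simp add: Rex_simps restriction_is_aobj)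
  show "fmap Res q \<in> Hom ?Z (fobj Res (Dom ?R q)) (fobj Res (Cod ?R q))" if q: "q \<in> Arr ?R" for q
  proof -
    obtain S \<theta> T where e: "q = (S, \<theta>, T)" by (cases q)
    then have "S \<in> Obj ?R" "T \<in> Obj ?R" using q by (auto simp: Rex_simps)
    then show ?thesis using Res_arr[of S \<theta> T] Res_map[of S \<theta> T] q by (simp add: e Res_obj Rex_simps(3,4) aobj_Hom)
  qed
  show "fmap Res (Ide ?R T) = Ide ?Z (fobj Res T)" if T: "T \<in> Obj ?R" for T
    using Res_map[OF closed[OF T, unfolded Rex_simps(5)]] reg_Obj
    by (simp add: Rex_simps(5) Res_obj[OF T] aobj_category_simps restriction_obj_simps)
  show "fmap Res (r \<cdot>\<^bsub>?R\<^esub> q) = fmap Res r \<cdot>\<^bsub>?Z\<^esub> fmap Res q"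
    if q: "q \<in> Arr ?R" "r \<in> Arr ?R" "Cod ?R q = Dom ?R r" for q r
  proof -
    obtain S \<theta> T \<theta>' U where e: "q = (S, \<theta>, T)" "r = (T, \<theta>', U)"
      using q(3) by (cases q; cases r) (simp add: Rex_simps)
    have "r \<cdot>\<^bsub>?R\<^esub> q \<in> Arr ?R"
      using Rex_closed arr_in_Hom[OF q(1)] arr_in_Hom[OF q(2), folded q(3)]
      unfolding arrows_closed_def by (blast dest: HomD)
    then show ?thesis
      using Res_map[of S "\<lambda>M \<in> Obj (fpmod A). \<theta>' M \<bullet> \<theta> M" U] q reg_Obj
      by (simp add: e Rex_simps(6) Res_map aobj_category_simps)
  qed
  show "fmap Res (Plus ?R q r) = Plus ?Z (fmap Res q) (fmap Res r)"
    if q: "q \<in> Arr ?R" "r \<in> Arr ?R" "Dom ?R q = Dom ?R r" "Cod ?R q = Cod ?R r" for q r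
  proof -
    obtain S \<theta> T \<theta>' where e: "q = (S, \<theta>, T)" "r = (S, \<theta>', T)"
      using q(3,4) by (cases q; cases r) (simp add: Rex_simps)
    have "Plus ?R q r \<in> Arr ?R"
      using Rex_closed arr_in_Hom[OF q(1)] arr_in_Hom[OF q(2), folded q(3,4)]
      unfolding arrows_closed_def by (blast dest: HomD)
    then show ?thesis
      using Res_map[of S "\<lambda>M \<in> Obj (fpmod A). Plus C (\<theta> M) (\<theta>' M)" T] q reg_Obj
      by (simp add: e Rex_simps(7) Res_map aobj_category_simps)
  qed
  show "fmap Res (Scal ?R c q) = Scal ?Z c (fmap Res q)" if c: "c \<in> carrier K" and q: "q \<in> Arr ?R" for c q
  proof -
    obtain S \<theta> T where e: "q = (S, \<theta>, T)" by (cases q)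
    have "Scal ?R c q \<in> Arr ?R"
      using Rex_closed arr_in_Hom[OF q] c unfolding arrows_closed_def by (blast dest: HomD)
    then show ?thesis
      using Res_map[of S "\<lambda>M \<in> Obj (fpmod A). Scal C c (\<theta> M)" T] q reg_Obj
      by (simp add: e Rex_simps(8) Res_map aobj_category_simps)
  qed
qed


subsection \<open>Restriction of a tensor product\<close>

text \<open>The isomorphism \<open>A \<otimes> V \<rightarrow> V\<close>, \<open>a \<otimes> z \<mapsto> a z\<close>.\<close>

definition counit :: "('a, 'o, 'm) aobj \<Rightarrow> 'm" where
  "counit V = (SOME h. h \<in> Hom C (tobj V (reg_rmod A)) (fst V) \<and> iso_arr C h \<and>
     (\<forall>a \<in> carrier A. h \<bullet> univ_map V (reg_rmod A) (reg_elt a) = snd V a))"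

lemma counit:
  assumes V: "is_aobj K A C V"
  shows "counit V \<in> Hom C (tobj V (reg_rmod A)) (fst V)" "iso_arr C (counit V)"
    and "a \<in> carrier A \<Longrightarrow> counit V \<bullet> univ_map V (reg_rmod A) (reg_elt a) = snd V a"
proof -
  have Rm: "right_module A (reg_rmod A)" using reg_Obj by (simp add: fpmod_Obj)
  have "\<exists>h. h \<in> Hom C (tobj V (reg_rmod A)) (fst V) \<and> iso_arr C h \<and>
     (\<forall>a \<in> carrier A. h \<bullet> univ_map V (reg_rmod A) (reg_elt a) = snd V a)"
    using represents_iso[OF V Rm univ_map_represents[OF V reg_Obj] regular_represents[OF V]]
    by (auto simp: reg_elt_in inv_reg_elt)
  from someI_ex[OF this, folded counit_def]
  show "counit V \<in> Hom C (tobj V (reg_rmod A)) (fst V)" "iso_arr C (counit V)"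
    "a \<in> carrier A \<Longrightarrow> counit V \<bullet> univ_map V (reg_rmod A) (reg_elt a) = snd V a" by blast+
qed

lemma tobj_reg_eqI:
  assumes V: "is_aobj K A C V"
    and "h \<in> Hom C (tobj V (reg_rmod A)) W" "h' \<in> Hom C (tobj V (reg_rmod A)) W"
    and eq: "\<And>b. b \<in> carrier A \<Longrightarrow> h \<bullet> univ_map V (reg_rmod A) (reg_elt b) = h' \<bullet> univ_map V (reg_rmod A) (reg_elt b)"
  shows "h = h'"
proof (rule tobj_eqI[OF V reg_Obj assms(2,3)])
  fix x assume "x \<in> carrier (reg_rmod A)"
  then obtain b where "b \<in> carrier A" "x = reg_elt b" by (auto simp: reg_rmod_simps)
  then show "h \<bullet> univ_map V (reg_rmod A) x = h' \<bullet> univ_map V (reg_rmod A) x" using eq by simp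
qed

lemma counit_equivariant:
  assumes V: "is_aobj K A C V"
  shows "is_aarr K A C (restriction_obj A (fobj Ten V), counit V, V)"
proof -
  note e = counit[OF V]
  let ?R = "reg_rmod A"
  have "counit V \<bullet> fmap (fobj Ten V) (left_mult A a) = snd V a \<bullet> counit V" if a: "a \<in> carrier A" for a
  proof -
    note lm = functor_hom[OF Ten_obj_linear[OF V] left_mult_Hom[OF a]]
    have Rm: "right_module A ?R" using reg_Obj by (simp add: fpmod_Obj)
    have la: "left_mult A a = (?R, elt_map A ?R (reg_elt a), ?R)" by (simp add: left_mult_eq[OF a] elt_arr_def)
    have laA: "(?R, elt_map A ?R (reg_elt a), ?R) \<in> Arr (fpmod A)"
      using HomD(1)[OF left_mult_Hom[OF a]] by (simp add: la)
    show ?thesis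
    proof (rule tobj_reg_eqI[OF V comp_in_Hom[OF lm e(1)] comp_in_Hom[OF e(1) aobj_hom[OF V a]]])
      fix b assume b: "b \<in> carrier A"
      note ub = univ_map_in_Hom[OF V reg_Obj reg_elt_in[OF b]]
      have "fmap (fobj Ten V) (left_mult A a) \<bullet> univ_map V ?R (reg_elt b) = univ_map V ?R (reg_elt (a \<otimes>\<^bsub>A\<^esub> b))"
        using Ten_map_univ[OF V laA reg_elt_in[OF b]] a b by (simp add: la elt_map_apply reg_rmod_simps)
      then show "(counit V \<bullet> fmap (fobj Ten V) (left_mult A a)) \<bullet> univ_map V ?R (reg_elt b) =
          (snd V a \<bullet> counit V) \<bullet> univ_map V ?R (reg_elt b)"
        using comp_assoc[OF ub lm e(1)] comp_assoc[OF ub e(1) aobj_hom[OF V a]] a b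
        by (simp add: e(3) aobj_mult[OF V])
    qed
  qed
  then show ?thesis
    using e(1) V restriction_is_aobj[OF Ten_obj_linear[OF V]] by (simp add: is_aarr_iff restriction_obj_simps)
qed

lemma aarr_inverse:
  assumes h: "is_aarr K A C (V, h, W)" and iso: "iso_arr C h"
  shows "iso_arr (aobj_category K A C) (V, h, W)"
proof -
  have V: "is_aobj K A C V" "is_aobj K A C W" "h \<in> Hom C (fst V) (fst W)"
    and eq: "\<And>a. a \<in> carrier A \<Longrightarrow> h \<bullet> snd V a = snd W a \<bullet> h"
    using h by (auto simp: is_aarr_iff)
  obtain g where g: "g \<in> Hom C (fst W) (fst V)" "g \<bullet> h = Ide C (fst V)" "h \<bullet> g = Ide C (fst W)"
    using iso_arrE[OF iso V(3)] by blast
  have "snd V a \<bullet> g = g \<bullet> snd W a" if a: "a \<in> carrier A" for a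
    by (rule iso_square_inverse[OF V(3) g(1,3) V(3) g(1,2) aobj_hom[OF V(1) a] aobj_hom[OF V(2) a] eq[OF a, symmetric]])
  then have "is_aarr K A C (W, g, V)" using V g(1) by (simp add: is_aarr_iff)
  then have "(W, g, V) \<in> Hom (aobj_category K A C) W V" by (simp add: aobj_Hom)
  moreover have "(W, g, V) \<cdot>\<^bsub>aobj_category K A C\<^esub> (V, h, W) = Ide (aobj_category K A C) V"
    "(V, h, W) \<cdot>\<^bsub>aobj_category K A C\<^esub> (W, g, V) = Ide (aobj_category K A C) W"
    using g by (simp_all add: aobj_category_simps)
  ultimately show ?thesis
    using h unfolding iso_arr_def aobj_category_simps(2-4) by blast
qed

lemma restriction_of_tensor:
  "nat_isomorphic (aobj_category K A C) (aobj_category K A C)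
     (comp_functor (aobj_category K A C) Res Ten) (id_functor (aobj_category K A C))"
  unfolding nat_isomorphic_def
proof (intro exI conjI ballI)
  let ?Z = "aobj_category K A C"
  let ?G = "comp_functor ?Z Res Ten"
  let ?\<eta> = "\<lambda>V \<in> Obj ?Z. (restriction_obj A (fobj Ten V), counit V, V)"
  have Tobj: "fobj Ten V \<in> Obj (Rex K (fpmod A) C)" if "V \<in> Obj ?Z" for V
    using functor_obj[OF Ten_linear_Rex that] .
  have G: "fobj ?G V = restriction_obj A (fobj Ten V)" if "V \<in> Obj ?Z" for V
    using that by (simp add: comp_functor_def Res_obj[OF Tobj])
  show "nat_trans ?Z ?Z ?G (id_functor ?Z) ?\<eta>"
    unfolding nat_trans_def
  proof (intro conjI ballI)
    show "?\<eta> V \<in> Hom ?Z (fobj ?G V) (fobj (id_functor ?Z) V)" if V: "V \<in> Obj ?Z" for V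
      using counit_equivariant[of V] V by (simp add: G[OF V] id_functor_def aobj_Hom) (simp add: aobj_category_simps)
    fix q assume q: "q \<in> Arr ?Z"
    obtain V h W where e: "q = (V, h, W)" by (cases q)
    have h: "is_aarr K A C (V, h, W)" using q by (simp add: e aobj_category_simps)
    then have V: "is_aobj K A C V" "is_aobj K A C W" "h \<in> Hom C (fst V) (fst W)"
      and eq: "\<And>a. a \<in> carrier A \<Longrightarrow> h \<bullet> snd V a = snd W a \<bullet> h"
      by (auto simp: is_aarr_iff)
    let ?t = "tens_arr V h W (reg_rmod A)"
    note t = nat_transD(2)[OF Ten_arr(2)[OF h] reg_Obj] and eV = counit[OF V(1)] and eW = counit[OF V(2)]
    have "fmap Ten q \<in> Hom (Rex K (fpmod A) C) (fobj Ten V) (fobj Ten W)"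
      using functor_hom[OF Ten_linear_Rex, of q V W] h by (simp add: e aobj_Hom)
    then have "fmap Res (fmap Ten q) = (restriction_obj A (fobj Ten V), ?t, restriction_obj A (fobj Ten W))"
      using Res_map by (auto simp: e Ten_arr(1)[OF h] Rex_Hom)
    then have Gq: "fmap ?G q = (restriction_obj A (fobj Ten V), ?t, restriction_obj A (fobj Ten W))"
      using q by (simp add: comp_functor_def)
    have "counit W \<bullet> ?t = h \<bullet> counit V"
    proof (rule tobj_reg_eqI[OF V(1) comp_in_Hom[OF t eW(1)] comp_in_Hom[OF eV(1) V(3)]])
      fix b assume b: "b \<in> carrier A"
      note ub = univ_map_in_Hom[OF V(1) reg_Obj reg_elt_in[OF b]]
      have "(counit W \<bullet> ?t) \<bullet> univ_map V (reg_rmod A) (reg_elt b) = snd W b \<bullet> h"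
        using comp_assoc[OF ub t eW(1)] tens_arr_univ[OF h reg_Obj reg_elt_in[OF b]]
          comp_assoc[OF V(3) univ_map_in_Hom[OF V(2) reg_Obj reg_elt_in[OF b]] eW(1)] eW(3)[OF b] by simp
      then show "(counit W \<bullet> ?t) \<bullet> univ_map V (reg_rmod A) (reg_elt b) =
          (h \<bullet> counit V) \<bullet> univ_map V (reg_rmod A) (reg_elt b)"
        using comp_assoc[OF ub eV(1) V(3)] eV(3)[OF b] eq[OF b] by simp
    qed
    then show "?\<eta> (Cod ?Z q) \<cdot>\<^bsub>?Z\<^esub> fmap ?G q = fmap (id_functor ?Z) q \<cdot>\<^bsub>?Z\<^esub> ?\<eta> (Dom ?Z q)"
      using q V(1,2) by (simp add: Gq) (simp add: e aobj_category_simps id_functor_def)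
  qed simp
  show "iso_arr ?Z (?\<eta> V)" if V: "V \<in> Obj ?Z" for V
    using V aarr_inverse[OF counit_equivariant counit(2), of V] by simp (simp add: aobj_category_simps)
qed


subsection \<open>The tensor product with a restriction\<close>

text \<open>The isomorphism \<open>M \<otimes> T(A) \<rightarrow> T(M)\<close>, \<open>x \<otimes> z \<mapsto> T(x) z\<close>, for a right exact functor \<open>T\<close>.\<close>

definition unit_comp :: "('a umod, 'a uarr, 'o, 'm) func \<Rightarrow> 'a umod \<Rightarrow> 'm" where
  "unit_comp T = (\<lambda>M \<in> Obj (fpmod A). SOME h. h \<in> Hom C (tobj (restriction_obj A T) M) (fobj T M) \<and>
     iso_arr C h \<and> (\<forall>x \<in> carrier M. h \<bullet> univ_map (restriction_obj A T) M x = eval_map T M x))"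

context
  assumes coherent: "right_coherent A"
begin

context
  fixes T
  assumes lin: "linear_functor K (fpmod A) C T" and rex: "right_exact (fpmod A) C T"
begin

lemma unit_comp:
  assumes M: "M \<in> Obj (fpmod A)"
  shows "unit_comp T M \<in> Hom C (tobj (restriction_obj A T) M) (fobj T M)" "iso_arr C (unit_comp T M)"
    and "x \<in> carrier M \<Longrightarrow> unit_comp T M \<bullet> univ_map (restriction_obj A T) M x = eval_map T M x"
proof -
  let ?R = "restriction_obj A T"
  have R: "is_aobj K A C ?R" by (rule restriction_is_aobj[OF lin])
  have Mm: "right_module A M" using M by (simp add: fpmod_Obj)
  have "unit_comp T M \<in> Hom C (tobj ?R M) (fobj T M) \<and> iso_arr C (unit_comp T M) \<and>
    (\<forall>x \<in> carrier M. unit_comp T M \<bullet> univ_map ?R M x = eval_map T M x)"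
    using someI_ex[OF represents_iso[OF R Mm univ_map_represents[OF R M] eval_represents[OF lin rex coherent M]]] M
    by (simp add: unit_comp_def)
  then show "unit_comp T M \<in> Hom C (tobj ?R M) (fobj T M)" "iso_arr C (unit_comp T M)"
    "x \<in> carrier M \<Longrightarrow> unit_comp T M \<bullet> univ_map ?R M x = eval_map T M x" by blast+
qed

lemma unit_nat_trans: "nat_trans (fpmod A) C (fobj Ten (restriction_obj A T)) T (unit_comp T)"
  unfolding nat_trans_def
proof (intro conjI ballI)
  let ?R = "restriction_obj A T"
  have R: "is_aobj K A C ?R" by (rule restriction_is_aobj[OF lin])
  show "unit_comp T \<in> extensional (Obj (fpmod A))" by (simp add: unit_comp_def)
  show "unit_comp T M \<in> Hom C (tobj ?R M) (fobj T M)" if "M \<in> Obj (fpmod A)" for M by (rule unit_comp(1)[OF that])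
  fix f assume f: "f \<in> Arr (fpmod A)"
  obtain M f' N where e: "f = (M, f', N)" by (cases f)
  then have MN: "M \<in> Obj (fpmod A)" "N \<in> Obj (fpmod A)" "f' \<in> rmod_hom A M N" using f by (auto simp: fpmod_Arr)
  have fA: "(M, f', N) \<in> Arr (fpmod A)" using f by (simp add: e)
  note Rf = Ten_map_Hom[OF R fA] and uM = unit_comp[OF MN(1)] and uN = unit_comp[OF MN(2)]
  have Tf: "fmap T (M, f', N) \<in> Hom C (fobj T M) (fobj T N)"
    using functor_hom[OF lin arr_in_Hom[OF fA]] by (simp add: fpmod_simps)
  show "unit_comp T (Cod (fpmod A) f) \<bullet> fmap (fobj Ten ?R) f = fmap T f \<bullet> unit_comp T (Dom (fpmod A) f)"
    unfolding e fpmod_simps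
  proof (rule tobj_eqI[OF R MN(1) comp_in_Hom[OF Rf uN(1)] comp_in_Hom[OF uM(1) Tf]])
    fix x assume x: "x \<in> carrier M"
    note ux = univ_map_in_Hom[OF R MN(1) x]
    show "(unit_comp T N \<bullet> fmap (fobj Ten ?R) (M, f', N)) \<bullet> univ_map ?R M x =
        (fmap T (M, f', N) \<bullet> unit_comp T M) \<bullet> univ_map ?R M x"
      using comp_assoc[OF ux Rf uN(1)] comp_assoc[OF ux uM(1) Tf] Ten_map_univ[OF R fA x]
        uM(3)[OF x] uN(3)[OF rmod_hom_closed[OF MN(3) x]] eval_map_natural[OF lin fA x] by simp
  qed
qed

end

lemma tensor_of_restriction:
  "nat_isomorphic (Rex K (fpmod A) C) (Rex K (fpmod A) C)
     (comp_functor (Rex K (fpmod A) C) Ten Res) (id_functor (Rex K (fpmod A) C))"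
  unfolding nat_isomorphic_def
proof (intro exI conjI ballI)
  let ?X = "Rex K (fpmod A) C"
  let ?G = "comp_functor ?X Ten Res"
  let ?\<eta> = "\<lambda>T \<in> Obj ?X. (fobj Ten (restriction_obj A T), unit_comp T, T)"
  have lin: "linear_functor K (fpmod A) C T" "right_exact (fpmod A) C T" if "T \<in> Obj ?X" for T
    using that by (auto simp: Rex_simps)
  have R: "is_aobj K A C (restriction_obj A T)" if "T \<in> Obj ?X" for T
    by (rule restriction_is_aobj[OF lin(1)[OF that]])
  have G: "fobj ?G T = fobj Ten (restriction_obj A T)" if "T \<in> Obj ?X" for T
    using that by (simp add: comp_functor_def Res_obj)
  have arr: "(fobj Ten (restriction_obj A T), unit_comp T, T) \<in> Arr ?X" if T: "T \<in> Obj ?X" for T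
    using unit_nat_trans[OF lin[OF T]] lin[OF T] Ten_obj_linear[OF R[OF T]] Ten_right_exact[OF R[OF T]]
    by (simp add: Rex_simps)
  show "nat_trans ?X ?X ?G (id_functor ?X) ?\<eta>"
    unfolding nat_trans_def
  proof (intro conjI ballI)
    show "?\<eta> T \<in> Hom ?X (fobj ?G T) (fobj (id_functor ?X) T)" if T: "T \<in> Obj ?X" for T
      using arr[OF T] T by (simp add: G id_functor_def Rex_Hom)
    fix q assume q: "q \<in> Arr ?X"
    obtain S \<theta> T where e: "q = (S, \<theta>, T)" by (cases q)
    have S: "S \<in> Obj ?X" and T: "T \<in> Obj ?X" and \<theta>: "nat_trans (fpmod A) C S T \<theta>"
      using q by (auto simp: e Rex_simps)
    let ?S = "restriction_obj A S" and ?T = "restriction_obj A T" and ?R = "reg_rmod A"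
    have qA: "(S, \<theta>, T) \<in> Arr ?X" using q by (simp add: e)
    note h = Res_arr[OF qA]
    have Gq: "fmap ?G q = (fobj Ten ?S, tens_arr ?S (\<theta> ?R) ?T, fobj Ten ?T)"
      using q by (simp add: comp_functor_def e Res_map[OF qA] Ten_arr(1)[OF h])
    have "unit_comp T M \<bullet> tens_arr ?S (\<theta> ?R) ?T M = \<theta> M \<bullet> unit_comp S M" if M: "M \<in> Obj (fpmod A)" for M
    proof -
      note t = nat_transD(2)[OF Ten_arr(2)[OF h] M] and uS = unit_comp[OF lin[OF S] M] and uT = unit_comp[OF lin[OF T] M]
      note \<theta>M = nat_transD(2)[OF \<theta> M]
      show ?thesis
      proof (rule tobj_eqI[OF R[OF S] M comp_in_Hom[OF t uT(1)] comp_in_Hom[OF uS(1) \<theta>M]])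
        fix x assume x: "x \<in> carrier M"
        note ux = univ_map_in_Hom[OF R[OF S] M x]
        have \<theta>R: "\<theta> ?R \<in> Hom C (fst ?S) (fst ?T)" using h by (simp add: is_aarr_iff)
        have "(unit_comp T M \<bullet> tens_arr ?S (\<theta> ?R) ?T M) \<bullet> univ_map ?S M x = eval_map T M x \<bullet> \<theta> ?R"
          using comp_assoc[OF ux t uT(1)] tens_arr_univ[OF h M x]
            comp_assoc[OF \<theta>R univ_map_in_Hom[OF R[OF T] M x] uT(1)] uT(3)[OF x] by simp
        also have "\<dots> = \<theta> M \<bullet> eval_map S M x"
          using nat_transD(3)[OF \<theta> elt_arr_Hom[OF M x]] x by (simp add: eval_map_def)
        also have "\<dots> = (\<theta> M \<bullet> unit_comp S M) \<bullet> univ_map ?S M x"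
          using comp_assoc[OF ux uS(1) \<theta>M] uS(3)[OF x] by simp
        finally show "(unit_comp T M \<bullet> tens_arr ?S (\<theta> ?R) ?T M) \<bullet> univ_map ?S M x =
            (\<theta> M \<bullet> unit_comp S M) \<bullet> univ_map ?S M x" .
      qed
    qed
    then show "?\<eta> (Cod ?X q) \<cdot>\<^bsub>?X\<^esub> fmap ?G q = fmap (id_functor ?X) q \<cdot>\<^bsub>?X\<^esub> ?\<eta> (Dom ?X q)"
      using q S T by (simp add: Gq id_functor_def) (simp add: e Rex_simps(3-6) cong: restrict_cong)
  qed simp
  show "iso_arr ?X (?\<eta> T)" if T: "T \<in> Obj ?X" for T
  proof -
    let ?F = "fobj Ten (restriction_obj A T)"
    obtain \<theta> where \<theta>: "nat_trans (fpmod A) C T ?F \<theta>"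
      "\<And>M. M \<in> Obj (fpmod A) \<Longrightarrow> \<theta> M \<bullet> unit_comp T M = Ide C (fobj ?F M) \<and> unit_comp T M \<bullet> \<theta> M = Ide C (fobj T M)"
      using nat_trans_inverse[OF fpmod_dom_cod Ten_obj_linear[OF R[OF T]] lin(1)[OF T] unit_nat_trans[OF lin[OF T]]
          unit_comp(2)[OF lin[OF T]]] by blast
    have "(T, \<theta>, ?F) \<in> Hom ?X T ?F" using arr[OF T] \<theta>(1) by (simp add: Rex_Hom Rex_simps)
    moreover have "(T, \<theta>, ?F) \<cdot>\<^bsub>?X\<^esub> (?F, unit_comp T, T) = Ide ?X ?F"
      "(?F, unit_comp T, T) \<cdot>\<^bsub>?X\<^esub> (T, \<theta>, ?F) = Ide ?X T"
      using \<theta>(2) by (simp_all add: Rex_simps(5,6) cong: restrict_cong)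
    ultimately have "iso_arr ?X (?F, unit_comp T, T)"
      using arr[OF T] unfolding iso_arr_def Rex_simps(3,4) by blast
    then show ?thesis using T by simp
  qed
qed

lemma Rex_equivalence:
  "quasi_inverse_equivalences K (Rex K (fpmod A) C) (aobj_category K A C) Res Ten"
  unfolding quasi_inverse_equivalences_def
  using Res_linear Ten_linear_Rex tensor_of_restriction restriction_of_tensor by blast

text \<open>The isomorphisms of \<open>M \<otimes> T(A)\<close> with \<open>T(M)\<close> are natural in \<open>M\<close>, and exactness is invariant under them.\<close>

lemma exact_restriction_flat:
  assumes lin: "linear_functor K (fpmod A) C T" and ex: "exact (fpmod A) C T"
  shows "exact (fpmod A) C (fobj Ten (restriction_obj A T))"
proof -
  note rex = exact_imp_right_exact[OF ex]
  let ?F = "fobj Ten (restriction_obj A T)"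
  have F: "linear_functor K (fpmod A) C ?F" by (rule Ten_obj_linear[OF restriction_is_aobj[OF lin]])
  note u = unit_nat_trans[OF lin rex] and iso = unit_comp[OF lin rex]
  obtain \<theta> where \<theta>: "nat_trans (fpmod A) C T ?F \<theta>"
    "\<And>M. M \<in> Obj (fpmod A) \<Longrightarrow> \<theta> M \<bullet> unit_comp T M = Ide C (fobj ?F M) \<and> unit_comp T M \<bullet> \<theta> M = Ide C (fobj T M)"
    using nat_trans_inverse[OF fpmod_dom_cod F lin u iso(2)] by blast
  show ?thesis
  proof (rule exact_nat_iso[OF fpmod_dom_cod lin F \<theta>(1) _ ex])
    show "iso_arr C (\<theta> M)" if "M \<in> Obj (fpmod A)" for M
      using iso_arrI[OF nat_transD(2)[OF \<theta>(1) that] iso(1)[OF that]] \<theta>(2)[OF that] by blast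
  qed
qed

lemma Exact_eq: "Exact K (fpmod A) C = full_subcat (Rex K (fpmod A) C) (exact (fpmod A) C)"
proof -
  let ?F = "functor_category K (fpmod A) C"
  have "{T \<in> Obj ?F. exact (fpmod A) C T} = {T \<in> {T \<in> Obj ?F. right_exact (fpmod A) C T}. exact (fpmod A) C T}"
    "{q \<in> Arr ?F. exact (fpmod A) C (Dom ?F q) \<and> exact (fpmod A) C (Cod ?F q)} =
     {q \<in> {q \<in> Arr ?F. right_exact (fpmod A) C (Dom ?F q) \<and> right_exact (fpmod A) C (Cod ?F q)}.
       exact (fpmod A) C (Dom ?F q) \<and> exact (fpmod A) C (Cod ?F q)}"
    using exact_imp_right_exact by blast+
  then show ?thesis by (simp add: Exact_def Rex_def full_subcat_def)
qed

lemma Exact_equivalence: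
  "quasi_inverse_equivalences K (Exact K (fpmod A) C) (Flat K A C Ten)
     (restrict_functor (Exact K (fpmod A) C) Res) (restrict_functor (Flat K A C Ten) Ten)"
  unfolding Exact_eq Flat_def
proof (rule quasi_inverse_equivalences_restrict[OF Rex_equivalence Rex_closed aobj_closed])
  show "flat A C Ten (fobj Res T)" if "T \<in> Obj (Rex K (fpmod A) C)" "exact (fpmod A) C T" for T
    using that exact_restriction_flat[of T] by (simp add: Res_obj flat_def Rex_simps)
  show "exact (fpmod A) C (fobj Ten V)" if "flat A C Ten V" for V
    using that by (simp add: flat_def)
qed

end

end

theorem proposition2p4:
  fixes K :: "'k ring" and A :: "('k, 'a) module" and C :: "('k, 'o, 'm) lincat"
  assumes "algebraically_closed K"
    and "unital_algebra K A"
    and "right_coherent A"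
    and "abelian_category K C"
  shows "(\<exists>Ten \<Phi>. is_tensor K A C Ten \<Phi>) \<and>
    (\<forall>Ten \<Phi>. is_tensor K A C Ten \<Phi> \<longrightarrow>
       quasi_inverse_equivalences K (Rex K (fpmod A) C) (aobj_category K A C)
         (restriction_functor K A C) Ten \<and>
       quasi_inverse_equivalences K (Exact K (fpmod A) C) (Flat K A C Ten)
         (restrict_functor (Exact K (fpmod A) C) (restriction_functor K A C))
         (restrict_functor (Flat K A C Ten) Ten))"
proof (intro conjI allI impI)
  interpret abelian_category K C by fact
  have ac: "abelian_category_with_algebra K C A"
    using assms(2,4) by (simp add: abelian_category_with_algebra_def abelian_category_with_algebra_axioms_def)
  show "\<exists>Ten \<Phi>. is_tensor K A C Ten \<Phi>"
    using abelian_category_with_algebra.tensor_is_tensor[OF ac] by blast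
  fix Ten \<Phi> assume "is_tensor K A C Ten \<Phi>"
  then have t: "tensor_product K C A Ten \<Phi>"
    using ac by (simp add: tensor_product_def tensor_product_axioms_def)
  show "quasi_inverse_equivalences K (Rex K (fpmod A) C) (aobj_category K A C) (restriction_functor K A C) Ten"
    by (rule tensor_product.Rex_equivalence[OF t assms(3)])
  show "quasi_inverse_equivalences K (Exact K (fpmod A) C) (Flat K A C Ten)
      (restrict_functor (Exact K (fpmod A) C) (restriction_functor K A C)) (restrict_functor (Flat K A C Ten) Ten)"
    by (rule tensor_product.Exact_equivalence[OF t assms(3)])
qed

end
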